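(* (i) Let $G$ be a pronilpotent group. If $G$ is FA in the class of all profinite groups, or FA in the class of all pronilpotent groups, then the set of primes $p$ such that $G$ has a nontrivial Sylow pro-$p$ subgroup is finite. (ii) Let $\mathfrak{G}$ be a linear algebraic group of positive dimension defined over $\mathbb{Q}$, and let $\pi$ be a set of primes. If $\mathfrak{G}(\mathbb{Z}_\pi)$ is FA in the class of all profinite groups, then $\pi$ is finite.
   Context: Let $\mathcal{C}$ be a class of profinite groups. A group $G\in\mathcal{C}$ is FA (finitely axiomatizable) in $\mathcal{C}$ if there is a sentence $\sigma_G$ of the first-order language of group theory such that for every $H\in\mathcal{C}$: $H\models\sigma_G$ if and only if $H\cong G$ as topological groups. A pronilpotent group is an inverse limit of finite nilpotent groups; it is the direct product of its Sylow pro-$p$ subgroups. For a set $\pi$ of primes, $\mathbb{Z}_\pi=\prod_{p\in\pi}\mathbb{Z}_p$. The linear algebraic group $\mathfrak{G}$ is regarded as a closed subgroup of some $\mathrm{GL}_n$ defined over $\mathbb{Q}$; $\mathfrak{G}(\mathbb{Z}_p)=\mathfrak{G}(\mathbb{Q}_p)\cap\mathrm{GL}_n(\mathbb{Z}_p)$ and $\mathfrak{G}(\mathbb{Z}_\pi)=\prod_{p\in\pi}\mathfrak{G}(\mathbb{Z}_p)$, with the product topology. *)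

theory Defs
  imports
    "HOL-Analysis.Analysis"
    "HOL-Algebra.Algebra"
    "HOL-Algebra.Algebraic_Closure_Type"
    "HOL-Library.Poly_Mapping"
begin

section \<open>Topological groups\<close>

record 'a topgroup = "'a monoid" +
  gtop :: "'a topology"

definition topological_group :: "'a topgroup \<Rightarrow> bool" where
  "topological_group G \<longleftrightarrow>
     group G \<and> topspace (gtop G) = carrier G \<and>
     continuous_map (prod_topology (gtop G) (gtop G)) (gtop G) (\<lambda>(x, y). x \<otimes>\<^bsub>G\<^esub> y) \<and>
     continuous_map (gtop G) (gtop G) (\<lambda>x. inv\<^bsub>G\<^esub> x)"

definition topgroup_isomorphic :: "'a topgroup \<Rightarrow> 'b topgroup \<Rightarrow> bool" where
  "topgroup_isomorphic G H \<longleftrightarrow>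
     (\<exists>f. f \<in> iso G H \<and> homeomorphic_map (gtop G) (gtop H) f)"

definition subtopgroup :: "'a topgroup \<Rightarrow> 'a set \<Rightarrow> 'a topgroup" where
  "subtopgroup G P = G\<lparr>carrier := P, gtop := subtopology (gtop G) P\<rparr>"

definition product_topgroup :: "'i set \<Rightarrow> ('i \<Rightarrow> 'a topgroup) \<Rightarrow> ('i \<Rightarrow> 'a) topgroup" where
  "product_topgroup I G =
     \<lparr>carrier = carrier (product_group I G),
      monoid.mult = monoid.mult (product_group I G),
      one = one (product_group I G),
      gtop = product_topology (\<lambda>i. gtop (G i)) I\<rparr>"

section \<open>Inverse limits of finite groups\<close>

definition inverse_system ::
  "'i set \<Rightarrow> ('i \<Rightarrow> 'i \<Rightarrow> bool) \<Rightarrow> ('i \<Rightarrow> 'b monoid) \<Rightarrow> ('i \<Rightarrow> 'i \<Rightarrow> 'b \<Rightarrow> 'b) \<Rightarrow> bool" where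
  "inverse_system I leq F \<phi> \<longleftrightarrow>
     I \<noteq> {} \<and>
     (\<forall>i\<in>I. leq i i) \<and>
     (\<forall>i\<in>I. \<forall>j\<in>I. \<forall>k\<in>I. leq i j \<longrightarrow> leq j k \<longrightarrow> leq i k) \<and>
     (\<forall>i\<in>I. \<forall>j\<in>I. \<exists>k\<in>I. leq i k \<and> leq j k) \<and>
     (\<forall>i\<in>I. group (F i)) \<and>
     (\<forall>i\<in>I. \<forall>j\<in>I. leq i j \<longrightarrow> \<phi> i j \<in> hom (F j) (F i)) \<and>
     (\<forall>i\<in>I. \<forall>x\<in>carrier (F i). \<phi> i i x = x) \<and>
     (\<forall>i\<in>I. \<forall>j\<in>I. \<forall>k\<in>I. leq i j \<longrightarrow> leq j k \<longrightarrow>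
        (\<forall>x\<in>carrier (F k). \<phi> i j (\<phi> j k x) = \<phi> i k x))"

definition discrete_topgroup :: "'a monoid \<Rightarrow> 'a topgroup" where
  "discrete_topgroup F =
     \<lparr>carrier = carrier F, monoid.mult = monoid.mult F, one = one F,
      gtop = discrete_topology (carrier F)\<rparr>"

definition inverse_limit ::
  "'i set \<Rightarrow> ('i \<Rightarrow> 'i \<Rightarrow> bool) \<Rightarrow> ('i \<Rightarrow> 'b monoid) \<Rightarrow> ('i \<Rightarrow> 'i \<Rightarrow> 'b \<Rightarrow> 'b) \<Rightarrow> ('i \<Rightarrow> 'b) topgroup" where
  "inverse_limit I leq F \<phi> =
     subtopgroup (product_topgroup I (\<lambda>i. discrete_topgroup (F i)))
       {x \<in> (\<Pi>\<^sub>E i\<in>I. carrier (F i)). \<forall>i\<in>I. \<forall>j\<in>I. leq i j \<longrightarrow> \<phi> i j (x j) = x i}"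

text \<open>HOL cannot quantify over the types of the index set and of the finite groups. Nothing is
  lost by fixing them: a finite group is isomorphic to one on \<^typ>\<open>nat\<close>, and an inverse limit of
  finite groups from a class closed under subgroups (as are all the classes used below) is also the
  inverse limit of its images in these groups, which can be indexed by the kernels of the
  projections, i.e. by sets of type \<^typ>\<open>'a set\<close>.\<close>

definition inverse_limit_of_finite :: "(nat monoid \<Rightarrow> bool) \<Rightarrow> 'a topgroup \<Rightarrow> bool" where
  "inverse_limit_of_finite \<P> G \<longleftrightarrow>
     topological_group G \<and>
     (\<exists>(I :: 'a set set) leq F \<phi>.
        inverse_system I leq F \<phi> \<and>
        (\<forall>i\<in>I. finite (carrier (F i)) \<and> \<P> (F i)) \<and>
        topgroup_isomorphic G (inverse_limit I leq F \<phi>))"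

primrec lower_central :: "('a, 'm) monoid_scheme \<Rightarrow> nat \<Rightarrow> 'a set" where
  "lower_central G 0 = carrier G"
| "lower_central G (Suc k) =
     generate G {x \<otimes>\<^bsub>G\<^esub> y \<otimes>\<^bsub>G\<^esub> inv\<^bsub>G\<^esub> x \<otimes>\<^bsub>G\<^esub> inv\<^bsub>G\<^esub> y | x y.
                   x \<in> lower_central G k \<and> y \<in> carrier G}"

definition nilpotent_group :: "('a, 'm) monoid_scheme \<Rightarrow> bool" where
  "nilpotent_group G \<longleftrightarrow> group G \<and> (\<exists>k. lower_central G k = {\<one>\<^bsub>G\<^esub>})"

definition profinite_group :: "'a topgroup \<Rightarrow> bool" where
  "profinite_group G \<longleftrightarrow> inverse_limit_of_finite (\<lambda>_. True) G"

definition pronilpotent_group :: "'a topgroup \<Rightarrow> bool" where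
  "pronilpotent_group G \<longleftrightarrow> inverse_limit_of_finite nilpotent_group G"

definition pro_p_group :: "nat \<Rightarrow> 'a topgroup \<Rightarrow> bool" where
  "pro_p_group p G \<longleftrightarrow> inverse_limit_of_finite (\<lambda>F. \<exists>k. order F = p ^ k) G"

text \<open>The index of a closed subgroup \<open>P\<close> is the supernatural number
  \<open>lcm {|G : U| | P \<le> U, U open}\<close>; the last conjunct says that it is prime to \<open>p\<close>.\<close>

definition sylow_pro_subgroup :: "nat \<Rightarrow> 'a topgroup \<Rightarrow> 'a set \<Rightarrow> bool" where
  "sylow_pro_subgroup p G P \<longleftrightarrow>
     subgroup P G \<and> closedin (gtop G) P \<and> pro_p_group p (subtopgroup G P) \<and>
     (\<forall>U. subgroup U G \<and> openin (gtop G) U \<and> P \<subseteq> U \<longrightarrow> \<not> p dvd card (rcosets\<^bsub>G\<^esub> U))"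

section \<open>The first-order language of groups and finite axiomatizability\<close>

datatype grp_term = TVar nat | TOne | TMul grp_term grp_term | TInv grp_term

datatype grp_form =
    FEq grp_term grp_term
  | FNeg grp_form
  | FAnd grp_form grp_form
  | FEx nat grp_form

primrec eval_term :: "('a, 'm) monoid_scheme \<Rightarrow> (nat \<Rightarrow> 'a) \<Rightarrow> grp_term \<Rightarrow> 'a" where
  "eval_term G e (TVar i) = e i"
| "eval_term G e TOne = \<one>\<^bsub>G\<^esub>"
| "eval_term G e (TMul s t) = eval_term G e s \<otimes>\<^bsub>G\<^esub> eval_term G e t"
| "eval_term G e (TInv t) = inv\<^bsub>G\<^esub> (eval_term G e t)"

primrec sat_form :: "('a, 'm) monoid_scheme \<Rightarrow> (nat \<Rightarrow> 'a) \<Rightarrow> grp_form \<Rightarrow> bool" where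
  "sat_form G e (FEq s t) \<longleftrightarrow> eval_term G e s = eval_term G e t"
| "sat_form G e (FNeg f) \<longleftrightarrow> \<not> sat_form G e f"
| "sat_form G e (FAnd f g) \<longleftrightarrow> sat_form G e f \<and> sat_form G e g"
| "sat_form G e (FEx i f) \<longleftrightarrow> (\<exists>x\<in>carrier G. sat_form G (e(i := x)) f)"

primrec term_vars :: "grp_term \<Rightarrow> nat set" where
  "term_vars (TVar i) = {i}"
| "term_vars TOne = {}"
| "term_vars (TMul s t) = term_vars s \<union> term_vars t"
| "term_vars (TInv t) = term_vars t"

primrec free_vars :: "grp_form \<Rightarrow> nat set" where
  "free_vars (FEq s t) = term_vars s \<union> term_vars t"
| "free_vars (FNeg f) = free_vars f"
| "free_vars (FAnd f g) = free_vars f \<union> free_vars g"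
| "free_vars (FEx i f) = free_vars f - {i}"

definition sentence :: "grp_form \<Rightarrow> bool" where
  "sentence \<sigma> \<longleftrightarrow> free_vars \<sigma> = {}"

definition models :: "('a, 'm) monoid_scheme \<Rightarrow> grp_form \<Rightarrow> bool" where
  "models G \<sigma> \<longleftrightarrow> (\<forall>e. range e \<subseteq> carrier G \<longrightarrow> sat_form G e \<sigma>)"

text \<open>HOL cannot quantify over types here either: a class of groups is a set of topological groups
  whose elements have the same type as those of \<open>G\<close>. Being FA in such a class is implied by being
  FA in the corresponding class of groups over all types, so as a hypothesis it is the weaker
  one.\<close>

definition FA_in :: "'a topgroup set \<Rightarrow> 'a topgroup \<Rightarrow> bool" where
  "FA_in \<C> G \<longleftrightarrow>
     G \<in> \<C> \<and>
     (\<exists>\<sigma>. sentence \<sigma> \<and> (\<forall>H\<in>\<C>. models H \<sigma> \<longleftrightarrow> topgroup_isomorphic H G))"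

section \<open>The field of p-adic numbers\<close>

text \<open>\<open>\<rat>\<^sub>p\<close> is the completion of \<open>\<rat>\<close> for the p-adic absolute value: Cauchy sequences modulo
  null sequences.\<close>

definition padic_val :: "nat \<Rightarrow> rat \<Rightarrow> int" where
  "padic_val p x =
     (case quotient_of x of (a, b) \<Rightarrow>
        int (multiplicity (int p) a) - int (multiplicity (int p) b))"

definition padic_abs :: "nat \<Rightarrow> rat \<Rightarrow> real" where
  "padic_abs p x = (if x = 0 then 0 else real p powi (- padic_val p x))"

definition padic_cauchy :: "nat \<Rightarrow> (nat \<Rightarrow> rat) set" where
  "padic_cauchy p = {s. \<forall>e>0. \<exists>N. \<forall>m\<ge>N. \<forall>n\<ge>N. padic_abs p (s m - s n) < e}"

definition padic_null :: "nat \<Rightarrow> (nat \<Rightarrow> rat) set" where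
  "padic_null p = {s. (\<lambda>n. padic_abs p (s n)) \<longlonglongrightarrow> 0}"

definition padic_cauchy_ring :: "nat \<Rightarrow> (nat \<Rightarrow> rat) ring" where
  "padic_cauchy_ring p =
     \<lparr>carrier = padic_cauchy p, monoid.mult = (\<lambda>s t n. s n * t n), one = (\<lambda>n. 1),
      ring.zero = (\<lambda>n. 0), add = (\<lambda>s t n. s n + t n)\<rparr>"

type_synonym padic = "(nat \<Rightarrow> rat) set"

definition Qp :: "nat \<Rightarrow> padic ring" where
  "Qp p = padic_cauchy_ring p Quot padic_null p"

definition padic_of_rat :: "nat \<Rightarrow> rat \<Rightarrow> padic" where
  "padic_of_rat p c = padic_null p +>\<^bsub>padic_cauchy_ring p\<^esub> (\<lambda>n. c)"

definition padic_norm :: "nat \<Rightarrow> padic \<Rightarrow> real" where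
  "padic_norm p x = (THE r. \<forall>s\<in>x. (\<lambda>n. padic_abs p (s n)) \<longlonglongrightarrow> r)"

definition Qp_topology :: "nat \<Rightarrow> padic topology" where
  "Qp_topology p =
     Metric_space.mtopology (carrier (Qp p)) (\<lambda>x y. padic_norm p (x \<ominus>\<^bsub>Qp p\<^esub> y))"

definition Zp :: "nat \<Rightarrow> padic ring" where
  "Zp p = (Qp p)\<lparr>carrier := {x \<in> carrier (Qp p). padic_norm p x \<le> 1}\<rparr>"

section \<open>Linear algebraic groups over the rationals\<close>

abbreviation mat_index :: "nat \<Rightarrow> (nat \<times> nat) set" where
  "mat_index n \<equiv> {..<n} \<times> {..<n}"

definition mat_monoid :: "('b, 'm) ring_scheme \<Rightarrow> nat \<Rightarrow> (nat \<times> nat \<Rightarrow> 'b) monoid" where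
  "mat_monoid R n =
     \<lparr>carrier = (\<Pi>\<^sub>E ij\<in>mat_index n. carrier R),
      monoid.mult = (\<lambda>A B. \<lambda>(i, j)\<in>mat_index n. \<Oplus>\<^bsub>R\<^esub>k\<in>{..<n}. A (i, k) \<otimes>\<^bsub>R\<^esub> B (k, j)),
      one = (\<lambda>(i, j)\<in>mat_index n. if i = j then \<one>\<^bsub>R\<^esub> else \<zero>\<^bsub>R\<^esub>)\<rparr>"

definition GL :: "('b, 'm) ring_scheme \<Rightarrow> nat \<Rightarrow> (nat \<times> nat \<Rightarrow> 'b) monoid" where
  "GL R n = units_of (mat_monoid R n)"

text \<open>Polynomials in the matrix entries are finitely supported maps from monomials to
  coefficients, and monomials are finitely supported maps from variables to exponents.\<close>

type_synonym 'k mpoly = "((nat \<times> nat) \<Rightarrow>\<^sub>0 nat) \<Rightarrow>\<^sub>0 'k"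

definition mpolys :: "nat \<Rightarrow> 'k::zero mpoly set" where
  "mpolys n = {f. \<forall>m\<in>Poly_Mapping.keys f. Poly_Mapping.keys m \<subseteq> mat_index n}"

definition mpoly_eval ::
  "('b, 'm) ring_scheme \<Rightarrow> ('k::zero \<Rightarrow> 'b) \<Rightarrow> 'k mpoly \<Rightarrow> (nat \<times> nat \<Rightarrow> 'b) \<Rightarrow> 'b" where
  "mpoly_eval R c f x =
     (\<Oplus>\<^bsub>R\<^esub>m\<in>Poly_Mapping.keys f.
        c (Poly_Mapping.lookup f m) \<otimes>\<^bsub>R\<^esub>
        (\<Otimes>\<^bsub>R\<^esub>v\<in>Poly_Mapping.keys m. x v [^]\<^bsub>R\<^esub> Poly_Mapping.lookup m v))"

definition zeros_GL ::
  "('b, 'm) ring_scheme \<Rightarrow> ('k::zero \<Rightarrow> 'b) \<Rightarrow> nat \<Rightarrow> 'k mpoly set \<Rightarrow> (nat \<times> nat \<Rightarrow> 'b) set" where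
  "zeros_GL R c n S = {g \<in> carrier (GL R n). \<forall>f\<in>S. mpoly_eval R c f g = \<zero>\<^bsub>R\<^esub>}"

abbreviation complex_ring :: "complex ring" where
  "complex_ring \<equiv> ring_of_type_algebra"

definition zariski_closed :: "nat \<Rightarrow> (nat \<times> nat \<Rightarrow> complex) set \<Rightarrow> bool" where
  "zariski_closed n Z \<longleftrightarrow> (\<exists>S\<subseteq>mpolys n. Z = zeros_GL complex_ring (\<lambda>c. c) n S)"

definition zariski_irreducible :: "nat \<Rightarrow> (nat \<times> nat \<Rightarrow> complex) set \<Rightarrow> bool" where
  "zariski_irreducible n Z \<longleftrightarrow>
     zariski_closed n Z \<and> Z \<noteq> {} \<and>
     (\<forall>A B. zariski_closed n A \<longrightarrow> zariski_closed n B \<longrightarrow> Z = A \<union> B \<longrightarrow> Z = A \<or> Z = B)"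

definition zariski_dim :: "nat \<Rightarrow> (nat \<times> nat \<Rightarrow> complex) set \<Rightarrow> enat" where
  "zariski_dim n V =
     Sup {enat k | k. \<exists>Z. (\<forall>i\<le>k. zariski_irreducible n (Z i) \<and> Z i \<subseteq> V) \<and>
                           (\<forall>i<k. Z i \<subset> Z (Suc i))}"

text \<open>An algebraic group over \<open>\<rat>\<close> is given by its group \<open>\<GG>\<close> of complex points, which has to be cut out
  in \<open>GL\<^sub>n(\<complex>)\<close> by polynomials with rational coefficients. (Equations involving \<open>1/det\<close> may be
  multiplied by a power of \<open>det\<close>.) Its points over other fields are the zeros of all rational
  polynomials vanishing on \<open>\<GG>\<close>.\<close>

definition linear_algebraic_group_over_Q :: "nat \<Rightarrow> (nat \<times> nat \<Rightarrow> complex) set \<Rightarrow> bool" where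
  "linear_algebraic_group_over_Q n \<GG> \<longleftrightarrow>
     subgroup \<GG> (GL complex_ring n) \<and>
     (\<exists>S\<subseteq>mpolys n. \<GG> = zeros_GL complex_ring of_rat n S)"

definition rational_ideal :: "nat \<Rightarrow> (nat \<times> nat \<Rightarrow> complex) set \<Rightarrow> rat mpoly set" where
  "rational_ideal n \<GG> = {f \<in> mpolys n. \<forall>g\<in>\<GG>. mpoly_eval complex_ring of_rat f g = 0}"

definition points_Qp :: "nat \<Rightarrow> (nat \<times> nat \<Rightarrow> complex) set \<Rightarrow> nat \<Rightarrow> (nat \<times> nat \<Rightarrow> padic) set" where
  "points_Qp n \<GG> p = zeros_GL (Qp p) (padic_of_rat p) n (rational_ideal n \<GG>)"

definition points_Zp ::
  "nat \<Rightarrow> (nat \<times> nat \<Rightarrow> complex) set \<Rightarrow> nat \<Rightarrow> (nat \<times> nat \<Rightarrow> padic) topgroup" where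
  "points_Zp n \<GG> p =
     (let C = points_Qp n \<GG> p \<inter> carrier (GL (Zp p) n) in
       \<lparr>carrier = C,
        monoid.mult = monoid.mult (GL (Qp p) n),
        one = one (GL (Qp p) n),
        gtop = subtopology (product_topology (\<lambda>_. Qp_topology p) (mat_index n)) C\<rparr>)"

definition points_Zpi ::
  "nat \<Rightarrow> (nat \<times> nat \<Rightarrow> complex) set \<Rightarrow> nat set \<Rightarrow> (nat \<Rightarrow> nat \<times> nat \<Rightarrow> padic) topgroup" where
  "points_Zpi n \<GG> \<pi> = product_topgroup \<pi> (points_Zp n \<GG>)"

end

theory Submission
  imports Defs
begin

text \<open>A first-order sentence cannot notice the loss of a suitable finite set of direct factors. This is the
Feferman--Vaught principle: for every sentence \<open>\<sigma>\<close> there is a finite set of formulas such that the truth of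
\<open>\<sigma>\<close> in \<open>A \<times> B\<close> depends on \<open>A\<close> only through those formulas (\<open>finite_determining_set\<close>). Let \<open>G\<close> be a product
of pieces indexed by infinitely many primes. Among the products of the pieces over the initial segments of
the primes, two satisfy the same formulas of the finite set; exchanging one for the other inside \<open>G\<close> removes
the pieces of a nonempty finite set \<open>D\<close> of primes without changing the truth of \<open>\<sigma>\<close>
(\<open>exists_omission\<close>). What remains is a closed subgroup \<open>H\<close> of \<open>G\<close>, hence again profinite, and pronilpotent if
\<open>G\<close> is (\<open>inverse_limit_of_finite_closed_subgroup\<close>). If \<open>\<sigma>\<close> axiomatizes \<open>G\<close>, then \<open>H\<close> is isomorphic to \<open>G\<close>, and
each part of the theorem refutes this by a property of the primes in \<open>D\<close>.

In part (i) the pieces are the pro-\<open>S\<close> parts of \<open>G\<close>. A nontrivial element \<open>x\<close> of a Sylow pro-\<open>p\<close> subgroup, with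
\<open>p \<in> D\<close>, has powers \<open>x\<^bsup>p^k\<^esup>\<close> arbitrarily close to \<open>1\<close>. An isomorphism carries it to an element of \<open>H\<close> with the same
property, whose image in each finite nilpotent quotient has an order that is a power of \<open>p\<close> and prime to \<open>p\<close>
(\<open>pronilpotent_FA_finite_primes\<close>).

In part (ii) let \<open>\<Gamma>\<^sub>q\<close> be the group of \<open>\<int>\<^sub>q\<close>-points and \<open>f\<close> an isomorphism from \<open>H\<close>, the product over
\<open>q \<notin> D\<close>, onto the full product \<open>G\<close>. Choose \<open>p \<in> D\<close> and \<open>u \<in> \<Gamma>\<^sub>p\<close> of infinite order that has \<open>q\<^sup>j\<close>-th roots
for all primes \<open>q \<noteq> p\<close> and all \<open>j\<close>. The preimage \<open>h\<close> of \<open>u\<close> inherits the roots. Its coordinate in \<open>\<Gamma>\<^sub>q\<close> is then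
infinitely \<open>q\<close>-divisible, and in \<open>\<Gamma>\<^sub>q\<close> this forces it to be torsion. So \<open>h\<close> is the limit of its truncations to
finite sets of coordinates, which are commuting torsion elements. Their images have only finitely many
\<open>p\<close>-coordinates, since commuting torsion elements of \<open>\<Gamma>\<^sub>p\<close> form a finite set, and they converge to \<open>u\<close>, so
\<open>u\<close> is torsion (\<open>FA_product_finite\<close>).

It remains to establish the three properties of \<open>\<Gamma>\<^sub>p\<close>. Two follow from its congruence subgroups
(\<open>commuting_torsion_finite\<close>, \<open>divisible_imp_torsion\<close>): the matrices congruent to \<open>1\<close> modulo \<open>p\<^sup>2\<close> have finite
index and contain no torsion, and raising to the \<open>p\<close>-th power contracts them. The element \<open>u\<close> is
\<open>exp (p\<^sup>K Y)\<close> for a nonzero rational matrix \<open>Y\<close> of the Lie algebra (\<open>divisible_point\<close>): dividing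
\<open>p\<^sup>K\<close> by a number prime to \<open>p\<close> does not affect convergence. The matrix \<open>Y\<close> exists by
\<open>rational_one_parameter_subgroup\<close>. A group of positive dimension is infinite and so has a nonzero Lie algebra over
\<open>\<complex>\<close>; as the equations are rational, this Lie algebra is stable under embeddings of subrings of \<open>\<complex>\<close>, and an element
of minimal support with some entry \<open>1\<close> is fixed by all of them, hence rational.\<close>

section \<open>Feferman--Vaught for binary products\<close>

lemma eval_term_closed:
  assumes "group G" "range e \<subseteq> carrier G"
  shows "eval_term G e t \<in> carrier G"
proof -
  interpret group G by fact
  show ?thesis using assms(2) by (induction t) auto
qed

lemma eval_term_cong:
  "(\<And>i. i \<in> term_vars t \<Longrightarrow> e i = e' i) \<Longrightarrow> eval_term G e t = eval_term G e' t"
  by (induction t) auto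

lemma sat_form_cong:
  "(\<And>i. i \<in> free_vars f \<Longrightarrow> e i = e' i) \<Longrightarrow> sat_form G e f \<longleftrightarrow> sat_form G e' f"
proof (induction f arbitrary: e e')
  case (FEq s t)
  have "eval_term G e s = eval_term G e' s" "eval_term G e t = eval_term G e' t"
    by (rule eval_term_cong; use FEq in simp)+
  then show ?case by simp
next
  case (FNeg f)
  have "sat_form G e f \<longleftrightarrow> sat_form G e' f" by (rule FNeg.IH) (use FNeg.prems in simp)
  then show ?case by simp
next
  case (FAnd f g)
  have "sat_form G e f \<longleftrightarrow> sat_form G e' f" by (rule FAnd.IH) (use FAnd.prems in simp)
  moreover have "sat_form G e g \<longleftrightarrow> sat_form G e' g" by (rule FAnd.IH) (use FAnd.prems in simp)
  ultimately show ?case by simp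
next
  case (FEx i f)
  have "sat_form G (e(i := x)) f \<longleftrightarrow> sat_form G (e'(i := x)) f" for x
    by (rule FEx.IH) (use FEx.prems in auto)
  then show ?case by simp
qed

lemma models_sentence_iff:
  assumes "group G" "sentence \<sigma>" "range e \<subseteq> carrier G"
  shows "models G \<sigma> \<longleftrightarrow> sat_form G e \<sigma>"
proof -
  have "sat_form G e' \<sigma> \<longleftrightarrow> sat_form G e \<sigma>" for e'
    by (rule sat_form_cong) (use assms(2) in \<open>simp add: sentence_def\<close>)
  then show ?thesis using assms(3) unfolding models_def by blast
qed

lemma eval_term_iso:
  assumes "group G" "group H" "h \<in> hom G H" "range e \<subseteq> carrier G"
  shows "eval_term H (\<lambda>i. h (e i)) t = h (eval_term G e t)"
proof -
  interpret group_hom G H h using assms by (simp add: group_hom_def group_hom_axioms_def)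
  show ?thesis
    by (induction t) (auto simp: eval_term_closed[OF assms(1,4)])
qed

lemma sat_form_iso:
  assumes "group G" "group H" "h \<in> iso G H" "range e \<subseteq> carrier G"
  shows "sat_form H (\<lambda>i. h (e i)) f \<longleftrightarrow> sat_form G e f"
  using assms(4)
proof (induction f arbitrary: e)
  case (FEq s t)
  have "inj_on h (carrier G)" using assms(3) by (auto simp: iso_def bij_betw_def)
  moreover have "h \<in> hom G H" using assms(3) by (auto simp: iso_def)
  ultimately show ?case
    using eval_term_iso[OF assms(1,2) _ FEq] eval_term_closed[OF assms(1) FEq]
    by (simp add: inj_on_eq_iff)
next
  case (FEx i f)
  have img: "h ` carrier G = carrier H" using assms(3) by (auto simp: iso_def bij_betw_def)
  have "sat_form H ((\<lambda>i. h (e i))(i := h x)) f \<longleftrightarrow> sat_form G (e(i := x)) f"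
    if "x \<in> carrier G" for x
  proof -
    have "(\<lambda>i. h (e i))(i := h x) = (\<lambda>j. h ((e(i := x)) j))" by auto
    moreover have "range (e(i := x)) \<subseteq> carrier G" using FEx.prems that by auto
    ultimately show ?thesis using FEx.IH[of "e(i := x)"] by (simp only:)
  qed
  then show ?case unfolding sat_form.simps img[symmetric] by auto
qed auto

lemma models_iso:
  assumes "group G" "group H" "h \<in> iso G H" "sentence \<sigma>"
  shows "models G \<sigma> \<longleftrightarrow> models H \<sigma>"
proof -
  have r: "range (\<lambda>_::nat. \<one>\<^bsub>G\<^esub>) \<subseteq> carrier G"
    using monoid.one_closed[OF group.is_monoid[OF assms(1)]] by auto
  have r': "range (\<lambda>_::nat. h \<one>\<^bsub>G\<^esub>) \<subseteq> carrier H"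
    using assms(3) r by (auto simp: iso_def hom_def)
  show ?thesis
    unfolding models_sentence_iff[OF assms(1,4) r] models_sentence_iff[OF assms(2,4) r']
    by (rule sat_form_iso[OF assms(1-3) r, symmetric])
qed

definition FTrue :: grp_form where "FTrue = FEq TOne TOne"

text \<open>The formula that singles out the assignments under which exactly the members of \<open>P\<close> among \<open>fs\<close> are true.\<close>

primrec signed_conj :: "grp_form list \<Rightarrow> grp_form set \<Rightarrow> grp_form" where
  "signed_conj [] P = FTrue"
| "signed_conj (f # fs) P = FAnd (if f \<in> P then f else FNeg f) (signed_conj fs P)"

lemma sat_signed_conj:
  "sat_form G e (signed_conj fs P) \<longleftrightarrow> (\<forall>f\<in>set fs. f \<in> P \<longleftrightarrow> sat_form G e f)"
  by (induction fs) (auto simp: FTrue_def)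

definition agree :: "grp_form set \<Rightarrow> 'a topgroup \<Rightarrow> (nat \<Rightarrow> 'a) \<Rightarrow> 'a topgroup \<Rightarrow> (nat \<Rightarrow> 'a) \<Rightarrow> bool" where
  "agree \<Phi> A e A' e' \<longleftrightarrow> (\<forall>f\<in>\<Phi>. sat_form A e f \<longleftrightarrow> sat_form A' e' f)"

lemma eval_term_DirProd:
  assumes "group A" "group B" "range e \<subseteq> carrier A" "range d \<subseteq> carrier B"
  shows "eval_term (A \<times>\<times> B) (\<lambda>i. (e i, d i)) t = (eval_term A e t, eval_term B d t)"
  by (induction t)
    (auto simp: inv_DirProd[OF assms(1,2)] eval_term_closed[OF assms(1,3)] eval_term_closed[OF assms(2,4)])

text \<open>The reduction behind Feferman--Vaught: the second factor and its assignment are kept, and the first factor may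
be exchanged for any other one that agrees on \<open>\<Phi>\<close>.\<close>

definition determining :: "grp_form \<Rightarrow> grp_form set \<Rightarrow> 'a itself \<Rightarrow> bool" where
  "determining f \<Phi> (_ :: 'a itself) \<longleftrightarrow>
     (\<forall>(A::'a topgroup) A' (B::'a topgroup) e e' d. group A \<longrightarrow> group A' \<longrightarrow> group B \<longrightarrow>
        range e \<subseteq> carrier A \<longrightarrow> range e' \<subseteq> carrier A' \<longrightarrow> range d \<subseteq> carrier B \<longrightarrow> agree \<Phi> A e A' e' \<longrightarrow>
        (sat_form (A \<times>\<times> B) (\<lambda>i. (e i, d i)) f \<longleftrightarrow> sat_form (A' \<times>\<times> B) (\<lambda>i. (e' i, d i)) f))"

text \<open>A witness in \<open>A \<times> B\<close> is a pair \<open>(a, b)\<close>. The formulas of \<open>\<Psi>\<close> say which sets of formulas of \<open>\<Phi>\<close> are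
realised by values of the quantified variable, so \<open>A'\<close> contains some \<open>a'\<close> with the same \<open>\<Phi>\<close>-type as \<open>a\<close>, and
\<open>(a', b)\<close> is a witness in \<open>A' \<times> B\<close>.\<close>

lemma determining_Ex:
  assumes det: "determining f \<Phi> TYPE('a)" and fin: "finite \<Phi>"
  shows "\<exists>\<Psi>. finite \<Psi> \<and> determining (FEx i f) \<Psi> TYPE('a)"
proof -
  obtain fs where fs: "set fs = \<Phi>" using fin finite_list by blast
  define \<Psi> where "\<Psi> = (\<lambda>P. FEx i (signed_conj fs P)) ` Pow \<Phi>"
  have step: "sat_form (A' \<times>\<times> B) (\<lambda>i. (e' i, d i)) (FEx i f)"
    if A: "group (A::'a topgroup)" "group A'" "group (B::'a topgroup)"
      and r: "range e \<subseteq> carrier A" "range e' \<subseteq> carrier A'" "range d \<subseteq> carrier B"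
      and ag: "agree \<Psi> A e A' e'"
      and s: "sat_form (A \<times>\<times> B) (\<lambda>i. (e i, d i)) (FEx i f)" for A A' B e e' d
  proof -
    obtain a b where ab: "a \<in> carrier A" "b \<in> carrier B"
      and sab: "sat_form (A \<times>\<times> B) ((\<lambda>i. (e i, d i))(i := (a, b))) f"
      using s by auto
    define P where "P = {g\<in>\<Phi>. sat_form A (e(i := a)) g}"
    have "sat_form A e (FEx i (signed_conj fs P))"
      using ab by (auto simp: sat_signed_conj fs P_def intro!: bexI[of _ a])
    moreover have "FEx i (signed_conj fs P) \<in> \<Psi>" unfolding \<Psi>_def P_def by blast
    ultimately have "sat_form A' e' (FEx i (signed_conj fs P))"
      using ag unfolding agree_def by blast
    then obtain a' where a': "a' \<in> carrier A'" and *: "sat_form A' (e'(i := a')) (signed_conj fs P)"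
      by auto
    have "agree \<Phi> A (e(i := a)) A' (e'(i := a'))"
      using * by (auto simp: agree_def sat_signed_conj fs P_def)
    moreover have "(\<lambda>j. (e j, d j))(i := (a, b)) = (\<lambda>j. ((e(i := a)) j, (d(i := b)) j))"
      "(\<lambda>j. (e' j, d j))(i := (a', b)) = (\<lambda>j. ((e'(i := a')) j, (d(i := b)) j))" by auto
    moreover have "range (e(i := a)) \<subseteq> carrier A" "range (e'(i := a')) \<subseteq> carrier A'"
      "range (d(i := b)) \<subseteq> carrier B" using r ab a' by auto
    ultimately have "sat_form (A' \<times>\<times> B) ((\<lambda>j. (e' j, d j))(i := (a', b))) f"
      using det[unfolded determining_def, rule_format, of A A' B "e(i := a)" "e'(i := a')" "d(i := b)"]
        A sab by simp
    then show ?thesis using a' ab by auto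
  qed
  have sym: "agree \<Psi> A' e' A e" if "agree \<Psi> A e A' e'" for A A' :: "'a topgroup" and e e' 
    using that by (auto simp: agree_def)
  have "determining (FEx i f) \<Psi> TYPE('a)"
    unfolding determining_def
  proof (intro allI impI)
    fix A A' B :: "'a topgroup" and e e' d :: "nat \<Rightarrow> 'a"
    assume *: "group A" "group A'" "group B" "range e \<subseteq> carrier A" "range e' \<subseteq> carrier A'"
      "range d \<subseteq> carrier B" and ag: "agree \<Psi> A e A' e'"
    show "sat_form (A \<times>\<times> B) (\<lambda>i. (e i, d i)) (FEx i f) \<longleftrightarrow>
        sat_form (A' \<times>\<times> B) (\<lambda>i. (e' i, d i)) (FEx i f)"
      using step[OF *(1,2,3,4,5,6) ag] step[OF *(2,1,3,5,4,6) sym[OF ag]] by blast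
  qed
  moreover have "finite \<Psi>" using fin by (simp add: \<Psi>_def)
  ultimately show ?thesis by blast
qed

lemma finite_determining_set:
  "\<exists>\<Phi>. finite \<Phi> \<and> determining f \<Phi> TYPE('a)"
proof (induction f)
  case (FEq s t)
  have "determining (FEq s t) {FEq s t} TYPE('a)"
    unfolding determining_def agree_def by (auto simp: eval_term_DirProd)
  then show ?case by blast
next
  case (FNeg f)
  then obtain \<Phi> where "finite \<Phi>" "determining f \<Phi> TYPE('a)" by blast
  then show ?case by (intro exI[of _ \<Phi>]) (auto simp: determining_def)
next
  case (FAnd f g)
  then obtain \<Phi> \<Psi> where *: "finite \<Phi>" "determining f \<Phi> TYPE('a)"
    "finite \<Psi>" "determining g \<Psi> TYPE('a)" by blast
  have "determining (FAnd f g) (\<Phi> \<union> \<Psi>) TYPE('a)"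
    unfolding determining_def
  proof (intro allI impI)
    fix A A' B :: "'a topgroup" and e e' d :: "nat \<Rightarrow> 'a"
    assume a: "group A" "group A'" "group B" "range e \<subseteq> carrier A" "range e' \<subseteq> carrier A'"
      "range d \<subseteq> carrier B" and "agree (\<Phi> \<union> \<Psi>) A e A' e'"
    then have "agree \<Phi> A e A' e'" "agree \<Psi> A e A' e'" by (auto simp: agree_def)
    then show "sat_form (A \<times>\<times> B) (\<lambda>i. (e i, d i)) (FAnd f g) \<longleftrightarrow>
        sat_form (A' \<times>\<times> B) (\<lambda>i. (e' i, d i)) (FAnd f g)"
      using *(2,4)[unfolded determining_def, rule_format, of A A' B e e' d] a by simp
  qed
  then show ?case using * by blast
next
  case (FEx i f)
  then show ?case using determining_Ex by blast
qed

section \<open>Omitting factors of an internal product\<close>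

definition internal_product :: "'a topgroup \<Rightarrow> 'a set \<Rightarrow> 'a set \<Rightarrow> 'a set \<Rightarrow> bool" where
  "internal_product G M A B \<longleftrightarrow> subgroup M G \<and> subgroup A G \<and> subgroup B G \<and>
     (\<forall>a\<in>A. \<forall>b\<in>B. a \<otimes>\<^bsub>G\<^esub> b = b \<otimes>\<^bsub>G\<^esub> a) \<and> A \<inter> B = {\<one>\<^bsub>G\<^esub>} \<and>
     M = (\<lambda>(a, b). a \<otimes>\<^bsub>G\<^esub> b) ` (A \<times> B)"

lemma subtopgroup_simps [simp]:
  "carrier (subtopgroup G P) = P" "monoid.mult (subtopgroup G P) = monoid.mult G"
  "one (subtopgroup G P) = one G" "gtop (subtopgroup G P) = subtopology (gtop G) P"
  by (auto simp: subtopgroup_def)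

lemma group_subtopgroup:
  fixes G :: "'a topgroup"
  assumes "group G" "subgroup P G"
  shows "group (subtopgroup G P)"
proof -
  have "group (G\<lparr>carrier := P\<rparr>)" using assms group.subgroup_imp_group by blast
  then show ?thesis unfolding group_def group_axioms_def monoid_def Units_def by simp
qed

text \<open>Otherwise \<open>a'\<^sup>-\<^sup>1 a = b' b\<^sup>-\<^sup>1\<close> would be a nontrivial common element.\<close>

lemma (in group) subgroup_product_unique:
  assumes "subgroup A G" "subgroup B G" "A \<inter> B = {\<one>}"
    and "a \<in> A" "a' \<in> A" "b \<in> B" "b' \<in> B" "a \<otimes> b = a' \<otimes> b'"
  shows "a = a'"
proof -
  have c: "a \<in> carrier G" "b \<in> carrier G" "a' \<in> carrier G" "b' \<in> carrier G"
    using assms subgroup.subset by blast+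
  have "a = a' \<otimes> b' \<otimes> inv b" using inv_solve_right[of a "a' \<otimes> b'" b] c assms(8) by simp
  then have "a = a' \<otimes> (b' \<otimes> inv b)" using c by (simp add: m_assoc)
  then have eq: "inv a' \<otimes> a = b' \<otimes> inv b" using c inv_solve_left[of "b' \<otimes> inv b" a' a] by auto
  have "inv a' \<otimes> a \<in> A" "b' \<otimes> inv b \<in> B"
    using assms by (auto intro: subgroup.m_closed subgroup.m_inv_closed)
  then have "inv a' \<otimes> a \<in> A \<inter> B" by (simp add: eq)
  then have "inv a' \<otimes> a = \<one>" by (simp only: assms(3) singleton_iff)
  then show ?thesis using c inv_solve_left[of \<one> a' a] by simp
qed

lemma internal_product_iso:
  fixes G :: "'a topgroup" (structure)
  assumes G: "group G" and ip: "internal_product G M A B"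
  shows "(\<lambda>(a, b). a \<otimes>\<^bsub>G\<^esub> b) \<in> iso (subtopgroup G A \<times>\<times> subtopgroup G B) (subtopgroup G M)"
proof -
  interpret group G by fact
  have sub: "A \<subseteq> carrier G" "B \<subseteq> carrier G" "subgroup A G" "subgroup B G"
    using ip unfolding internal_product_def by (blast dest: subgroup.subset)+
  have com: "\<And>a b. a \<in> A \<Longrightarrow> b \<in> B \<Longrightarrow> a \<otimes> b = b \<otimes> a"
    and M: "M = (\<lambda>(a, b). a \<otimes> b) ` (A \<times> B)" and triv: "A \<inter> B = {\<one>}"
    using ip unfolding internal_product_def by blast+
  have "inj_on (\<lambda>(a, b). a \<otimes> b) (A \<times> B)"
  proof (rule inj_onI, clarsimp)
    fix a b a' b' assume *: "a \<in> A" "b \<in> B" "a' \<in> A" "b' \<in> B" "a \<otimes> b = a' \<otimes> b'"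
    then have "a = a'" using subgroup_product_unique[OF sub(3,4) triv *(1,3,2,4,5)] by blast
    moreover have "a \<in> carrier G" "b \<in> carrier G" "b' \<in> carrier G" using * sub by auto
    ultimately show "a = a' \<and> b = b'" using *(5) by simp
  qed
  moreover have "a \<otimes> c \<otimes> (b \<otimes> d) = a \<otimes> b \<otimes> (c \<otimes> d)"
    if "a \<in> A" "c \<in> A" "b \<in> B" "d \<in> B" for a b c d
  proof -
    have "a \<in> carrier G" "b \<in> carrier G" "c \<in> carrier G" "d \<in> carrier G" using that sub by auto
    then have "a \<otimes> c \<otimes> (b \<otimes> d) = a \<otimes> (c \<otimes> b) \<otimes> d" "a \<otimes> b \<otimes> (c \<otimes> d) = a \<otimes> (b \<otimes> c) \<otimes> d"
      by (simp_all add: m_assoc)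
    then show ?thesis by (simp only: com[OF that(2,3)])
  qed
  ultimately show ?thesis
    unfolding iso_def hom_def bij_betw_def M by auto
qed

text \<open>The groups \<open>K {p\<in>P. p < i}\<close> realise finitely many patterns of truth on a determining set, so two indices
\<open>i < j\<close> have the same one. Both \<open>K UNIV\<close> and the group without the primes \<open>p\<close> with \<open>i \<le> p < j\<close> are products
with the common factor \<open>K (- {p\<in>P. p < j})\<close>, and they differ by exchanging the two initial segments.\<close>

lemma exists_omission:
  fixes G :: "'a topgroup" (structure) and K :: "nat set \<Rightarrow> 'a set"
  assumes G: "group G"
    and K: "\<And>A B. A \<inter> B = {} \<Longrightarrow> internal_product G (K (A \<union> B)) (K A) (K B)"
    and inf: "infinite P" and \<sigma>: "sentence \<sigma>"
  shows "\<exists>D. D \<subseteq> P \<and> D \<noteq> {} \<and>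
     (models (subtopgroup G (K (- D))) \<sigma> \<longleftrightarrow> models (subtopgroup G (K UNIV)) \<sigma>)"
proof -
  interpret group G by fact
  obtain \<Phi> where fin: "finite \<Phi>" and det: "determining \<sigma> \<Phi> TYPE('a)"
    using finite_determining_set by blast
  define I where "I = (\<lambda>i. {p\<in>P. p < i})"
  define S where "S = (\<lambda>A. subtopgroup G (K A))"
  define e where "e = (\<lambda>_::nat. \<one>)"
  define t where "t = (\<lambda>i. {f\<in>\<Phi>. sat_form (S (I i)) e f})"
  have sub: "subgroup (K A) G" for A using K[of A "{}"] by (auto simp: internal_product_def)
  have gS: "group (S A)" for A unfolding S_def using group_subtopgroup G sub by blast
  have re: "range e \<subseteq> carrier (S A)" for A
    using subgroup.one_closed[OF sub] by (auto simp: e_def S_def)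
  have "t ` P \<subseteq> Pow \<Phi>" by (auto simp: t_def)
  then have "finite (t ` P)" using fin finite_subset by blast
  then have "\<not> inj_on t P" using inf finite_imageD by blast
  \<comment> \<open>Two initial segments whose products agree on the determining set.\<close>
  then obtain i j where ij: "i \<in> P" "j \<in> P" "t i = t j" "i < j"
    by (metis inj_onI linorder_neqE_nat)
  define D where "D = I j - I i"
  have prod: "models (S (A \<union> B)) \<sigma> \<longleftrightarrow> sat_form (S A \<times>\<times> S B) (\<lambda>i. (e i, e i)) \<sigma>"
    if "A \<inter> B = {}" for A B
  proof -
    have "models (S A \<times>\<times> S B) \<sigma> \<longleftrightarrow> models (S (A \<union> B)) \<sigma>"
      using models_iso[OF DirProd_group[OF gS gS] gS _ \<sigma>] internal_product_iso[OF G K[OF that]]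
      unfolding S_def by blast
    moreover have "range (\<lambda>i. (e i, e i)) \<subseteq> carrier (S A \<times>\<times> S B)" using re by auto
    ultimately show ?thesis using models_sentence_iff[OF DirProd_group[OF gS gS] \<sigma>] by blast
  qed
  have "agree \<Phi> (S (I i)) e (S (I j)) e" using ij(3) by (auto simp: t_def agree_def)
  then have eq: "sat_form (S (I i) \<times>\<times> S (- I j)) (\<lambda>i. (e i, e i)) \<sigma> \<longleftrightarrow>
      sat_form (S (I j) \<times>\<times> S (- I j)) (\<lambda>i. (e i, e i)) \<sigma>"
    using det[unfolded determining_def, rule_format, OF gS gS gS re re re] by blast
  have sub_ij: "I i \<subseteq> I j" using ij(4) by (auto simp: I_def)
  have "I i \<union> - I j = - D" "I j \<union> - I j = UNIV" "I i \<inter> - I j = {}" "I j \<inter> - I j = {}"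
    using sub_ij by (auto simp: D_def)
  then have "models (S (- D)) \<sigma> \<longleftrightarrow> models (S UNIV) \<sigma>"
    using prod[of "I i" "- I j"] prod[of "I j" "- I j"] eq by simp
  moreover have "D \<subseteq> P" "i \<in> D" using ij by (auto simp: D_def I_def)
  ultimately show ?thesis unfolding S_def by blast
qed

section \<open>Inverse limits of finite groups and their closed subgroups\<close>

text \<open>An inverse limit described inside \<open>G\<close> instead of by tuples: the maps \<open>\<rho> i\<close> are the projections, they separate
points, every compatible family is attained, and their fibres form a base of the topology. In this form a closed
subgroup inherits the presentation by restricting the \<open>\<rho> i\<close>.\<close>

definition quotient_system ::
  "'a set set \<Rightarrow> ('a set \<Rightarrow> 'a set \<Rightarrow> bool) \<Rightarrow> ('a set \<Rightarrow> nat monoid) \<Rightarrow>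
   ('a set \<Rightarrow> 'a set \<Rightarrow> nat \<Rightarrow> nat) \<Rightarrow> ('a set \<Rightarrow> 'a \<Rightarrow> nat) \<Rightarrow> 'a topgroup \<Rightarrow> bool" where
  "quotient_system I leq F \<phi> \<rho> G \<longleftrightarrow>
     inverse_system I leq F \<phi> \<and>
     (\<forall>i\<in>I. \<rho> i \<in> hom G (F i)) \<and>
     (\<forall>i\<in>I. continuous_map (gtop G) (discrete_topology (carrier (F i))) (\<rho> i)) \<and>
     (\<forall>i\<in>I. \<forall>j\<in>I. leq i j \<longrightarrow> (\<forall>x\<in>carrier G. \<phi> i j (\<rho> j x) = \<rho> i x)) \<and>
     (\<forall>x\<in>carrier G. \<forall>y\<in>carrier G. (\<forall>i\<in>I. \<rho> i x = \<rho> i y) \<longrightarrow> x = y) \<and>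
     (\<forall>z\<in>(\<Pi>\<^sub>E i\<in>I. carrier (F i)). (\<forall>i\<in>I. \<forall>j\<in>I. leq i j \<longrightarrow> \<phi> i j (z j) = z i) \<longrightarrow>
        (\<exists>x\<in>carrier G. \<forall>i\<in>I. \<rho> i x = z i)) \<and>
     (\<forall>W x. openin (gtop G) W \<longrightarrow> x \<in> W \<longrightarrow>
        (\<exists>k\<in>I. \<forall>y\<in>carrier G. \<rho> k y = \<rho> k x \<longrightarrow> y \<in> W))"

lemma quotient_systemD:
  assumes "quotient_system I leq F \<phi> \<rho> G"
  shows "inverse_system I leq F \<phi>"
    and "\<And>i. i \<in> I \<Longrightarrow> \<rho> i \<in> hom G (F i)"
    and "\<And>i. i \<in> I \<Longrightarrow> continuous_map (gtop G) (discrete_topology (carrier (F i))) (\<rho> i)"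
    and "\<And>i j x. i \<in> I \<Longrightarrow> j \<in> I \<Longrightarrow> leq i j \<Longrightarrow> x \<in> carrier G \<Longrightarrow> \<phi> i j (\<rho> j x) = \<rho> i x"
    and "\<And>x y. x \<in> carrier G \<Longrightarrow> y \<in> carrier G \<Longrightarrow> (\<And>i. i \<in> I \<Longrightarrow> \<rho> i x = \<rho> i y) \<Longrightarrow> x = y"
    and "\<And>z. z \<in> (\<Pi>\<^sub>E i\<in>I. carrier (F i)) \<Longrightarrow> (\<And>i j. i \<in> I \<Longrightarrow> j \<in> I \<Longrightarrow> leq i j \<Longrightarrow> \<phi> i j (z j) = z i)
      \<Longrightarrow> \<exists>x\<in>carrier G. \<forall>i\<in>I. \<rho> i x = z i"
    and "\<And>W x. openin (gtop G) W \<Longrightarrow> x \<in> W \<Longrightarrow> \<exists>k\<in>I. \<forall>y\<in>carrier G. \<rho> k y = \<rho> k x \<longrightarrow> y \<in> W"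
  using assms unfolding quotient_system_def by simp_all

lemma inverse_systemD:
  assumes "inverse_system I leq F \<phi>"
  shows "I \<noteq> {}"
    and "\<And>i j k. i \<in> I \<Longrightarrow> j \<in> I \<Longrightarrow> k \<in> I \<Longrightarrow> leq i j \<Longrightarrow> leq j k \<Longrightarrow> leq i k"
    and "\<And>i j. i \<in> I \<Longrightarrow> j \<in> I \<Longrightarrow> \<exists>k\<in>I. leq i k \<and> leq j k"
    and "\<And>i. i \<in> I \<Longrightarrow> group (F i)"
    and "\<And>i j. i \<in> I \<Longrightarrow> j \<in> I \<Longrightarrow> leq i j \<Longrightarrow> \<phi> i j \<in> hom (F j) (F i)"
  using assms unfolding inverse_system_def by blast+

lemma inverse_system_upper_bound:
  assumes sys: "inverse_system I leq F \<phi>" and "finite J" "J \<subseteq> I"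
  shows "\<exists>k\<in>I. \<forall>j\<in>J. leq j k"
  using assms(2,3)
proof (induction J)
  case empty then show ?case using inverse_systemD(1)[OF sys] by auto
next
  case (insert j J)
  then obtain k where k: "k \<in> I" "\<forall>j\<in>J. leq j k" by auto
  then obtain l where l: "l \<in> I" "leq j l" "leq k l"
    using inverse_systemD(3)[OF sys, of j k] insert.prems by auto
  have "leq i l" if "i \<in> J" for i
    by (rule inverse_systemD(2)[OF sys, of i k]) (use k l that insert.prems in auto)
  then show ?case using l by blast
qed

lemma inverse_limit_simps:
  "carrier (inverse_limit I leq F \<phi>) =
     {x \<in> (\<Pi>\<^sub>E i\<in>I. carrier (F i)). \<forall>i\<in>I. \<forall>j\<in>I. leq i j \<longrightarrow> \<phi> i j (x j) = x i}"
  "x \<otimes>\<^bsub>inverse_limit I leq F \<phi>\<^esub> y = (\<lambda>i\<in>I. x i \<otimes>\<^bsub>F i\<^esub> y i)"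
  "\<one>\<^bsub>inverse_limit I leq F \<phi>\<^esub> = (\<lambda>i\<in>I. \<one>\<^bsub>F i\<^esub>)"
  "gtop (inverse_limit I leq F \<phi>) =
     subtopology (product_topology (\<lambda>i. discrete_topology (carrier (F i))) I)
       (carrier (inverse_limit I leq F \<phi>))"
  by (simp_all add: inverse_limit_def product_topgroup_def discrete_topgroup_def subtopgroup_def)

text \<open>The only clause that is not immediate is the one about the topology. A basic open set of the
product restricts finitely many coordinates, and by directedness a single coordinate above them controls all of
these.\<close>

lemma quotient_system_of_inverse_limit:
  assumes G: "topological_group G" and sys: "inverse_system I leq F \<phi>"
    and iso: "topgroup_isomorphic G (inverse_limit I leq F \<phi>)"
  shows "\<exists>\<rho>. quotient_system I leq F \<phi> \<rho> G"
proof -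
  define L where "L = inverse_limit I leq F \<phi>"
  define TT where "TT = product_topology (\<lambda>i. discrete_topology (carrier (F i))) I"
  obtain f where f: "f \<in> iso G L" "homeomorphic_map (gtop G) (gtop L) f"
    using iso by (auto simp: topgroup_isomorphic_def L_def)
  define \<rho> where "\<rho> = (\<lambda>i x. f x i)"
  have ts: "topspace (gtop G) = carrier G" and grp: "group G"
    using G by (auto simp: topological_group_def)
  have cL: "carrier L = {x \<in> (\<Pi>\<^sub>E i\<in>I. carrier (F i)). \<forall>i\<in>I. \<forall>j\<in>I. leq i j \<longrightarrow> \<phi> i j (x j) = x i}"
    and tL: "gtop L = subtopology TT (carrier L)"
    by (simp_all add: L_def TT_def inverse_limit_simps)
  have img: "f ` carrier G = carrier L" and inj: "inj_on f (carrier G)"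
    using f(1) by (auto simp: iso_def bij_betw_def)
  have fL: "f x \<in> carrier L" if "x \<in> carrier G" for x using img that by blast
  have "\<rho> i \<in> hom G (F i)" if "i \<in> I" for i
  proof (rule homI)
    fix x assume "x \<in> carrier G" then show "\<rho> i x \<in> carrier (F i)"
      using fL[of x] that by (auto simp: \<rho>_def cL)
  next
    fix x y assume "x \<in> carrier G" "y \<in> carrier G"
    then have "f (x \<otimes>\<^bsub>G\<^esub> y) = f x \<otimes>\<^bsub>L\<^esub> f y" using f(1) by (simp add: iso_def hom_mult)
    then show "\<rho> i (x \<otimes>\<^bsub>G\<^esub> y) = \<rho> i x \<otimes>\<^bsub>F i\<^esub> \<rho> i y"
      using that by (simp add: \<rho>_def L_def inverse_limit_simps)
  qed
  moreover have "continuous_map (gtop G) (discrete_topology (carrier (F i))) (\<rho> i)" if "i \<in> I" for i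
  proof -
    have "continuous_map (gtop G) TT f"
      using homeomorphic_imp_continuous_map[OF f(2)]
      by (simp add: tL continuous_map_in_subtopology)
    then show ?thesis using that by (simp add: TT_def \<rho>_def continuous_map_componentwise)
  qed
  moreover have "\<phi> i j (\<rho> j x) = \<rho> i x" if "i \<in> I" "j \<in> I" "leq i j" "x \<in> carrier G" for i j x
    using fL[OF that(4)] that by (auto simp: cL \<rho>_def)
  moreover have "x = y" if "x \<in> carrier G" "y \<in> carrier G" "\<forall>i\<in>I. \<rho> i x = \<rho> i y" for x y
  proof -
    have "f x = f y"
    proof (rule PiE_ext)
      show "f x \<in> (\<Pi>\<^sub>E i\<in>I. carrier (F i))" "f y \<in> (\<Pi>\<^sub>E i\<in>I. carrier (F i))"
        using fL that(1,2) by (auto simp: cL)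
    qed (use that(3) in \<open>simp add: \<rho>_def\<close>)
    then show ?thesis using inj that by (simp add: inj_on_eq_iff)
  qed
  moreover have "\<exists>x\<in>carrier G. \<forall>i\<in>I. \<rho> i x = z i"
    if "z \<in> (\<Pi>\<^sub>E i\<in>I. carrier (F i))" "\<forall>i\<in>I. \<forall>j\<in>I. leq i j \<longrightarrow> \<phi> i j (z j) = z i" for z
  proof -
    have "z \<in> carrier L" using that by (simp add: cL)
    then have "z \<in> f ` carrier G" by (simp only: img)
    then obtain x where "x \<in> carrier G" "f x = z" by auto
    then show ?thesis by (auto simp: \<rho>_def)
  qed
  moreover have "\<exists>k\<in>I. \<forall>y\<in>carrier G. \<rho> k y = \<rho> k x \<longrightarrow> y \<in> W"
    if W: "openin (gtop G) W" and x: "x \<in> W" for W x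
  proof -
    have Wc: "W \<subseteq> carrier G" using openin_subset[OF W] ts by simp
    have "openin (gtop L) (f ` W)"
      using homeomorphic_map_openness[OF f(2)] W Wc ts by blast
    then obtain V where V: "openin TT V" "f ` W = V \<inter> carrier L"
      by (auto simp: tL openin_subtopology)
    have "f x \<in> V" using V x by blast
    then obtain U where U: "finite {i \<in> I. U i \<noteq> carrier (F i)}" "f x \<in> Pi\<^sub>E I U" "Pi\<^sub>E I U \<subseteq> V"
      using V(1) by (force simp: TT_def openin_product_topology_alt)
    define J where "J = {i \<in> I. U i \<noteq> carrier (F i)}"
    have "finite J" "J \<subseteq> I" using U(1) by (auto simp: J_def)
    then obtain k where k: "k \<in> I" "\<And>j. j \<in> J \<Longrightarrow> leq j k"
      using inverse_system_upper_bound[OF sys, of J] by auto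
    have "y \<in> W" if y: "y \<in> carrier G" "\<rho> k y = \<rho> k x" for y
    proof -
      have "x \<in> carrier G" using x Wc by blast
      have "f y i \<in> U i" if i: "i \<in> I" for i
      proof (cases "i \<in> J")
        case True
        have "\<phi> i k (f y k) = f y i" "\<phi> i k (f x k) = f x i"
          using fL[OF y(1)] fL[OF \<open>x \<in> carrier G\<close>] i k True by (auto simp: cL)
        then have "f y i = f x i" using y(2) by (simp add: \<rho>_def)
        then show ?thesis using U(2) i by auto
      next
        case False
        then show ?thesis using i fL[OF y(1)] by (auto simp: J_def cL)
      qed
      then have "f y \<in> Pi\<^sub>E I U" using fL[OF y(1)] by (auto simp: cL PiE_iff)
      then have "f y \<in> f ` W" using U(3) V(2) fL[OF y(1)] by blast
      then show "y \<in> W" using inj Wc y(1) by (auto simp: inj_on_def)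
    qed
    then show ?thesis using k(1) by blast
  qed
  ultimately have "quotient_system I leq F \<phi> \<rho> G"
    using sys unfolding quotient_system_def by simp
  then show ?thesis by blast
qed

text \<open>The map \<open>x \<mapsto> (\<rho> i x)\<^sub>i\<close> is injective because the \<open>\<rho> i\<close> separate points, surjective because
compatible families are attained, and open because every point of an open set has a whole fibre of some \<open>\<rho> k\<close> in
that set.\<close>

lemma inverse_limit_of_quotient_system:
  assumes G: "topological_group G" and qs: "quotient_system I leq F \<phi> \<rho> G"
  shows "topgroup_isomorphic G (inverse_limit I leq F \<phi>)"
proof -
  define L where "L = inverse_limit I leq F \<phi>"
  define TT where "TT = product_topology (\<lambda>i. discrete_topology (carrier (F i))) I"
  define f where "f = (\<lambda>x. \<lambda>i\<in>I. \<rho> i x)"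
  have ts: "topspace (gtop G) = carrier G" and grp: "group G"
    using G by (auto simp: topological_group_def)
  have cL: "carrier L = {x \<in> (\<Pi>\<^sub>E i\<in>I. carrier (F i)). \<forall>i\<in>I. \<forall>j\<in>I. leq i j \<longrightarrow> \<phi> i j (x j) = x i}"
    and tL: "gtop L = subtopology TT (carrier L)"
    by (simp_all add: L_def TT_def inverse_limit_simps)
  have \<rho>: "\<And>i x. i \<in> I \<Longrightarrow> x \<in> carrier G \<Longrightarrow> \<rho> i x \<in> carrier (F i)"
    "\<And>i x y. i \<in> I \<Longrightarrow> x \<in> carrier G \<Longrightarrow> y \<in> carrier G \<Longrightarrow> \<rho> i (x \<otimes>\<^bsub>G\<^esub> y) = \<rho> i x \<otimes>\<^bsub>F i\<^esub> \<rho> i y"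
    using quotient_systemD(2)[OF qs] by (auto simp: hom_def)
  have compat: "\<And>i j x. i \<in> I \<Longrightarrow> j \<in> I \<Longrightarrow> leq i j \<Longrightarrow> x \<in> carrier G \<Longrightarrow> \<phi> i j (\<rho> j x) = \<rho> i x"
    using quotient_systemD(4)[OF qs] .
  have fL: "f x \<in> carrier L" if "x \<in> carrier G" for x
    using that \<rho>(1) compat by (auto simp: cL f_def)
  have hom: "f \<in> hom G L"
    using fL \<rho>(2) by (auto simp: hom_def L_def inverse_limit_simps f_def intro!: restrict_ext)
  have inj: "inj_on f (carrier G)"
  proof (rule inj_onI)
    fix x y assume *: "x \<in> carrier G" "y \<in> carrier G" "f x = f y"
    have "\<rho> i x = \<rho> i y" if "i \<in> I" for i using fun_cong[OF *(3), of i] that by (simp add: f_def)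
    then show "x = y" using quotient_systemD(5)[OF qs] * by blast
  qed
  have surj: "carrier L \<subseteq> f ` carrier G"
  proof
    fix z assume z: "z \<in> carrier L"
    then obtain x where x: "x \<in> carrier G" "\<forall>i\<in>I. \<rho> i x = z i"
      using quotient_systemD(6)[OF qs, of z] by (auto simp: cL)
    have "f x = z" using x z by (auto simp: f_def cL PiE_iff extensional_def)
    then show "z \<in> f ` carrier G" using x by blast
  qed
  have img: "f ` carrier G = carrier L" using fL surj by blast
  have tsL: "topspace (gtop L) = carrier L" by (auto simp: tL TT_def cL)
  have cont: "continuous_map (gtop G) (gtop L) f"
    unfolding tL continuous_map_in_subtopology
  proof
    have "continuous_map (gtop G) (discrete_topology (carrier (F i))) (\<lambda>x. f x i)" if "i \<in> I" for i
      using quotient_systemD(3)[OF qs that] that by (simp add: f_def)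
    then show "continuous_map (gtop G) TT f"
      unfolding TT_def continuous_map_componentwise by (auto simp: f_def)
    show "f \<in> topspace (gtop G) \<rightarrow> carrier L" using fL by (simp add: ts)
  qed
  have op: "open_map (gtop G) (gtop L) f"
    unfolding open_map_def
  proof (intro allI impI)
    fix W assume W: "openin (gtop G) W"
    have "\<exists>T. openin (gtop L) T \<and> z \<in> T \<and> T \<subseteq> f ` W" if zW: "z \<in> f ` W" for z
    proof -
      obtain x where x: "x \<in> W" "z = f x" using zW by blast
      then have xc: "x \<in> carrier G" using openin_subset[OF W] ts by blast
      obtain k where k: "k \<in> I" "\<forall>y\<in>carrier G. \<rho> k y = \<rho> k x \<longrightarrow> y \<in> W"
        using quotient_systemD(7)[OF qs W x(1)] by blast
      define T where "T = {w \<in> topspace TT. w k = \<rho> k x} \<inter> carrier L"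
      have "continuous_map TT (discrete_topology (carrier (F k))) (\<lambda>w. w k)"
        unfolding TT_def using k(1) by (rule continuous_map_product_projection)
      then have "openin TT {w \<in> topspace TT. w k \<in> {\<rho> k x}}"
        by (rule openin_continuous_map_preimage) (use \<rho>(1) k xc in auto)
      then have "openin (gtop L) T"
        unfolding tL openin_subtopology T_def by auto
      moreover have "z \<in> T" using fL[OF xc] x k by (auto simp: T_def TT_def cL f_def)
      moreover have "T \<subseteq> f ` W"
      proof
        fix w assume w: "w \<in> T"
        then obtain y where y: "y \<in> carrier G" "w = f y" using surj by (auto simp: T_def)
        then have "y \<in> W" using w k by (auto simp: T_def f_def)
        then show "w \<in> f ` W" using y by blast
      qed
      ultimately show ?thesis by blast
    qed
    then show "openin (gtop L) (f ` W)" by (subst openin_subopen) blast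
  qed
  have "homeomorphic_map (gtop G) (gtop L) f"
    using bijective_open_imp_homeomorphic_map[OF cont op] img inj by (simp add: ts tsL)
  moreover have "f \<in> iso G L" using hom inj img by (auto simp: iso_def bij_betw_def)
  ultimately show ?thesis by (auto simp: topgroup_isomorphic_def L_def)
qed

lemma topological_group_subtopgroup:
  fixes G :: "'a topgroup" (structure)
  assumes G: "topological_group G" and K: "subgroup K G"
  shows "topological_group (subtopgroup G K)"
proof -
  have grp: "group G" and ts: "topspace (gtop G) = carrier G" using G by (auto simp: topological_group_def)
  interpret group G by fact
  have KG: "K \<subseteq> carrier G" using K by (rule subgroup.subset)
  have gK: "group (subtopgroup G K)" by (rule group_subtopgroup[OF grp K])
  have inv: "inv\<^bsub>subtopgroup G K\<^esub> x = inv x" if "x \<in> K" for x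
    by (rule group.inv_equality[OF gK]) (use that K KG in \<open>auto simp: subgroup.m_inv_closed\<close>)
  have "continuous_map (subtopology (prod_topology (gtop G) (gtop G)) (K \<times> K)) (gtop G) (\<lambda>(x, y). x \<otimes> y)"
    using G continuous_map_from_subtopology by (auto simp: topological_group_def)
  moreover have "(\<lambda>(x, y). x \<otimes> y) \<in> topspace (subtopology (prod_topology (gtop G) (gtop G)) (K \<times> K)) \<rightarrow> K"
    using K by (auto intro: subgroup.m_closed)
  ultimately have m: "continuous_map (prod_topology (subtopology (gtop G) K) (subtopology (gtop G) K))
      (subtopology (gtop G) K) (\<lambda>(x, y). x \<otimes> y)"
    unfolding subtopology_Times[symmetric] by (simp add: continuous_map_in_subtopology)
  have "continuous_map (subtopology (gtop G) K) (gtop G) (\<lambda>x. inv x)"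
    using G continuous_map_from_subtopology by (auto simp: topological_group_def)
  moreover have "(\<lambda>x. inv x) \<in> topspace (subtopology (gtop G) K) \<rightarrow> K"
    using K by (auto intro: subgroup.m_inv_closed)
  ultimately have "continuous_map (subtopology (gtop G) K) (subtopology (gtop G) K) (\<lambda>x. inv x)"
    by (simp add: continuous_map_in_subtopology)
  then have i: "continuous_map (subtopology (gtop G) K) (subtopology (gtop G) K) (\<lambda>x. inv\<^bsub>subtopgroup G K\<^esub> x)"
    by (rule continuous_map_eq) (auto simp: inv ts)
  show ?thesis
    using gK m i KG unfolding topological_group_def by (simp add: ts inf_absorb2)
qed

text \<open>The finite quotients of \<open>K\<close> are the images \<open>\<rho> i ` K\<close>. Closedness is what makes compatible families in them come from
\<open>K\<close>: such a family comes from some \<open>x \<in> G\<close>, all of whose basic neighbourhoods meet \<open>K\<close>.\<close>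

lemma inverse_limit_of_finite_closed_subgroup:
  fixes G :: "'a topgroup"
  assumes GP: "inverse_limit_of_finite \<P> G" and K: "subgroup K G" and cl: "closedin (gtop G) K"
    and her: "\<And>F H. \<P> F \<Longrightarrow> group F \<Longrightarrow> subgroup H F \<Longrightarrow> \<P> (F\<lparr>carrier := H\<rparr>)"
  shows "inverse_limit_of_finite \<P> (subtopgroup G K)"
proof -
  have G: "topological_group G" using GP by (simp add: inverse_limit_of_finite_def)
  then have grp: "group G" and ts: "topspace (gtop G) = carrier G" by (auto simp: topological_group_def)
  obtain I :: "'a set set" and leq F \<phi> where sys: "inverse_system I leq F \<phi>"
    and F: "\<And>i. i \<in> I \<Longrightarrow> finite (carrier (F i)) \<and> \<P> (F i)"
    and iso: "topgroup_isomorphic G (inverse_limit I leq F \<phi>)"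
    using GP unfolding inverse_limit_of_finite_def by blast
  obtain \<rho> where qs: "quotient_system I leq F \<phi> \<rho> G"
    using quotient_system_of_inverse_limit[OF G sys iso] by blast
  define F' where "F' = (\<lambda>i. (F i)\<lparr>carrier := \<rho> i ` K\<rparr>)"
  have KG: "K \<subseteq> carrier G" using K by (rule subgroup.subset)
  have grF: "group (F i)" if "i \<in> I" for i using inverse_systemD(4)[OF sys that] .
  note hom = quotient_systemD(2)[OF qs]
  note compat = quotient_systemD(4)[OF qs]
  have subF: "subgroup (\<rho> i ` K) (F i)" if "i \<in> I" for i
    using group_hom.subgroup_img_is_subgroup[of G "F i" "\<rho> i" K] hom grF grp K that
    by (auto simp: group_hom_def group_hom_axioms_def)
  have order: "I \<noteq> {}" "\<forall>i\<in>I. leq i i"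
    "\<forall>i\<in>I. \<forall>j\<in>I. \<forall>k\<in>I. leq i j \<longrightarrow> leq j k \<longrightarrow> leq i k"
    "\<forall>i\<in>I. \<forall>j\<in>I. \<exists>k\<in>I. leq i k \<and> leq j k"
    and maps: "\<And>i x. i \<in> I \<Longrightarrow> x \<in> carrier (F i) \<Longrightarrow> \<phi> i i x = x"
    "\<And>i j k x. i \<in> I \<Longrightarrow> j \<in> I \<Longrightarrow> k \<in> I \<Longrightarrow> leq i j \<Longrightarrow> leq j k \<Longrightarrow> x \<in> carrier (F k) \<Longrightarrow>
      \<phi> i j (\<phi> j k x) = \<phi> i k x"
    using sys unfolding inverse_system_def by blast+
  have sys': "inverse_system I leq F' \<phi>"
    unfolding inverse_system_def
  proof (intro conjI)
    show "\<forall>i\<in>I. group (F' i)"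
      using subF grF by (auto simp: F'_def intro: group.subgroup_imp_group)
    show "\<forall>i\<in>I. \<forall>j\<in>I. leq i j \<longrightarrow> \<phi> i j \<in> hom (F' j) (F' i)"
    proof (intro ballI impI)
      fix i j assume ij: "i \<in> I" "j \<in> I" "leq i j"
      have h: "\<phi> i j \<in> hom (F j) (F i)" using inverse_systemD(5)[OF sys ij] .
      show "\<phi> i j \<in> hom (F' j) (F' i)"
      proof (rule homI)
        fix x assume "x \<in> carrier (F' j)" then show "\<phi> i j x \<in> carrier (F' i)"
          using compat[OF ij] KG by (auto simp: F'_def)
      next
        fix x y assume "x \<in> carrier (F' j)" "y \<in> carrier (F' j)"
        then have "x \<in> carrier (F j)" "y \<in> carrier (F j)"
          using subgroup.subset[OF subF[OF ij(2)]] by (auto simp: F'_def)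
        then show "\<phi> i j (x \<otimes>\<^bsub>F' j\<^esub> y) = \<phi> i j x \<otimes>\<^bsub>F' i\<^esub> \<phi> i j y"
          using hom_mult[OF h] by (simp add: F'_def)
      qed
    qed
    have "x \<in> carrier (F i)" if "i \<in> I" "x \<in> carrier (F' i)" for i x
      using that subgroup.subset[OF subF[OF that(1)]] by (auto simp: F'_def)
    then show "\<forall>i\<in>I. \<forall>x\<in>carrier (F' i). \<phi> i i x = x"
      "\<forall>i\<in>I. \<forall>j\<in>I. \<forall>k\<in>I. leq i j \<longrightarrow> leq j k \<longrightarrow>
        (\<forall>x\<in>carrier (F' k). \<phi> i j (\<phi> j k x) = \<phi> i k x)"
      using maps by blast+
  qed (fact order)+
  have "quotient_system I leq F' \<phi> \<rho> (subtopgroup G K)"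
    unfolding quotient_system_def
  proof (intro conjI)
    show "inverse_system I leq F' \<phi>" by fact
    show "\<forall>i\<in>I. \<rho> i \<in> hom (subtopgroup G K) (F' i)"
      using hom KG by (auto simp: hom_def F'_def subset_iff)
    show "\<forall>i\<in>I. continuous_map (gtop (subtopgroup G K)) (discrete_topology (carrier (F' i))) (\<rho> i)"
    proof
      fix i assume i: "i \<in> I"
      have c: "continuous_map (gtop G) (discrete_topology (carrier (F i))) (\<rho> i)"
        using quotient_systemD(3)[OF qs i] .
      have eq: "discrete_topology (carrier (F' i)) = subtopology (discrete_topology (carrier (F i))) (\<rho> i ` K)"
        using subgroup.subset[OF subF[OF i]] by (simp add: F'_def subtopology_discrete_topology inf_absorb2)
      show "continuous_map (gtop (subtopgroup G K)) (discrete_topology (carrier (F' i))) (\<rho> i)"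
        unfolding eq by (rule continuous_map_into_subtopology)
          (use continuous_map_from_subtopology[OF c, of K] in auto)
    qed
    show "\<forall>i\<in>I. \<forall>j\<in>I. leq i j \<longrightarrow> (\<forall>x\<in>carrier (subtopgroup G K). \<phi> i j (\<rho> j x) = \<rho> i x)"
      using compat KG by auto
    show "\<forall>x\<in>carrier (subtopgroup G K). \<forall>y\<in>carrier (subtopgroup G K). (\<forall>i\<in>I. \<rho> i x = \<rho> i y) \<longrightarrow> x = y"
    proof (intro ballI impI)
      fix x y assume "x \<in> carrier (subtopgroup G K)" "y \<in> carrier (subtopgroup G K)" "\<forall>i\<in>I. \<rho> i x = \<rho> i y"
      then show "x = y" using KG by (intro quotient_systemD(5)[OF qs]) auto
    qed
    show "\<forall>z\<in>\<Pi>\<^sub>E i\<in>I. carrier (F' i). (\<forall>i\<in>I. \<forall>j\<in>I. leq i j \<longrightarrow> \<phi> i j (z j) = z i) \<longrightarrow>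
        (\<exists>x\<in>carrier (subtopgroup G K). \<forall>i\<in>I. \<rho> i x = z i)"
    proof (intro ballI impI)
      fix z assume z: "z \<in> (\<Pi>\<^sub>E i\<in>I. carrier (F' i))" "\<forall>i\<in>I. \<forall>j\<in>I. leq i j \<longrightarrow> \<phi> i j (z j) = z i"
      have "z \<in> (\<Pi>\<^sub>E i\<in>I. carrier (F i))"
      proof (rule PiE_I)
        fix i assume i: "i \<in> I"
        then have "z i \<in> \<rho> i ` K" using z(1) by (auto simp: F'_def PiE_iff)
        then show "z i \<in> carrier (F i)" using subgroup.subset[OF subF[OF i]] by blast
      qed (use z(1) in auto)
      then obtain x where x: "x \<in> carrier G" "\<forall>i\<in>I. \<rho> i x = z i"
        using quotient_systemD(6)[OF qs, of z] z(2) by auto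
      have "x \<in> K"
      proof (rule ccontr)
        assume "x \<notin> K"
        moreover have "openin (gtop G) (carrier G - K)" using cl by (simp add: closedin_def ts)
        ultimately obtain k where k: "k \<in> I" "\<forall>y\<in>carrier G. \<rho> k y = \<rho> k x \<longrightarrow> y \<in> carrier G - K"
          using quotient_systemD(7)[OF qs, of "carrier G - K" x] x(1) by auto
        have "z k \<in> \<rho> k ` K" using z(1) k(1) by (auto simp: F'_def PiE_iff)
        then obtain y where "y \<in> K" "\<rho> k y = \<rho> k x" using x k(1) by auto
        then show False using k KG by blast
      qed
      then show "\<exists>x\<in>carrier (subtopgroup G K). \<forall>i\<in>I. \<rho> i x = z i" using x by auto
    qed
    show "\<forall>W x. openin (gtop (subtopgroup G K)) W \<longrightarrow> x \<in> W \<longrightarrow>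
        (\<exists>k\<in>I. \<forall>y\<in>carrier (subtopgroup G K). \<rho> k y = \<rho> k x \<longrightarrow> y \<in> W)"
    proof (intro allI impI)
      fix W x assume "openin (gtop (subtopgroup G K)) W" and x: "x \<in> W"
      then obtain V where V: "openin (gtop G) V" "W = V \<inter> K" by (auto simp: openin_subtopology)
      then obtain k where "k \<in> I" "\<forall>y\<in>carrier G. \<rho> k y = \<rho> k x \<longrightarrow> y \<in> V"
        using quotient_systemD(7)[OF qs V(1), of x] x by auto
      then show "\<exists>k\<in>I. \<forall>y\<in>carrier (subtopgroup G K). \<rho> k y = \<rho> k x \<longrightarrow> y \<in> W"
        using V KG by auto
    qed
  qed
  then have "topgroup_isomorphic (subtopgroup G K) (inverse_limit I leq F' \<phi>)"
    using inverse_limit_of_quotient_system topological_group_subtopgroup[OF G K] by blast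
  moreover have "\<forall>i\<in>I. finite (carrier (F' i)) \<and> \<P> (F' i)"
    using F her grF subF finite_subset[OF subgroup.subset[OF subF]] by (auto simp: F'_def)
  ultimately show ?thesis
    unfolding inverse_limit_of_finite_def using sys' topological_group_subtopgroup[OF G K] by blast
qed

lemma subtopgroup_carrier:
  fixes G :: "'a topgroup"
  assumes "topspace (gtop G) = carrier G"
  shows "subtopgroup G (carrier G) = G"
  unfolding subtopgroup_def using assms by (simp flip: assms)

lemma topgroup_isomorphic_refl: "topgroup_isomorphic G G"
  unfolding topgroup_isomorphic_def by (rule exI[of _ id]) (auto simp: iso_def hom_def)

lemma Hausdorff_inverse_limit_of_finite:
  assumes "inverse_limit_of_finite \<P> (G :: 'b topgroup)" shows "Hausdorff_space (gtop G)"
proof -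
  obtain I :: "'b set set" and leq and F :: "'b set \<Rightarrow> nat monoid" and \<phi> f
    where "homeomorphic_map (gtop G) (gtop (inverse_limit I leq F \<phi>)) f"
    using assms unfolding inverse_limit_of_finite_def topgroup_isomorphic_def by blast
  moreover have "Hausdorff_space (gtop (inverse_limit I leq F \<phi>))"
    unfolding inverse_limit_simps
    by (intro Hausdorff_space_subtopology) (simp add: Hausdorff_space_product_topology)
  ultimately show ?thesis
    using homeomorphic_Hausdorff_space homeomorphic_map_imp_homeomorphic_space by blast
qed

section \<open>Nilpotent groups\<close>

context group begin

abbreviation commutator :: "'a \<Rightarrow> 'a \<Rightarrow> 'a" where
  "commutator x y \<equiv> x \<otimes> y \<otimes> inv x \<otimes> inv y"

lemma commutator_closed: "x \<in> carrier G \<Longrightarrow> y \<in> carrier G \<Longrightarrow> commutator x y \<in> carrier G"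
  by simp

lemma conj_mult:
  assumes "g \<in> carrier G" "x \<in> carrier G" "y \<in> carrier G"
  shows "(g \<otimes> x \<otimes> inv g) \<otimes> (g \<otimes> y \<otimes> inv g) = g \<otimes> (x \<otimes> y) \<otimes> inv g"
proof -
  have "(g \<otimes> x \<otimes> inv g) \<otimes> (g \<otimes> y \<otimes> inv g) = g \<otimes> x \<otimes> (inv g \<otimes> g) \<otimes> y \<otimes> inv g"
    using assms by (simp only: m_assoc m_closed inv_closed)
  then show ?thesis using assms by (simp add: m_assoc)
qed

lemma conj_inv:
  assumes "g \<in> carrier G" "x \<in> carrier G"
  shows "inv (g \<otimes> x \<otimes> inv g) = g \<otimes> inv x \<otimes> inv g"
  using assms by (simp add: inv_mult_group m_assoc)

lemma conj_commutator:
  assumes "g \<in> carrier G" "x \<in> carrier G" "y \<in> carrier G"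
  shows "g \<otimes> commutator x y \<otimes> inv g = commutator (g \<otimes> x \<otimes> inv g) (g \<otimes> y \<otimes> inv g)"
  using assms by (simp add: conj_mult conj_inv)

lemma lower_central_normal: "lower_central G k \<lhd> G"
proof (induction k)
  case 0
  show ?case by (rule normal_invI) (auto intro: subgroup_self)
next
  case (Suc k)
  interpret N: normal "lower_central G k" G by (rule Suc)
  show ?case unfolding lower_central.simps
  proof (rule normal_generateI)
    show "{commutator x y |x y. x \<in> lower_central G k \<and> y \<in> carrier G} \<subseteq> carrier G"
      using N.subset by (auto dest: subsetD)
    fix h g assume "h \<in> {commutator x y |x y. x \<in> lower_central G k \<and> y \<in> carrier G}"
      and g: "g \<in> carrier G"
    then obtain x y where xy: "x \<in> lower_central G k" "y \<in> carrier G" "h = commutator x y" by blast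
    have "x \<in> carrier G" using N.subset xy(1) by blast
    then have "g \<otimes> h \<otimes> inv g = commutator (g \<otimes> x \<otimes> inv g) (g \<otimes> y \<otimes> inv g)"
      using conj_commutator g xy by simp
    moreover have "g \<otimes> x \<otimes> inv g \<in> lower_central G k" using N.inv_op_closed2 xy(1) g by blast
    moreover have "g \<otimes> y \<otimes> inv g \<in> carrier G" using xy(2) g by simp
    ultimately show "g \<otimes> h \<otimes> inv g \<in> {commutator x y |x y. x \<in> lower_central G k \<and> y \<in> carrier G}"
      by blast
  qed
qed

lemma lower_central_subset: "lower_central G k \<subseteq> carrier G"
  using normal_imp_subgroup[OF lower_central_normal] by (rule subgroup.subset)

lemma commutator_in_lower_central:
  "x \<in> lower_central G k \<Longrightarrow> y \<in> carrier G \<Longrightarrow> commutator x y \<in> lower_central G (Suc k)"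
  unfolding lower_central.simps by (rule generate.incl) blast

lemma lower_central_subgroup:
  assumes H: "subgroup H G"
  shows "lower_central (G\<lparr>carrier := H\<rparr>) k \<subseteq> lower_central G k"
proof (induction k)
  case 0 then show ?case using subgroup.subset[OF H] by simp
next
  case (Suc k)
  interpret H: group "G\<lparr>carrier := H\<rparr>" using H by (rule subgroup_imp_group)
  define S where "S = {x \<otimes>\<^bsub>G\<lparr>carrier := H\<rparr>\<^esub> y \<otimes>\<^bsub>G\<lparr>carrier := H\<rparr>\<^esub> inv\<^bsub>G\<lparr>carrier := H\<rparr>\<^esub> x \<otimes>\<^bsub>G\<lparr>carrier := H\<rparr>\<^esub> inv\<^bsub>G\<lparr>carrier := H\<rparr>\<^esub> y | x y.
                   x \<in> lower_central (G\<lparr>carrier := H\<rparr>) k \<and> y \<in> carrier (G\<lparr>carrier := H\<rparr>)}"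
  have S: "S \<subseteq> H"
    unfolding S_def using H.lower_central_subset[of k] H.commutator_closed by fastforce
  have S2: "S \<subseteq> {commutator x y |x y. x \<in> lower_central G k \<and> y \<in> carrier G}"
  proof
    fix z assume "z \<in> S"
    then obtain x y where "x \<in> lower_central (G\<lparr>carrier := H\<rparr>) k" "y \<in> H"
      "z = x \<otimes> y \<otimes> inv\<^bsub>G\<lparr>carrier := H\<rparr>\<^esub> x \<otimes> inv\<^bsub>G\<lparr>carrier := H\<rparr>\<^esub> y"
      by (auto simp: S_def)
    moreover from this have "x \<in> H" using H.lower_central_subset[of k] by auto
    ultimately have "x \<in> lower_central G k" "y \<in> carrier G" "z = commutator x y"
      using Suc m_inv_consistent[OF H] subgroup.subset[OF H] by auto
    then show "z \<in> {commutator x y |x y. x \<in> lower_central G k \<and> y \<in> carrier G}" by blast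
  qed
  have "lower_central (G\<lparr>carrier := H\<rparr>) (Suc k) = generate G S"
    unfolding lower_central.simps S_def[symmetric] using generate_consistent[OF S H] .
  also have "\<dots> \<subseteq> lower_central G (Suc k)"
    unfolding lower_central.simps by (rule mono_generate[OF S2])
  finally show ?case .
qed

lemma nilpotent_subgroup:
  assumes "nilpotent_group G" "subgroup H G"
  shows "nilpotent_group (G\<lparr>carrier := H\<rparr>)"
proof -
  interpret H: group "G\<lparr>carrier := H\<rparr>" using assms(2) by (rule subgroup_imp_group)
  obtain k where "lower_central G k = {\<one>}" using assms(1) by (auto simp: nilpotent_group_def)
  then have "lower_central (G\<lparr>carrier := H\<rparr>) k \<subseteq> {\<one>}" using lower_central_subgroup[OF assms(2), of k] by simp
  moreover have "\<one> \<in> lower_central (G\<lparr>carrier := H\<rparr>) k"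
    using subgroup.one_closed[OF normal_imp_subgroup[OF H.lower_central_normal[of k]]] by simp
  ultimately show ?thesis unfolding nilpotent_group_def using H.is_group by (auto intro!: exI[of _ k])
qed

text \<open>The identity \<open>[x\<^sup>n, y] = [x, y]\<^sup>n\<close> for a central commutator, with inverses cleared.\<close>

lemma central_commutator_pow:
  assumes c: "x \<in> carrier G" "y \<in> carrier G" "c \<in> carrier G"
    and xy: "x \<otimes> y = c \<otimes> (y \<otimes> x)" and cx: "c \<otimes> x = x \<otimes> c" and cy: "c \<otimes> y = y \<otimes> c"
  shows "x [^] (n::nat) \<otimes> y = c [^] n \<otimes> (y \<otimes> x [^] n)"
proof (induction n)
  case 0 show ?case using c by simp
next
  case (Suc n)
  have cn: "x \<otimes> c [^] n = c [^] n \<otimes> x" using c cx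
    by (induction n) (simp_all add: m_assoc[symmetric], simp add: m_assoc)
  have "x [^] Suc n \<otimes> y = x \<otimes> (x [^] n \<otimes> y)" using c by (simp only: nat_pow_Suc2 m_assoc nat_pow_closed)
  also have "\<dots> = (x \<otimes> c [^] n) \<otimes> y \<otimes> x [^] n" using c Suc by (simp add: m_assoc)
  also have "\<dots> = c [^] n \<otimes> (x \<otimes> y) \<otimes> x [^] n" using c by (simp add: cn m_assoc)
  also have "\<dots> = (c [^] n \<otimes> c) \<otimes> (y \<otimes> (x \<otimes> x [^] n))" using c by (simp add: xy m_assoc)
  also have "\<dots> = c [^] Suc n \<otimes> (y \<otimes> x [^] Suc n)" using c nat_pow_Suc2[of x n] by simp
  finally show ?case .
qed

text \<open>In an abelian image, exponent \<open>m\<close> of the generators passes to all elements.\<close>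

lemma generate_pow_image:
  assumes "group Q" and r: "r \<in> hom G Q" and S: "S \<subseteq> carrier G"
    and com: "\<And>u v. u \<in> generate G S \<Longrightarrow> v \<in> generate G S \<Longrightarrow> r u \<otimes>\<^bsub>Q\<^esub> r v = r v \<otimes>\<^bsub>Q\<^esub> r u"
    and pow: "\<And>s. s \<in> S \<Longrightarrow> r s [^]\<^bsub>Q\<^esub> (m::nat) = \<one>\<^bsub>Q\<^esub>"
    and h: "h \<in> generate G S"
  shows "r h [^]\<^bsub>Q\<^esub> m = \<one>\<^bsub>Q\<^esub>"
proof -
  interpret Q: group Q by fact
  interpret h: group_hom G Q r using r by unfold_locales
  have *: "x \<in> carrier G" if "x \<in> generate G S" for x using generate_in_carrier[OF S that] .
  show ?thesis using h
  proof (induction h rule: generate.induct)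
    case (inv s)
    then show ?case using pow[OF inv] S by (simp add: subset_iff Q.nat_pow_inv)
  next
    case (eng u v)
    then show ?case using com[OF eng(1,2)] * by (simp add: Q.pow_mult_distrib)
  qed (use pow in auto)
qed

lemma commutator_eq:
  assumes "x \<in> carrier G" "y \<in> carrier G"
  shows "x \<otimes> y = commutator x y \<otimes> (y \<otimes> x)"
proof -
  have "commutator x y \<otimes> (y \<otimes> x) = x \<otimes> y \<otimes> (inv x \<otimes> (inv y \<otimes> y) \<otimes> x)"
    using assms by (simp only: m_assoc m_closed inv_closed)
  then show ?thesis using assms by simp
qed

text \<open>Modulo the next term, a term of the lower central series becomes central. The statements about nilpotent groups
below are proved by induction along the series, each step being a computation with central commutators in this
quotient.\<close>

lemma lower_central_quotient:
  obtains r where "group (G Mod lower_central G (Suc k))" "group_hom G (G Mod lower_central G (Suc k)) r"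
    "\<And>x. x \<in> carrier G \<Longrightarrow> r x = \<one>\<^bsub>G Mod lower_central G (Suc k)\<^esub> \<longleftrightarrow> x \<in> lower_central G (Suc k)"
    "\<And>x y. x \<in> lower_central G k \<Longrightarrow> y \<in> carrier G \<Longrightarrow>
      r x \<otimes>\<^bsub>G Mod lower_central G (Suc k)\<^esub> r y = r y \<otimes>\<^bsub>G Mod lower_central G (Suc k)\<^esub> r x"
proof -
  define N where "N = lower_central G (Suc k)"
  interpret N: normal N G unfolding N_def by (rule lower_central_normal)
  define Q where "Q = G Mod N"
  interpret Q: group Q unfolding Q_def by (rule N.factorgroup_is_group)
  define r where "r = (\<lambda>x. N #> x)"
  interpret h: group_hom G Q r
    using N.r_coset_hom_Mod by unfold_locales (simp add: r_def Q_def)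
  have ker: "r x = \<one>\<^bsub>Q\<^esub> \<longleftrightarrow> x \<in> N" if "x \<in> carrier G" for x
    using coset_join1[OF _ that N.subgroup_axioms] coset_join2[OF that N.subgroup_axioms]
    by (auto simp: r_def Q_def FactGroup_def)
  have com: "r x \<otimes>\<^bsub>Q\<^esub> r y = r y \<otimes>\<^bsub>Q\<^esub> r x"
    if "x \<in> lower_central G k" "y \<in> carrier G" for x y
  proof -
    have x: "x \<in> carrier G" using that lower_central_subset by blast
    have "r (commutator x y) = \<one>\<^bsub>Q\<^esub>"
      using ker[OF commutator_closed[OF x that(2)]] commutator_in_lower_central[OF that] by (simp only: N_def)
    moreover have "r x \<otimes>\<^bsub>Q\<^esub> r y = r (commutator x y) \<otimes>\<^bsub>Q\<^esub> (r y \<otimes>\<^bsub>Q\<^esub> r x)"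
      using arg_cong[OF commutator_eq[OF x that(2)], of r] x that(2)
      by (simp only: h.hom_mult m_closed commutator_closed)
    ultimately have "r x \<otimes>\<^bsub>Q\<^esub> r y = \<one>\<^bsub>Q\<^esub> \<otimes>\<^bsub>Q\<^esub> (r y \<otimes>\<^bsub>Q\<^esub> r x)" by (simp only:)
    also have "\<dots> = r y \<otimes>\<^bsub>Q\<^esub> r x" by (rule Q.l_one) (use x that(2) in simp)
    finally show ?thesis .
  qed
  show ?thesis
    by (rule that[of r, folded N_def, folded Q_def, OF Q.is_group h.group_hom_axioms ker com])
qed

lemma eq_one_of_coprime_pow:
  assumes "x \<in> carrier G" "x [^] (a::nat) = \<one>" "x [^] (b::nat) = \<one>" "coprime a b"
  shows "x = \<one>"
proof -
  have "ord x dvd a" "ord x dvd b" using assms pow_eq_id by auto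
  then have "ord x dvd 1" using assms(4) coprime_common_divisor by blast
  then have "x [^] (1::nat) = \<one>" using assms pow_eq_id[of x 1] by blast
  then show ?thesis using assms by simp
qed

text \<open>By induction \<open>[x, y]\<close> lies in every term of the lower central series. Modulo the next term it is central, so
its \<open>a\<close>-th power is \<open>[x\<^sup>a, y] = 1\<close> and its \<open>b\<close>-th power is \<open>[x, y\<^sup>b] = 1\<close>.\<close>

lemma nilpotent_coprime_commute:
  assumes nil: "nilpotent_group G" and c: "x \<in> carrier G" "y \<in> carrier G"
    and pow: "x [^] (a::nat) = \<one>" "y [^] (b::nat) = \<one>" "coprime a b"
  shows "x \<otimes> y = y \<otimes> x"
proof -
  have "commutator x y \<in> lower_central G k" for k
  proof (induction k)
    case 0 show ?case using c by simp
  next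
    case (Suc k)
    define Q where "Q = G Mod lower_central G (Suc k)"
    obtain r where Q: "group Q" and h: "group_hom G Q r"
      and ker: "\<And>x. x \<in> carrier G \<Longrightarrow> r x = \<one>\<^bsub>Q\<^esub> \<longleftrightarrow> x \<in> lower_central G (Suc k)"
      and cent: "\<And>x y. x \<in> lower_central G k \<Longrightarrow> y \<in> carrier G \<Longrightarrow> r x \<otimes>\<^bsub>Q\<^esub> r y = r y \<otimes>\<^bsub>Q\<^esub> r x"
      using lower_central_quotient[of k] unfolding Q_def by blast
    interpret h: group_hom G Q r by (rule h)
    let ?c = "r (commutator x y)"
    have cc: "?c \<in> carrier Q" "r x \<in> carrier Q" "r y \<in> carrier Q" using c by simp_all
    have cx: "?c \<otimes>\<^bsub>Q\<^esub> r x = r x \<otimes>\<^bsub>Q\<^esub> ?c" and cy: "?c \<otimes>\<^bsub>Q\<^esub> r y = r y \<otimes>\<^bsub>Q\<^esub> ?c"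
      using cent[OF Suc] c by blast+
    have eq: "r x \<otimes>\<^bsub>Q\<^esub> r y = ?c \<otimes>\<^bsub>Q\<^esub> (r y \<otimes>\<^bsub>Q\<^esub> r x)"
      using arg_cong[OF commutator_eq[OF c], of r] c by (simp only: h.hom_mult m_closed commutator_closed)
    have px: "r x [^]\<^bsub>Q\<^esub> a = \<one>\<^bsub>Q\<^esub>" "r y [^]\<^bsub>Q\<^esub> b = \<one>\<^bsub>Q\<^esub>"
      using pow c by (metis h.hom_nat_pow h.hom_one)+
    have "?c [^]\<^bsub>Q\<^esub> a \<otimes>\<^bsub>Q\<^esub> r y = \<one>\<^bsub>Q\<^esub> \<otimes>\<^bsub>Q\<^esub> r y"
      using h.H.central_commutator_pow[OF cc(2,3,1) eq cx cy, of a] cc px by simp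
    then have ca: "?c [^]\<^bsub>Q\<^esub> a = \<one>\<^bsub>Q\<^esub>" using cc h.H.r_cancel by blast
    let ?d = "inv\<^bsub>Q\<^esub> ?c"
    have dc: "?d \<in> carrier Q" using cc by simp
    have comm_inv: "?d \<otimes>\<^bsub>Q\<^esub> z = z \<otimes>\<^bsub>Q\<^esub> ?d" if "?c \<otimes>\<^bsub>Q\<^esub> z = z \<otimes>\<^bsub>Q\<^esub> ?c" "z \<in> carrier Q" for z
    proof -
      have "?c \<otimes>\<^bsub>Q\<^esub> (z \<otimes>\<^bsub>Q\<^esub> ?d) = z"
        using that cc dc by (simp only: h.H.m_assoc[symmetric]) (simp add: h.H.m_assoc)
      then show ?thesis using h.H.inv_solve_left[of "z \<otimes>\<^bsub>Q\<^esub> ?d" "?c" z] that cc dc by simp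
    qed
    have eq': "r y \<otimes>\<^bsub>Q\<^esub> r x = ?d \<otimes>\<^bsub>Q\<^esub> (r x \<otimes>\<^bsub>Q\<^esub> r y)"
      using h.H.inv_solve_left[of "r y \<otimes>\<^bsub>Q\<^esub> r x" ?c "r x \<otimes>\<^bsub>Q\<^esub> r y"] cc eq by simp
    have "?d [^]\<^bsub>Q\<^esub> b \<otimes>\<^bsub>Q\<^esub> r x = \<one>\<^bsub>Q\<^esub> \<otimes>\<^bsub>Q\<^esub> r x"
      using h.H.central_commutator_pow[OF cc(3,2) dc eq' comm_inv[OF cy cc(3)] comm_inv[OF cx cc(2)], of b] cc px
      by simp
    then have "?d [^]\<^bsub>Q\<^esub> b = \<one>\<^bsub>Q\<^esub>" using cc dc h.H.r_cancel by blast
    then have "?c [^]\<^bsub>Q\<^esub> b = \<one>\<^bsub>Q\<^esub>" using cc h.H.nat_pow_inv[of ?c b] by simp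
    then have "?c = \<one>\<^bsub>Q\<^esub>" using h.H.eq_one_of_coprime_pow[OF cc(1) ca _ pow(3)] by blast
    then show ?case using ker[OF commutator_closed[OF c]] by blast
  qed
  then have "commutator x y = \<one>" using nil by (auto simp: nilpotent_group_def)
  then show ?thesis using commutator_eq[OF c] c by simp
qed

text \<open>Each factor of the series is abelian and generated by the classes of commutators \<open>[x, y]\<close> with \<open>x\<close> in the
previous term. There \<open>[x, y]\<^sup>m = [x\<^sup>m, y]\<close>, which is trivial because \<open>x\<^sup>m\<close> lies one term further down by
induction.\<close>

lemma lower_central_pow:
  assumes S: "S \<subseteq> carrier G" and gen: "generate G S = carrier G"
    and pow: "\<And>s. s \<in> S \<Longrightarrow> s [^] (m::nat) = \<one>"
  shows "h \<in> lower_central G k \<Longrightarrow> h [^] m \<in> lower_central G (Suc k)"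
proof (induction k arbitrary: h)
  case 0
  define Q where "Q = G Mod lower_central G (Suc 0)"
  obtain r where Q: "group Q" and h: "group_hom G Q r"
    and ker: "\<And>x. x \<in> carrier G \<Longrightarrow> r x = \<one>\<^bsub>Q\<^esub> \<longleftrightarrow> x \<in> lower_central G (Suc 0)"
    and cent: "\<And>x y. x \<in> lower_central G 0 \<Longrightarrow> y \<in> carrier G \<Longrightarrow> r x \<otimes>\<^bsub>Q\<^esub> r y = r y \<otimes>\<^bsub>Q\<^esub> r x"
    using lower_central_quotient[of 0] unfolding Q_def by blast
  interpret h: group_hom G Q r by (rule h)
  have "r h [^]\<^bsub>Q\<^esub> m = \<one>\<^bsub>Q\<^esub>"
  proof (rule generate_pow_image[OF Q h.homh S])
    fix s assume "s \<in> S" then show "r s [^]\<^bsub>Q\<^esub> m = \<one>\<^bsub>Q\<^esub>"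
      using pow S by (metis h.hom_nat_pow h.hom_one subsetD)
  qed (use cent gen 0 in auto)
  then show ?case using ker 0 by (simp flip: h.hom_nat_pow)
next
  case (Suc k)
  define Q where "Q = G Mod lower_central G (Suc (Suc k))"
  obtain r where Q: "group Q" and h: "group_hom G Q r"
    and ker: "\<And>x. x \<in> carrier G \<Longrightarrow> r x = \<one>\<^bsub>Q\<^esub> \<longleftrightarrow> x \<in> lower_central G (Suc (Suc k))"
    and cent: "\<And>x y. x \<in> lower_central G (Suc k) \<Longrightarrow> y \<in> carrier G \<Longrightarrow> r x \<otimes>\<^bsub>Q\<^esub> r y = r y \<otimes>\<^bsub>Q\<^esub> r x"
    using lower_central_quotient[of "Suc k"] unfolding Q_def by blast
  interpret h: group_hom G Q r by (rule h)
  define T where "T = {commutator x y |x y. x \<in> lower_central G k \<and> y \<in> carrier G}"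
  have lc: "lower_central G (Suc k) = generate G T" by (simp add: T_def)
  have T: "T \<subseteq> carrier G" using lower_central_subset[of k] by (auto simp: T_def)
  have hc: "h \<in> carrier G" using Suc.prems lower_central_subset by blast
  have "r h [^]\<^bsub>Q\<^esub> m = \<one>\<^bsub>Q\<^esub>"
  proof (rule generate_pow_image[OF Q h.homh T])
    fix u v assume "u \<in> generate G T" "v \<in> generate G T"
    then show "r u \<otimes>\<^bsub>Q\<^esub> r v = r v \<otimes>\<^bsub>Q\<^esub> r u" using cent[of u v] lower_central_subset[of "Suc k"]
      unfolding lc by blast
  next
    fix s assume "s \<in> T"
    then obtain x y where xy: "x \<in> lower_central G k" "y \<in> carrier G" "s = commutator x y"
      by (auto simp: T_def)
    have x: "x \<in> carrier G" using xy lower_central_subset by blast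
    have s: "s \<in> lower_central G (Suc k)" using commutator_in_lower_central xy by blast
    have sc: "s \<in> carrier G" using x xy by simp
    have eq: "r x \<otimes>\<^bsub>Q\<^esub> r y = r s \<otimes>\<^bsub>Q\<^esub> (r y \<otimes>\<^bsub>Q\<^esub> r x)"
      using arg_cong[OF commutator_eq[OF x xy(2)], of r] x xy sc
      by (simp only: h.hom_mult m_closed commutator_closed)
    have cxy: "r x [^]\<^bsub>Q\<^esub> m \<otimes>\<^bsub>Q\<^esub> r y = r y \<otimes>\<^bsub>Q\<^esub> r x [^]\<^bsub>Q\<^esub> m"
      using cent[OF Suc.IH[OF xy(1)] xy(2)] x by (simp add: h.hom_nat_pow)
    have cc: "r x \<in> carrier Q" "r y \<in> carrier Q" "r s \<in> carrier Q" using x xy(2) sc by simp_all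
    have "r s [^]\<^bsub>Q\<^esub> m \<otimes>\<^bsub>Q\<^esub> (r y \<otimes>\<^bsub>Q\<^esub> r x [^]\<^bsub>Q\<^esub> m) = \<one>\<^bsub>Q\<^esub> \<otimes>\<^bsub>Q\<^esub> (r y \<otimes>\<^bsub>Q\<^esub> r x [^]\<^bsub>Q\<^esub> m)"
      using h.H.central_commutator_pow[OF cc eq cent[OF s x] cent[OF s xy(2)], of m] cc cxy by simp
    then show "r s [^]\<^bsub>Q\<^esub> m = \<one>\<^bsub>Q\<^esub>" using cc by (meson h.H.r_cancel h.H.m_closed h.H.nat_pow_closed h.H.one_closed)
  qed (use Suc.prems lc in auto)
  then show ?case using ker hc by (simp flip: h.hom_nat_pow)
qed

text \<open>In the subgroup generated by \<open>x\<close> and \<open>y\<close>, taking \<open>m\<close>-th powers descends the lower central series, which reaches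
the trivial group.\<close>

lemma nilpotent_mult_torsion:
  assumes nil: "nilpotent_group G" and c: "x \<in> carrier G" "y \<in> carrier G"
    and pow: "x [^] (m::nat) = \<one>" "y [^] m = \<one>"
  shows "\<exists>k. (x \<otimes> y) [^] (m ^ k) = \<one>"
proof -
  define H where "H = generate G {x, y}"
  have H: "subgroup H G" unfolding H_def by (rule generate_is_subgroup) (use c in auto)
  interpret H: group "G\<lparr>carrier := H\<rparr>" using H by (rule subgroup_imp_group)
  have xy: "{x, y} \<subseteq> H" by (auto simp: H_def intro: generate.incl)
  have *: "h [^] (m ^ k) \<in> lower_central (G\<lparr>carrier := H\<rparr>) k" if h: "h \<in> H" for h k
  proof (induction k)
    case 0 then show ?case using h subgroup.subset[OF H] by auto
  next
    case (Suc k)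
    have "(h [^] (m ^ k)) [^]\<^bsub>G\<lparr>carrier := H\<rparr>\<^esub> m \<in> lower_central (G\<lparr>carrier := H\<rparr>) (Suc k)"
    proof (rule H.lower_central_pow[OF _ _ _ Suc])
      show "generate (G\<lparr>carrier := H\<rparr>) {x, y} = carrier (G\<lparr>carrier := H\<rparr>)"
        using generate_consistent[OF xy H] by (simp add: H_def)
    qed (use xy pow in \<open>auto simp flip: nat_pow_consistent\<close>)
    then show ?case
      using h subgroup.subset[OF H] by (auto simp: nat_pow_pow mult.commute simp flip: nat_pow_consistent)
  qed
  obtain k where "lower_central (G\<lparr>carrier := H\<rparr>) k = {\<one>}"
    using nilpotent_subgroup[OF nil H] by (auto simp: nilpotent_group_def)
  moreover have "x \<otimes> y \<in> H" using xy H by (auto intro: subgroup.m_closed)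
  ultimately show ?thesis using *[of "x \<otimes> y" k] by auto
qed

end

section \<open>Primary parts and pronilpotent groups\<close>

definition primes_within :: "nat set \<Rightarrow> nat \<Rightarrow> bool" where
  "primes_within S m \<longleftrightarrow> 0 < m \<and> (\<forall>p. Factorial_Ring.prime p \<longrightarrow> p dvd m \<longrightarrow> p \<in> S)"

lemma primes_within_mult: "primes_within S m \<Longrightarrow> primes_within S n \<Longrightarrow> primes_within S (m * n)"
  by (auto simp: primes_within_def prime_dvd_mult_iff)

lemma primes_within_1: "primes_within S 1"
  by (auto simp: primes_within_def)

lemma primes_within_pow: "primes_within S m \<Longrightarrow> primes_within S (m ^ k)"
  by (induction k) (auto simp: primes_within_1[simplified] primes_within_mult)

lemma primes_within_coprime:
  assumes "primes_within S m" "primes_within T n" "S \<inter> T = {}"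
  shows "coprime m n"
proof (rule ccontr)
  assume "\<not> coprime m n"
  then have "gcd m n \<noteq> 1" using coprime_iff_gcd_eq_1 by blast
  then obtain p where "Factorial_Ring.prime p" "p dvd gcd m n" using prime_factor_nat by blast
  then show False using assms by (auto simp: primes_within_def)
qed

lemma primes_within_split:
  assumes "primes_within (S \<union> T) m" "S \<inter> T = {}"
  shows "\<exists>a b. m = a * b \<and> primes_within S a \<and> primes_within T b"
  using assms(1)
proof (induction m rule: less_induct)
  case (less m)
  show ?case
  proof (cases "m = 1")
    case True
    then show ?thesis using primes_within_1 by (intro exI[of _ 1]) auto
  next
    case False
    then obtain p where p: "Factorial_Ring.prime p" "p dvd m" using prime_factor_nat by blast
    then obtain n where n: "m = p * n" by blast
    have m0: "0 < m" using less.prems by (simp add: primes_within_def)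
    have "p > 1" using p(1) by (rule prime_gt_1_nat)
    then have "n < m" using n m0 by simp
    moreover have "primes_within (S \<union> T) n" using less.prems n m0 by (auto simp: primes_within_def)
    ultimately obtain a b where ab: "n = a * b" "primes_within S a" "primes_within T b"
      using less.IH by blast
    have pw: "primes_within {p} p" using p(1) \<open>p > 1\<close> by (auto simp: primes_within_def primes_dvd_imp_eq)
    have "p \<in> S \<union> T" using less.prems p unfolding primes_within_def by blast
    then show ?thesis
    proof
      assume "p \<in> S"
      then have "primes_within S p" using pw by (auto simp: primes_within_def)
      then show ?thesis using ab n primes_within_mult[of S p a]
        by (intro exI[of _ "p * a"] exI[of _ b]) simp
    next
      assume "p \<in> T"
      then have "primes_within T p" using pw by (auto simp: primes_within_def)
      then show ?thesis using ab n primes_within_mult[of T p b]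
        by (intro exI[of _ a] exI[of _ "p * b"]) simp
    qed
  qed
qed

definition primary_part :: "('a, 'm) monoid_scheme \<Rightarrow> nat set \<Rightarrow> 'a set" where
  "primary_part G S = {x \<in> carrier G. \<exists>m. primes_within S m \<and> x [^]\<^bsub>G\<^esub> m = \<one>\<^bsub>G\<^esub>}"

context group begin

lemma pow_dvd_one:
  assumes "x \<in> carrier G" "x [^] (m::nat) = \<one>" "m dvd n"
  shows "x [^] n = \<one>"
  using assms pow_eq_id[OF assms(1)] dvd_trans[of "ord x" m n] by simp

lemma primary_part_subgroup:
  assumes nil: "nilpotent_group G"
  shows "subgroup (primary_part G S) G"
proof (rule subgroupI)
  show "primary_part G S \<subseteq> carrier G" by (auto simp: primary_part_def)
  have "\<one> [^] (1::nat) = \<one>" by simp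
  then have "\<one> \<in> primary_part G S" using primes_within_1[of S] by (auto simp: primary_part_def simp del: nat_pow_one)
  then show "primary_part G S \<noteq> {}" by blast
next
  fix x assume "x \<in> primary_part G S"
  then obtain m where "x \<in> carrier G" "primes_within S m" "x [^] m = \<one>" by (auto simp: primary_part_def)
  then show "inv x \<in> primary_part G S" by (auto simp: primary_part_def nat_pow_inv)
next
  fix x y assume "x \<in> primary_part G S" "y \<in> primary_part G S"
  then obtain m n where x: "x \<in> carrier G" "primes_within S m" "x [^] m = \<one>"
    and y: "y \<in> carrier G" "primes_within S n" "y [^] n = \<one>" by (auto simp: primary_part_def)
  have "x [^] (m * n) = \<one>" "y [^] (m * n) = \<one>" using pow_dvd_one x y by auto
  then obtain k where "(x \<otimes> y) [^] ((m * n) ^ k) = \<one>"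
    using nilpotent_mult_torsion[OF nil x(1) y(1)] by blast
  then show "x \<otimes> y \<in> primary_part G S"
    using x y primes_within_pow[OF primes_within_mult[OF x(2) y(2)]] by (auto simp: primary_part_def)
qed

lemma primary_part_commute:
  assumes "nilpotent_group G" "S \<inter> T = {}" "x \<in> primary_part G S" "y \<in> primary_part G T"
  shows "x \<otimes> y = y \<otimes> x"
  using assms nilpotent_coprime_commute primes_within_coprime unfolding primary_part_def by blast

lemma primary_part_disjoint:
  assumes "S \<inter> T = {}" "x \<in> primary_part G S" "x \<in> primary_part G T"
  shows "x = \<one>"
  using assms eq_one_of_coprime_pow primes_within_coprime unfolding primary_part_def by blast

lemma primary_part_mono: "S \<subseteq> T \<Longrightarrow> primary_part G S \<subseteq> primary_part G T"
  by (force simp: primary_part_def primes_within_def)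

text \<open>If \<open>x\<close> has exponent \<open>a b\<close> with \<open>a\<close> and \<open>b\<close> coprime and \<open>u b + v a = 1\<close>, then \<open>x = x\<^bsup>ub\<^esup> x\<^bsup>va\<^esup>\<close> is the
decomposition.\<close>

lemma primary_part_split:
  assumes x: "x \<in> primary_part G (S \<union> T)" and disj: "S \<inter> T = {}"
  shows "\<exists>a\<in>primary_part G S. \<exists>b\<in>primary_part G T. x = a \<otimes> b"
proof -
  obtain m where m: "x \<in> carrier G" "primes_within (S \<union> T) m" "x [^] m = \<one>"
    using x by (auto simp: primary_part_def)
  obtain a b where ab: "m = a * b" "primes_within S a" "primes_within T b"
    using primes_within_split[OF m(2) disj] by blast
  have cop: "coprime (int a) (int b)" using primes_within_coprime[OF ab(2,3) disj] by simp
  obtain u v where uv: "u * int b + v * int a = 1"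
    using bezout_int[of "int b" "int a"] cop by (metis coprime_commute coprime_iff_gcd_eq_1)
  have one: "x [^] (int a * int b * z) = \<one>" for z :: int
  proof -
    have "x [^] (int a * int b) = \<one>" using m(3) ab(1) by (metis int_pow_int of_nat_mult)
    then show ?thesis using m(1) int_pow_pow[of x "int a * int b" z] by simp
  qed
  define y where "y = x [^] (u * int b)"
  define z where "z = x [^] (v * int a)"
  have yz: "y \<in> carrier G" "z \<in> carrier G" using m(1) by (auto simp: y_def z_def)
  have "y [^] a = \<one>"
  proof -
    have "y [^] (int a) = x [^] (int a * int b * u)"
      using m(1) by (simp add: y_def int_pow_pow mult_ac)
    then show ?thesis using one by (simp add: int_pow_int)
  qed
  moreover have "z [^] b = \<one>"
  proof -
    have "z [^] (int b) = x [^] (int a * int b * v)"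
      using m(1) by (simp add: z_def int_pow_pow mult_ac)
    then show ?thesis using one by (simp add: int_pow_int)
  qed
  moreover have "x = y \<otimes> z"
    using int_pow_mult[OF m(1), of "u * int b" "v * int a"] m(1) uv by (simp add: y_def z_def)
  ultimately show ?thesis using yz ab unfolding primary_part_def by blast
qed

end

lemma primary_part_hom:
  assumes "group G" "group H" "h \<in> hom G H" "x \<in> primary_part G S"
  shows "h x \<in> primary_part H S"
proof -
  interpret h: group_hom G H h using assms by (simp add: group_hom_def group_hom_axioms_def)
  show ?thesis using assms(4) unfolding primary_part_def by (force simp flip: h.hom_nat_pow)
qed

text \<open>The pro-\<open>S\<close> part of a pronilpotent group; over a single prime it is the Sylow subgroup.\<close>

definition pro_primary_part :: "'i set \<Rightarrow> ('i \<Rightarrow> nat monoid) \<Rightarrow> ('i \<Rightarrow> 'a \<Rightarrow> nat) \<Rightarrow> 'a topgroup \<Rightarrow> nat set \<Rightarrow> 'a set" where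
  "pro_primary_part I F \<rho> G S = {x \<in> carrier G. \<forall>i\<in>I. \<rho> i x \<in> primary_part (F i) S}"

lemma pro_primary_part_UNIV:
  assumes "quotient_system I leq F \<phi> \<rho> G" "\<And>i. i \<in> I \<Longrightarrow> finite (carrier (F i))"
  shows "pro_primary_part I F \<rho> G UNIV = carrier G"
proof -
  have "\<rho> i x \<in> primary_part (F i) UNIV" if "i \<in> I" "x \<in> carrier G" for i x
  proof -
    interpret group "F i" using inverse_systemD(4)[OF quotient_systemD(1)[OF assms(1)] that(1)] .
    have "\<rho> i x \<in> carrier (F i)" using quotient_systemD(2)[OF assms(1) that(1)] that(2) by (auto simp: hom_def)
    moreover have "primes_within UNIV (order (F i))"
      using assms(2)[OF that(1)] order_gt_0_iff_finite by (auto simp: primes_within_def)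
    ultimately show ?thesis using pow_order_eq_1[of "\<rho> i x"] by (auto simp: primary_part_def)
  qed
  then show ?thesis by (auto simp: pro_primary_part_def)
qed

lemma pro_primary_part_closed:
  assumes qs: "quotient_system I leq F \<phi> \<rho> G" and ts: "topspace (gtop G) = carrier G"
  shows "closedin (gtop G) (pro_primary_part I F \<rho> G S)"
proof -
  have "closedin (gtop G) {x \<in> topspace (gtop G). \<rho> i x \<in> primary_part (F i) S}" if "i \<in> I" for i
    by (rule closedin_continuous_map_preimage[OF quotient_systemD(3)[OF qs that]])
      (auto simp: primary_part_def)
  moreover have "pro_primary_part I F \<rho> G S =
      (\<Inter>i\<in>I. {x \<in> topspace (gtop G). \<rho> i x \<in> primary_part (F i) S})"
    using inverse_systemD(1)[OF quotient_systemD(1)[OF qs]] by (auto simp: pro_primary_part_def ts)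
  moreover have "I \<noteq> {}" using inverse_systemD(1)[OF quotient_systemD(1)[OF qs]] .
  ultimately show ?thesis by (simp only:) (rule closedin_INT, auto)
qed

text \<open>Each finite nilpotent quotient decomposes. Its decompositions are unique, so the components of the images of \<open>x\<close> form
compatible families, which come from elements of \<open>G\<close>.\<close>

lemma pro_primary_part_internal_product:
  fixes G :: "'a topgroup" (structure)
  assumes qs: "quotient_system I leq F \<phi> \<rho> G" and G: "group G"
    and nil: "\<And>i. i \<in> I \<Longrightarrow> nilpotent_group (F i)" and disj: "S \<inter> T = {}"
  defines "K \<equiv> pro_primary_part I F \<rho> G"
  shows "internal_product G (K (S \<union> T)) (K S) (K T)"
proof -
  interpret group G by fact
  have gF: "group (F i)" if "i \<in> I" for i using nil[OF that] by (simp add: nilpotent_group_def)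
  have gh: "group_hom G (F i) (\<rho> i)" if "i \<in> I" for i
    using quotient_systemD(2)[OF qs that] gF[OF that] by (simp add: group_hom_def group_hom_axioms_def)
  have psub: "subgroup (primary_part (F i) S) (F i)" if "i \<in> I" for i S
    using group.primary_part_subgroup[OF gF[OF that] nil[OF that]] .
  have sub: "subgroup (K S) G" for S
  proof (rule subgroupI)
    show "K S \<subseteq> carrier G" by (auto simp: K_def pro_primary_part_def)
    have "\<one> \<in> K S"
      using subgroup.one_closed[OF psub] group_hom.hom_one[OF gh] by (auto simp: K_def pro_primary_part_def)
    then show "K S \<noteq> {}" by blast
  next
    fix x assume "x \<in> K S"
    then show "inv x \<in> K S"
      using subgroup.m_inv_closed[OF psub] group_hom.hom_inv[OF gh] by (auto simp: K_def pro_primary_part_def)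
  next
    fix x y assume "x \<in> K S" "y \<in> K S"
    then show "x \<otimes> y \<in> K S"
      using subgroup.m_closed[OF psub] group_hom.hom_mult[OF gh] by (auto simp: K_def pro_primary_part_def)
  qed
  have Kc: "x \<in> carrier G" "\<And>i. i \<in> I \<Longrightarrow> \<rho> i x \<in> primary_part (F i) S" if "x \<in> K S" for x S
    using that by (auto simp: K_def pro_primary_part_def)
  have com: "a \<otimes> b = b \<otimes> a" if ab: "a \<in> K S" "b \<in> K T" for a b
  proof (rule quotient_systemD(5)[OF qs])
    fix i assume i: "i \<in> I"
    have "\<rho> i a \<otimes>\<^bsub>F i\<^esub> \<rho> i b = \<rho> i b \<otimes>\<^bsub>F i\<^esub> \<rho> i a"
      using group.primary_part_commute[OF gF[OF i] nil[OF i] disj Kc(2)[OF ab(1) i] Kc(2)[OF ab(2) i]] .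
    then show "\<rho> i (a \<otimes> b) = \<rho> i (b \<otimes> a)"
      using group_hom.hom_mult[OF gh[OF i]] Kc(1) ab by simp
  qed (use Kc(1) ab in auto)
  have "x = \<one>" if "x \<in> K S" "x \<in> K T" for x
  proof (rule quotient_systemD(5)[OF qs])
    fix i assume i: "i \<in> I"
    show "\<rho> i x = \<rho> i \<one>"
      using group.primary_part_disjoint[OF gF[OF i] disj Kc(2)[OF that(1) i] Kc(2)[OF that(2) i]]
        group_hom.hom_one[OF gh[OF i]] by simp
  qed (use Kc(1) that in auto)
  then have triv: "K S \<inter> K T = {\<one>}" using sub subgroup.one_closed by blast
  have "K (S \<union> T) \<subseteq> (\<lambda>(a, b). a \<otimes> b) ` (K S \<times> K T)"
  proof
    fix x assume x: "x \<in> K (S \<union> T)"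
    have "\<exists>a b. a \<in> primary_part (F i) S \<and> b \<in> primary_part (F i) T \<and> \<rho> i x = a \<otimes>\<^bsub>F i\<^esub> b" if "i \<in> I" for i
      using group.primary_part_split[OF gF[OF that] Kc(2)[OF x that] disj] by blast
    then obtain a b where ab: "\<And>i. i \<in> I \<Longrightarrow> a i \<in> primary_part (F i) S"
      "\<And>i. i \<in> I \<Longrightarrow> b i \<in> primary_part (F i) T" "\<And>i. i \<in> I \<Longrightarrow> \<rho> i x = a i \<otimes>\<^bsub>F i\<^esub> b i" by metis
    have pc: "\<And>i S. primary_part (F i) S \<subseteq> carrier (F i)" by (auto simp: primary_part_def)
    have abc: "a i \<in> carrier (F i)" "b i \<in> carrier (F i)" if "i \<in> I" for i using ab pc that by blast+
    have tr: "primary_part (F i) S \<inter> primary_part (F i) T = {\<one>\<^bsub>F i\<^esub>}" if "i \<in> I" for i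
      using group.primary_part_disjoint[OF gF[OF that] disj] subgroup.one_closed[OF psub[OF that]] by blast
    have ca: "\<phi> i j (a j) = a i" and cb: "\<phi> i j (b j) = b i" if ij: "i \<in> I" "j \<in> I" "leq i j" for i j
    proof -
      have h: "\<phi> i j \<in> hom (F j) (F i)" using inverse_systemD(5)[OF quotient_systemD(1)[OF qs] ij] .
      have "\<phi> i j (\<rho> j x) = \<rho> i x" using quotient_systemD(4)[OF qs ij Kc(1)[OF x]] .
      then have eq: "\<phi> i j (a j) \<otimes>\<^bsub>F i\<^esub> \<phi> i j (b j) = a i \<otimes>\<^bsub>F i\<^esub> b i"
        using ab(3) ij abc[OF ij(2)] by (simp add: hom_mult[OF h])
      have m: "\<phi> i j (a j) \<in> primary_part (F i) S" "\<phi> i j (b j) \<in> primary_part (F i) T"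
        using primary_part_hom[OF gF[OF ij(2)] gF[OF ij(1)] h] ab ij(2) by blast+
      show 1: "\<phi> i j (a j) = a i"
        using group.subgroup_product_unique[OF gF[OF ij(1)] psub[OF ij(1)] psub[OF ij(1)] tr[OF ij(1)]
            m(1) ab(1)[OF ij(1)] m(2) ab(2)[OF ij(1)] eq] .
      interpret Fi: group "F i" by (rule gF[OF ij(1)])
      show "\<phi> i j (b j) = b i"
        using eq abc[OF ij(1)] subsetD[OF pc m(2)] by (simp add: 1)
    qed
    have "restrict a I \<in> (\<Pi>\<^sub>E i\<in>I. carrier (F i))" "restrict b I \<in> (\<Pi>\<^sub>E i\<in>I. carrier (F i))"
      using abc by auto
    then obtain u v where uv: "u \<in> carrier G" "\<forall>i\<in>I. \<rho> i u = restrict a I i"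
      "v \<in> carrier G" "\<forall>i\<in>I. \<rho> i v = restrict b I i"
      using quotient_systemD(6)[OF qs, of "restrict a I"] quotient_systemD(6)[OF qs, of "restrict b I"] ca cb
      by auto
    have "x = u \<otimes> v"
    proof (rule quotient_systemD(5)[OF qs Kc(1)[OF x]])
      fix i assume "i \<in> I"
      then show "\<rho> i x = \<rho> i (u \<otimes> v)" using uv ab(3) group_hom.hom_mult[OF gh] by simp
    qed (use uv in auto)
    moreover have "u \<in> K S" "v \<in> K T" using uv ab by (auto simp: K_def pro_primary_part_def)
    ultimately show "x \<in> (\<lambda>(a, b). a \<otimes> b) ` (K S \<times> K T)" by auto
  qed
  moreover have "K S \<subseteq> K (S \<union> T)" "K T \<subseteq> K (S \<union> T)"
    using group.primary_part_mono[OF gF, of _ S "S \<union> T"] group.primary_part_mono[OF gF, of _ T "S \<union> T"]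
    unfolding K_def pro_primary_part_def by blast+
  then have "(\<lambda>(a, b). a \<otimes> b) ` (K S \<times> K T) \<subseteq> K (S \<union> T)"
    using subgroup.m_closed[OF sub[of "S \<union> T"]] by (auto dest: subsetD)
  ultimately have "K (S \<union> T) = (\<lambda>(a, b). a \<otimes> b) ` (K S \<times> K T)" by (rule equalityI)
  then show ?thesis unfolding internal_product_def using sub com triv by blast
qed

text \<open>An open neighbourhood of \<open>1\<close> contains the kernel of a homomorphism of the pro-\<open>p\<close> group to a finite \<open>p\<close>-group.\<close>

lemma pro_p_power_near_one:
  fixes G :: "'a topgroup" (structure)
  assumes G: "topological_group G" and P: "subgroup P G" and pro: "pro_p_group p (subtopgroup G P)"
    and x: "x \<in> P" and W: "openin (gtop G) W" "\<one> \<in> W"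
  shows "\<exists>k. x [^] (p ^ k) \<in> W"
proof -
  have grp: "group G" using G by (simp add: topological_group_def)
  interpret group G by fact
  let ?P = "subtopgroup G P"
  have tP: "topological_group ?P" by (rule topological_group_subtopgroup[OF G P])
  interpret P: group ?P using tP by (simp add: topological_group_def)
  obtain I :: "'a set set" and leq and F :: "'a set \<Rightarrow> nat monoid" and \<phi> where sys: "inverse_system I leq F \<phi>"
    and F: "\<And>i. i \<in> I \<Longrightarrow> finite (carrier (F i)) \<and> (\<exists>k. order (F i) = p ^ k)"
    and iso: "topgroup_isomorphic ?P (inverse_limit I leq F \<phi>)"
    using pro unfolding pro_p_group_def inverse_limit_of_finite_def by blast
  obtain \<rho> where qs: "quotient_system I leq F \<phi> \<rho> ?P"
    using quotient_system_of_inverse_limit[OF tP sys iso] by blast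
  have "openin (gtop ?P) (W \<inter> P)" using W by (auto simp: openin_subtopology)
  moreover have "\<one> \<in> W \<inter> P" using W subgroup.one_closed[OF P] by blast
  ultimately obtain i where i: "i \<in> I" "\<forall>y\<in>P. \<rho> i y = \<rho> i \<one> \<longrightarrow> y \<in> W \<inter> P"
    using quotient_systemD(7)[OF qs, of "W \<inter> P" \<one>] by auto
  obtain k where k: "order (F i) = p ^ k" using F i by blast
  interpret F: group "F i" using inverse_systemD(4)[OF sys i(1)] .
  interpret h: group_hom ?P "F i" "\<rho> i"
    using quotient_systemD(2)[OF qs i(1)] by unfold_locales
  have pw: "y [^]\<^bsub>?P\<^esub> n = y [^] n" for y and n :: nat unfolding nat_pow_def by simp
  have "\<rho> i (x [^]\<^bsub>?P\<^esub> (p ^ k)) = \<one>\<^bsub>F i\<^esub>"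
    using x h.hom_nat_pow[of x "p ^ k"] F.pow_order_eq_1[of "\<rho> i x"] h.hom_closed[of x] by (simp add: k)
  also have "\<dots> = \<rho> i \<one>" using h.hom_one by simp
  finally have "\<rho> i (x [^] (p ^ k)) = \<rho> i \<one>" by (simp only: pw)
  moreover have "x [^] (p ^ k) \<in> P" using P.nat_pow_closed[of x "p ^ k"] x pw by simp
  ultimately show ?thesis using i(2) by blast
qed

text \<open>Removing the primes in \<open>D\<close> leaves the pro-\<open>(-D)\<close> part \<open>H\<close>, which would be isomorphic to \<open>G\<close>. A Sylow
pro-\<open>p\<close> subgroup of \<open>G\<close> with \<open>p \<in> D\<close> is then trivial, since in the finite quotients of \<open>H\<close> the orders of elements
are prime to \<open>p\<close>.\<close>

theorem pronilpotent_FA_finite_primes: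
  fixes G :: "'a topgroup" (structure)
  assumes pn: "pronilpotent_group G"
    and FA: "FA_in {H. profinite_group H} G \<or> FA_in {H. pronilpotent_group H} G"
  shows "finite {p. Factorial_Ring.prime p \<and> (\<exists>P. sylow_pro_subgroup p G P \<and> P \<noteq> {\<one>})}"
proof (rule ccontr)
  assume inf: "infinite {p. Factorial_Ring.prime p \<and> (\<exists>P. sylow_pro_subgroup p G P \<and> P \<noteq> {\<one>})}" (is "infinite ?Q")
  have G: "topological_group G" using pn by (simp add: pronilpotent_group_def inverse_limit_of_finite_def)
  then have grp: "group G" and ts: "topspace (gtop G) = carrier G" by (auto simp: topological_group_def)
  interpret group G by fact
  obtain I :: "'a set set" and leq and F :: "'a set \<Rightarrow> nat monoid" and \<phi> where sys: "inverse_system I leq F \<phi>"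
    and F: "\<And>i. i \<in> I \<Longrightarrow> finite (carrier (F i)) \<and> nilpotent_group (F i)"
    and iso: "topgroup_isomorphic G (inverse_limit I leq F \<phi>)"
    using pn unfolding pronilpotent_group_def inverse_limit_of_finite_def by blast
  obtain \<rho> where qs: "quotient_system I leq F \<phi> \<rho> G"
    using quotient_system_of_inverse_limit[OF G sys iso] by blast
  define K where "K = pro_primary_part I F \<rho> G"
  have ip: "internal_product G (K (A \<union> B)) (K A) (K B)" if "A \<inter> B = {}" for A B
    unfolding K_def using pro_primary_part_internal_product[OF qs grp _ that] F by blast
  obtain \<C> where FA: "FA_in \<C> G"
    and \<C>: "\<C> = {H. profinite_group H} \<or> \<C> = {H. pronilpotent_group H}"
    using FA by metis
  have G\<C>: "G \<in> \<C>" using FA unfolding FA_in_def by (rule conjunct1)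
  obtain \<sigma> where \<sigma>: "sentence \<sigma>"
    and ax: "\<And>H. H \<in> \<C> \<Longrightarrow> models H \<sigma> \<longleftrightarrow> topgroup_isomorphic H G"
    using conjunct2[OF FA[unfolded FA_in_def]] by metis
  obtain D where D: "D \<subseteq> ?Q" "D \<noteq> {}"
    "models (subtopgroup G (K (- D))) \<sigma> \<longleftrightarrow> models (subtopgroup G (K UNIV)) \<sigma>"
    using exists_omission[OF grp ip inf \<sigma>] by blast
  define H where "H = subtopgroup G (K (- D))"
  have "K UNIV = carrier G" unfolding K_def using pro_primary_part_UNIV[OF qs] F by blast
  then have "subtopgroup G (K UNIV) = G" using subtopgroup_carrier[OF ts] by simp
  moreover have "topgroup_isomorphic G G"
    by (rule topgroup_isomorphic_refl)
  ultimately have mH: "models H \<sigma>" using D(3) ax[OF G\<C>] by (simp add: H_def)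
  have sub: "subgroup (K A) G" for A using ip[of A "{}"] by (simp add: internal_product_def)
  have cl: "closedin (gtop G) (K A)" for A unfolding K_def by (rule pro_primary_part_closed[OF qs ts])
  have "pronilpotent_group H"
    unfolding pronilpotent_group_def H_def
  proof (rule inverse_limit_of_finite_closed_subgroup[OF _ sub cl])
    show "inverse_limit_of_finite nilpotent_group G" using pn by (simp add: pronilpotent_group_def)
  qed (rule group.nilpotent_subgroup)
  moreover have "profinite_group H"
    using \<open>pronilpotent_group H\<close>
    unfolding profinite_group_def pronilpotent_group_def inverse_limit_of_finite_def by blast
  ultimately have "H \<in> \<C>" using \<C> by blast
  then obtain f where f: "f \<in> iso H G" "homeomorphic_map (gtop H) (gtop G) f"
    using ax mH unfolding topgroup_isomorphic_def by blast
  have gH: "group H" unfolding H_def by (rule group_subtopgroup[OF grp sub])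
  interpret H: group H by (rule gH)
  interpret f: group_hom H G f using f(1) by unfold_locales (simp add: iso_def)
  obtain p where "p \<in> D" using D(2) by blast
  then obtain P where p: "Factorial_Ring.prime p" "sylow_pro_subgroup p G P" "P \<noteq> {\<one>}" using D(1) by blast
  have P: "subgroup P G" "pro_p_group p (subtopgroup G P)" using p(2) by (auto simp: sylow_pro_subgroup_def)
  then obtain x where x: "x \<in> P" "x \<noteq> \<one>" using p(3) subgroup.one_closed by blast
  have xc: "x \<in> carrier G" using x P subgroup.subset by blast
  have cH: "carrier H = K (- D)" and KG: "K (- D) \<subseteq> carrier G"
    using subgroup.subset[OF sub] by (auto simp: H_def)
  have bij: "bij_betw f (carrier H) (carrier G)" using f(1) by (simp add: iso_def)
  then have "x \<in> f ` carrier H" using xc by (simp add: bij_betw_def)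
  then obtain y where y: "y \<in> carrier H" "f y = x" by auto
  \<comment> \<open>In every finite quotient the image of \<open>y\<close> has an order that is a power of \<open>p\<close> as well as prime to \<open>p\<close>.\<close>
  have "y = \<one>"
  proof (rule quotient_systemD(5)[OF qs])
    show "y \<in> carrier G" using y cH KG by blast
    fix i assume i: "i \<in> I"
    interpret Fi: group "F i" using inverse_systemD(4)[OF sys i] .
    interpret h: group_hom G "F i" "\<rho> i" using quotient_systemD(2)[OF qs i] by unfold_locales
    define U where "U = {z \<in> carrier H. \<rho> i z = \<one>\<^bsub>F i\<^esub>}"
    have "openin (gtop G) {z \<in> topspace (gtop G). \<rho> i z \<in> {\<one>\<^bsub>F i\<^esub>}}"
      by (rule openin_continuous_map_preimage[OF quotient_systemD(3)[OF qs i]]) simp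
    then have "openin (gtop H) U"
      using KG by (auto simp: H_def U_def openin_subtopology ts intro!: exI)
    moreover have "U \<subseteq> topspace (gtop H)" using KG by (auto simp: U_def H_def ts)
    ultimately have W: "openin (gtop G) (f ` U)" using homeomorphic_map_openness[OF f(2)] by blast
    have "\<one>\<^bsub>H\<^esub> \<in> U" using H.one_closed h.hom_one by (auto simp: U_def H_def)
    then have "\<one> \<in> f ` U" using f.hom_one by (metis image_eqI)
    then obtain k where "x [^] (p ^ k) \<in> f ` U" using pro_p_power_near_one[OF G P x(1) W] by blast
    then have "f (y [^]\<^bsub>H\<^esub> (p ^ k)) \<in> f ` U" using y f.hom_nat_pow by simp
    moreover have "U \<subseteq> carrier H" by (auto simp: U_def)
    ultimately have "y [^]\<^bsub>H\<^esub> (p ^ k) \<in> U"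
      using bij y by (meson H.nat_pow_closed bij_betw_imp_inj_on inj_on_image_mem_iff)
    moreover have "y [^]\<^bsub>H\<^esub> (p ^ k) = y [^] (p ^ k)" unfolding nat_pow_def H_def by simp
    ultimately have "\<rho> i (y [^] (p ^ k)) = \<one>\<^bsub>F i\<^esub>" by (simp add: U_def)
    then have "\<rho> i y [^]\<^bsub>F i\<^esub> (p ^ k) = \<one>\<^bsub>F i\<^esub>" using y cH KG h.hom_nat_pow[of y "p ^ k"] by auto
    moreover have "primes_within {p} (p ^ k)"
      using p(1) by (intro primes_within_pow) (auto simp: primes_within_def primes_dvd_imp_eq prime_gt_0_nat)
    ultimately have "\<rho> i y \<in> primary_part (F i) {p}"
      using y cH KG by (auto simp: primary_part_def)
    moreover have "\<rho> i y \<in> primary_part (F i) (- D)" using y cH i by (auto simp: K_def pro_primary_part_def)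
    ultimately show "\<rho> i y = \<rho> i \<one>"
      using Fi.primary_part_disjoint[of "{p}" "- D"] \<open>p \<in> D\<close> h.hom_one by auto
  qed auto
  then have "x = \<one>" using y f.hom_one by (simp add: H_def)
  then show False using x(2) by simp
qed

section \<open>Products of topological groups\<close>

lemma product_topgroup_simps:
  "carrier (product_topgroup I \<Gamma>) = (\<Pi>\<^sub>E i\<in>I. carrier (\<Gamma> i))"
  "x \<otimes>\<^bsub>product_topgroup I \<Gamma>\<^esub> y = (\<lambda>i\<in>I. x i \<otimes>\<^bsub>\<Gamma> i\<^esub> y i)"
  "\<one>\<^bsub>product_topgroup I \<Gamma>\<^esub> = (\<lambda>i\<in>I. \<one>\<^bsub>\<Gamma> i\<^esub>)"
  "gtop (product_topgroup I \<Gamma>) = product_topology (\<lambda>i. gtop (\<Gamma> i)) I"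
  by (simp_all add: product_topgroup_def)

definition single_coordinate :: "'i set \<Rightarrow> ('i \<Rightarrow> 'b topgroup) \<Rightarrow> 'i \<Rightarrow> 'b \<Rightarrow> 'i \<Rightarrow> 'b" where
  "single_coordinate I \<Gamma> p x = (\<lambda>i\<in>I. if i = p then x else \<one>\<^bsub>\<Gamma> i\<^esub>)"

text \<open>Only the product is assumed to be a group whose topology lives on its carrier; both properties descend to the factors
(\<open>group_factor\<close>, \<open>topspace_factor\<close>).\<close>

locale topgroup_product =
  fixes I :: "nat set" and \<Gamma> :: "nat \<Rightarrow> 'b topgroup" and G :: "(nat \<Rightarrow> 'b) topgroup"
  defines "G \<equiv> product_topgroup I \<Gamma>"
  assumes G: "group G" and ts: "topspace (gtop G) = carrier G"
begin

sublocale G: group G by (rule G)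

lemma carrier_G: "carrier G = (\<Pi>\<^sub>E i\<in>I. carrier (\<Gamma> i))"
  and mult_G: "x \<otimes>\<^bsub>G\<^esub> y = (\<lambda>i\<in>I. x i \<otimes>\<^bsub>\<Gamma> i\<^esub> y i)"
  and one_G: "\<one>\<^bsub>G\<^esub> = (\<lambda>i\<in>I. \<one>\<^bsub>\<Gamma> i\<^esub>)"
  and gtop_G: "gtop G = product_topology (\<lambda>i. gtop (\<Gamma> i)) I"
  by (simp_all add: G_def product_topgroup_simps)

lemma one_factor: "i \<in> I \<Longrightarrow> \<one>\<^bsub>\<Gamma> i\<^esub> \<in> carrier (\<Gamma> i)"
  using G.one_closed by (auto simp: carrier_G one_G PiE_iff)

lemma single_closed: "p \<in> I \<Longrightarrow> x \<in> carrier (\<Gamma> p) \<Longrightarrow> single_coordinate I \<Gamma> p x \<in> carrier G"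
  using one_factor by (auto simp: carrier_G single_coordinate_def)

lemma group_factor:
  assumes p: "p \<in> I" shows "group (\<Gamma> p)"
proof -
  let ?e = "single_coordinate I \<Gamma> p"
  have ep: "?e x p = x" for x using p by (simp add: single_coordinate_def)
  have mp: "(x \<otimes>\<^bsub>G\<^esub> y) p = x p \<otimes>\<^bsub>\<Gamma> p\<^esub> y p" for x y using p by (simp add: mult_G)
  have cp: "x p \<in> carrier (\<Gamma> p)" if "x \<in> carrier G" for x using that p by (auto simp: carrier_G)
  show ?thesis
  proof (rule groupI)
    fix x y assume "x \<in> carrier (\<Gamma> p)" "y \<in> carrier (\<Gamma> p)"
    then show "x \<otimes>\<^bsub>\<Gamma> p\<^esub> y \<in> carrier (\<Gamma> p)"
      using cp[OF G.m_closed[OF single_closed[OF p, of x] single_closed[OF p, of y]]] by (simp add: mp ep)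
  next
    show "\<one>\<^bsub>\<Gamma> p\<^esub> \<in> carrier (\<Gamma> p)" by (rule one_factor[OF p])
  next
    fix x y z assume *: "x \<in> carrier (\<Gamma> p)" "y \<in> carrier (\<Gamma> p)" "z \<in> carrier (\<Gamma> p)"
    show "x \<otimes>\<^bsub>\<Gamma> p\<^esub> y \<otimes>\<^bsub>\<Gamma> p\<^esub> z = x \<otimes>\<^bsub>\<Gamma> p\<^esub> (y \<otimes>\<^bsub>\<Gamma> p\<^esub> z)"
      using fun_cong[OF G.m_assoc[OF single_closed[OF p *(1)] single_closed[OF p *(2)] single_closed[OF p *(3)]], of p]
      by (simp add: mp ep)
  next
    fix x assume x: "x \<in> carrier (\<Gamma> p)"
    have "\<one>\<^bsub>G\<^esub> p = \<one>\<^bsub>\<Gamma> p\<^esub>" using p by (simp add: one_G)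
    then show "\<one>\<^bsub>\<Gamma> p\<^esub> \<otimes>\<^bsub>\<Gamma> p\<^esub> x = x"
      using fun_cong[OF G.l_one[OF single_closed[OF p x]], of p] by (simp only: mp ep)
    show "\<exists>y\<in>carrier (\<Gamma> p). y \<otimes>\<^bsub>\<Gamma> p\<^esub> x = \<one>\<^bsub>\<Gamma> p\<^esub>"
    proof (rule bexI)
      show "(inv\<^bsub>G\<^esub> (?e x)) p \<otimes>\<^bsub>\<Gamma> p\<^esub> x = \<one>\<^bsub>\<Gamma> p\<^esub>"
        using fun_cong[OF G.l_inv[OF single_closed[OF p x]], of p] \<open>\<one>\<^bsub>G\<^esub> p = \<one>\<^bsub>\<Gamma> p\<^esub>\<close> by (simp only: mp ep)
      show "(inv\<^bsub>G\<^esub> (?e x)) p \<in> carrier (\<Gamma> p)" using cp[OF G.inv_closed[OF single_closed[OF p x]]] .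
    qed
  qed
qed

lemma topspace_factor: assumes "i \<in> I" shows "topspace (gtop (\<Gamma> i)) = carrier (\<Gamma> i)"
proof -
  have eq: "(\<Pi>\<^sub>E i\<in>I. topspace (gtop (\<Gamma> i))) = (\<Pi>\<^sub>E i\<in>I. carrier (\<Gamma> i))"
    using ts by (simp add: gtop_G carrier_G)
  have "(\<Pi>\<^sub>E i\<in>I. carrier (\<Gamma> i)) \<noteq> {}" using G.one_closed carrier_G by auto
  then show ?thesis using eq assms by (auto simp: PiE_eq_iff PiE_eq_empty_iff)
qed

lemma inv_coordinate: "x \<in> carrier G \<Longrightarrow> i \<in> I \<Longrightarrow> (inv\<^bsub>G\<^esub> x) i = inv\<^bsub>\<Gamma> i\<^esub> (x i)"
proof -
  assume x: "x \<in> carrier G" and i: "i \<in> I"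
  have "(inv\<^bsub>G\<^esub> x) i \<otimes>\<^bsub>\<Gamma> i\<^esub> x i = \<one>\<^bsub>\<Gamma> i\<^esub>"
    using fun_cong[OF G.l_inv[OF x], of i] i by (simp add: mult_G one_G)
  then show ?thesis
    using group.inv_equality[OF group_factor[OF i]] x G.inv_closed[OF x] i by (force simp: carrier_G)
qed

lemma pow_coordinate: "i \<in> I \<Longrightarrow> (x [^]\<^bsub>G\<^esub> (n::nat)) i = x i [^]\<^bsub>\<Gamma> i\<^esub> n"
  by (induction n) (simp_all add: one_G mult_G)

lemma eq_iff_coordinates: "x \<in> carrier G \<Longrightarrow> y \<in> carrier G \<Longrightarrow> (\<And>i. i \<in> I \<Longrightarrow> x i = y i) \<Longrightarrow> x = y"
  unfolding carrier_G by (rule PiE_ext)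

definition supported :: "nat set \<Rightarrow> (nat \<Rightarrow> 'b) set" where
  "supported A = {x \<in> carrier G. \<forall>i\<in>I - A. x i = \<one>\<^bsub>\<Gamma> i\<^esub>}"

definition truncation :: "nat set \<Rightarrow> (nat \<Rightarrow> 'b) \<Rightarrow> (nat \<Rightarrow> 'b)" where
  "truncation A x = (\<lambda>i\<in>I. if i \<in> A then x i else \<one>\<^bsub>\<Gamma> i\<^esub>)"

lemma truncation_closed: "x \<in> carrier G \<Longrightarrow> truncation A x \<in> carrier G"
  using one_factor by (auto simp: carrier_G truncation_def)

lemma supported_subgroup: "subgroup (supported A) G"
proof (rule G.subgroupI)
  show "supported A \<subseteq> carrier G" by (auto simp: supported_def)
  have "\<one>\<^bsub>G\<^esub> \<in> supported A" unfolding supported_def using G.one_closed by (simp add: one_G)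
  then show "supported A \<noteq> {}" by blast
  fix x assume x: "x \<in> supported A"
  have "inv\<^bsub>\<Gamma> i\<^esub> \<one>\<^bsub>\<Gamma> i\<^esub> = \<one>\<^bsub>\<Gamma> i\<^esub>" if "i \<in> I" for i
    using monoid.inv_one[OF group.is_monoid[OF group_factor[OF that]]] .
  then show "inv\<^bsub>G\<^esub> x \<in> supported A" using x by (auto simp: supported_def inv_coordinate)
next
  fix x y assume "x \<in> supported A" "y \<in> supported A"
  moreover have "\<one>\<^bsub>\<Gamma> i\<^esub> \<otimes>\<^bsub>\<Gamma> i\<^esub> \<one>\<^bsub>\<Gamma> i\<^esub> = \<one>\<^bsub>\<Gamma> i\<^esub>" if "i \<in> I" for i
    using group.is_monoid[OF group_factor[OF that]] by (simp add: monoid.l_one)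
  ultimately show "x \<otimes>\<^bsub>G\<^esub> y \<in> supported A"
    using G.m_closed[of x y] by (auto simp: supported_def) (auto simp: mult_G)
qed

lemma supported_internal_product:
  assumes "A \<inter> B = {}"
  shows "internal_product G (supported (A \<union> B)) (supported A) (supported B)"
proof -
  have mon: "monoid (\<Gamma> i)" if "i \<in> I" for i using group_factor[OF that] by (rule group.is_monoid)
  have com: "a \<otimes>\<^bsub>G\<^esub> b = b \<otimes>\<^bsub>G\<^esub> a" if ab: "a \<in> supported A" "b \<in> supported B" for a b
  proof (rule eq_iff_coordinates)
    fix i assume i: "i \<in> I"
    have c: "a i \<in> carrier (\<Gamma> i)" "b i \<in> carrier (\<Gamma> i)" using ab i by (auto simp: supported_def carrier_G)
    have "a i = \<one>\<^bsub>\<Gamma> i\<^esub> \<or> b i = \<one>\<^bsub>\<Gamma> i\<^esub>" using ab i assms by (auto simp: supported_def)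
    then show "(a \<otimes>\<^bsub>G\<^esub> b) i = (b \<otimes>\<^bsub>G\<^esub> a) i"
      using i c monoid.l_one[OF mon[OF i]] monoid.r_one[OF mon[OF i]] by (auto simp: mult_G)
  qed (use ab in \<open>auto simp: supported_def\<close>)
  have triv: "supported A \<inter> supported B = {\<one>\<^bsub>G\<^esub>}"
  proof (intro equalityI subsetI)
    fix x assume x: "x \<in> supported A \<inter> supported B"
    have "x = \<one>\<^bsub>G\<^esub>"
    proof (rule eq_iff_coordinates)
      fix i assume "i \<in> I"
      then show "x i = \<one>\<^bsub>G\<^esub> i" using x assms by (auto simp: supported_def one_G)
    qed (use x in \<open>auto simp: supported_def\<close>)
    then show "x \<in> {\<one>\<^bsub>G\<^esub>}" by simp
  qed (use subgroup.one_closed[OF supported_subgroup] in auto)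
  have "x \<in> (\<lambda>(a, b). a \<otimes>\<^bsub>G\<^esub> b) ` (supported A \<times> supported B)" if x: "x \<in> supported (A \<union> B)" for x
  proof -
    have xc: "x \<in> carrier G" using x by (simp add: supported_def)
    have "x = truncation A x \<otimes>\<^bsub>G\<^esub> truncation B x"
    proof (rule eq_iff_coordinates)
      fix i assume i: "i \<in> I"
      have "x i \<in> carrier (\<Gamma> i)" using xc i by (auto simp: carrier_G)
      then show "x i = (truncation A x \<otimes>\<^bsub>G\<^esub> truncation B x) i"
        using x i assms monoid.l_one[OF mon[OF i]] monoid.r_one[OF mon[OF i]] one_factor[OF i]
        by (auto simp: mult_G truncation_def supported_def)
    qed (use xc truncation_closed in auto)
    moreover have "truncation A x \<in> supported A" "truncation B x \<in> supported B"
      using truncation_closed[OF xc] by (auto simp: supported_def) (auto simp: truncation_def)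
    ultimately show ?thesis by (intro image_eqI[of _ _ "(truncation A x, truncation B x)"]) simp_all
  qed
  moreover have "a \<otimes>\<^bsub>G\<^esub> b \<in> supported (A \<union> B)" if ab: "a \<in> supported A" "b \<in> supported B" for a b
    by (rule subgroup.m_closed[OF supported_subgroup]) (use ab in \<open>auto simp: supported_def\<close>)
  ultimately have "supported (A \<union> B) = (\<lambda>(a, b). a \<otimes>\<^bsub>G\<^esub> b) ` (supported A \<times> supported B)" by auto
  then show ?thesis unfolding internal_product_def using supported_subgroup com triv by blast
qed

lemma closedin_coordinate:
  assumes H: "Hausdorff_space (gtop G)" and i: "i \<in> I" and T: "finite T"
  shows "closedin (gtop G) {x \<in> carrier G. x i \<in> T}"
proof -
  have "(\<Pi>\<^sub>E i\<in>I. topspace (gtop (\<Gamma> i))) \<noteq> {}" using ts G.one_closed by (auto simp: gtop_G)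
  then have "Hausdorff_space (gtop (\<Gamma> i))"
    using H i by (simp add: gtop_G Hausdorff_space_product_topology)
  then have "closedin (gtop (\<Gamma> i)) (T \<inter> carrier (\<Gamma> i))"
    using T topspace_factor[OF i] by (intro closedin_Hausdorff_finite) auto
  moreover have "continuous_map (gtop G) (gtop (\<Gamma> i)) (\<lambda>x. x i)"
    unfolding gtop_G using i by (rule continuous_map_product_projection)
  ultimately have "closedin (gtop G) {x \<in> topspace (gtop G). x i \<in> T \<inter> carrier (\<Gamma> i)}"
    using closedin_continuous_map_preimage by blast
  moreover have "{x \<in> topspace (gtop G). x i \<in> T \<inter> carrier (\<Gamma> i)} = {x \<in> carrier G. x i \<in> T}"
    using ts i by (auto simp: carrier_G)
  ultimately show ?thesis by simp
qed

lemma supported_closed: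
  assumes H: "Hausdorff_space (gtop G)"
  shows "closedin (gtop G) (supported A)"
proof (cases "I - A = {}")
  case True
  then have "supported A = topspace (gtop G)" using ts by (auto simp: supported_def)
  then show ?thesis by simp
next
  case False
  have "supported A = (\<Inter>i\<in>I - A. {x \<in> carrier G. x i \<in> {\<one>\<^bsub>\<Gamma> i\<^esub>}})"
    using False by (auto simp: supported_def)
  moreover have "closedin (gtop G) (\<Inter>i\<in>I - A. {x \<in> carrier G. x i \<in> {\<one>\<^bsub>\<Gamma> i\<^esub>}})"
  proof (rule closedin_INT)
    fix i assume "i \<in> I - A"
    then show "closedin (gtop G) {x \<in> carrier G. x i \<in> {\<one>\<^bsub>\<Gamma> i\<^esub>}}"
      by (intro closedin_coordinate[OF H]) auto
  qed (use False in auto)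
  ultimately show ?thesis by simp
qed

text \<open>A basic open set of the product topology restricts finitely many coordinates.\<close>

lemma truncation_near:
  assumes V: "openin (gtop G) V" and h: "h \<in> V"
  shows "\<exists>F. finite F \<and> truncation F h \<in> V"
proof -
  obtain U where U: "finite {i \<in> I. U i \<noteq> topspace (gtop (\<Gamma> i))}" "h \<in> Pi\<^sub>E I U" "Pi\<^sub>E I U \<subseteq> V"
    using V h by (force simp: gtop_G openin_product_topology_alt)
  define F where "F = {i \<in> I. U i \<noteq> topspace (gtop (\<Gamma> i))}"
  have "truncation F h \<in> Pi\<^sub>E I U"
  proof (rule PiE_I)
    fix i assume i: "i \<in> I"
    show "truncation F h i \<in> U i"
      using U(2) i topspace_factor[OF i] one_factor[OF i] by (auto simp: truncation_def F_def)
  qed (auto simp: truncation_def)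
  then show ?thesis using U F_def by blast
qed

lemma truncation_torsion:
  assumes h: "h \<in> carrier G" and F: "finite F"
    and tor: "\<And>i. i \<in> I \<Longrightarrow> \<exists>m>0. h i [^]\<^bsub>\<Gamma> i\<^esub> (m::nat) = \<one>\<^bsub>\<Gamma> i\<^esub>"
  shows "\<exists>m>0. truncation F h [^]\<^bsub>G\<^esub> (m::nat) = \<one>\<^bsub>G\<^esub>"
proof -
  obtain m where m: "\<And>i. i \<in> I \<Longrightarrow> m i > (0::nat) \<and> h i [^]\<^bsub>\<Gamma> i\<^esub> m i = \<one>\<^bsub>\<Gamma> i\<^esub>" using tor by metis
  define M where "M = (\<Prod>i\<in>F \<inter> I. m i)"
  have fin: "finite (F \<inter> I)" using F by simp
  have "truncation F h [^]\<^bsub>G\<^esub> M = \<one>\<^bsub>G\<^esub>"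
  proof (rule eq_iff_coordinates)
    fix i assume i: "i \<in> I"
    interpret group "\<Gamma> i" by (rule group_factor[OF i])
    have hi: "h i \<in> carrier (\<Gamma> i)" using h i by (auto simp: carrier_G)
    show "(truncation F h [^]\<^bsub>G\<^esub> M) i = \<one>\<^bsub>G\<^esub> i"
    proof (cases "i \<in> F")
      case True
      then have "m i dvd M" unfolding M_def using fin i by (intro dvd_prodI) auto
      then have "h i [^]\<^bsub>\<Gamma> i\<^esub> M = \<one>\<^bsub>\<Gamma> i\<^esub>"
        using pow_eq_id[OF hi] m[OF i] dvd_trans by blast
      then show ?thesis using True i by (simp add: pow_coordinate truncation_def one_G)
    next
      case False
      then show ?thesis using i by (simp add: pow_coordinate truncation_def one_G)
    qed
  qed (use truncation_closed[OF h] in auto)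
  moreover have "M > 0" unfolding M_def using m by (auto intro: prod_pos)
  ultimately show ?thesis by blast
qed

end

text \<open>The topologies of the factors enter through the single assumption that their product is profinite, so the other
three assumptions are purely algebraic. They produce an element \<open>u\<close> of one removed factor and its preimage \<open>h\<close>;
\<open>h\<close> is a limit of commuting torsion elements, whose images have only finitely many \<open>p\<close>-coordinates, all different
from \<open>u\<close>.\<close>

theorem FA_product_finite:
  fixes \<Gamma> :: "nat \<Rightarrow> 'b topgroup"
  assumes FA: "FA_in {H. profinite_group H} (product_topgroup \<pi> \<Gamma>)"
    and divisible: "\<And>p. p \<in> \<pi> \<Longrightarrow> group (\<Gamma> p) \<Longrightarrow>
      \<exists>u\<in>carrier (\<Gamma> p). (\<forall>m>0. u [^]\<^bsub>\<Gamma> p\<^esub> (m::nat) \<noteq> \<one>\<^bsub>\<Gamma> p\<^esub>) \<and>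
        (\<forall>q\<in>\<pi>. q \<noteq> p \<longrightarrow> (\<forall>j. \<exists>v\<in>carrier (\<Gamma> p). v [^]\<^bsub>\<Gamma> p\<^esub> (q ^ j) = u))"
    and torsion_finite: "\<And>p T. p \<in> \<pi> \<Longrightarrow> group (\<Gamma> p) \<Longrightarrow> T \<subseteq> carrier (\<Gamma> p) \<Longrightarrow>
      (\<And>x y. x \<in> T \<Longrightarrow> y \<in> T \<Longrightarrow> x \<otimes>\<^bsub>\<Gamma> p\<^esub> y = y \<otimes>\<^bsub>\<Gamma> p\<^esub> x) \<Longrightarrow>
      (\<And>x. x \<in> T \<Longrightarrow> \<exists>m>0. x [^]\<^bsub>\<Gamma> p\<^esub> (m::nat) = \<one>\<^bsub>\<Gamma> p\<^esub>) \<Longrightarrow> finite T"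
    and divisible_torsion: "\<And>q y. q \<in> \<pi> \<Longrightarrow> group (\<Gamma> q) \<Longrightarrow> y \<in> carrier (\<Gamma> q) \<Longrightarrow>
      (\<And>j. \<exists>w\<in>carrier (\<Gamma> q). w [^]\<^bsub>\<Gamma> q\<^esub> (q ^ j) = y) \<Longrightarrow> \<exists>m>0. y [^]\<^bsub>\<Gamma> q\<^esub> (m::nat) = \<one>\<^bsub>\<Gamma> q\<^esub>"
  shows "finite \<pi>"
proof (rule ccontr)
  assume inf: "infinite \<pi>"
  define G where "G = product_topgroup \<pi> \<Gamma>"
  have GC: "profinite_group G" using FA unfolding FA_in_def G_def by auto
  obtain \<sigma> where \<sigma>: "sentence \<sigma>"
    and "\<forall>H\<in>{H :: (nat \<Rightarrow> 'b) topgroup. profinite_group H}. models H \<sigma> \<longleftrightarrow> topgroup_isomorphic H G"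
    using conjunct2[OF FA[unfolded FA_in_def]] unfolding G_def by metis
  then have ax: "models H \<sigma> \<longleftrightarrow> topgroup_isomorphic H G" if "profinite_group H" for H :: "(nat \<Rightarrow> 'b) topgroup"
    using that by simp
  have tG: "topological_group G" using GC by (simp add: profinite_group_def inverse_limit_of_finite_def)
  then have grp: "group G" and ts: "topspace (gtop G) = carrier G" by (auto simp: topological_group_def)
  interpret topgroup_product \<pi> \<Gamma> G
    using grp ts by (simp_all add: G_def topgroup_product_def)
  have haus: "Hausdorff_space (gtop G)"
    using GC Hausdorff_inverse_limit_of_finite unfolding profinite_group_def by blast
  obtain D where D: "D \<subseteq> \<pi>" "D \<noteq> {}"
    "models (subtopgroup G (supported (- D))) \<sigma> \<longleftrightarrow> models (subtopgroup G (supported UNIV)) \<sigma>"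
    using exists_omission[OF grp supported_internal_product inf \<sigma>] by blast
  define K where "K = supported (- D)"
  define H where "H = subtopgroup G K"
  have "supported UNIV = carrier G" by (auto simp: supported_def)
  then have "subtopgroup G (supported UNIV) = G" using subtopgroup_carrier[OF ts] by simp
  moreover have "topgroup_isomorphic G G"
    by (rule topgroup_isomorphic_refl)
  ultimately have mH: "models H \<sigma>" using D(3) ax[OF GC] unfolding H_def K_def by (simp only:)
  have sub: "subgroup K G" unfolding K_def by (rule supported_subgroup)
  have KG: "K \<subseteq> carrier G" using sub by (rule subgroup.subset)
  have "profinite_group H"
    unfolding profinite_group_def H_def
  proof (rule inverse_limit_of_finite_closed_subgroup[OF _ sub])
    show "inverse_limit_of_finite (\<lambda>_. True) G" using GC by (simp add: profinite_group_def)
    show "closedin (gtop G) K" unfolding K_def by (rule supported_closed[OF haus])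
  qed simp
  then obtain f where f: "f \<in> iso H G" "homeomorphic_map (gtop H) (gtop G) f"
    using ax mH unfolding topgroup_isomorphic_def by blast
  have gH: "group H" unfolding H_def by (rule group_subtopgroup[OF grp sub])
  interpret H: group H by (rule gH)
  interpret f: group_hom H G f using f(1) by unfold_locales (simp add: iso_def)
  have cH: "carrier H = K" and powH: "\<And>x n. x [^]\<^bsub>H\<^esub> (n::nat) = x [^]\<^bsub>G\<^esub> n"
    by (simp_all add: H_def nat_pow_def)
  have inj: "inj_on f K" and img: "f ` K = carrier G" using f(1) by (auto simp: iso_def bij_betw_def cH)
  obtain p where pD: "p \<in> D" using D(2) by blast
  then have p: "p \<in> \<pi>" using D(1) by blast
  obtain u where u: "u \<in> carrier (\<Gamma> p)" and u_inf: "\<And>m. m > 0 \<Longrightarrow> u [^]\<^bsub>\<Gamma> p\<^esub> (m::nat) \<noteq> \<one>\<^bsub>\<Gamma> p\<^esub>"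
    and u_div: "\<And>q j. q \<in> \<pi> \<Longrightarrow> q \<noteq> p \<Longrightarrow> \<exists>v\<in>carrier (\<Gamma> p). v [^]\<^bsub>\<Gamma> p\<^esub> (q ^ j) = u"
  proof -
    obtain u where u: "u \<in> carrier (\<Gamma> p)" "(\<forall>m>0. u [^]\<^bsub>\<Gamma> p\<^esub> (m::nat) \<noteq> \<one>\<^bsub>\<Gamma> p\<^esub>) \<and>
        (\<forall>q\<in>\<pi>. q \<noteq> p \<longrightarrow> (\<forall>j. \<exists>v\<in>carrier (\<Gamma> p). v [^]\<^bsub>\<Gamma> p\<^esub> (q ^ j) = u))"
      using divisible[OF p group_factor[OF p]] by (rule bexE)
    show ?thesis by (rule that[of u]) (use u in simp_all)
  qed
  let ?e = "single_coordinate \<pi> \<Gamma> p"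
  have "?e u \<in> f ` K" using single_closed[OF p u] by (simp only: img)
  then obtain h where h: "h \<in> K" "f h = ?e u" by auto
  have hc: "h \<in> carrier G" using h KG by blast
  \<comment> \<open>Off \<open>D\<close>, the roots of \<open>u\<close> give roots of the preimage \<open>h\<close>; on \<open>D\<close>, the coordinate is trivial.\<close>
  have tor: "\<exists>m>0. h q [^]\<^bsub>\<Gamma> q\<^esub> (m::nat) = \<one>\<^bsub>\<Gamma> q\<^esub>" if q: "q \<in> \<pi>" for q
  proof (cases "q \<in> D")
    case True
    then have "h q = \<one>\<^bsub>\<Gamma> q\<^esub>" using h q by (simp add: K_def supported_def)
    then have "h q [^]\<^bsub>\<Gamma> q\<^esub> (1::nat) = \<one>\<^bsub>\<Gamma> q\<^esub>"
      using monoid.nat_pow_one[OF group.is_monoid[OF group_factor[OF q]]] by (simp only:)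
    then show ?thesis using zero_less_one by blast
  next
    case False
    show ?thesis
    proof (rule divisible_torsion[OF q group_factor[OF q]])
      show "h q \<in> carrier (\<Gamma> q)" using hc q by (auto simp: carrier_G)
      fix j
      obtain v where v: "v \<in> carrier (\<Gamma> p)" "v [^]\<^bsub>\<Gamma> p\<^esub> (q ^ j) = u" using u_div q False pD by blast
      have "?e v \<in> f ` K" using single_closed[OF p v(1)] by (simp only: img)
      then obtain w where w: "w \<in> K" "f w = ?e v" by auto
      have "?e v [^]\<^bsub>G\<^esub> (q ^ j) = ?e u"
      proof (rule eq_iff_coordinates)
        fix i assume i: "i \<in> \<pi>"
        show "(?e v [^]\<^bsub>G\<^esub> (q ^ j)) i = ?e u i"
          using i v(2) monoid.nat_pow_one[OF group.is_monoid[OF group_factor[OF i]]]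
          by (auto simp: pow_coordinate single_coordinate_def)
      qed (use single_closed p u v in auto)
      then have "f (w [^]\<^bsub>H\<^esub> (q ^ j)) = f h" using w h f.hom_nat_pow[of w "q ^ j"] by (simp add: cH)
      moreover have "w [^]\<^bsub>H\<^esub> (q ^ j) \<in> K" using H.nat_pow_closed[of w "q ^ j"] w by (simp add: cH)
      ultimately have "w [^]\<^bsub>H\<^esub> (q ^ j) = h" using inj h(1) by (simp add: inj_on_eq_iff)
      then have "w q [^]\<^bsub>\<Gamma> q\<^esub> (q ^ j) = h q" using pow_coordinate[OF q, of w "q ^ j"] by (simp add: powH)
      moreover have "w q \<in> carrier (\<Gamma> q)" using w KG q by (auto simp: carrier_G)
      ultimately show "\<exists>w\<in>carrier (\<Gamma> q). w [^]\<^bsub>\<Gamma> q\<^esub> (q ^ j) = h q" by blast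
    qed
  qed
  have trK: "truncation F h \<in> K" for F
    using truncation_closed[OF hc, of F] h by (auto simp: K_def supported_def) (auto simp: truncation_def)
  have fc: "f (truncation F h) \<in> carrier G" for F using trK[of F] img by blast
  have torf: "\<exists>m>0. f (truncation F h) p [^]\<^bsub>\<Gamma> p\<^esub> (m::nat) = \<one>\<^bsub>\<Gamma> p\<^esub>" if F: "finite F" for F
  proof -
    obtain m where m: "m > 0" "truncation F h [^]\<^bsub>G\<^esub> (m::nat) = \<one>\<^bsub>G\<^esub>" using truncation_torsion[OF hc F tor] by blast
    have "f (truncation F h) [^]\<^bsub>G\<^esub> m = f (truncation F h [^]\<^bsub>H\<^esub> m)"
      using f.hom_nat_pow[of "truncation F h" m] trK by (simp add: cH)
    also have "\<dots> = \<one>\<^bsub>G\<^esub>" using m(2) f.hom_one by (simp only: powH) (simp add: H_def)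
    finally have "f (truncation F h) p [^]\<^bsub>\<Gamma> p\<^esub> m = \<one>\<^bsub>\<Gamma> p\<^esub>"
      using pow_coordinate[OF p, of "f (truncation F h)" m] p by (simp add: one_G)
    then show ?thesis using m(1) by blast
  qed
  \<comment> \<open>The finitely many \<open>p\<close>-coordinates of images of truncations; \<open>W\<close> below is a neighbourhood of \<open>f h\<close>
    avoiding them.\<close>
  define T where "T = {f (truncation F h) p |F. finite F}"
  have finT: "finite T"
  proof (rule torsion_finite[OF p group_factor[OF p]])
    show "T \<subseteq> carrier (\<Gamma> p)" using fc p by (auto simp: T_def carrier_G PiE_iff)
    fix x assume "x \<in> T"
    then obtain F where F: "finite F" "x = f (truncation F h) p" by (auto simp: T_def)
    show "\<exists>m>0. x [^]\<^bsub>\<Gamma> p\<^esub> (m::nat) = \<one>\<^bsub>\<Gamma> p\<^esub>" unfolding F(2) by (rule torf[OF F(1)])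
    fix y assume "y \<in> T"
    then obtain F' where F': "finite F'" "y = f (truncation F' h) p" by (auto simp: T_def)
    have "truncation F h \<otimes>\<^bsub>G\<^esub> truncation F' h = truncation F' h \<otimes>\<^bsub>G\<^esub> truncation F h"
    proof (rule eq_iff_coordinates)
      fix i assume i: "i \<in> \<pi>"
      have "h i \<in> carrier (\<Gamma> i)" using hc i by (auto simp: carrier_G)
      then show "(truncation F h \<otimes>\<^bsub>G\<^esub> truncation F' h) i = (truncation F' h \<otimes>\<^bsub>G\<^esub> truncation F h) i"
        using i group.is_monoid[OF group_factor[OF i]] by (auto simp: mult_G truncation_def monoid.l_one monoid.r_one)
    qed (use truncation_closed[OF hc] in auto)
    then have "f (truncation F h) \<otimes>\<^bsub>G\<^esub> f (truncation F' h) = f (truncation F' h) \<otimes>\<^bsub>G\<^esub> f (truncation F h)"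
      using f.hom_mult[of "truncation F h" "truncation F' h"] f.hom_mult[of "truncation F' h" "truncation F h"] trK
      by (simp add: cH H_def)
    from fun_cong[OF this, of p] show "x \<otimes>\<^bsub>\<Gamma> p\<^esub> y = y \<otimes>\<^bsub>\<Gamma> p\<^esub> x" using p F F' by (simp add: mult_G)
  qed
  have uT: "u \<notin> T" using torf u_inf unfolding T_def by blast
  define W where "W = carrier G - {x \<in> carrier G. x p \<in> T}"
  have "openin (gtop G) W"
    unfolding W_def using closedin_coordinate[OF haus p finT] by (simp add: closedin_def ts)
  then have "openin (gtop H) {x \<in> topspace (gtop H). f x \<in> W}"
    by (rule openin_continuous_map_preimage[OF homeomorphic_imp_continuous_map[OF f(2)]])
  moreover have tH: "topspace (gtop H) = K" using KG by (auto simp: H_def ts)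
  ultimately obtain V where V: "openin (gtop G) V" "{x \<in> K. f x \<in> W} = V \<inter> K"
    by (auto simp: H_def openin_subtopology)
  have "f h \<in> W" using h single_closed[OF p u] uT p by (auto simp: W_def single_coordinate_def)
  then have "h \<in> V" using h V by blast
  then obtain F where F: "finite F" "truncation F h \<in> V" using truncation_near[OF V(1)] by blast
  then have "f (truncation F h) \<in> W" using trK V by blast
  then show False using F(1) by (auto simp: W_def T_def)
qed

section \<open>The p-adic absolute value on the rationals\<close>

locale padic =
  fixes p :: nat
  assumes prime: "Factorial_Ring.prime p"
begin

lemma p_gt_1: "1 < p" using prime by (rule prime_gt_1_nat)
lemma prime_int: "Factorial_Ring.prime (int p)" using prime by simp

abbreviation vabs :: "rat \<Rightarrow> real" where "vabs \<equiv> padic_abs p"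

lemma padic_val_fraction:
  assumes "a \<noteq> 0" "b \<noteq> 0"
  shows "padic_val p (of_int a / of_int b) = int (multiplicity (int p) a) - int (multiplicity (int p) b)"
proof -
  obtain c d where cd: "quotient_of (of_int a / of_int b) = (c, d)" by fastforce
  then have d: "d > 0" and eq: "of_int a / of_int b = (of_int c / of_int d :: rat)"
    using quotient_of_denom_pos quotient_of_div by blast+
  then have "of_int (a * d) = (of_int (c * b) :: rat)" using assms by (simp add: field_simps)
  then have e: "a * d = c * b" by (simp only: of_int_eq_iff)
  have c: "c \<noteq> 0" using e assms d by auto
  have "multiplicity (int p) (a * d) = multiplicity (int p) (c * b)" by (simp add: e)
  then have "multiplicity (int p) a + multiplicity (int p) d = multiplicity (int p) c + multiplicity (int p) b"
    using assms c d prime_int by (simp add: prime_elem_multiplicity_mult_distrib)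
  then show ?thesis by (simp add: padic_val_def cd)
qed

lemma rat_fraction: obtains a b :: int where "x = (of_int a / of_int b :: rat)" "b > 0"
  using quotient_of_div quotient_of_denom_pos by (metis surj_pair)

lemma vabs_0 [simp]: "vabs 0 = 0" by (simp add: padic_abs_def)

lemma vabs_nonneg [simp]: "0 \<le> vabs x" by (simp add: padic_abs_def)

lemma vabs_eq_0_iff [simp]: "vabs x = 0 \<longleftrightarrow> x = 0" using p_gt_1 by (simp add: padic_abs_def)

lemma vabs_fraction:
  assumes "a \<noteq> 0" "b \<noteq> 0"
  shows "vabs (of_int a / of_int b) = real p powi (int (multiplicity (int p) b) - int (multiplicity (int p) a))"
  using assms by (simp add: padic_abs_def padic_val_fraction)

lemma vabs_mult: "vabs (x * y) = vabs x * vabs y"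
proof (cases "x = 0 \<or> y = 0")
  case False
  obtain a b where x: "x = of_int a / of_int b" "b > 0" by (rule rat_fraction)
  obtain c d where y: "y = of_int c / of_int d" "d > 0" by (rule rat_fraction)
  have nz: "a \<noteq> 0" "b \<noteq> 0" "c \<noteq> 0" "d \<noteq> 0" using False x y by auto
  have "x * y = of_int (a * c) / of_int (b * d)" by (simp add: x y)
  moreover have "a * c \<noteq> 0" "b * d \<noteq> 0" using nz by auto
  ultimately have "vabs (x * y) = real p powi (int (multiplicity (int p) (b * d)) - int (multiplicity (int p) (a * c)))"
    using vabs_fraction[of "a * c" "b * d"] by metis
  also have "\<dots> = real p powi ((int (multiplicity (int p) b) - int (multiplicity (int p) a)) +
      (int (multiplicity (int p) d) - int (multiplicity (int p) c)))"
    using nz prime_int by (simp add: prime_elem_multiplicity_mult_distrib algebra_simps)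
  also have "\<dots> = vabs x * vabs y"
    unfolding x(1) y(1) using nz p_gt_1 by (simp add: vabs_fraction power_int_add)
  finally show ?thesis .
qed auto

lemma vabs_1 [simp]: "vabs 1 = 1"
  using vabs_fraction[of 1 1] by simp

lemma vabs_minus [simp]: "vabs (- x) = vabs x"
proof -
  have "vabs (- 1) * vabs (- 1) = 1" using vabs_mult[of "-1" "-1"] by simp
  then have "vabs (- 1) = 1" using vabs_nonneg[of "-1"] by (simp add: square_eq_1_iff)
  then show ?thesis using vabs_mult[of "-1" x] by simp
qed

lemma vabs_diff_commute: "vabs (x - y) = vabs (y - x)"
  using vabs_minus[of "x - y"] by simp

lemma vabs_power: "vabs (x ^ k) = vabs x ^ k"
  by (induction k) (simp_all add: vabs_mult)

lemma vabs_inverse: "vabs (inverse x) = inverse (vabs x)"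
proof (cases "x = 0")
  case False
  then have "vabs x * vabs (inverse x) = 1" using vabs_mult[of x "inverse x"] by simp
  then show ?thesis by (simp add: inverse_unique)
qed auto

lemma vabs_of_int_le_1: "vabs (of_int a) \<le> 1"
proof (cases "a = 0")
  case False
  then have "vabs (of_int a) = real p powi (- int (multiplicity (int p) a))"
    using vabs_fraction[of a 1] by simp
  also have "\<dots> \<le> 1" using p_gt_1 by (simp add: power_int_minus inverse_le_1_iff)
  finally show ?thesis .
qed auto

lemma vabs_of_nat_le_1: "vabs (of_nat k) \<le> 1"
  using vabs_of_int_le_1[of "int k"] by simp

lemma vabs_of_int_eq_1: "\<not> int p dvd a \<Longrightarrow> vabs (of_int a) = 1"
proof -
  assume *: "\<not> int p dvd a"
  then have "a \<noteq> 0" by auto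
  then show ?thesis using vabs_fraction[of a 1] * by (simp add: not_dvd_imp_multiplicity_0)
qed

lemma vabs_p: "vabs (of_nat p) = 1 / real p"
  using vabs_fraction[of "int p" 1] p_gt_1 prime_int by (simp add: power_int_minus divide_inverse)

lemma vabs_other_prime: "Factorial_Ring.prime q \<Longrightarrow> q \<noteq> p \<Longrightarrow> vabs (of_nat q) = 1"
  using vabs_of_int_eq_1[of "int q"] prime primes_dvd_imp_eq by auto

lemma vabs_le_1_iff_fraction:
  assumes "vabs x \<le> 1"
  obtains a b where "x = of_int a / of_int b" "\<not> int p dvd b" "b > 0"
proof -
  obtain a b where q: "quotient_of x = (a, b)" by fastforce
  then have x: "x = of_int a / of_int b" and b: "b > 0" and cop: "coprime a b"
    using quotient_of_div quotient_of_denom_pos quotient_of_coprime by blast+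
  have "\<not> int p dvd b"
  proof
    assume pb: "int p dvd b"
    then have pa: "\<not> int p dvd a" using cop prime_int by (meson coprime_common_divisor not_prime_unit)
    then have a: "a \<noteq> 0" by auto
    have "multiplicity (int p) b > 0" using pb b prime_int by (simp add: prime_multiplicity_gt_zero_iff)
    moreover have "vabs x = real p powi (int (multiplicity (int p) b))"
      using vabs_fraction[OF a, of b] b pa by (simp add: x not_dvd_imp_multiplicity_0)
    ultimately have "vabs x > 1" using p_gt_1 by simp
    then show False using assms by simp
  qed
  then show ?thesis using that x b by blast
qed

text \<open>Closure of the localisation of \<open>\<int>\<close> at \<open>p\<close> under addition; the ultrametric inequality follows from it by scaling.\<close>

lemma vabs_add_le_1: assumes "vabs x \<le> 1" "vabs y \<le> 1" shows "vabs (x + y) \<le> 1"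
proof -
  obtain a b where x: "x = of_int a / of_int b" "\<not> int p dvd b" "b > 0" using vabs_le_1_iff_fraction[OF assms(1)] .
  obtain c d where y: "y = of_int c / of_int d" "\<not> int p dvd d" "d > 0" using vabs_le_1_iff_fraction[OF assms(2)] .
  have "x + y = of_int (a * d + c * b) * inverse (of_int (b * d))" using x y by (simp add: field_simps)
  moreover have "\<not> int p dvd b * d" using x y prime_int by (simp add: prime_dvd_mult_iff)
  ultimately show ?thesis
    using vabs_of_int_le_1[of "a * d + c * b"] vabs_of_int_eq_1[of "b * d"] by (simp only: vabs_mult vabs_inverse) simp
qed

lemma vabs_add: "vabs (x + y) \<le> max (vabs x) (vabs y)"
proof -
  have *: "vabs (x + y) \<le> vabs x" if "vabs y \<le> vabs x" for x y
  proof (cases "x = 0")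
    case True
    then have "vabs y = 0" using that vabs_nonneg[of y] by simp
    then show ?thesis using True by simp
  next
    case False
    have "vabs x > 0" using False vabs_nonneg[of x] by (simp add: less_le)
    then have "vabs y / vabs x \<le> 1" using that by (simp add: divide_le_eq_1)
    then have "vabs (y / x) \<le> 1" by (simp add: divide_inverse vabs_mult vabs_inverse)
    then have "vabs (1 + y / x) \<le> 1" by (intro vabs_add_le_1) auto
    then have "vabs x * vabs (1 + y / x) \<le> vabs x" by (intro mult_left_le) simp_all
    moreover have "x * (1 + y / x) = x + y" using False by (simp add: field_simps)
    ultimately show ?thesis by (metis vabs_mult)
  qed
  show ?thesis using *[of x y] *[of y x] by (cases "vabs y \<le> vabs x") (auto simp: add.commute)
qed

lemma vabs_diff: "vabs (x - y) \<le> max (vabs x) (vabs y)"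
  using vabs_add[of x "- y"] by simp

lemma vabs_add_le: "vabs x \<le> e \<Longrightarrow> vabs y \<le> e \<Longrightarrow> vabs (x + y) \<le> e"
  using vabs_add[of x y] by linarith

lemma vabs_diff_trans: "vabs (x - y) \<le> e \<Longrightarrow> vabs (y - z) \<le> e \<Longrightarrow> vabs (x - z) \<le> e"
  using vabs_add_le[of "x - y" e "y - z"] by simp

lemma vabs_add_eq: assumes "vabs y < vabs x" shows "vabs (x + y) = vabs x"
proof (rule antisym)
  show "vabs (x + y) \<le> vabs x" using vabs_add[of x y] assms by simp
  show "vabs x \<le> vabs (x + y)" using vabs_diff[of "x + y" y] assms by auto
qed

lemma vabs_sum_le: "0 \<le> e \<Longrightarrow> (\<And>k. k \<in> A \<Longrightarrow> vabs (f k) \<le> e) \<Longrightarrow> vabs (sum f A) \<le> e"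
  by (induction A rule: infinite_finite_induct) (auto intro: vabs_add_le)

lemma vabs_abs_diff: "\<bar>vabs x - vabs y\<bar> \<le> vabs (x - y)"
proof -
  have "max (vabs a) (vabs b) \<le> vabs a + vabs b" for a b by simp
  then have "vabs x \<le> vabs (x - y) + vabs y" "vabs y \<le> vabs (y - x) + vabs x"
    using vabs_add[of "x - y" y] vabs_add[of "y - x" x] by (simp_all only: diff_add_cancel) (meson order_trans)+
  then show ?thesis using vabs_diff_commute[of x y] by auto
qed

text \<open>The absolute value takes only powers of \<open>p\<close> as nonzero values.\<close>

lemma vabs_less_p_imp_le_1: assumes "vabs x < real p" shows "vabs x \<le> 1"
proof (cases "x = 0")
  case False
  then have "real p powi (- padic_val p x) < real p powi 1" using assms by (simp add: padic_abs_def)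
  then have "- padic_val p x < 1"
    using p_gt_1 power_int_increasing[of 1 "- padic_val p x" "real p"] by linarith
  then have "- padic_val p x \<le> 0" by simp
  then have "real p powi (- padic_val p x) \<le> real p powi 0"
    using p_gt_1 by (intro power_int_increasing) auto
  then show ?thesis using False by (simp add: padic_abs_def)
qed auto

lemma vabs_le_of_dvd: "int p ^ e dvd a \<Longrightarrow> vabs (of_int a) \<le> (1 / real p) ^ e"
proof -
  assume "int p ^ e dvd a"
  then obtain b where "a = int p ^ e * b" by blast
  then have "vabs (of_int a) = (1 / real p) ^ e * vabs (of_int b)"
    by (simp add: vabs_mult vabs_power vabs_p[simplified])
  also have "\<dots> \<le> (1 / real p) ^ e * 1" by (intro mult_left_mono vabs_of_int_le_1) auto
  finally show ?thesis by simp
qed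

text \<open>The denominator is invertible modulo \<open>p\<^sup>e\<close>.\<close>

lemma integer_approximation:
  assumes "vabs x \<le> 1"
  shows "\<exists>c\<in>{0..<int p ^ e}. vabs (x - of_int c) \<le> (1 / real p) ^ e"
proof -
  obtain a b where x: "x = of_int a / of_int b" "\<not> int p dvd b" "b > 0" using vabs_le_1_iff_fraction[OF assms] .
  have "coprime b (int p ^ e)" 
    using prime_imp_coprime[OF prime_int x(2)] by (simp add: coprime_commute)
  then obtain u v where uv: "u * b + v * int p ^ e = 1"
    by (metis bezout_int coprime_iff_gcd_eq_1)
  define c where "c = (a * u) mod int p ^ e"
  have "int p ^ e dvd a - b * c"
  proof -
    have "a - b * (a * u) = int p ^ e * (a * v)" using uv by (simp add: algebra_simps) (metis distrib_left mult.assoc mult.commute mult.right_neutral)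
    then have "int p ^ e dvd a - b * (a * u)" by simp
    moreover have "int p ^ e dvd b * (a * u) - b * c"
      unfolding c_def by (simp flip: right_diff_distrib add: dvd_mult)
    ultimately show ?thesis using dvd_add[of "int p ^ e" "a - b * (a * u)" "b * (a * u) - b * c"] by simp
  qed
  then have "vabs (of_int (a - b * c)) \<le> (1 / real p) ^ e" by (rule vabs_le_of_dvd)
  moreover have "x - of_int c = of_int (a - b * c) * inverse (of_int b)" using x by (simp add: field_simps)
  then have "vabs (x - of_int c) = vabs (of_int (a - b * c))"
    using vabs_of_int_eq_1[OF x(2)] by (simp only: vabs_mult vabs_inverse) simp
  ultimately have "vabs (x - of_int c) \<le> (1 / real p) ^ e" by simp
  moreover have "c \<in> {0..<int p ^ e}" using p_gt_1 by (auto simp: c_def)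
  ultimately show ?thesis by blast
qed

text \<open>The multiples of \<open>p\<close> up to \<open>p a + b\<close> are \<open>p \<cdot> 1, \<dots>, p \<cdot> a\<close>.\<close>

lemma vabs_fact: "vabs (fact (p * a + b)) = (1 / real p) ^ a * vabs (fact a)" if "b < p"
  using that
proof (induction a arbitrary: b)
  case 0
  show ?case using 0
  proof (induction b)
    case (Suc b)
    have "\<not> p dvd Suc b" using Suc.prems by (meson dvd_imp_le not_less zero_less_Suc)
    then have "vabs (of_nat (Suc b)) = 1" using vabs_of_int_eq_1[of "int (Suc b)"] by (simp only: int_dvd_int_iff of_int_of_nat_eq) simp
    moreover have "fact (p * 0 + Suc b) = (of_nat (Suc b) * fact (p * 0 + b) :: rat)" by simp
    ultimately show ?case using Suc by (simp add: vabs_mult)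
  qed simp
next
  case (Suc a)
  show ?case using Suc.prems
  proof (induction b)
    case 0
    have e: "p * Suc a = Suc (p * a + (p - 1))" using p_gt_1 by simp
    have "fact (p * Suc a + 0) = (of_nat (p * Suc a) * fact (p * a + (p - 1)) :: rat)"
      by (simp only: e add_0_right fact_Suc)
    moreover have "vabs (fact (p * a + (p - 1))) = (1 / real p) ^ a * vabs (fact a)"
      by (rule Suc.IH) (use p_gt_1 in simp)
    ultimately have "vabs (fact (p * Suc a + 0)) = (1 / real p) * vabs (of_nat (Suc a)) * ((1 / real p) ^ a * vabs (fact a))"
      by (simp only: vabs_mult of_nat_mult vabs_p)
    also have "\<dots> = (1 / real p) ^ Suc a * vabs (fact (Suc a))"
      by (simp only: fact_Suc vabs_mult power_Suc mult_ac)
    finally show ?case .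
  next
    case (Suc b)
    have "\<not> p dvd (p * Suc a + Suc b)" using Suc.prems
      by (metis dvd_add_right_iff dvd_triv_left nat_dvd_not_less zero_less_Suc)
    then have "vabs (of_nat (p * Suc a + Suc b)) = 1"
      using vabs_of_int_eq_1[of "int (p * Suc a + Suc b)"] by (simp only: int_dvd_int_iff of_int_of_nat_eq) simp
    moreover have "fact (p * Suc a + Suc b) = (of_nat (p * Suc a + Suc b) * fact (p * Suc a + b) :: rat)"
      by (simp only: add_Suc_right fact_Suc)
    ultimately show ?case using Suc by (simp add: vabs_mult)
  qed
qed

text \<open>Weaker than Legendre's formula, but enough to make exponentials converge: passing from
\<open>k\<close> to \<open>k div p\<close> at least halves \<open>k\<close>.\<close>

lemma vabs_fact_ge: "(1 / real p) ^ k \<le> vabs (fact k)"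
proof (induction k rule: less_induct)
  case (less k)
  define a where "a = k div p"
  have k: "k = p * a + k mod p" by (simp add: a_def)
  show ?case
  proof (cases "k = 0")
    case False
    then have ak: "a < k" unfolding a_def using p_gt_1 by simp
    have "2 * a \<le> p * a" using p_gt_1 by simp
    then have "a + a \<le> k" using k by linarith
    then have "(1 / real p) ^ k \<le> (1 / real p) ^ (a + a)" using p_gt_1 by (intro power_decreasing) auto
    also have "\<dots> \<le> (1 / real p) ^ a * vabs (fact a)" using less[OF ak] by (simp add: power_add mult_left_mono)
    also have "\<dots> = vabs (fact k)" using vabs_fact[of "k mod p" a] p_gt_1 k by simp
    finally show ?thesis .
  qed auto
qed

lemma vabs_inverse_fact: "vabs (inverse (fact k)) \<le> real p ^ k"
proof -
  have "0 < (1 / real p) ^ k" using p_gt_1 by simp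
  then have "inverse (vabs (fact k)) \<le> inverse ((1 / real p) ^ k)" using vabs_fact_ge by (rule le_imp_inverse_le[rotated])
  then show ?thesis by (simp add: vabs_inverse power_one_over)
qed

end

section \<open>p-adic numbers as classes of Cauchy sequences\<close>

context padic begin

abbreviation cauchy where "cauchy \<equiv> padic_cauchy p"
abbreviation null where "null \<equiv> padic_null p"
abbreviation CR where "CR \<equiv> padic_cauchy_ring p"

lemma cauchyD: "s \<in> cauchy \<Longrightarrow> e > 0 \<Longrightarrow> \<exists>N. \<forall>m\<ge>N. \<forall>n\<ge>N. vabs (s m - s n) < e"
  by (simp add: padic_cauchy_def)

lemma nullD: "s \<in> null \<Longrightarrow> e > 0 \<Longrightarrow> \<forall>\<^sub>F t in sequentially. vabs (s t) < e"
  unfolding padic_null_def using order_tendstoD(2) by fastforce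

lemma nullI: "(\<And>e. e > 0 \<Longrightarrow> \<forall>\<^sub>F t in sequentially. vabs (s t) < e) \<Longrightarrow> s \<in> null"
  unfolding padic_null_def mem_Collect_eq
  by (rule order_tendstoI) (auto intro!: always_eventually intro: less_le_trans[OF _ vabs_nonneg])

lemma null_bound:
  assumes "s \<in> null" "\<And>t. vabs (r t) \<le> B * vabs (s t)" "B > 0" shows "r \<in> null"
proof (rule nullI)
  fix e :: real assume "e > 0"
  then have "e / B > 0" using assms(3) by simp
  then have "\<forall>\<^sub>F t in sequentially. vabs (s t) < e / B" by (rule nullD[OF assms(1)])
  then show "\<forall>\<^sub>F t in sequentially. vabs (r t) < e"
  proof (rule eventually_mono)
    fix t assume "vabs (s t) < e / B"
    then have "B * vabs (s t) < e" using assms(3) by (simp add: pos_less_divide_eq mult.commute)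
    then show "vabs (r t) < e" using assms(2)[of t] by linarith
  qed
qed

lemma null_add: "s \<in> null \<Longrightarrow> r \<in> null \<Longrightarrow> (\<lambda>t. s t + r t) \<in> null"
proof (rule nullI)
  fix e :: real assume *: "s \<in> null" "r \<in> null" "e > 0"
  show "\<forall>\<^sub>F t in sequentially. vabs (s t + r t) < e"
    using eventually_conj[OF nullD[OF *(1,3)] nullD[OF *(2,3)]]
    by (rule eventually_mono) (use vabs_add in \<open>meson le_less_trans max_less_iff_conj\<close>)
qed

lemma null_minus: "s \<in> null \<Longrightarrow> (\<lambda>t. - s t) \<in> null"
  by (simp add: padic_null_def)

lemma null_diff: "s \<in> null \<Longrightarrow> r \<in> null \<Longrightarrow> (\<lambda>t. s t - r t) \<in> null"
  using null_add[OF _ null_minus] by fastforce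

lemma null_zero: "(\<lambda>t. 0) \<in> null" by (simp add: padic_null_def)

lemma null_imp_cauchy: assumes s: "s \<in> null" shows "s \<in> cauchy"
  unfolding padic_cauchy_def mem_Collect_eq
proof (intro allI impI)
  fix e :: real assume "e > 0"
  then obtain N where N: "\<And>t. t \<ge> N \<Longrightarrow> vabs (s t) < e" using nullD[OF s] by (auto simp: eventually_sequentially)
  have "vabs (s m - s n) < e" if "m \<ge> N" "n \<ge> N" for m n
    using vabs_diff[of "s m" "s n"] N[OF that(1)] N[OF that(2)] by linarith
  then show "\<exists>N. \<forall>m\<ge>N. \<forall>n\<ge>N. vabs (s m - s n) < e" by blast
qed

lemma cauchy_const: "(\<lambda>t. c) \<in> cauchy" by (simp add: padic_cauchy_def)

lemma cauchy_add:
  assumes "s \<in> cauchy" "r \<in> cauchy" shows "(\<lambda>t. s t + r t) \<in> cauchy"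
  unfolding padic_cauchy_def mem_Collect_eq
proof (intro allI impI)
  fix e :: real assume e: "e > 0"
  obtain N M where N: "\<And>m n. m \<ge> N \<Longrightarrow> n \<ge> N \<Longrightarrow> vabs (s m - s n) < e"
    and M: "\<And>m n. m \<ge> M \<Longrightarrow> n \<ge> M \<Longrightarrow> vabs (r m - r n) < e"
    using cauchyD[OF assms(1) e] cauchyD[OF assms(2) e] by metis
  have "vabs ((s m + r m) - (s n + r n)) < e" if "m \<ge> max N M" "n \<ge> max N M" for m n
    using vabs_add[of "s m - s n" "r m - r n"] N[of m n] M[of m n] that by (simp add: add_diff_add)
  then show "\<exists>N. \<forall>m\<ge>N. \<forall>n\<ge>N. vabs ((s m + r m) - (s n + r n)) < e" by blast
qed

lemma cauchy_minus: "s \<in> cauchy \<Longrightarrow> (\<lambda>t. - s t) \<in> cauchy"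
  unfolding padic_cauchy_def by (simp add: vabs_diff_commute add.commute[of "- _"])

lemma cauchy_bounded: assumes s: "s \<in> cauchy" obtains B where "B > 0" "\<And>t. vabs (s t) \<le> B"
proof -
  obtain N where N: "\<And>m n. m \<ge> N \<Longrightarrow> n \<ge> N \<Longrightarrow> vabs (s m - s n) < 1" using cauchyD[OF s, of 1] by auto
  define B where "B = Max ((\<lambda>t. vabs (s t)) ` {..N}) + 1"
  have le: "vabs (s t) \<le> Max ((\<lambda>t. vabs (s t)) ` {..N})" if "t \<le> N" for t using that by (intro Max_ge) auto
  have B0: "B > 0" using le[of N] vabs_nonneg[of "s N"] unfolding B_def by linarith
  have "vabs (s t) \<le> B" for t
  proof (cases "t \<le> N")
    case True then show ?thesis using le[OF True] unfolding B_def by linarith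
  next
    case False
    then have "vabs (s t) \<le> max (vabs (s t - s N)) (vabs (s N))" using vabs_add[of "s t - s N" "s N"] by simp
    then show ?thesis using N[of t N] False le[of N] vabs_nonneg[of "s N"] unfolding B_def by linarith
  qed
  then show ?thesis using that B0 by blast
qed

lemma cauchy_mult:
  assumes "s \<in> cauchy" "r \<in> cauchy" shows "(\<lambda>t. s t * r t) \<in> cauchy"
  unfolding padic_cauchy_def mem_Collect_eq
proof (intro allI impI)
  fix e :: real assume e: "e > 0"
  obtain B where B: "B > 0" "\<And>t. vabs (s t) \<le> B" using cauchy_bounded[OF assms(1)] by blast
  obtain C where C: "C > 0" "\<And>t. vabs (r t) \<le> C" using cauchy_bounded[OF assms(2)] by blast
  have eB: "e / B > 0" "e / C > 0" using e B C by auto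
  obtain N M where N: "\<And>m n. m \<ge> N \<Longrightarrow> n \<ge> N \<Longrightarrow> vabs (s m - s n) < e / C"
    and M: "\<And>m n. m \<ge> M \<Longrightarrow> n \<ge> M \<Longrightarrow> vabs (r m - r n) < e / B"
    using cauchyD[OF assms(1) eB(2)] cauchyD[OF assms(2) eB(1)] by metis
  have "vabs (s m * r m - s n * r n) < e" if "m \<ge> max N M" "n \<ge> max N M" for m n
  proof -
    have "vabs (s m * (r m - r n)) \<le> B * vabs (r m - r n)"
      unfolding vabs_mult using B by (intro mult_right_mono) auto
    also have "\<dots> < B * (e / B)" using M[of m n] that B(1) by (intro mult_strict_left_mono) auto
    finally have 1: "vabs (s m * (r m - r n)) < e" using B by simp
    have "vabs ((s m - s n) * r n) \<le> vabs (s m - s n) * C"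
      unfolding vabs_mult using C by (intro mult_left_mono) auto
    also have "\<dots> < (e / C) * C" using N[of m n] that C(1) by (intro mult_strict_right_mono) auto
    finally have 2: "vabs ((s m - s n) * r n) < e" using C by simp
    have "s m * r m - s n * r n = s m * (r m - r n) + (s m - s n) * r n" by (simp add: algebra_simps)
    then show ?thesis using vabs_add[of "s m * (r m - r n)" "(s m - s n) * r n"] 1 2 by simp
  qed
  then show "\<exists>N. \<forall>m\<ge>N. \<forall>n\<ge>N. vabs (s m * r m - s n * r n) < e" by blast
qed

lemma null_mult_cauchy:
  assumes "s \<in> null" "r \<in> cauchy" shows "(\<lambda>t. s t * r t) \<in> null"
proof -
  obtain B where B: "B > 0" "\<And>t. vabs (r t) \<le> B" using cauchy_bounded[OF assms(2)] by blast
  show ?thesis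
  proof (rule null_bound[OF assms(1) _ B(1)])
    fix t show "vabs (s t * r t) \<le> B * vabs (s t)"
      using mult_left_mono[OF B(2)[of t], of "vabs (s t)"] by (simp add: vabs_mult mult.commute)
  qed
qed

lemma CR_simps [simp]:
  "carrier CR = cauchy" "monoid.mult CR = (\<lambda>s r t. s t * r t)" "one CR = (\<lambda>t. 1)"
  "ring.zero CR = (\<lambda>t. 0)" "add CR = (\<lambda>s r t. s t + r t)"
  by (simp_all add: padic_cauchy_ring_def)

lemma cring_CR: "cring CR"
proof (rule cringI)
  show "abelian_group CR"
  proof (rule abelian_groupI; (simp add: cauchy_add cauchy_const)?)
    fix s assume "s \<in> cauchy"
    then show "\<exists>r\<in>cauchy. (\<lambda>t. r t + s t) = (\<lambda>t. 0)" using cauchy_minus by (intro bexI[of _ "\<lambda>t. - s t"]) auto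
  qed (simp_all add: add_ac)
  show "comm_monoid CR"
    by (rule comm_monoidI) (simp_all add: cauchy_mult cauchy_const mult_ac)
qed (simp add: distrib_right)

lemma ideal_null: "ideal null CR"
proof (rule idealI)
  interpret R: cring CR by (rule cring_CR)
  show "ring CR" by (rule R.ring_axioms)
  show "subgroup null (add_monoid CR)"
  proof (rule group.subgroupI)
    show "group (add_monoid CR)" by (rule R.a_group)
    show "null \<subseteq> carrier (add_monoid CR)" using null_imp_cauchy by auto
    show "null \<noteq> {}" using null_zero by blast
    fix s assume s: "s \<in> null"
    have "\<ominus>\<^bsub>CR\<^esub> s = (\<lambda>t. - s t)"
      by (rule R.minus_equality) (use s null_imp_cauchy cauchy_minus in auto)
    then show "inv\<^bsub>add_monoid CR\<^esub> s \<in> null" using null_minus[OF s] by (simp add: a_inv_def)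
  qed (auto simp: null_add)
qed (use null_mult_cauchy in \<open>auto simp: mult.commute\<close>)

text \<open>The element of \<open>\<rat>\<^sub>p\<close> represented by a Cauchy sequence. All computations with p-adic numbers below are carried out on
representatives.\<close>

definition cls :: "(nat \<Rightarrow> rat) \<Rightarrow> padic" where "cls s = null +>\<^bsub>CR\<^esub> s"

lemma mem_cls: assumes "s \<in> cauchy" shows "r \<in> cls s \<longleftrightarrow> (\<lambda>t. r t - s t) \<in> null"
proof
  assume "r \<in> cls s"
  then obtain h where "h \<in> null" "r = (\<lambda>t. h t + s t)" by (auto simp: cls_def a_r_coset_def' )
  then show "(\<lambda>t. r t - s t) \<in> null" by simp
next
  assume "(\<lambda>t. r t - s t) \<in> null"
  then show "r \<in> cls s" unfolding cls_def a_r_coset_def' by (force intro: bexI[of _ "\<lambda>t. r t - s t"])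
qed

lemma cls_eq_iff: assumes "s \<in> cauchy" "r \<in> cauchy" shows "cls s = cls r \<longleftrightarrow> (\<lambda>t. s t - r t) \<in> null"
proof
  assume "cls s = cls r"
  moreover have "s \<in> cls s" using mem_cls[OF assms(1)] null_zero by simp
  ultimately show "(\<lambda>t. s t - r t) \<in> null" using mem_cls[OF assms(2)] by simp
next
  assume n: "(\<lambda>t. s t - r t) \<in> null"
  show "cls s = cls r"
  proof (rule Set.set_eqI)
    fix x
    have "(\<lambda>t. x t - s t) \<in> null \<longleftrightarrow> (\<lambda>t. x t - r t) \<in> null"
      using null_add[OF _ n, of "\<lambda>t. x t - s t"] null_diff[OF _ n, of "\<lambda>t. x t - r t"] by (auto simp: fun_eq_iff)
    then show "x \<in> cls s \<longleftrightarrow> x \<in> cls r" using mem_cls assms by simp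
  qed
qed

lemma cls_self: "s \<in> cauchy \<Longrightarrow> s \<in> cls s" using mem_cls null_zero by simp

abbreviation Q where "Q \<equiv> Qp p"

lemma ring_Q: "cring Q"
  unfolding Qp_def by (rule ideal.quotient_is_cring[OF ideal_null cring_CR])

lemma cls_hom: "cls \<in> ring_hom CR Q"
  unfolding Qp_def cls_def[abs_def] by (rule ideal.rcos_ring_hom[OF ideal_null])

lemma carrier_Q: "carrier Q = cls ` cauchy"
  by (auto simp: Qp_def FactRing_def A_RCOSETS_def' cls_def)

lemma cls_closed: "s \<in> cauchy \<Longrightarrow> cls s \<in> carrier Q" by (simp add: carrier_Q)

lemma cls_mult: "s \<in> cauchy \<Longrightarrow> r \<in> cauchy \<Longrightarrow> cls s \<otimes>\<^bsub>Q\<^esub> cls r = cls (\<lambda>t. s t * r t)"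
  and cls_add: "s \<in> cauchy \<Longrightarrow> r \<in> cauchy \<Longrightarrow> cls s \<oplus>\<^bsub>Q\<^esub> cls r = cls (\<lambda>t. s t + r t)"
  and cls_one: "\<one>\<^bsub>Q\<^esub> = cls (\<lambda>t. 1)"
  using ring_hom_mult[OF cls_hom] ring_hom_add[OF cls_hom] ring_hom_one[OF cls_hom] by auto

lemma cls_zero: "\<zero>\<^bsub>Q\<^esub> = cls (\<lambda>t. 0)"
proof -
  interpret ring_hom_ring CR Q cls
    using cring_CR ring_Q cls_hom by (intro ring_hom_ringI2) (auto simp: cring_def)
  show ?thesis using hom_zero by simp
qed

lemma padic_of_rat_cls: "padic_of_rat p c = cls (\<lambda>t. c)"
  by (simp add: padic_of_rat_def cls_def)

lemma vabs_convergent: assumes s: "s \<in> cauchy" shows "\<exists>r. (\<lambda>t. vabs (s t)) \<longlonglongrightarrow> r"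
proof -
  have "Cauchy (\<lambda>t. vabs (s t))"
  proof (rule metric_CauchyI)
    fix e :: real assume "e > 0"
    then obtain N where "\<forall>m\<ge>N. \<forall>n\<ge>N. vabs (s m - s n) < e" using cauchyD[OF s] by blast
    then show "\<exists>M. \<forall>m\<ge>M. \<forall>n\<ge>M. dist (vabs (s m)) (vabs (s n)) < e"
      by (intro exI[of _ N]) (auto simp: dist_real_def intro: le_less_trans[OF vabs_abs_diff])
  qed
  then show ?thesis by (simp add: Cauchy_convergent_iff convergent_def)
qed

lemma padic_norm_cls:
  assumes s: "s \<in> cauchy" shows "(\<lambda>t. vabs (s t)) \<longlonglongrightarrow> padic_norm p (cls s)"
proof -
  obtain r where r: "(\<lambda>t. vabs (s t)) \<longlonglongrightarrow> r" using vabs_convergent[OF s] by blast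
  have all: "(\<lambda>t. vabs (x t)) \<longlonglongrightarrow> r" if x: "x \<in> cls s" for x
  proof -
    have "(\<lambda>t. vabs (x t - s t)) \<longlonglongrightarrow> 0" using x mem_cls[OF s] by (simp add: padic_null_def)
    then have "(\<lambda>t. vabs (x t) - vabs (s t)) \<longlonglongrightarrow> 0"
      by (rule Lim_null_comparison[rotated]) (auto simp: vabs_abs_diff)
    from tendsto_add[OF this r] show ?thesis by simp
  qed
  have "padic_norm p (cls s) = r"
    unfolding padic_norm_def
  proof (rule the_equality)
    show "\<forall>x\<in>cls s. (\<lambda>t. vabs (x t)) \<longlonglongrightarrow> r" using all by blast
    fix r' assume "\<forall>x\<in>cls s. (\<lambda>t. vabs (x t)) \<longlonglongrightarrow> r'"
    then show "r' = r" using LIMSEQ_unique[OF _ r] cls_self[OF s] by blast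
  qed
  then show ?thesis using r by simp
qed

lemma padic_norm_le_1_iff:
  assumes s: "s \<in> cauchy"
  shows "padic_norm p (cls s) \<le> 1 \<longleftrightarrow> (\<forall>\<^sub>F t in sequentially. vabs (s t) \<le> 1)"
proof
  assume "padic_norm p (cls s) \<le> 1"
  then have "padic_norm p (cls s) < real p" using p_gt_1 by simp
  then have "\<forall>\<^sub>F t in sequentially. vabs (s t) < real p" using order_tendstoD(2)[OF padic_norm_cls[OF s]] by blast
  then show "\<forall>\<^sub>F t in sequentially. vabs (s t) \<le> 1" by (rule eventually_mono) (rule vabs_less_p_imp_le_1)
next
  assume "\<forall>\<^sub>F t in sequentially. vabs (s t) \<le> 1"
  then show "padic_norm p (cls s) \<le> 1" by (rule tendsto_upperbound[OF padic_norm_cls[OF s]]) simp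
qed

lemma cauchy_sum: "(\<And>k. k \<in> A \<Longrightarrow> s k \<in> cauchy) \<Longrightarrow> (\<lambda>t. \<Sum>k\<in>A. s k t) \<in> cauchy"
  by (induction A rule: infinite_finite_induct) (auto intro: cauchy_add cauchy_const)

definition integral_seqs where "integral_seqs = {s \<in> cauchy. \<forall>\<^sub>F t in sequentially. vabs (s t) \<le> 1}"

lemma carrier_Zp: "carrier (Zp p) = cls ` integral_seqs"
  using padic_norm_le_1_iff by (auto simp: Zp_def carrier_Q integral_seqs_def)

lemma Zp_simps [simp]: "monoid.mult (Zp p) = monoid.mult Q" "one (Zp p) = one Q"
   "ring.zero (Zp p) = ring.zero Q" "add (Zp p) = add Q"
  by (simp_all add: Zp_def)

lemma integral_add:
  assumes "s \<in> integral_seqs" "r \<in> integral_seqs" shows "(\<lambda>t. s t + r t) \<in> integral_seqs"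
proof -
  have "\<forall>\<^sub>F t in sequentially. vabs (s t) \<le> 1 \<and> vabs (r t) \<le> 1"
    using assms by (simp add: integral_seqs_def eventually_conj)
  then have "\<forall>\<^sub>F t in sequentially. vabs (s t + r t) \<le> 1" by (rule eventually_mono) (simp add: vabs_add_le)
  then show ?thesis using assms cauchy_add by (simp add: integral_seqs_def)
qed

lemma integral_mult:
  assumes "s \<in> integral_seqs" "r \<in> integral_seqs" shows "(\<lambda>t. s t * r t) \<in> integral_seqs"
proof -
  have "\<forall>\<^sub>F t in sequentially. vabs (s t) \<le> 1 \<and> vabs (r t) \<le> 1"
    using assms by (simp add: integral_seqs_def eventually_conj)
  then have "\<forall>\<^sub>F t in sequentially. vabs (s t * r t) \<le> 1"
    by (rule eventually_mono) (simp add: vabs_mult mult_le_one)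
  then show ?thesis using assms cauchy_mult by (simp add: integral_seqs_def)
qed

lemma integral_of_int: "(\<lambda>t. of_int c) \<in> integral_seqs"
  unfolding integral_seqs_def using cauchy_const vabs_of_int_le_1 by auto

lemma integral_cauchy: "s \<in> integral_seqs \<Longrightarrow> s \<in> cauchy" by (simp add: integral_seqs_def)

lemma abelian_monoid_Zp: "abelian_monoid (Zp p)"
proof -
  interpret Q: cring Q by (rule ring_Q)
  have sub: "x \<in> carrier Q" if "x \<in> carrier (Zp p)" for x using that by (simp add: Zp_def)
  show ?thesis
  proof (rule abelian_monoidI)
    fix x y assume "x \<in> carrier (Zp p)" "y \<in> carrier (Zp p)"
    then obtain s r where "s \<in> integral_seqs" "x = cls s" "r \<in> integral_seqs" "y = cls r" by (auto simp: carrier_Zp)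
    then show "x \<oplus>\<^bsub>Zp p\<^esub> y \<in> carrier (Zp p)"
      using cls_add integral_cauchy integral_add by (simp add: carrier_Zp)
  next
    show "\<zero>\<^bsub>Zp p\<^esub> \<in> carrier (Zp p)" using integral_of_int[of 0] by (auto simp: carrier_Zp cls_zero)
  qed (use sub in \<open>simp_all add: Q.a_ac\<close>)
qed

lemma finsum_cls_Q:
  assumes "finite A" "\<And>k. k \<in> A \<Longrightarrow> s k \<in> cauchy"
  shows "(\<Oplus>\<^bsub>Q\<^esub>k\<in>A. cls (s k)) = cls (\<lambda>t. \<Sum>k\<in>A. s k t)"
proof -
  interpret Q: cring Q by (rule ring_Q)
  show ?thesis using assms
  proof (induction A)
    case empty then show ?case by (simp add: cls_zero)
  next
    case (insert a A)
    then show ?case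
      using cauchy_sum[of A s] by (subst Q.finsum_insert) (auto simp: cls_closed cls_add)
  qed
qed

lemma finsum_cls_Zp:
  assumes "finite A" "\<And>k. k \<in> A \<Longrightarrow> s k \<in> integral_seqs"
  shows "(\<Oplus>\<^bsub>Zp p\<^esub>k\<in>A. cls (s k)) = cls (\<lambda>t. \<Sum>k\<in>A. s k t)"
proof -
  interpret Z: abelian_monoid "Zp p" by (rule abelian_monoid_Zp)
  show ?thesis using assms
  proof (induction A)
    case empty then show ?case by (simp add: cls_zero)
  next
    case (insert a A)
    have "(\<lambda>t. \<Sum>k\<in>A. s k t) \<in> cauchy" "s a \<in> cauchy"
      using cauchy_sum[of A s] insert.prems integral_cauchy by auto
    then show ?case
      using insert by (subst Z.finsum_insert) (auto simp: carrier_Zp cls_add)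
  qed
qed

end

section \<open>Matrices of p-adic numbers\<close>

text \<open>Matrices are functions on pairs of indices, of which only the values below \<open>n\<close> matter; this allows the dimension to be a
variable.\<close>

definition mm :: "nat \<Rightarrow> (nat \<times> nat \<Rightarrow> 'a::comm_ring_1) \<Rightarrow> (nat \<times> nat \<Rightarrow> 'a) \<Rightarrow> nat \<times> nat \<Rightarrow> 'a" where
  "mm n A B = (\<lambda>(i, j). \<Sum>k<n. A (i, k) * B (k, j))"

definition idm :: "nat \<times> nat \<Rightarrow> 'a::comm_ring_1" where
  "idm = (\<lambda>(i, j). if i = j then 1 else 0)"

primrec mpow :: "nat \<Rightarrow> (nat \<times> nat \<Rightarrow> 'a::comm_ring_1) \<Rightarrow> nat \<Rightarrow> nat \<times> nat \<Rightarrow> 'a" where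
  "mpow n A 0 = idm"
| "mpow n A (Suc k) = mm n (mpow n A k) A"

lemma mm_idm_left: "i < n \<Longrightarrow> mm n idm A (i, j) = A (i, j)"
  by (simp add: mm_def idm_def if_distrib[of "\<lambda>x. x * _"] cong: if_cong)

lemma mm_idm_right: "j < n \<Longrightarrow> mm n A idm (i, j) = A (i, j)"
  by (simp add: mm_def idm_def if_distrib[of "\<lambda>x. _ * x"] eq_commute[of _ j] cong: if_cong)

lemma mm_cong:
  "(\<And>k. k < n \<Longrightarrow> A (i, k) = A' (i, k)) \<Longrightarrow> (\<And>k. k < n \<Longrightarrow> B (k, j) = B' (k, j)) \<Longrightarrow>
   mm n A B (i, j) = mm n A' B' (i, j)"
  by (simp add: mm_def)

lemma mm_assoc: "mm n (mm n A B) C = mm n A (mm n B C)"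
proof (rule ext, clarify)
  fix i j
  have "mm n (mm n A B) C (i, j) = (\<Sum>k<n. \<Sum>l<n. A (i, l) * B (l, k) * C (k, j))"
    by (simp add: mm_def sum_distrib_right)
  also have "\<dots> = (\<Sum>l<n. \<Sum>k<n. A (i, l) * B (l, k) * C (k, j))" by (rule sum.swap)
  also have "\<dots> = mm n A (mm n B C) (i, j)" by (simp add: mm_def sum_distrib_left mult.assoc)
  finally show "mm n (mm n A B) C (i, j) = mm n A (mm n B C) (i, j)" .
qed

lemma mpow_add: "i < n \<Longrightarrow> j < n \<Longrightarrow> mpow n A (r + s) (i, j) = mm n (mpow n A r) (mpow n A s) (i, j)"
proof (induction s arbitrary: j)
  case 0 then show ?case by (simp add: mm_idm_right)
next
  case (Suc s)
  have "mpow n A (r + Suc s) (i, j) = mm n (mpow n A (r + s)) A (i, j)" by simp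
  also have "\<dots> = mm n (mm n (mpow n A r) (mpow n A s)) A (i, j)"
    by (rule mm_cong) (use Suc in auto)
  finally show ?case by (simp add: mm_assoc)
qed

context padic begin

text \<open>In
\<open>(1 + E)\<^sup>k = 1 + k E + \<dots>\<close> the ultrametric inequality bounds the remainder by the square of the bound for \<open>E\<close>,
whatever the binomial coefficients are.\<close>

lemma mpow_near_identity:
  assumes A: "\<And>ij. ij \<in> mat_index n \<Longrightarrow> vabs (A ij - idm ij) \<le> e" and e: "e \<le> 1"
    and ij: "ij \<in> mat_index n"
  shows "vabs (mpow n A k ij - idm ij - of_nat k * (A ij - idm ij)) \<le> e * e"
    and "vabs (mpow n A k ij - idm ij) \<le> e"
proof -
  have e0: "0 \<le> e" using order_trans[OF vabs_nonneg A[OF ij]] .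
  have ee: "e * e \<le> e" using e e0 by (simp add: mult_left_le)
  have kB: "vabs (of_nat k * (A ij - idm ij)) \<le> e" if "ij \<in> mat_index n" for k ij
    using mult_mono[OF vabs_of_nat_le_1[of k] A[OF that]] by (simp add: vabs_mult)
  have 2: "vabs (mpow n A k ij - idm ij) \<le> e"
    if "vabs (mpow n A k ij - idm ij - of_nat k * (A ij - idm ij)) \<le> e * e" "ij \<in> mat_index n" for k ij
    using vabs_add_le[OF order_trans[OF that(1) ee] kB[OF that(2), of k]] by simp
  have 1: "vabs (mpow n A k ij - idm ij - of_nat k * (A ij - idm ij)) \<le> e * e" if "ij \<in> mat_index n" for ij
    using that
  proof (induction k arbitrary: ij)
    case 0 then show ?case using e0 by simp
  next
    case (Suc k)
    obtain i j where ij: "ij = (i, j)" "i < n" "j < n" using Suc.prems by auto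
    define P where "P = mpow n A k"
    have "mm n P A (i, j) = mm n P idm (i, j) + mm n idm (\<lambda>x. A x - idm x) (i, j) +
        (\<Sum>l<n. (P (i, l) - idm (i, l)) * (A (l, j) - idm (l, j)))"
      unfolding mm_def by (simp add: sum.distrib[symmetric] algebra_simps)
    also have "\<dots> = P (i, j) + (A (i, j) - idm (i, j)) +
        (\<Sum>l<n. (P (i, l) - idm (i, l)) * (A (l, j) - idm (l, j)))"
      using ij by (simp add: mm_idm_left mm_idm_right)
    finally have eq: "mpow n A (Suc k) ij - idm ij - of_nat (Suc k) * (A ij - idm ij) =
        (P ij - idm ij - of_nat k * (A ij - idm ij)) +
        (\<Sum>l<n. (P (i, l) - idm (i, l)) * (A (l, j) - idm (l, j)))"
      by (simp add: P_def ij(1) algebra_simps)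
    have "vabs (\<Sum>l<n. (P (i, l) - idm (i, l)) * (A (l, j) - idm (l, j))) \<le> e * e"
    proof (rule vabs_sum_le)
      fix l assume "l \<in> {..<n}"
      then have l: "(i, l) \<in> mat_index n" "(l, j) \<in> mat_index n" using ij by auto
      show "vabs ((P (i, l) - idm (i, l)) * (A (l, j) - idm (l, j))) \<le> e * e"
        unfolding vabs_mult P_def using 2[OF Suc.IH[OF l(1)] l(1)] A[OF l(2)] e0 by (intro mult_mono) auto
    qed (use e0 in simp)
    then show ?case unfolding eq using Suc.IH[OF Suc.prems] by (intro vabs_add_le) (simp_all add: P_def)
  qed
  show "vabs (mpow n A k ij - idm ij - of_nat k * (A ij - idm ij)) \<le> e * e" by (rule 1[OF ij])
  then show "vabs (mpow n A k ij - idm ij) \<le> e" by (rule 2[OF _ ij])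
qed

definition matcls :: "nat \<Rightarrow> (nat \<times> nat \<Rightarrow> nat \<Rightarrow> rat) \<Rightarrow> nat \<times> nat \<Rightarrow> padic" where
  "matcls n M = (\<lambda>ij\<in>mat_index n. cls (M ij))"

text \<open>A matrix over \<open>\<rat>\<^sub>p\<close> is represented by an entrywise Cauchy sequence of rational matrices, and \<open>matcls\<close> takes
the classes of its entries.\<close>

definition cauchy_matrix :: "nat \<Rightarrow> (nat \<times> nat \<Rightarrow> nat \<Rightarrow> rat) \<Rightarrow> bool" where
  "cauchy_matrix n M \<longleftrightarrow> (\<forall>ij\<in>mat_index n. M ij \<in> cauchy)"

definition seqmm :: "nat \<Rightarrow> (nat \<times> nat \<Rightarrow> nat \<Rightarrow> rat) \<Rightarrow> (nat \<times> nat \<Rightarrow> nat \<Rightarrow> rat) \<Rightarrow> nat \<times> nat \<Rightarrow> nat \<Rightarrow> rat" where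
  "seqmm n M N = (\<lambda>ij t. mm n (\<lambda>x. M x t) (\<lambda>x. N x t) ij)"

lemma cauchy_matrix_mm: "cauchy_matrix n M \<Longrightarrow> cauchy_matrix n N \<Longrightarrow> cauchy_matrix n (seqmm n M N)"
  by (auto simp: cauchy_matrix_def seqmm_def mm_def intro!: cauchy_sum cauchy_mult)

lemma cauchy_matrix_id: "cauchy_matrix n (\<lambda>ij t. idm ij)"
  by (simp add: cauchy_matrix_def cauchy_const)

lemma matcls_mult:
  assumes "cauchy_matrix n M" "cauchy_matrix n N"
  shows "matcls n M \<otimes>\<^bsub>mat_monoid Q n\<^esub> matcls n N = matcls n (seqmm n M N)"
proof -
  have "(\<Oplus>\<^bsub>Q\<^esub>k\<in>{..<n}. matcls n M (i, k) \<otimes>\<^bsub>Q\<^esub> matcls n N (k, j)) = cls (seqmm n M N (i, j))"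
    if ij: "i < n" "j < n" for i j
  proof -
    have "(\<Oplus>\<^bsub>Q\<^esub>k\<in>{..<n}. matcls n M (i, k) \<otimes>\<^bsub>Q\<^esub> matcls n N (k, j)) =
        (\<Oplus>\<^bsub>Q\<^esub>k\<in>{..<n}. cls (\<lambda>t. M (i, k) t * N (k, j) t))"
    proof -
      interpret Q: cring Q by (rule ring_Q)
      show ?thesis
        by (rule Q.finsum_cong') (use assms ij in \<open>auto simp: matcls_def cauchy_matrix_def cls_mult intro!: cls_closed cauchy_mult\<close>)
    qed
    also have "\<dots> = cls (seqmm n M N (i, j))"
      using finsum_cls_Q[of "{..<n}" "\<lambda>k t. M (i, k) t * N (k, j) t"] assms ij
      by (simp add: seqmm_def mm_def cauchy_matrix_def cauchy_mult)
    finally show ?thesis .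
  qed
  then show ?thesis by (auto simp: mat_monoid_def matcls_def fun_eq_iff)
qed

lemma matcls_mult_Zp:
  assumes "\<And>ij. ij \<in> mat_index n \<Longrightarrow> M ij \<in> integral_seqs" "\<And>ij. ij \<in> mat_index n \<Longrightarrow> N ij \<in> integral_seqs"
  shows "matcls n M \<otimes>\<^bsub>mat_monoid (Zp p) n\<^esub> matcls n N = matcls n (seqmm n M N)"
proof -
  have "(\<Oplus>\<^bsub>Zp p\<^esub>k\<in>{..<n}. matcls n M (i, k) \<otimes>\<^bsub>Q\<^esub> matcls n N (k, j)) = cls (seqmm n M N (i, j))"
    if ij: "i < n" "j < n" for i j
  proof -
    interpret Z: abelian_monoid "Zp p" by (rule abelian_monoid_Zp)
    have "(\<Oplus>\<^bsub>Zp p\<^esub>k\<in>{..<n}. matcls n M (i, k) \<otimes>\<^bsub>Q\<^esub> matcls n N (k, j)) =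
        (\<Oplus>\<^bsub>Zp p\<^esub>k\<in>{..<n}. cls (\<lambda>t. M (i, k) t * N (k, j) t))"
      by (rule Z.finsum_cong')
        (use assms ij in \<open>auto simp: matcls_def cls_mult integral_cauchy carrier_Zp integral_mult\<close>)
    also have "\<dots> = cls (seqmm n M N (i, j))"
      using finsum_cls_Zp[of "{..<n}" "\<lambda>k t. M (i, k) t * N (k, j) t"] assms ij
      by (simp add: seqmm_def mm_def integral_mult)
    finally show ?thesis .
  qed
  then show ?thesis by (auto simp: mat_monoid_def matcls_def fun_eq_iff)
qed

lemma matcls_one: "\<one>\<^bsub>mat_monoid Q n\<^esub> = matcls n (\<lambda>ij t. idm ij)"
  by (auto simp: mat_monoid_def matcls_def idm_def cls_one cls_zero fun_eq_iff)

lemma matcls_one_Zp: "\<one>\<^bsub>mat_monoid (Zp p) n\<^esub> = matcls n (\<lambda>ij t. idm ij)"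
  by (auto simp: mat_monoid_def matcls_def idm_def cls_one cls_zero fun_eq_iff)

lemma matcls_eq_iff:
  assumes "cauchy_matrix n M" "cauchy_matrix n N"
  shows "matcls n M = matcls n N \<longleftrightarrow> (\<forall>ij\<in>mat_index n. (\<lambda>t. M ij t - N ij t) \<in> null)"
proof -
  have "matcls n M = matcls n N \<longleftrightarrow> (\<forall>ij\<in>mat_index n. cls (M ij) = cls (N ij))"
    by (auto simp: matcls_def fun_eq_iff restrict_def)
  then show ?thesis using cls_eq_iff assms by (auto simp: cauchy_matrix_def)
qed

end

section \<open>Congruence subgroups of p-adic points\<close>

text \<open>That the points form a group is inherited from the product of these groups over all primes, which is a
profinite group by assumption.\<close>

locale padic_points = padic +
  fixes n :: nat and \<GG> :: "(nat \<times> nat \<Rightarrow> complex) set" and \<Gamma>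
  defines "\<Gamma> \<equiv> points_Zp n \<GG> p"
  assumes group_points: "group \<Gamma>"
begin

sublocale group \<Gamma> by (rule group_points)

lemma mult_\<Gamma>: "monoid.mult \<Gamma> = monoid.mult (mat_monoid Q n)" and one_\<Gamma>: "one \<Gamma> = one (mat_monoid Q n)"
  by (simp_all add: \<Gamma>_def points_Zp_def Let_def GL_def units_of_def)

lemma integral_rep:
  assumes "g \<in> carrier \<Gamma>"
  obtains M where "g = matcls n M" "\<And>ij. ij \<in> mat_index n \<Longrightarrow> M ij \<in> integral_seqs"
proof -
  have "g \<in> carrier (mat_monoid (Zp p) n)"
    using assms by (auto simp: \<Gamma>_def points_Zp_def Let_def GL_def units_of_def Units_def)
  then have g: "g \<in> (\<Pi>\<^sub>E ij\<in>mat_index n. cls ` integral_seqs)" by (simp add: mat_monoid_def carrier_Zp)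
  have "\<exists>s. s \<in> integral_seqs \<and> g ij = cls s" if "ij \<in> mat_index n" for ij
    using PiE_mem[OF g that] by blast
  then obtain M where M: "\<And>ij. ij \<in> mat_index n \<Longrightarrow> M ij \<in> integral_seqs \<and> g ij = cls (M ij)" by metis
  have "g = matcls n M"
    using g M by (auto simp: matcls_def fun_eq_iff PiE_iff extensional_def restrict_def)
  then show ?thesis using that M by blast
qed

lemma rep:
  assumes "g \<in> carrier \<Gamma>"
  obtains M where "g = matcls n M" "cauchy_matrix n M"
  using integral_rep[OF assms] integral_cauchy unfolding cauchy_matrix_def by metis

lemma matcls_pow:
  assumes "cauchy_matrix n M"
  shows "matcls n M [^]\<^bsub>\<Gamma>\<^esub> (k::nat) = matcls n (\<lambda>ij t. mpow n (\<lambda>x. M x t) k ij) \<and>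
     cauchy_matrix n (\<lambda>ij t. mpow n (\<lambda>x. M x t) k ij)"
proof (induction k)
  case 0 then show ?case using cauchy_matrix_id by (simp add: one_\<Gamma> matcls_one)
next
  case (Suc k)
  have "seqmm n (\<lambda>ij t. mpow n (\<lambda>x. M x t) k ij) M = (\<lambda>ij t. mpow n (\<lambda>x. M x t) (Suc k) ij)"
    by (simp add: seqmm_def)
  then show ?case using Suc assms matcls_mult[of n "\<lambda>ij t. mpow n (\<lambda>x. M x t) k ij" M]
      cauchy_matrix_mm[of n "\<lambda>ij t. mpow n (\<lambda>x. M x t) k ij" M]
    by (simp add: mult_\<Gamma>)
qed

text \<open>The congruence subgroups: the entries of \<open>g\<close> are within \<open>e\<close> of those of the identity matrix. Using one
representative that is eventually close avoids the norm on \<open>\<rat>\<^sub>p\<close>.\<close>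

definition small :: "real \<Rightarrow> (nat \<times> nat \<Rightarrow> padic) \<Rightarrow> bool" where
  "small e g \<longleftrightarrow> (\<exists>M. g = matcls n M \<and> cauchy_matrix n M \<and>
     (\<forall>\<^sub>F t in sequentially. \<forall>ij\<in>mat_index n. vabs (M ij t - idm ij) \<le> e))"

lemma smallI:
  "g = matcls n M \<Longrightarrow> cauchy_matrix n M \<Longrightarrow>
   \<forall>\<^sub>F t in sequentially. \<forall>ij\<in>mat_index n. vabs (M ij t - idm ij) \<le> e \<Longrightarrow> small e g"
  unfolding small_def by (intro exI[of _ M] conjI)

lemma smallE:
  assumes "small e g"
  obtains M where "g = matcls n M" "cauchy_matrix n M"
    "\<forall>\<^sub>F t in sequentially. \<forall>ij\<in>mat_index n. vabs (M ij t - idm ij) \<le> e"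
  using assms unfolding small_def by (elim exE conjE)

lemma eventually_index:
  "(\<forall>ij\<in>mat_index n. \<forall>\<^sub>F t in sequentially. P ij t) \<longleftrightarrow> (\<forall>\<^sub>F t in sequentially. \<forall>ij\<in>mat_index n. P ij t)"
  by (rule eventually_ball_finite_distrib[symmetric]) simp

lemma small_pow:
  assumes "small e g" "e \<le> 1" shows "small e (g [^]\<^bsub>\<Gamma>\<^esub> (k::nat))"
proof -
  obtain M where M: "g = matcls n M" "cauchy_matrix n M"
    "\<forall>\<^sub>F t in sequentially. \<forall>ij\<in>mat_index n. vabs (M ij t - idm ij) \<le> e"
    using assms(1) by (rule smallE)
  have "\<forall>\<^sub>F t in sequentially. \<forall>ij\<in>mat_index n. vabs (mpow n (\<lambda>x. M x t) k ij - idm ij) \<le> e"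
    using M(3)
  proof (rule eventually_mono, intro ballI)
    fix t ij assume "\<forall>ij\<in>mat_index n. vabs (M ij t - idm ij) \<le> e" and ij: "ij \<in> mat_index n"
    then show "vabs (mpow n (\<lambda>x. M x t) k ij - idm ij) \<le> e"
      by (intro mpow_near_identity(2)[OF _ assms(2) ij]) (rule bspec)
  qed
  then show ?thesis
    by (rule smallI[rotated 2]) (use matcls_pow[OF M(2)] M(1) in simp_all)
qed

text \<open>In \<open>(1 + E)\<^sup>p \<equiv> 1 + p E\<close> both the linear term and the quadratic error gain a factor \<open>1 / p\<close>.\<close>

lemma small_pow_p:
  assumes "small e g" "e \<le> 1 / real p" shows "small (e / real p) (g [^]\<^bsub>\<Gamma>\<^esub> p)"
proof -
  obtain M where M: "g = matcls n M" "cauchy_matrix n M"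
    "\<forall>\<^sub>F t in sequentially. \<forall>ij\<in>mat_index n. vabs (M ij t - idm ij) \<le> e"
    using assms(1) by (rule smallE)
  have "1 / real p \<le> 1" using p_gt_1 by simp
  then have e1: "e \<le> 1" using assms(2) by linarith
  have "\<forall>\<^sub>F t in sequentially. \<forall>ij\<in>mat_index n. vabs (mpow n (\<lambda>x. M x t) p ij - idm ij) \<le> e / real p"
    using M(3)
  proof (rule eventually_mono, intro ballI)
    fix t ij assume A: "\<forall>ij\<in>mat_index n. vabs (M ij t - idm ij) \<le> e" and ij: "ij \<in> mat_index n"
    have e0: "0 \<le> e" using order_trans[OF vabs_nonneg bspec[OF A ij]] .
    let ?A = "\<lambda>x. M x t"
    have "vabs (mpow n ?A p ij - idm ij - of_nat p * (M ij t - idm ij)) \<le> e * e"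
      by (rule mpow_near_identity(1)[OF _ e1 ij]) (rule bspec[OF A])
    also have "\<dots> \<le> e / real p" using mult_left_mono[OF assms(2) e0] by simp
    finally have 1: "vabs (mpow n ?A p ij - idm ij - of_nat p * (M ij t - idm ij)) \<le> e / real p" .
    have "vabs (of_nat p * (M ij t - idm ij)) = 1 / real p * vabs (M ij t - idm ij)"
      by (simp only: vabs_mult vabs_p)
    also have "\<dots> \<le> e / real p" using bspec[OF A ij] by (simp add: divide_right_mono)
    finally show "vabs (mpow n ?A p ij - idm ij) \<le> e / real p"
      using vabs_add_le[OF 1, of "of_nat p * (M ij t - idm ij)"] by simp
  qed
  then show ?thesis
    by (rule smallI[rotated 2]) (use matcls_pow[OF M(2)] M(1) in simp_all)
qed

lemma small_imp_one:
  assumes g: "g \<in> carrier \<Gamma>" and small: "\<And>e. e > 0 \<Longrightarrow> \<exists>e'\<le>e. small e' g"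
  shows "g = \<one>\<^bsub>\<Gamma>\<^esub>"
proof -
  obtain M where M: "g = matcls n M" "cauchy_matrix n M" using rep[OF g] .
  have "(\<lambda>t. M ij t - idm ij) \<in> null" if ij: "ij \<in> mat_index n" for ij
  proof (rule nullI)
    fix e :: real assume e: "e > 0"
    then obtain e' where e': "e' \<le> e / 2" "small e' g" using small[of "e / 2"] by auto
    obtain N where N: "g = matcls n N" "cauchy_matrix n N"
      "\<forall>\<^sub>F t in sequentially. \<forall>ij\<in>mat_index n. vabs (N ij t - idm ij) \<le> e'" using e'(2) by (rule smallE)
    have "(\<lambda>t. M ij t - N ij t) \<in> null" 
      using matcls_eq_iff[OF M(2) N(2)] M(1) N(1) ij by metis
    then have "\<forall>\<^sub>F t in sequentially. vabs (M ij t - N ij t) < e" using e by (rule nullD)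
    then have "\<forall>\<^sub>F t in sequentially. vabs (M ij t - N ij t) < e \<and> vabs (N ij t - idm ij) \<le> e'"
      by (rule eventually_conj) (use N(3) ij in \<open>auto elim: eventually_mono\<close>)
    then show "\<forall>\<^sub>F t in sequentially. vabs (M ij t - idm ij) < e"
    proof (rule eventually_mono)
      fix t assume "vabs (M ij t - N ij t) < e \<and> vabs (N ij t - idm ij) \<le> e'"
      then show "vabs (M ij t - idm ij) < e"
        using vabs_add[of "M ij t - N ij t" "N ij t - idm ij"] e e'(1) by (simp add: max_def split: if_splits)
    qed
  qed
  then show ?thesis using matcls_eq_iff[OF M(2) cauchy_matrix_id] M(1) by (simp add: one_\<Gamma> matcls_one)
qed

lemma vabs_prime_ge: "Factorial_Ring.prime r \<Longrightarrow> 1 / real p \<le> vabs (of_nat r)"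
  using vabs_p vabs_other_prime[of r] p_gt_1 by (cases "r = p") auto

text \<open>The power \<open>(1 + E)\<^sup>r\<close> is \<open>1 + r E\<close> up to an error of size \<open>\<bar>E\<bar>\<^sup>2\<close>, which is smaller than \<open>\<bar>r E\<bar>\<close> because
\<open>\<bar>r\<bar> \<ge> 1 / p > \<bar>E\<bar>\<close>. So \<open>(1 + E)\<^sup>r = 1\<close> forces \<open>E = 0\<close>. The exponent \<open>2\<close> is needed: \<open>-1\<close> is congruent to
\<open>1\<close> modulo \<open>2\<close>.\<close>

lemma small_prime_root:
  assumes g: "g \<in> carrier \<Gamma>" and sm: "small ((1 / real p) ^ 2) g" and r: "Factorial_Ring.prime r"
    and root: "g [^]\<^bsub>\<Gamma>\<^esub> (r::nat) = \<one>\<^bsub>\<Gamma>\<^esub>"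
  shows "g = \<one>\<^bsub>\<Gamma>\<^esub>"
proof -
  obtain M where M: "g = matcls n M" "cauchy_matrix n M"
    "\<forall>\<^sub>F t in sequentially. \<forall>ij\<in>mat_index n. vabs (M ij t - idm ij) \<le> (1 / real p) ^ 2"
    using sm by (rule smallE)
  have "matcls n (\<lambda>ij t. mpow n (\<lambda>x. M x t) r ij) = matcls n (\<lambda>ij t. idm ij)"
    using root matcls_pow[OF M(2), of r] M(1) by (simp add: one_\<Gamma> matcls_one)
  then have null: "\<forall>ij\<in>mat_index n. (\<lambda>t. mpow n (\<lambda>x. M x t) r ij - idm ij) \<in> null"
    using matcls_eq_iff[OF conjunct2[OF matcls_pow[OF M(2), of r]] cauchy_matrix_id] by blast
  have p2: "(1 / real p) ^ 2 < 1 / real p" "(1 / real p) ^ 2 \<le> 1"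
    using p_gt_1 power_strict_decreasing[of 1 2 "1 / real p"] by (simp_all add: power_le_one)
  have "(\<lambda>t. M ij t - idm ij) \<in> null" if ij: "ij \<in> mat_index n" for ij
  proof (rule nullI)
    fix e :: real assume e: "e > 0"
    then have "e / real p > 0" using p_gt_1 by simp
    then have "\<forall>\<^sub>F t in sequentially. \<forall>ij\<in>mat_index n. vabs (mpow n (\<lambda>x. M x t) r ij - idm ij) < e / real p"
      unfolding eventually_index[symmetric] by (intro ballI nullD[OF bspec[OF null]])
    then have "\<forall>\<^sub>F t in sequentially. (\<forall>ij\<in>mat_index n. vabs (mpow n (\<lambda>x. M x t) r ij - idm ij) < e / real p) \<and>
        (\<forall>ij\<in>mat_index n. vabs (M ij t - idm ij) \<le> (1 / real p) ^ 2)" using M(3) by (rule eventually_conj)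
    then show "\<forall>\<^sub>F t in sequentially. vabs (M ij t - idm ij) < e"
    proof (rule eventually_mono)
      fix t assume t: "(\<forall>ij\<in>mat_index n. vabs (mpow n (\<lambda>x. M x t) r ij - idm ij) < e / real p) \<and>
        (\<forall>ij\<in>mat_index n. vabs (M ij t - idm ij) \<le> (1 / real p) ^ 2)"
      define A where "A = (\<lambda>x. M x t)"
      define b where "b = (\<lambda>x. vabs (A x - idm x))"
      have "Max (b ` mat_index n) \<in> b ` mat_index n" using ij by (intro Max_in) auto
      then obtain x where x: "x \<in> mat_index n" "b x = Max (b ` mat_index n)" by auto
      have bx: "b y \<le> b x" if "y \<in> mat_index n" for y unfolding x(2) using that by (intro Max_ge) auto
      have bp: "b x \<le> (1 / real p) ^ 2" using t x(1) unfolding b_def A_def by blast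
      then have b1: "b x \<le> 1" using p2 by linarith
      have "b x < e"
      proof (cases "b x = 0")
        case False
        then have b0: "b x > 0" using vabs_nonneg[of "A x - idm x"] unfolding b_def by linarith
        have "vabs (mpow n A r x - idm x - of_nat r * (A x - idm x)) \<le> b x * b x"
          by (rule mpow_near_identity(1)[OF _ b1 x(1)]) (use bx in \<open>simp add: b_def\<close>)
        also have "\<dots> < vabs (of_nat r) * b x"
          using bp p2 vabs_prime_ge[OF r] b0 by (intro mult_strict_right_mono) linarith+
        also have "\<dots> = vabs (of_nat r * (A x - idm x))" by (simp add: vabs_mult b_def)
        finally have "vabs (of_nat r * (A x - idm x) + (mpow n A r x - idm x - of_nat r * (A x - idm x))) =
            vabs (of_nat r * (A x - idm x))" by (rule vabs_add_eq)
        then have "vabs (of_nat r) * b x = vabs (mpow n A r x - idm x)" by (simp add: vabs_mult b_def)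
        also have "\<dots> < e / real p" using t x(1) unfolding A_def by blast
        finally have "vabs (of_nat r) * b x < e / real p" .
        moreover have "1 / real p * b x \<le> vabs (of_nat r) * b x" using vabs_prime_ge[OF r] b0 by (intro mult_right_mono) auto
        ultimately have "b x / real p < e / real p" by simp
        then show ?thesis using p_gt_1 by (simp add: divide_less_cancel)
      qed (use e in simp)
      then show "vabs (M ij t - idm ij) < e" using bx[OF ij] by (simp add: b_def A_def)
    qed
  qed
  then show ?thesis using matcls_eq_iff[OF M(2) cauchy_matrix_id] M(1) by (simp add: one_\<Gamma> matcls_one)
qed

lemma small_torsion_free:
  assumes "g \<in> carrier \<Gamma>" "small ((1 / real p) ^ 2) g" "g [^]\<^bsub>\<Gamma>\<^esub> (m::nat) = \<one>\<^bsub>\<Gamma>\<^esub>" "m > 0"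
  shows "g = \<one>\<^bsub>\<Gamma>\<^esub>"
  using assms(3,4)
proof (induction m rule: less_induct)
  case (less m)
  show ?case
  proof (cases "m = 1")
    case True
    then show ?thesis using less.prems assms(1) by simp
  next
    case False
    then obtain r where r: "Factorial_Ring.prime r" "r dvd m" using prime_factor_nat by blast
    then obtain k where k: "m = r * k" by blast
    have r1: "1 < r" using r(1) by (rule prime_gt_1_nat)
    have p2: "(1 / real p) ^ 2 \<le> 1" using p_gt_1 by (simp add: power_le_one)
    have "(g [^]\<^bsub>\<Gamma>\<^esub> k) [^]\<^bsub>\<Gamma>\<^esub> r = \<one>\<^bsub>\<Gamma>\<^esub>" using less.prems(1) assms(1) by (simp add: nat_pow_pow k mult.commute)
    then have "g [^]\<^bsub>\<Gamma>\<^esub> k = \<one>\<^bsub>\<Gamma>\<^esub>"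
      using small_prime_root[OF _ small_pow[OF assms(2) p2] r(1)] assms(1) by simp
    moreover have "k < m" "k > 0" using k less.prems(2) r1 by auto
    ultimately show ?thesis using less.IH by blast
  qed
qed

text \<open>The matrix \<open>g\<close> is congruent to the integer matrix \<open>c\<close> modulo \<open>p\<^sup>e\<close>.\<close>

definition residue :: "nat \<Rightarrow> (nat \<times> nat \<Rightarrow> padic) \<Rightarrow> (nat \<times> nat \<Rightarrow> int) \<Rightarrow> bool" where
  "residue e g c \<longleftrightarrow> (\<exists>M. g = matcls n M \<and> cauchy_matrix n M \<and>
     (\<forall>\<^sub>F t in sequentially. \<forall>ij\<in>mat_index n. vabs (M ij t - of_int (c ij)) \<le> (1 / real p) ^ e))"

lemma residueE:
  assumes "residue e g c"
  obtains M where "g = matcls n M" "cauchy_matrix n M"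
    "\<forall>\<^sub>F t in sequentially. \<forall>ij\<in>mat_index n. vabs (M ij t - of_int (c ij)) \<le> (1 / real p) ^ e"
  using assms unfolding residue_def by (elim exE conjE)

abbreviation residue_set :: "nat \<Rightarrow> (nat \<times> nat \<Rightarrow> int) set" where
  "residue_set e \<equiv> (\<Pi>\<^sub>E ij\<in>mat_index n. {0..<int p ^ e})"

lemma finite_residue_set: "finite (residue_set e)"
  by (intro finite_PiE) auto

lemma residue_exists:
  assumes "g \<in> carrier \<Gamma>" shows "\<exists>c\<in>residue_set e. residue e g c"
proof -
  obtain M where M: "g = matcls n M" "\<And>ij. ij \<in> mat_index n \<Longrightarrow> M ij \<in> integral_seqs" using integral_rep[OF assms] by blast
  have "\<exists>c\<in>{0..<int p ^ e}. \<forall>\<^sub>F t in sequentially. vabs (M ij t - of_int c) \<le> (1 / real p) ^ e"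
    if ij: "ij \<in> mat_index n" for ij
  proof -
    have s: "M ij \<in> cauchy" "\<forall>\<^sub>F t in sequentially. vabs (M ij t) \<le> 1" using M(2)[OF ij] by (auto simp: integral_seqs_def)
    have "(1 / real p) ^ e > 0" using p_gt_1 by simp
    then obtain N where N: "\<And>m k. m \<ge> N \<Longrightarrow> k \<ge> N \<Longrightarrow> vabs (M ij m - M ij k) < (1 / real p) ^ e"
      using cauchyD[OF s(1)] by blast
    obtain N' where N': "\<And>m. m \<ge> N' \<Longrightarrow> vabs (M ij m) \<le> 1" using s(2) by (auto simp: eventually_sequentially)
    define K where "K = max N N'"
    obtain c where c: "c \<in> {0..<int p ^ e}" "vabs (M ij K - of_int c) \<le> (1 / real p) ^ e"
      using integer_approximation[OF N'[of K], of e] by (auto simp: K_def)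
    have "vabs (M ij t - of_int c) \<le> (1 / real p) ^ e" if "t \<ge> K" for t
      by (rule vabs_diff_trans[OF _ c(2)]) (use N[of t K] that in \<open>auto simp: K_def\<close>)
    then show ?thesis using c(1) unfolding eventually_sequentially by blast
  qed
  then obtain c where c: "\<And>ij. ij \<in> mat_index n \<Longrightarrow> c ij \<in> {0..<int p ^ e} \<and>
      (\<forall>\<^sub>F t in sequentially. vabs (M ij t - of_int (c ij)) \<le> (1 / real p) ^ e)" by metis
  have "residue e g (restrict c (mat_index n))"
    unfolding residue_def
  proof (intro exI[of _ M] conjI)
    show "cauchy_matrix n M" using M(2) integral_cauchy by (auto simp: cauchy_matrix_def)
    show "\<forall>\<^sub>F t in sequentially. \<forall>ij\<in>mat_index n.
        vabs (M ij t - of_int (restrict c (mat_index n) ij)) \<le> (1 / real p) ^ e"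
      unfolding eventually_index[symmetric] using c by simp
  qed (rule M(1))
  moreover have "restrict c (mat_index n) \<in> residue_set e" using c by auto
  ultimately show ?thesis by blast
qed

text \<open>Multiplying the congruence \<open>g \<equiv> h\<close> by the integral matrix \<open>g\<^sup>-\<^sup>1\<close> preserves it.\<close>

lemma residue_eq:
  assumes g: "g \<in> carrier \<Gamma>" and h: "h \<in> carrier \<Gamma>" and gc: "residue e g c" and hc: "residue e h c"
  shows "small ((1 / real p) ^ e) (inv\<^bsub>\<Gamma>\<^esub> g \<otimes>\<^bsub>\<Gamma>\<^esub> h)"
proof -
  define d where "d = (1 / real p) ^ e"
  have d0: "d > 0" using p_gt_1 by (simp add: d_def)
  obtain A where A: "g = matcls n A" "cauchy_matrix n A"
    "\<forall>\<^sub>F t in sequentially. \<forall>ij\<in>mat_index n. vabs (A ij t - of_int (c ij)) \<le> d"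
    using gc unfolding d_def by (rule residueE)
  obtain B where B: "h = matcls n B" "cauchy_matrix n B"
    "\<forall>\<^sub>F t in sequentially. \<forall>ij\<in>mat_index n. vabs (B ij t - of_int (c ij)) \<le> d"
    using hc unfolding d_def by (rule residueE)
  obtain N where N: "inv\<^bsub>\<Gamma>\<^esub> g = matcls n N" "\<And>ij. ij \<in> mat_index n \<Longrightarrow> N ij \<in> integral_seqs"
    using integral_rep[OF inv_closed[OF g]] by blast
  have Nc: "cauchy_matrix n N" using N(2) integral_cauchy by (auto simp: cauchy_matrix_def)
  have N1: "\<forall>\<^sub>F t in sequentially. \<forall>ij\<in>mat_index n. vabs (N ij t) \<le> 1"
    unfolding eventually_index[symmetric] using N(2) by (simp add: integral_seqs_def)
  have "matcls n (seqmm n N A) = matcls n (\<lambda>ij t. idm ij)"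
    using l_inv[OF g] matcls_mult[OF Nc A(2)] by (simp only: N(1) mult_\<Gamma> one_\<Gamma> matcls_one flip: A(1))
  then have nu: "\<forall>ij\<in>mat_index n. (\<lambda>t. seqmm n N A ij t - idm ij) \<in> null"
    by (rule iffD1[OF matcls_eq_iff[OF cauchy_matrix_mm[OF Nc A(2)] cauchy_matrix_id]])
  have I: "\<forall>\<^sub>F t in sequentially. \<forall>ij\<in>mat_index n. vabs (seqmm n N A ij t - idm ij) < d"
    unfolding eventually_index[symmetric] by (intro ballI nullD[OF bspec[OF nu] d0])
  have eq: "inv\<^bsub>\<Gamma>\<^esub> g \<otimes>\<^bsub>\<Gamma>\<^esub> h = matcls n (seqmm n N B)" using matcls_mult[OF Nc B(2)] by (simp only: N(1) mult_\<Gamma> flip: B(1))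
  have "\<forall>\<^sub>F t in sequentially. ((\<forall>ij\<in>mat_index n. vabs (A ij t - of_int (c ij)) \<le> d) \<and>
      (\<forall>ij\<in>mat_index n. vabs (B ij t - of_int (c ij)) \<le> d)) \<and>
      ((\<forall>ij\<in>mat_index n. vabs (N ij t) \<le> 1) \<and> (\<forall>ij\<in>mat_index n. vabs (seqmm n N A ij t - idm ij) < d))"
    by (intro eventually_conj A(3) B(3) N1 I)
  then have "\<forall>\<^sub>F t in sequentially. \<forall>ij\<in>mat_index n. vabs (seqmm n N B ij t - idm ij) \<le> d"
  proof (rule eventually_mono, intro ballI)
    fix t ij assume ij: "ij \<in> mat_index n"
    assume t: "((\<forall>ij\<in>mat_index n. vabs (A ij t - of_int (c ij)) \<le> d) \<and>
      (\<forall>ij\<in>mat_index n. vabs (B ij t - of_int (c ij)) \<le> d)) \<and>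
      ((\<forall>ij\<in>mat_index n. vabs (N ij t) \<le> 1) \<and> (\<forall>ij\<in>mat_index n. vabs (seqmm n N A ij t - idm ij) < d))"
    obtain i j where ij': "ij = (i, j)" "i < n" "j < n" using ij by auto
    have BA: "vabs (B x t - A x t) \<le> d" if "x \<in> mat_index n" for x
    proof (rule vabs_diff_trans)
      show "vabs (B x t - of_int (c x)) \<le> d" using t that by blast
      have "vabs (A x t - of_int (c x)) \<le> d" using t that by blast
      then show "vabs (of_int (c x) - A x t) \<le> d" by (simp only: vabs_diff_commute)
    qed
    have "seqmm n N B ij t - idm ij = (seqmm n N A ij t - idm ij) + (\<Sum>k<n. N (i, k) t * (B (k, j) t - A (k, j) t))"
      by (simp add: seqmm_def mm_def ij' right_diff_distrib sum_subtractf)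
    moreover have "vabs (\<Sum>k<n. N (i, k) t * (B (k, j) t - A (k, j) t)) \<le> d"
    proof (rule vabs_sum_le)
      fix k assume "k \<in> {..<n}"
      then have k: "(i, k) \<in> mat_index n" "(k, j) \<in> mat_index n" using ij' by auto
      have "vabs (N (i, k) t) * vabs (B (k, j) t - A (k, j) t) \<le> 1 * d"
      proof (rule mult_mono)
        show "vabs (N (i, k) t) \<le> 1" using t k(1) by blast
      qed (use BA[OF k(2)] in simp_all)
      then show "vabs (N (i, k) t * (B (k, j) t - A (k, j) t)) \<le> d" by (simp add: vabs_mult)
    qed (use d0 in simp)
    moreover have "vabs (seqmm n N A ij t - idm ij) < d" using t ij by blast
    then have "vabs (seqmm n N A ij t - idm ij) \<le> d" by (rule less_imp_le)
    ultimately show "vabs (seqmm n N B ij t - idm ij) \<le> d" using vabs_add_le by (simp only:)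
  qed
  then show ?thesis
    using smallI[OF eq cauchy_matrix_mm[OF Nc B(2)]] by (simp only: d_def)
qed

text \<open>Two commuting torsion elements with the same residue modulo \<open>p\<^sup>2\<close> have a torsion quotient in the torsion-free
congruence subgroup, so they are equal.\<close>

lemma commuting_torsion_finite:
  assumes T: "T \<subseteq> carrier \<Gamma>" and com: "\<And>x y. x \<in> T \<Longrightarrow> y \<in> T \<Longrightarrow> x \<otimes>\<^bsub>\<Gamma>\<^esub> y = y \<otimes>\<^bsub>\<Gamma>\<^esub> x"
    and tor: "\<And>x. x \<in> T \<Longrightarrow> \<exists>m>0. x [^]\<^bsub>\<Gamma>\<^esub> (m::nat) = \<one>\<^bsub>\<Gamma>\<^esub>"
  shows "finite T"
proof -
  have "\<forall>g\<in>T. \<exists>c. c \<in> residue_set 2 \<and> residue 2 g c" using residue_exists T by blast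
  then obtain c where c: "\<And>g. g \<in> T \<Longrightarrow> c g \<in> residue_set 2 \<and> residue 2 g (c g)" by metis
  have "inj_on c T"
  proof (rule inj_onI)
    fix g h assume gh: "g \<in> T" "h \<in> T" "c g = c h"
    have gc: "g \<in> carrier \<Gamma>" "h \<in> carrier \<Gamma>" using gh T by auto
    have "residue 2 h (c g)" using c[OF gh(2)] gh(3) by simp
    then have sm: "small ((1 / real p) ^ 2) (inv\<^bsub>\<Gamma>\<^esub> g \<otimes>\<^bsub>\<Gamma>\<^esub> h)"
      using residue_eq[OF gc] c[OF gh(1)] by blast
    obtain a b where ab: "a > 0" "g [^]\<^bsub>\<Gamma>\<^esub> (a::nat) = \<one>\<^bsub>\<Gamma>\<^esub>" "b > 0" "h [^]\<^bsub>\<Gamma>\<^esub> (b::nat) = \<one>\<^bsub>\<Gamma>\<^esub>" using tor gh by metis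
    have "inv\<^bsub>\<Gamma>\<^esub> g \<otimes>\<^bsub>\<Gamma>\<^esub> h = h \<otimes>\<^bsub>\<Gamma>\<^esub> inv\<^bsub>\<Gamma>\<^esub> g"
    proof -
      have "g \<otimes>\<^bsub>\<Gamma>\<^esub> (h \<otimes>\<^bsub>\<Gamma>\<^esub> inv\<^bsub>\<Gamma>\<^esub> g) = h" using com[OF gh(1,2)] gc by (simp add: m_assoc[symmetric]) (simp add: m_assoc)
      then show ?thesis using gc inv_solve_left[of "h \<otimes>\<^bsub>\<Gamma>\<^esub> inv\<^bsub>\<Gamma>\<^esub> g" g h] by simp
    qed
    then have "(inv\<^bsub>\<Gamma>\<^esub> g \<otimes>\<^bsub>\<Gamma>\<^esub> h) [^]\<^bsub>\<Gamma>\<^esub> (a * b) = inv\<^bsub>\<Gamma>\<^esub> g [^]\<^bsub>\<Gamma>\<^esub> (a * b) \<otimes>\<^bsub>\<Gamma>\<^esub> h [^]\<^bsub>\<Gamma>\<^esub> (a * b)"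
      using gc by (intro pow_mult_distrib) auto
    also have "\<dots> = \<one>\<^bsub>\<Gamma>\<^esub>"
    proof -
      have "g [^]\<^bsub>\<Gamma>\<^esub> (a * b) = \<one>\<^bsub>\<Gamma>\<^esub>" "h [^]\<^bsub>\<Gamma>\<^esub> (b * a) = \<one>\<^bsub>\<Gamma>\<^esub>"
        using ab(2,4) gc nat_pow_pow[of g a b, symmetric] nat_pow_pow[of h b a, symmetric] by (simp_all only: nat_pow_one)
      then show ?thesis using gc by (simp add: nat_pow_inv mult.commute[of b a])
    qed
    finally have "inv\<^bsub>\<Gamma>\<^esub> g \<otimes>\<^bsub>\<Gamma>\<^esub> h = \<one>\<^bsub>\<Gamma>\<^esub>"
      using small_torsion_free[OF _ sm, of "a * b"] ab gc by simp
    then have "h = g" using gc inv_solve_left[of "\<one>\<^bsub>\<Gamma>\<^esub>" g h] by simp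
    then show "g = h" by simp
  qed
  moreover have "finite (c ` T)" using c finite_residue_set by (meson finite_subset image_subsetI)
  ultimately show ?thesis using finite_imageD by blast
qed

text \<open>By the pigeonhole principle two of the powers of \<open>g\<close> with exponents up to the number \<open>K\<close> of residues coincide modulo
\<open>p\<close>; the factorial of \<open>K\<close> is an exponent that works for all \<open>g\<close>.\<close>

lemma power_small: "\<exists>M>0. \<forall>g\<in>carrier \<Gamma>. small (1 / real p) (g [^]\<^bsub>\<Gamma>\<^esub> (M::nat))"
proof -
  define K where "K = card (residue_set 1)"
  have "small (1 / real p) (g [^]\<^bsub>\<Gamma>\<^esub> (fact K :: nat))" if g: "g \<in> carrier \<Gamma>" for g
  proof -
    have "\<forall>k. \<exists>c. c \<in> residue_set 1 \<and> residue 1 (g [^]\<^bsub>\<Gamma>\<^esub> (k::nat)) c" using residue_exists[OF nat_pow_closed[OF g]] by blast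
    then obtain c where c: "\<And>k::nat. c k \<in> residue_set 1 \<and> residue 1 (g [^]\<^bsub>\<Gamma>\<^esub> k) (c k)" by metis
    have "c ` {..K} \<subseteq> residue_set 1" using c by blast
    then have "card (c ` {..K}) \<le> K" unfolding K_def by (rule card_mono[OF finite_residue_set])
    then have "\<not> inj_on c {..K}" using card_image[of c "{..K}"] by auto
    then obtain i j where ij: "i \<le> K" "j \<le> K" "i < j" "c i = c j"
      unfolding inj_on_def by (metis atMost_iff linorder_neqE_nat)
    have "residue 1 (g [^]\<^bsub>\<Gamma>\<^esub> j) (c i)" using c[of j] ij(4) by simp
    then have "small ((1 / real p) ^ 1) (inv\<^bsub>\<Gamma>\<^esub> (g [^]\<^bsub>\<Gamma>\<^esub> i) \<otimes>\<^bsub>\<Gamma>\<^esub> g [^]\<^bsub>\<Gamma>\<^esub> j)"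
      using residue_eq[OF nat_pow_closed[OF g] nat_pow_closed[OF g]] c[of i] by blast
    moreover have "g [^]\<^bsub>\<Gamma>\<^esub> j = g [^]\<^bsub>\<Gamma>\<^esub> i \<otimes>\<^bsub>\<Gamma>\<^esub> g [^]\<^bsub>\<Gamma>\<^esub> (j - i)" using g ij(3) by (simp add: nat_pow_mult)
    then have "inv\<^bsub>\<Gamma>\<^esub> (g [^]\<^bsub>\<Gamma>\<^esub> i) \<otimes>\<^bsub>\<Gamma>\<^esub> g [^]\<^bsub>\<Gamma>\<^esub> j = g [^]\<^bsub>\<Gamma>\<^esub> (j - i)"
      using g inv_solve_left[of "g [^]\<^bsub>\<Gamma>\<^esub> (j - i)" "g [^]\<^bsub>\<Gamma>\<^esub> i" "g [^]\<^bsub>\<Gamma>\<^esub> j"] by simp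
    ultimately have s: "small (1 / real p) (g [^]\<^bsub>\<Gamma>\<^esub> (j - i))" by simp
    have "(j - i) dvd (fact K :: nat)" using ij by (intro dvd_fact) auto
    then obtain l where l: "(fact K :: nat) = (j - i) * l" by blast
    have "1 / real p \<le> 1" using p_gt_1 by simp
    then show ?thesis using small_pow[OF s, of l] g by (simp add: l nat_pow_pow)
  qed
  then show ?thesis using fact_gt_zero by blast
qed

text \<open>If \<open>y = w\<^bsup>p^j\<^esup>\<close>, then \<open>y\<^sup>M = (w\<^sup>M)\<^bsup>p^j\<^esup>\<close> with \<open>w\<^sup>M\<close> congruent to \<open>1\<close> modulo \<open>p\<close>, so \<open>y\<^sup>M\<close> is congruent to \<open>1\<close>
modulo \<open>p\<^sup>j\<close>, for every \<open>j\<close>.\<close>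

lemma divisible_imp_torsion:
  assumes y: "y \<in> carrier \<Gamma>" and div: "\<And>j. \<exists>w\<in>carrier \<Gamma>. w [^]\<^bsub>\<Gamma>\<^esub> (p ^ j) = y"
  shows "\<exists>m>0. y [^]\<^bsub>\<Gamma>\<^esub> (m::nat) = \<one>\<^bsub>\<Gamma>\<^esub>"
proof -
  obtain M :: nat where M: "M > 0" "\<And>g. g \<in> carrier \<Gamma> \<Longrightarrow> small (1 / real p) (g [^]\<^bsub>\<Gamma>\<^esub> M)" using power_small by blast
  have sm: "small ((1 / real p) ^ Suc j) (g [^]\<^bsub>\<Gamma>\<^esub> (p ^ j))" if "small (1 / real p) g" "g \<in> carrier \<Gamma>" for g j
  proof (induction j)
    case 0 then show ?case using that by simp
  next
    case (Suc j)
    have "(1 / real p) ^ Suc j \<le> 1 / real p" using p_gt_1 by (simp add: power_le_one mult_left_le divide_le_cancel del: power_one_over)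
    from small_pow_p[OF Suc this] show ?case using that(2) by (simp add: nat_pow_pow mult.commute)
  qed
  have "y [^]\<^bsub>\<Gamma>\<^esub> M = \<one>\<^bsub>\<Gamma>\<^esub>"
  proof (rule small_imp_one)
    fix e :: real assume "e > 0"
    then obtain j where j: "(1 / real p) ^ j < e" using real_arch_pow_inv[of e "1 / real p"] p_gt_1 by auto
    obtain w where w: "w \<in> carrier \<Gamma>" "w [^]\<^bsub>\<Gamma>\<^esub> (p ^ j) = y" using div by blast
    have "small ((1 / real p) ^ Suc j) ((w [^]\<^bsub>\<Gamma>\<^esub> M) [^]\<^bsub>\<Gamma>\<^esub> (p ^ j))" using sm[OF M(2)[OF w(1)]] w by simp
    moreover have "(w [^]\<^bsub>\<Gamma>\<^esub> M) [^]\<^bsub>\<Gamma>\<^esub> (p ^ j) = y [^]\<^bsub>\<Gamma>\<^esub> M"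
      using w nat_pow_pow[OF w(1), of M "p ^ j"] nat_pow_pow[OF w(1), of "p ^ j" M] by (simp add: mult.commute)
    moreover have "(1 / real p) ^ Suc j \<le> (1 / real p) ^ j" using p_gt_1 by (intro power_decreasing) auto
    ultimately show "\<exists>e'\<le>e. small e' (y [^]\<^bsub>\<Gamma>\<^esub> M)" using j by (intro exI[of _ "(1 / real p) ^ Suc j"]) auto
  qed (use y in simp)
  then show ?thesis using M(1) by blast
qed

end

section \<open>Matrix exponentials over the p-adic numbers\<close>

text \<open>The matrix \<open>exp (a Y t)\<close> of formal power series in \<open>t\<close>. Keeping \<open>t\<close> formal lets the same object be evaluated
p-adically, over \<open>\<complex>\<close>, and through ring homomorphisms of the coefficients.\<close>

definition expm :: "nat \<Rightarrow> (nat \<times> nat \<Rightarrow> 'a::field_char_0) \<Rightarrow> 'a \<Rightarrow> nat \<times> nat \<Rightarrow> 'a fps" where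
  "expm n Y a = (\<lambda>ij. Abs_fps (\<lambda>k. a ^ k / fact k * mpow n Y k ij))"

lemma expm_nth [simp]: "expm n Y a ij $ k = a ^ k / fact k * mpow n Y k ij"
  by (simp add: expm_def)

lemma expm_0: "expm n Y 0 ij = fps_const (idm ij)"
  by (rule fps_ext) (auto simp: power_0_left)

lemma expm_add:
  assumes "i < n" "j < n"
  shows "mm n (expm n Y a) (expm n Y b) (i, j) = expm n Y (a + b) (i, j)"
proof (rule fps_ext)
  fix k
  have "mm n (expm n Y a) (expm n Y b) (i, j) $ k =
      (\<Sum>l<n. \<Sum>r=0..k. (a ^ r / fact r * mpow n Y r (i, l)) * (b ^ (k - r) / fact (k - r) * mpow n Y (k - r) (l, j)))"
    by (simp add: mm_def fps_sum_nth fps_mult_nth)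
  also have "\<dots> = (\<Sum>r=0..k. \<Sum>l<n. (a ^ r / fact r * mpow n Y r (i, l)) * (b ^ (k - r) / fact (k - r) * mpow n Y (k - r) (l, j)))"
    by (rule sum.swap)
  also have "\<dots> = (\<Sum>r=0..k. of_nat (k choose r) * a ^ r * b ^ (k - r) / fact k * mpow n Y k (i, j))"
  proof (rule sum.cong[OF refl])
    fix r assume r: "r \<in> {0..k}"
    have "(\<Sum>l<n. (a ^ r / fact r * mpow n Y r (i, l)) * (b ^ (k - r) / fact (k - r) * mpow n Y (k - r) (l, j))) =
        a ^ r / fact r * (b ^ (k - r) / fact (k - r)) * mm n (mpow n Y r) (mpow n Y (k - r)) (i, j)"
      by (simp add: mm_def sum_distrib_left mult_ac)
    also have "mm n (mpow n Y r) (mpow n Y (k - r)) (i, j) = mpow n Y k (i, j)"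
      using mpow_add[OF assms, of Y r "k - r"] r by simp
    also have "a ^ r / fact r * (b ^ (k - r) / fact (k - r)) = of_nat (k choose r) * a ^ r * b ^ (k - r) / fact k"
      using r by (simp add: binomial_fact field_simps)
    finally show "(\<Sum>l<n. (a ^ r / fact r * mpow n Y r (i, l)) * (b ^ (k - r) / fact (k - r) * mpow n Y (k - r) (l, j))) =
        of_nat (k choose r) * a ^ r * b ^ (k - r) / fact k * mpow n Y k (i, j)" .
  qed
  also have "\<dots> = (\<Sum>r\<le>k. of_nat (k choose r) * a ^ r * b ^ (k - r)) / fact k * mpow n Y k (i, j)"
    by (simp add: sum_distrib_right sum_divide_distrib atMost_atLeast0)
  also have "\<dots> = expm n Y (a + b) (i, j) $ k" by (simp add: binomial_ring)
  finally show "mm n (expm n Y a) (expm n Y b) (i, j) $ k = expm n Y (a + b) (i, j) $ k" .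
qed

lemma expm_deriv:
  assumes "i < n" "j < n"
  shows "fps_deriv (expm n Y 1 (i, j)) = (\<Sum>l<n. expm n Y 1 (i, l) * fps_const (Y (l, j)))"
  by (rule fps_ext) (simp add: fps_sum_nth mm_def sum_distrib_left sum_divide_distrib field_simps del: of_nat_Suc)

text \<open>Evaluation of polynomials in a commutative ring given by a type class; \<open>mpoly_eval_complex\<close> and \<open>evc_meval\<close> relate it
to evaluation in rings given by a carrier.\<close>

definition meval :: "('k::zero \<Rightarrow> 'b::comm_ring_1) \<Rightarrow> 'k mpoly \<Rightarrow> (nat \<times> nat \<Rightarrow> 'b) \<Rightarrow> 'b" where
  "meval c f x = (\<Sum>m\<in>Poly_Mapping.keys f. c (Poly_Mapping.lookup f m) *
      (\<Prod>v\<in>Poly_Mapping.keys m. x v ^ Poly_Mapping.lookup m v))"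

context padic begin

text \<open>A sufficient condition for convergence at \<open>1\<close> that is stable under sums and products.\<close>

definition pbounded :: "rat fps \<Rightarrow> bool" where
  "pbounded a \<longleftrightarrow> (\<exists>C\<ge>0. \<forall>k. vabs (a $ k) \<le> C / real p ^ k)"

definition evs :: "rat fps \<Rightarrow> nat \<Rightarrow> rat" where
  "evs a = (\<lambda>t. \<Sum>k\<le>t. a $ k)"

lemma pbounded_const: "pbounded (fps_const c)"
  unfolding pbounded_def by (rule exI[of _ "vabs c"]) auto

lemma pbounded_add: assumes "pbounded a" "pbounded b" shows "pbounded (a + b)"
proof -
  obtain C D where C: "C \<ge> 0" "\<And>k. vabs (a $ k) \<le> C / real p ^ k"
    and D: "D \<ge> 0" "\<And>k. vabs (b $ k) \<le> D / real p ^ k" using assms unfolding pbounded_def by blast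
  have "vabs ((a + b) $ k) \<le> max C D / real p ^ k" for k
  proof -
    have "C / real p ^ k \<le> max C D / real p ^ k" "D / real p ^ k \<le> max C D / real p ^ k"
      by (simp_all add: divide_right_mono)
    then show ?thesis using C(2)[of k] D(2)[of k] by (simp add: vabs_add_le)
  qed
  then show ?thesis unfolding pbounded_def using C(1) by (intro exI[of _ "max C D"]) auto
qed

lemma pbounded_mult: assumes "pbounded a" "pbounded b" shows "pbounded (a * b)"
proof -
  obtain C D where C: "C \<ge> 0" "\<And>k. vabs (a $ k) \<le> C / real p ^ k"
    and D: "D \<ge> 0" "\<And>k. vabs (b $ k) \<le> D / real p ^ k" using assms unfolding pbounded_def by blast
  have "vabs ((a * b) $ k) \<le> C * D / real p ^ k" for k
    unfolding fps_mult_nth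
  proof (rule vabs_sum_le)
    fix i assume i: "i \<in> {0..k}"
    have "vabs (a $ i) * vabs (b $ (k - i)) \<le> (C / real p ^ i) * (D / real p ^ (k - i))"
      using C D by (intro mult_mono) auto
    also have "\<dots> = C * D / real p ^ k" using i by (simp flip: power_add)
    finally show "vabs (a $ i * b $ (k - i)) \<le> C * D / real p ^ k" by (simp add: vabs_mult)
  qed (use C(1) D(1) in simp)
  then show ?thesis unfolding pbounded_def using C(1) D(1) by (intro exI[of _ "C * D"]) auto
qed

lemma pbounded_sum: "(\<And>x. x \<in> A \<Longrightarrow> pbounded (f x)) \<Longrightarrow> pbounded (sum f A)"
  by (induction A rule: infinite_finite_induct) (auto intro: pbounded_add simp: pbounded_const[of 0, simplified])

lemma pbounded_prod: "(\<And>x. x \<in> A \<Longrightarrow> pbounded (f x)) \<Longrightarrow> pbounded (prod f A)"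
  by (induction A rule: infinite_finite_induct) (auto intro: pbounded_mult simp: pbounded_const[of 1, simplified])

lemma pbounded_power: "pbounded a \<Longrightarrow> pbounded (a ^ k)"
  by (induction k) (auto intro: pbounded_mult simp: pbounded_const[of 1, simplified])

lemma geometric_null:
  assumes "e > 0" "C \<ge> 0" shows "\<exists>N. \<forall>t\<ge>N. C / real p ^ t < e"
proof -
  obtain N where N: "(1 / real p) ^ N < e / (C + 1)"
    using real_arch_pow_inv[of "e / (C + 1)" "1 / real p"] assms p_gt_1 by auto
  have "C / real p ^ t < e" if t: "t \<ge> N" for t
  proof -
    have "(1 / real p) ^ t \<le> (1 / real p) ^ N" using t p_gt_1 by (intro power_decreasing) auto
    then have "(C + 1) * (1 / real p) ^ t < (C + 1) * (e / (C + 1))"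
      using N assms(2) by (intro mult_strict_left_mono) auto
    moreover have "C * (1 / real p) ^ t \<le> (C + 1) * (1 / real p) ^ t" by (intro mult_right_mono) auto
    ultimately show ?thesis using assms(2) by (simp add: power_one_over)
  qed
  then show ?thesis by blast
qed

lemma evs_cauchy: assumes "pbounded a" shows "evs a \<in> cauchy"
  unfolding padic_cauchy_def mem_Collect_eq
proof (intro allI impI)
  fix e :: real assume e: "e > 0"
  obtain C where C: "C \<ge> 0" "\<And>k. vabs (a $ k) \<le> C / real p ^ k" using assms unfolding pbounded_def by blast
  obtain N where N: "\<And>t. t \<ge> N \<Longrightarrow> C / real p ^ t < e" using geometric_null[OF e C(1)] by blast
  have *: "vabs (evs a m - evs a k) \<le> C / real p ^ N" if mk: "N \<le> k" "k \<le> m" for m k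
  proof -
    have "{..m} = {..k} \<union> {k<..m}" using mk by auto
    moreover have "{..k} \<inter> {k<..m} = {}" by auto
    ultimately have "evs a m = evs a k + (\<Sum>i\<in>{k<..m}. a $ i)" unfolding evs_def by (simp add: sum.union_disjoint)
    then have "evs a m - evs a k = (\<Sum>i\<in>{k<..m}. a $ i)" by simp
    moreover have "vabs (\<Sum>i\<in>{k<..m}. a $ i) \<le> C / real p ^ N"
    proof (rule vabs_sum_le)
      fix i assume "i \<in> {k<..m}"
      then have "real p ^ N \<le> real p ^ i" using mk p_gt_1 by (intro power_increasing) auto
      then have "C / real p ^ i \<le> C / real p ^ N" using C(1) p_gt_1 by (intro divide_left_mono) auto
      then show "vabs (a $ i) \<le> C / real p ^ N" using C(2)[of i] by linarith
    qed (use C(1) in simp)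
    ultimately show ?thesis by simp
  qed
  have "vabs (evs a m - evs a k) < e" if "m \<ge> N" "k \<ge> N" for m k
    using *[of k m] *[of m k] that N[of N] vabs_diff_commute[of "evs a m" "evs a k"]
    by (cases "k \<le> m") auto
  then show "\<exists>N. \<forall>m\<ge>N. \<forall>n\<ge>N. vabs (evs a m - evs a n) < e" by blast
qed

lemma evs_const: "evs (fps_const c) = (\<lambda>t. c)"
  by (auto simp: evs_def sum.delta' if_distrib cong: if_cong)

lemma evs_add: "evs (a + b) = (\<lambda>t. evs a t + evs b t)"
  by (simp add: evs_def sum.distrib)

lemma evs_sum: "evs (sum f L) = (\<lambda>t. \<Sum>l\<in>L. evs (f l) t)"
  unfolding evs_def fps_sum_nth by (rule ext) (rule sum.swap)

lemma null_sum: "(\<And>l. l \<in> L \<Longrightarrow> s l \<in> null) \<Longrightarrow> (\<lambda>t. \<Sum>l\<in>L. s l t) \<in> null"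
  by (induction L rule: infinite_finite_induct) (auto intro: null_add simp: null_zero)

text \<open>The product of the partial sums and the partial sum of the product differ by terms \<open>a\<^sub>i b\<^sub>j\<close> with
\<open>i + j > t\<close>.\<close>

lemma evs_mult: assumes "pbounded a" "pbounded b" shows "(\<lambda>t. evs a t * evs b t - evs (a * b) t) \<in> null"
proof -
  obtain C D where C: "C \<ge> 0" "\<And>k. vabs (a $ k) \<le> C / real p ^ k"
    and D: "D \<ge> 0" "\<And>k. vabs (b $ k) \<le> D / real p ^ k" using assms unfolding pbounded_def by blast
  have bound: "vabs (evs a t * evs b t - evs (a * b) t) \<le> C * D / real p ^ t" for t
  proof -
    define R where "R = {..t} \<times> {..t} - {(i, j). i + j \<le> t}"
    have T: "{(i, j). i + j \<le> t} \<subseteq> {..t} \<times> {..t}" by auto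
    have "evs a t * evs b t = (\<Sum>(i, j)\<in>{..t} \<times> {..t}. a $ i * b $ j)"
      by (simp add: evs_def sum_product sum.cartesian_product)
    also have "\<dots> = (\<Sum>(i, j)\<in>R. a $ i * b $ j) + (\<Sum>(i, j)\<in>{(i, j). i + j \<le> t}. a $ i * b $ j)"
      unfolding R_def by (rule sum.subset_diff[OF T]) simp
    also have "(\<Sum>(i, j)\<in>{(i, j). i + j \<le> t}. a $ i * b $ j) = evs (a * b) t"
      unfolding sum.triangle_reindex_eq by (simp add: evs_def fps_mult_nth atMost_atLeast0)
    finally have "evs a t * evs b t - evs (a * b) t = (\<Sum>(i, j)\<in>R. a $ i * b $ j)" by simp
    also have "vabs \<dots> \<le> C * D / real p ^ t"
    proof (rule vabs_sum_le)
      fix x assume x: "x \<in> R"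
      obtain i j where ij: "x = (i, j)" by fastforce
      then have ijt: "t \<le> i + j" using x by (auto simp: R_def)
      have "vabs (a $ i) * vabs (b $ j) \<le> (C / real p ^ i) * (D / real p ^ j)"
        using C D by (intro mult_mono) auto
      also have "\<dots> = C * D / real p ^ (i + j)" by (simp add: power_add)
      also have "\<dots> \<le> C * D / real p ^ t"
        using ijt C(1) D(1) p_gt_1 by (intro divide_left_mono) (auto intro: power_increasing)
      finally show "vabs (case x of (i, j) \<Rightarrow> a $ i * b $ j) \<le> C * D / real p ^ t" by (simp add: ij vabs_mult)
    qed (use C(1) D(1) in simp)
    finally show ?thesis .
  qed
  show ?thesis
  proof (rule nullI)
    fix e :: real assume "e > 0"
    then obtain N where "\<forall>t\<ge>N. C * D / real p ^ t < e" using geometric_null C(1) D(1) by (metis mult_nonneg_nonneg)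
    then show "\<forall>\<^sub>F t in sequentially. vabs (evs a t * evs b t - evs (a * b) t) < e"
      unfolding eventually_sequentially using bound le_less_trans by blast
  qed
qed

text \<open>The value at \<open>1\<close> in \<open>\<rat>\<^sub>p\<close> of a \<open>pbounded\<close> series, represented by its partial sums \<open>evs\<close>.\<close>

definition evc :: "rat fps \<Rightarrow> padic" where "evc a = cls (evs a)"

lemma evc_closed: "pbounded a \<Longrightarrow> evc a \<in> carrier Q"
  by (simp add: evc_def cls_closed evs_cauchy)

lemma evc_mult: "pbounded a \<Longrightarrow> pbounded b \<Longrightarrow> evc a \<otimes>\<^bsub>Q\<^esub> evc b = evc (a * b)"
  unfolding evc_def
  by (simp add: cls_mult evs_cauchy cls_eq_iff cauchy_mult pbounded_mult evs_mult)

lemma evc_add: "pbounded a \<Longrightarrow> pbounded b \<Longrightarrow> evc a \<oplus>\<^bsub>Q\<^esub> evc b = evc (a + b)"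
  unfolding evc_def by (simp add: cls_add evs_cauchy evs_add)

lemma evc_const: "evc (fps_const c) = padic_of_rat p c"
  unfolding evc_def evs_const padic_of_rat_cls ..

lemma evc_0: "evc 0 = \<zero>\<^bsub>Q\<^esub>" and evc_1: "evc 1 = \<one>\<^bsub>Q\<^esub>"
  using evs_const[of 0] evs_const[of 1] by (simp_all add: evc_def cls_zero cls_one)

lemma evc_sum:
  assumes "finite A" "\<And>x. x \<in> A \<Longrightarrow> pbounded (f x)"
  shows "(\<Oplus>\<^bsub>Q\<^esub>x\<in>A. evc (f x)) = evc (sum f A)"
proof -
  interpret Q: cring Q by (rule ring_Q)
  show ?thesis using assms
  proof (induction A)
    case (insert a A)
    then show ?case using pbounded_sum[of A f]
      by (subst Q.finsum_insert) (auto simp: evc_closed evc_add)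
  qed (simp add: evc_0)
qed

lemma evc_prod:
  assumes "finite A" "\<And>x. x \<in> A \<Longrightarrow> pbounded (f x)"
  shows "(\<Otimes>\<^bsub>Q\<^esub>x\<in>A. evc (f x)) = evc (prod f A)"
proof -
  interpret Q: cring Q by (rule ring_Q)
  show ?thesis using assms
  proof (induction A)
    case (insert a A)
    then show ?case using pbounded_prod[of A f]
      by (subst Q.finprod_insert) (auto simp: evc_closed evc_mult)
  qed (simp add: evc_1)
qed

lemma evc_power: "pbounded a \<Longrightarrow> evc a [^]\<^bsub>Q\<^esub> (k::nat) = evc (a ^ k)"
  by (induction k) (simp_all add: evc_1 evc_mult pbounded_power mult.commute)

lemma evc_meval:
  assumes f: "f \<in> mpolys n" and E: "\<And>ij. ij \<in> mat_index n \<Longrightarrow> pbounded (E ij)"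
  shows "mpoly_eval Q (padic_of_rat p) f (\<lambda>ij\<in>mat_index n. evc (E ij)) = evc (meval fps_const f E)"
proof -
  interpret Q: cring Q by (rule ring_Q)
  let ?x = "\<lambda>ij\<in>mat_index n. evc (E ij)"
  have mon: "(\<Otimes>\<^bsub>Q\<^esub>v\<in>Poly_Mapping.keys m. ?x v [^]\<^bsub>Q\<^esub> Poly_Mapping.lookup m v) =
      evc (\<Prod>v\<in>Poly_Mapping.keys m. E v ^ Poly_Mapping.lookup m v)"
    and bd: "pbounded (\<Prod>v\<in>Poly_Mapping.keys m. E v ^ Poly_Mapping.lookup m v)"
    if m: "m \<in> Poly_Mapping.keys f" for m
  proof -
    have sub: "Poly_Mapping.keys m \<subseteq> mat_index n" using f m unfolding mpolys_def by blast
    have "(\<Otimes>\<^bsub>Q\<^esub>v\<in>Poly_Mapping.keys m. ?x v [^]\<^bsub>Q\<^esub> Poly_Mapping.lookup m v) =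
        (\<Otimes>\<^bsub>Q\<^esub>v\<in>Poly_Mapping.keys m. evc (E v ^ Poly_Mapping.lookup m v))"
    proof (rule Q.finprod_cong')
      fix v assume "v \<in> Poly_Mapping.keys m"
      then have "v \<in> mat_index n" using sub by blast
      then show "?x v [^]\<^bsub>Q\<^esub> Poly_Mapping.lookup m v = evc (E v ^ Poly_Mapping.lookup m v)"
        using evc_power[OF E] by simp
    qed (use E sub in \<open>auto intro!: evc_closed pbounded_power\<close>)
    also have "\<dots> = evc (\<Prod>v\<in>Poly_Mapping.keys m. E v ^ Poly_Mapping.lookup m v)"
      by (rule evc_prod) (use pbounded_power[OF E] sub in auto)
    finally show "(\<Otimes>\<^bsub>Q\<^esub>v\<in>Poly_Mapping.keys m. ?x v [^]\<^bsub>Q\<^esub> Poly_Mapping.lookup m v) =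
      evc (\<Prod>v\<in>Poly_Mapping.keys m. E v ^ Poly_Mapping.lookup m v)" .
    show "pbounded (\<Prod>v\<in>Poly_Mapping.keys m. E v ^ Poly_Mapping.lookup m v)"
      using pbounded_power[OF E] sub by (intro pbounded_prod) auto
  qed
  have "mpoly_eval Q (padic_of_rat p) f ?x = (\<Oplus>\<^bsub>Q\<^esub>m\<in>Poly_Mapping.keys f.
      evc (fps_const (Poly_Mapping.lookup f m) * (\<Prod>v\<in>Poly_Mapping.keys m. E v ^ Poly_Mapping.lookup m v)))"
    unfolding mpoly_eval_def
  proof (rule Q.finsum_cong')
    fix m assume m: "m \<in> Poly_Mapping.keys f"
    show "padic_of_rat p (Poly_Mapping.lookup f m) \<otimes>\<^bsub>Q\<^esub> (\<Otimes>\<^bsub>Q\<^esub>v\<in>Poly_Mapping.keys m. ?x v [^]\<^bsub>Q\<^esub> Poly_Mapping.lookup m v) =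
        evc (fps_const (Poly_Mapping.lookup f m) * (\<Prod>v\<in>Poly_Mapping.keys m. E v ^ Poly_Mapping.lookup m v))"
      unfolding mon[OF m] evc_const[symmetric] by (rule evc_mult[OF pbounded_const bd[OF m]])
  qed (auto intro!: evc_closed pbounded_mult pbounded_const bd)
  also have "\<dots> = evc (meval fps_const f E)"
    unfolding meval_def by (rule evc_sum) (auto intro!: pbounded_mult pbounded_const bd)
  finally show ?thesis .
qed

end

context padic_points begin

text \<open>The matrices \<open>U b = exp (b Y)\<close> for \<open>b\<close> in a small disc are integral points of the group, because the
equations vanish identically on the formal exponential and the inverse is \<open>U (- b)\<close>. They satisfy \<open>(U b)\<^sup>m = U (m b)\<close>.
The disc is closed under division by integers prime to \<open>p\<close>, which gives the roots of \<open>U (p\<^sup>K)\<close>.\<close>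

lemma divisible_point:
  fixes Y :: "nat \<times> nat \<Rightarrow> rat"
  assumes nz: "\<exists>ij\<in>mat_index n. Y ij \<noteq> 0"
    and van: "\<And>f a. f \<in> rational_ideal n \<GG> \<Longrightarrow> meval fps_const f (expm n Y a) = 0"
  shows "\<exists>u\<in>carrier \<Gamma>. (\<forall>m>0. u [^]\<^bsub>\<Gamma>\<^esub> (m::nat) \<noteq> \<one>\<^bsub>\<Gamma>\<^esub>) \<and>
     (\<forall>q. Factorial_Ring.prime q \<longrightarrow> q \<noteq> p \<longrightarrow> (\<forall>j. \<exists>v\<in>carrier \<Gamma>. v [^]\<^bsub>\<Gamma>\<^esub> (q ^ j) = u))"
proof -
  have p0: "real p > 0" using p_gt_1 by simp
  define B where "B = Max ((\<lambda>ij. vabs (Y ij)) ` mat_index n)"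
  have ne: "mat_index n \<noteq> {}" using nz by blast
  have "B \<in> (\<lambda>ij. vabs (Y ij)) ` mat_index n" unfolding B_def using ne by (intro Max_in) auto
  then obtain i0 where i0: "i0 \<in> mat_index n" "B = vabs (Y i0)" by blast
  have BY: "vabs (Y ij) \<le> B" if "ij \<in> mat_index n" for ij unfolding B_def using that by (intro Max_ge) auto
  obtain ij1 where "ij1 \<in> mat_index n" "Y ij1 \<noteq> 0" using nz by blast
  then have B0: "B > 0" using BY[of ij1] vabs_nonneg[of "Y ij1"] vabs_eq_0_iff[of "Y ij1"] by linarith
  have powB: "vabs (mpow n Y k ij) \<le> B ^ k" if "ij \<in> mat_index n" for k ij
    using that
  proof (induction k arbitrary: ij)
    case 0 then show ?case by (auto simp: idm_def)
  next
    case (Suc k)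
    obtain i j where ij: "ij = (i, j)" "i < n" "j < n" using Suc.prems by auto
    show ?case unfolding mpow.simps mm_def ij prod.case
    proof (rule vabs_sum_le)
      fix l assume "l \<in> {..<n}"
      then have l: "(i, l) \<in> mat_index n" "(l, j) \<in> mat_index n" using ij by auto
      show "vabs (mpow n Y k (i, l) * Y (l, j)) \<le> B ^ Suc k"
        using mult_mono[OF Suc.IH[OF l(1)] BY[OF l(2)]] B0 by (simp add: vabs_mult mult.commute)
    qed (use B0 in simp)
  qed
  \<comment> \<open>Of the factor \<open>p\<^sup>3 B\<close>, the part \<open>B\<close> compensates the growth of \<open>Y\<^sup>k\<close> and one power of \<open>p\<close> that of \<open>1 / k!\<close>;
    the other two leave \<open>exp (b Y)\<close> congruent to \<open>1\<close> modulo \<open>p\<^sup>2\<close>, where there is no torsion.\<close>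
  obtain K where K: "(1 / real p) ^ K < 1 / (real p ^ 3 * B)"
    using real_arch_pow_inv[of "1 / (real p ^ 3 * B)" "1 / real p"] p_gt_1 B0 by auto
  define \<rho> where "\<rho> = (1 / real p) ^ K"
  have \<rho>B: "\<rho> * B \<le> 1 / real p ^ 3"
  proof -
    have "\<rho> * B \<le> 1 / (real p ^ 3 * B) * B" using K B0 unfolding \<rho>_def by (intro mult_right_mono) auto
    then show ?thesis using B0 by simp
  qed
  have coeff: "vabs (expm n Y b ij $ k) \<le> (vabs b * B * real p) ^ k" if "ij \<in> mat_index n" for b ij k
  proof -
    have "vabs (expm n Y b ij $ k) = vabs b ^ k * vabs (inverse (fact k)) * vabs (mpow n Y k ij)"
      by (simp add: divide_inverse vabs_mult vabs_power)
    also have "\<dots> \<le> vabs b ^ k * real p ^ k * B ^ k"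
      using vabs_inverse_fact powB[OF that] B0 by (intro mult_mono) auto
    also have "\<dots> = (vabs b * B * real p) ^ k" by (simp add: power_mult_distrib mult_ac)
    finally show ?thesis .
  qed
  have small_b: "vabs b * B * real p \<le> 1 / real p ^ 2" if "vabs b \<le> \<rho>" for b
  proof -
    have "vabs b * B \<le> \<rho> * B" using that B0 by (intro mult_right_mono) auto
    then have "vabs b * B * real p \<le> 1 / real p ^ 3 * real p" using \<rho>B p0 by (intro mult_right_mono) auto
    then show ?thesis using p0 by (simp add: power2_eq_square power3_eq_cube)
  qed
  have coeff2: "vabs (expm n Y b ij $ k) \<le> (1 / real p ^ 2) ^ k" if "ij \<in> mat_index n" "vabs b \<le> \<rho>" for b ij k
  proof -
    have "(vabs b * B * real p) ^ k \<le> (1 / real p ^ 2) ^ k" using small_b[OF that(2)] B0 p0 by (intro power_mono) auto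
    then show ?thesis using coeff[OF that(1), of b k] by linarith
  qed
  have pb: "pbounded (expm n Y b ij)" if "ij \<in> mat_index n" "vabs b \<le> \<rho>" for b ij
    unfolding pbounded_def
  proof (intro exI[of _ 1] conjI allI)
    fix k
    have "1 / real p ^ 2 \<le> 1 / real p" using p_gt_1 by (simp add: power2_eq_square field_simps)
    then have "(1 / real p ^ 2) ^ k \<le> (1 / real p) ^ k" by (intro power_mono) auto
    then show "vabs (expm n Y b ij $ k) \<le> 1 / real p ^ k" using coeff2[OF that, of k] by (simp add: power_one_over)
  qed simp
  define M where "M = (\<lambda>b ij. evs (expm n Y b ij))"
  define U where "U = (\<lambda>b. matcls n (M b))"
  have near: "vabs (M b ij t - idm ij) \<le> (1 / real p) ^ 2" if ij: "ij \<in> mat_index n" and b: "vabs b \<le> \<rho>" for b ij t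
  proof -
    have "{..t} = insert 0 {0<..t}" by auto
    then have "M b ij t = idm ij + (\<Sum>k\<in>{0<..t}. expm n Y b ij $ k)" unfolding M_def evs_def by simp
    moreover have "vabs (\<Sum>k\<in>{0<..t}. expm n Y b ij $ k) \<le> (1 / real p) ^ 2"
    proof (rule vabs_sum_le)
      fix k assume "k \<in> {0<..t}"
      then have "(1 / real p ^ 2) ^ k \<le> (1 / real p ^ 2) ^ 1" using p_gt_1 by (intro power_decreasing) (auto simp: one_le_power)
      then show "vabs (expm n Y b ij $ k) \<le> (1 / real p) ^ 2" using coeff2[OF ij b, of k] by (simp add: power_one_over)
    qed simp
    ultimately show ?thesis by simp
  qed
  have cm: "cauchy_matrix n (M b)" if "vabs b \<le> \<rho>" for b
    unfolding cauchy_matrix_def M_def using pb[OF _ that] evs_cauchy by blast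
  have int: "M b ij \<in> integral_seqs" if "ij \<in> mat_index n" "vabs b \<le> \<rho>" for b ij
  proof -
    have "vabs (M b ij t) \<le> 1" for t
    proof -
      have "(1 / real p) ^ 2 \<le> 1" using p_gt_1 by (simp add: power_le_one)
      then have "vabs (M b ij t - idm ij) \<le> 1" using near[OF that, of t] by linarith
      then have "vabs (M b ij t - idm ij + idm ij) \<le> 1" by (rule vabs_add_le) (auto simp: idm_def split: prod.splits)
      then show ?thesis by simp
    qed
    then show ?thesis using cm[OF that(2)] that(1) by (auto simp: integral_seqs_def cauchy_matrix_def)
  qed
  have Uevc: "U b = (\<lambda>ij\<in>mat_index n. evc (expm n Y b ij))" for b
    by (simp add: U_def matcls_def M_def evc_def)
  have prod_seq: "matcls n (seqmm n (M b) (M c)) = U (b + c)" if b: "vabs b \<le> \<rho>" and c: "vabs c \<le> \<rho>" for b c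
  proof -
    have bc: "vabs (b + c) \<le> \<rho>" using vabs_add_le b c by blast
    have "(\<lambda>t. seqmm n (M b) (M c) ij t - M (b + c) ij t) \<in> null" if ij: "ij \<in> mat_index n" for ij
    proof -
      obtain i j where ij': "ij = (i, j)" "i < n" "j < n" using ij by auto
      have e: "expm n Y (b + c) ij = (\<Sum>l<n. expm n Y b (i, l) * expm n Y c (l, j))"
        using expm_add[OF ij'(2,3), of Y b c] by (simp add: ij' mm_def)
      have "(\<lambda>t. seqmm n (M b) (M c) ij t - M (b + c) ij t) =
          (\<lambda>t. \<Sum>l<n. evs (expm n Y b (i, l)) t * evs (expm n Y c (l, j)) t
            - evs (expm n Y b (i, l) * expm n Y c (l, j)) t)"
        unfolding M_def e evs_sum by (simp add: seqmm_def mm_def ij' sum_subtractf)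
      also have "\<dots> \<in> null"
        by (intro null_sum evs_mult pb b c) (use ij' in auto)
      finally show ?thesis .
    qed
    then show ?thesis unfolding U_def using matcls_eq_iff[OF cauchy_matrix_mm[OF cm[OF b] cm[OF c]] cm[OF bc]] by blast
  qed
  have UQ: "U b \<otimes>\<^bsub>mat_monoid Q n\<^esub> U c = U (b + c)" if "vabs b \<le> \<rho>" "vabs c \<le> \<rho>" for b c
    using matcls_mult[OF cm[OF that(1)] cm[OF that(2)]] prod_seq[OF that] by (simp add: U_def)
  have UZ: "U b \<otimes>\<^bsub>mat_monoid (Zp p) n\<^esub> U c = U (b + c)" if "vabs b \<le> \<rho>" "vabs c \<le> \<rho>" for b c
    using matcls_mult_Zp[OF int[OF _ that(1)] int[OF _ that(2)]] prod_seq[OF that] by (simp add: U_def)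
  have U0: "U 0 = matcls n (\<lambda>ij t. idm ij)" unfolding U_def M_def expm_0 evs_const ..
  have UcQ: "U b \<in> carrier (mat_monoid Q n)" if "vabs b \<le> \<rho>" for b
    using cm[OF that] by (auto simp: U_def matcls_def mat_monoid_def cauchy_matrix_def intro: cls_closed)
  have UcZ: "U b \<in> carrier (mat_monoid (Zp p) n)" if "vabs b \<le> \<rho>" for b
    using int[OF _ that] by (auto simp: U_def matcls_def mat_monoid_def carrier_Zp)
  have U\<Gamma>: "U b \<in> carrier \<Gamma>" if b: "vabs b \<le> \<rho>" for b
  proof -
    have b': "vabs (- b) \<le> \<rho>" using b by simp
    have "U b \<in> Units (mat_monoid Q n)"
      unfolding Units_def using UcQ[OF b] UcQ[OF b'] UQ[OF b b'] UQ[OF b' b] U0 matcls_one by auto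
    moreover have "U b \<in> Units (mat_monoid (Zp p) n)"
      unfolding Units_def using UcZ[OF b] UcZ[OF b'] UZ[OF b b'] UZ[OF b' b] U0 matcls_one_Zp by auto
    moreover have "mpoly_eval Q (padic_of_rat p) f (U b) = \<zero>\<^bsub>Q\<^esub>" if f: "f \<in> rational_ideal n \<GG>" for f
    proof -
      have "f \<in> mpolys n" using f by (simp add: rational_ideal_def)
      then have "mpoly_eval Q (padic_of_rat p) f (U b) = evc (meval fps_const f (expm n Y b))"
        unfolding Uevc using pb[OF _ b] by (intro evc_meval) auto
      then show ?thesis using van[OF f] evc_0 by simp
    qed
    ultimately show ?thesis
      by (simp add: \<Gamma>_def points_Zp_def Let_def points_Qp_def zeros_GL_def GL_def units_of_def)
  qed
  have Upow: "U b [^]\<^bsub>\<Gamma>\<^esub> (m::nat) = U (of_nat m * b)" if b: "vabs b \<le> \<rho>" for b m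
  proof (induction m)
    case 0 then show ?case using U0 by (simp add: one_\<Gamma> matcls_one)
  next
    case (Suc m)
    have "vabs (of_nat m * b) \<le> 1 * \<rho>" unfolding vabs_mult using vabs_of_nat_le_1 b by (intro mult_mono) auto
    then show ?case using Suc UQ[of "of_nat m * b" b] b by (simp add: mult_\<Gamma> algebra_simps)
  qed
  define b where "b = (of_nat p :: rat) ^ K"
  have b\<rho>: "vabs b = \<rho>" by (simp add: b_def \<rho>_def vabs_power vabs_p)
  have sm: "small ((1 / real p) ^ 2) (U b)"
    by (rule smallI[OF _ cm]) (use near b\<rho> in \<open>auto simp: U_def\<close>)
  \<comment> \<open>At the entry \<open>i0\<close>, where \<open>Y\<close> is largest, the linear term of the exponential dominates all later ones.\<close>
  have "U b \<noteq> \<one>\<^bsub>\<Gamma>\<^esub>"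
  proof
    assume "U b = \<one>\<^bsub>\<Gamma>\<^esub>"
    then have "matcls n (M b) = matcls n (\<lambda>ij t. idm ij)" by (simp add: one_\<Gamma> matcls_one U_def)
    then have nul: "(\<lambda>t. M b i0 t - idm i0) \<in> null" using matcls_eq_iff[OF cm cauchy_matrix_id] b\<rho> i0(1) by auto
    define e where "e = \<rho> * B"
    have e0: "e > 0" unfolding e_def \<rho>_def using B0 p0 by simp
    have "vabs (M b i0 t - idm i0) = e" if t: "t \<ge> 1" for t
    proof -
      have "{..t} = insert 0 (insert 1 {1<..t})" using t by auto
      then have eq: "M b i0 t - idm i0 = b * mpow n Y 1 i0 + (\<Sum>k\<in>{1<..t}. expm n Y b i0 $ k)"
        unfolding M_def evs_def by simp
      obtain i j where ij: "i0 = (i, j)" "i < n" "j < n" using i0(1) by auto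
      have "mpow n Y 1 i0 = Y i0" using mm_idm_left[of i n Y j] ij by simp
      then have first: "vabs (b * mpow n Y 1 i0) = e" by (simp add: vabs_mult b\<rho> e_def i0(2))
      have "vabs (\<Sum>k\<in>{1<..t}. expm n Y b i0 $ k) \<le> e / real p"
      proof (rule vabs_sum_le)
        fix k assume "k \<in> {1<..t}"
        then obtain l where k: "k = Suc (Suc l)" by (metis add_2_eq_Suc greaterThanAtMost_iff le_add_diff_inverse less_eq_Suc_le numeral_2_eq_2 One_nat_def)
        have ep: "e * real p \<le> 1 / real p ^ 2" using small_b[of b] b\<rho> by (simp add: e_def)
        have "1 / real p ^ 2 \<le> 1" using p_gt_1 by (simp add: one_le_power)
        then have "e * real p \<le> 1" using ep by linarith
        then have "(e * real p) ^ l \<le> 1" using e0 p0 by (intro power_le_one) auto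
        then have "(e * real p) * ((e * real p) * (e * real p) ^ l) \<le> (e * real p) * (1 / real p ^ 2 * 1)"
          using ep e0 p0 by (intro mult_left_mono mult_mono) auto
        also have "\<dots> = e / real p" using p0 by (simp add: power2_eq_square)
        finally have "(e * real p) ^ k \<le> e / real p" by (simp add: k)
        then show "vabs (expm n Y b i0 $ k) \<le> e / real p"
          using coeff[OF i0(1), of b k] unfolding b\<rho> e_def by linarith
      qed (use e0 p0 in simp)
      also have "\<dots> < e" using e0 p_gt_1 by (simp add: divide_less_eq)
      finally have "vabs (\<Sum>k\<in>{1<..t}. expm n Y b i0 $ k) < vabs (b * mpow n Y 1 i0)" unfolding first .
      then show ?thesis unfolding eq using vabs_add_eq first by simp
    qed
    moreover have "\<forall>\<^sub>F t in sequentially. vabs (M b i0 t - idm i0) < e" using nullD[OF nul e0] .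
    then have "\<forall>\<^sub>F t in sequentially. vabs (M b i0 t - idm i0) < e \<and> t \<ge> 1" by (rule eventually_conj) (rule eventually_ge_at_top)
    then obtain t where "vabs (M b i0 t - idm i0) < e" "t \<ge> 1" by (auto simp: eventually_sequentially)
    ultimately show False by fastforce
  qed
  then have inf: "\<forall>m>0. U b [^]\<^bsub>\<Gamma>\<^esub> (m::nat) \<noteq> \<one>\<^bsub>\<Gamma>\<^esub>"
    using small_torsion_free[OF U\<Gamma> sm] b\<rho> by auto
  have div: "\<exists>v\<in>carrier \<Gamma>. v [^]\<^bsub>\<Gamma>\<^esub> (q ^ j) = U b" if q: "Factorial_Ring.prime q" "q \<noteq> p" for q j
  proof
    have "vabs (of_nat (q ^ j)) = 1" using vabs_other_prime[OF q] by (simp add: vabs_power)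
    then have "vabs (b / of_nat (q ^ j)) = \<rho>" by (simp add: divide_inverse vabs_mult vabs_inverse b\<rho>)
    moreover have "of_nat (q ^ j) * (b / of_nat (q ^ j)) = b" using prime_gt_0_nat[OF q(1)] by simp
    ultimately show "U (b / of_nat (q ^ j)) [^]\<^bsub>\<Gamma>\<^esub> (q ^ j) = U b" using Upow[of "b / of_nat (q ^ j)" "q ^ j"] by simp
    show "U (b / of_nat (q ^ j)) \<in> carrier \<Gamma>" using U\<Gamma> \<open>vabs (b / of_nat (q ^ j)) = \<rho>\<close> by simp
  qed
  show ?thesis using U\<Gamma>[of b] b\<rho> inf div by (intro bexI[of _ "U b"]) auto
qed

end

section \<open>Embeddings of countable subrings of the complex numbers\<close>

text \<open>Homomorphisms between subrings of the two types, with the subring as an explicit set; the same notion serves for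
coefficients and for power series over them.\<close>

locale partial_hom =
  fixes S :: "'a::comm_ring_1 set" and h :: "'a \<Rightarrow> 'b::comm_ring_1"
  assumes zero [simp]: "0 \<in> S" "h 0 = 0" and one [simp]: "1 \<in> S" "h 1 = 1"
    and add: "x \<in> S \<Longrightarrow> y \<in> S \<Longrightarrow> x + y \<in> S \<and> h (x + y) = h x + h y"
    and mult: "x \<in> S \<Longrightarrow> y \<in> S \<Longrightarrow> x * y \<in> S \<and> h (x * y) = h x * h y"
begin

lemma sum: "(\<And>i. i \<in> A \<Longrightarrow> f i \<in> S) \<Longrightarrow> sum f A \<in> S \<and> h (sum f A) = (\<Sum>i\<in>A. h (f i))"
  by (induction A rule: infinite_finite_induct) (simp_all add: add)

lemma prod: "(\<And>i. i \<in> A \<Longrightarrow> f i \<in> S) \<Longrightarrow> prod f A \<in> S \<and> h (prod f A) = (\<Prod>i\<in>A. h (f i))"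
  by (induction A rule: infinite_finite_induct) (simp_all add: mult)

lemma power: "x \<in> S \<Longrightarrow> x ^ k \<in> S \<and> h (x ^ k) = h x ^ k"
  by (induction k) (simp_all add: mult)

lemma meval:
  assumes f: "f \<in> mpolys n" and c: "\<And>q. c q \<in> S" "\<And>q. h (c q) = d q"
    and x: "\<And>ij. ij \<in> mat_index n \<Longrightarrow> x ij \<in> S \<and> h (x ij) = y ij"
  shows "meval c f x \<in> S \<and> h (meval c f x) = meval d f y"
proof -
  have mon: "(\<Prod>v\<in>Poly_Mapping.keys m. x v ^ Poly_Mapping.lookup m v) \<in> S \<and>
      h (\<Prod>v\<in>Poly_Mapping.keys m. x v ^ Poly_Mapping.lookup m v) =
        (\<Prod>v\<in>Poly_Mapping.keys m. y v ^ Poly_Mapping.lookup m v)"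
    if m: "m \<in> Poly_Mapping.keys f" for m
  proof -
    have sub: "Poly_Mapping.keys m \<subseteq> mat_index n" using f m unfolding mpolys_def by blast
    have v: "x v ^ k \<in> S \<and> h (x v ^ k) = y v ^ k" if "v \<in> Poly_Mapping.keys m" for v k
      using power[of "x v" k] x[of v] that sub by auto
    show ?thesis using prod[of "Poly_Mapping.keys m" "\<lambda>v. x v ^ Poly_Mapping.lookup m v"] v by simp
  qed
  have t: "c q * (\<Prod>v\<in>Poly_Mapping.keys m. x v ^ Poly_Mapping.lookup m v) \<in> S \<and>
      h (c q * (\<Prod>v\<in>Poly_Mapping.keys m. x v ^ Poly_Mapping.lookup m v)) =
        d q * (\<Prod>v\<in>Poly_Mapping.keys m. y v ^ Poly_Mapping.lookup m v)"
    if "m \<in> Poly_Mapping.keys f" for m q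
    using mult[OF c(1)[of q] conjunct1[OF mon[OF that]]] mon[OF that] c(2)[of q] by simp
  show ?thesis unfolding meval_def
    using sum[of "Poly_Mapping.keys f" "\<lambda>m. c (Poly_Mapping.lookup f m) * (\<Prod>v\<in>Poly_Mapping.keys m. x v ^ Poly_Mapping.lookup m v)"] t
    by simp
qed

lemma mpow:
  assumes "\<And>ij. ij \<in> mat_index n \<Longrightarrow> x ij \<in> S \<and> h (x ij) = y ij" and "ij \<in> mat_index n"
  shows "mpow n x k ij \<in> S \<and> h (mpow n x k ij) = mpow n y k ij"
  using assms(2)
proof (induction k arbitrary: ij)
  case 0 then show ?case by (auto simp: idm_def)
next
  case (Suc k)
  obtain i j where ij: "ij = (i, j)" "i < n" "j < n" using Suc.prems by auto
  have "mpow n x k (i, l) * x (l, j) \<in> S \<and> h (mpow n x k (i, l) * x (l, j)) = mpow n y k (i, l) * y (l, j)" if "l < n" for l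
    using mult[of "mpow n x k (i, l)" "x (l, j)"] Suc.IH[of "(i, l)"] assms(1)[of "(l, j)"] that ij by simp
  then show ?case using sum[of "{..<n}" "\<lambda>l. mpow n x k (i, l) * x (l, j)"] by (simp add: ij mm_def)
qed

lemma fps: "partial_hom {a. \<forall>k. fps_nth a k \<in> S} (\<lambda>a. Abs_fps (\<lambda>k. h (fps_nth a k)))"
proof
  fix x y :: "'a fps" assume xy: "x \<in> {a. \<forall>k. fps_nth a k \<in> S}" "y \<in> {a. \<forall>k. fps_nth a k \<in> S}"
  then have c: "fps_nth x i \<in> S" "fps_nth y i \<in> S" for i by auto
  have m: "fps_nth x i * fps_nth y j \<in> S \<and> h (fps_nth x i * fps_nth y j) = h (fps_nth x i) * h (fps_nth y j)" for i j
    using mult[OF c] .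
  have k: "fps_nth (x * y) k \<in> S \<and> h (fps_nth (x * y) k) = (\<Sum>i=0..k. h (fps_nth x i) * h (fps_nth y (k - i)))" for k
    using sum[of "{0..k}" "\<lambda>i. fps_nth x i * fps_nth y (k - i)"] m by (simp add: fps_mult_nth)
  show "x * y \<in> {a. \<forall>k. fps_nth a k \<in> S} \<and> Abs_fps (\<lambda>k. h (fps_nth (x * y) k)) =
      Abs_fps (\<lambda>k. h (fps_nth x k)) * Abs_fps (\<lambda>k. h (fps_nth y k))"
    using k by (auto intro!: fps_ext simp: fps_mult_nth)
  show "x + y \<in> {a. \<forall>k. fps_nth a k \<in> S} \<and> Abs_fps (\<lambda>k. h (fps_nth (x + y) k)) =
      Abs_fps (\<lambda>k. h (fps_nth x k)) + Abs_fps (\<lambda>k. h (fps_nth y k))"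
    using add[OF c] by (auto intro!: fps_ext)
qed (auto intro!: fps_ext)

end

text \<open>Countability of the subring guarantees that complex numbers transcendental over its image remain available.\<close>

locale embedding = partial_hom R \<phi> for R :: "complex set" and \<phi> :: "complex \<Rightarrow> complex" +
  assumes countable: "countable R" and rat: "of_rat q \<in> R" "\<phi> (of_rat q) = of_rat q"
    and inj0: "x \<in> R \<Longrightarrow> \<phi> x = 0 \<Longrightarrow> x = 0"
begin

lemma uminus: assumes "x \<in> R" shows "- x \<in> R \<and> \<phi> (- x) = - \<phi> x"
proof -
  have "(-1::complex) \<in> R" "\<phi> (-1) = -1" using rat[of "-1"] by simp_all
  then show ?thesis using mult[of "-1" x] assms by simp
qed

definition PR :: "complex poly set" where "PR = {p. \<forall>i. Polynomial.coeff p i \<in> R}"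

definition lift :: "complex poly \<Rightarrow> complex poly" where "lift p = map_poly \<phi> p"

lemma coeff_lift: "Polynomial.coeff (lift p) i = \<phi> (Polynomial.coeff p i)"
  by (simp add: lift_def coeff_map_poly)

lemma PR_add: "p \<in> PR \<Longrightarrow> q \<in> PR \<Longrightarrow> p + q \<in> PR \<and> lift (p + q) = lift p + lift q"
  by (auto simp: PR_def coeff_lift add intro!: poly_eqI)

lemma PR_mult: "p \<in> PR \<Longrightarrow> q \<in> PR \<Longrightarrow> p * q \<in> PR \<and> lift (p * q) = lift p * lift q"
proof -
  assume pq: "p \<in> PR" "q \<in> PR"
  have "Polynomial.coeff (p * q) k \<in> R \<and> \<phi> (Polynomial.coeff (p * q) k) = (\<Sum>i\<le>k. \<phi> (Polynomial.coeff p i) * \<phi> (Polynomial.coeff q (k - i)))" for k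
    using sum[of "{..k}" "\<lambda>i. Polynomial.coeff p i * Polynomial.coeff q (k - i)"] mult pq by (simp add: coeff_mult PR_def)
  then show ?thesis by (auto simp: PR_def coeff_lift coeff_mult intro!: poly_eqI)
qed

lemma PR_monom: "c \<in> R \<Longrightarrow> Polynomial.monom c k \<in> PR \<and> lift (Polynomial.monom c k) = Polynomial.monom (\<phi> c) k"
  by (auto simp: PR_def coeff_lift intro!: poly_eqI)

lemma PR_const: "c \<in> R \<Longrightarrow> [:c:] \<in> PR \<and> lift [:c:] = [:\<phi> c:]"
  using PR_monom[of c 0] by (simp add: Polynomial.monom_0)

lemma PR_0: "0 \<in> PR" "lift 0 = 0" using PR_monom[of 0 0] by simp_all

lemma PR_uminus: "p \<in> PR \<Longrightarrow> - p \<in> PR \<and> lift (- p) = - lift p"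
  by (auto simp: PR_def coeff_lift uminus intro!: poly_eqI)

lemma PR_smult: "c \<in> R \<Longrightarrow> p \<in> PR \<Longrightarrow> Polynomial.smult c p \<in> PR \<and> lift (Polynomial.smult c p) = Polynomial.smult (\<phi> c) (lift p)"
  by (auto simp: PR_def coeff_lift mult intro!: poly_eqI)

lemma lift_eq_0: "p \<in> PR \<Longrightarrow> lift p = 0 \<Longrightarrow> p = 0"
  by (auto simp: PR_def poly_eq_iff coeff_lift inj0)

lemma degree_lift: "p \<in> PR \<Longrightarrow> Polynomial.degree (lift p) = Polynomial.degree p"
proof (rule antisym)
  assume p: "p \<in> PR"
  show "Polynomial.degree (lift p) \<le> Polynomial.degree p" unfolding lift_def by (rule map_poly_degree_leq) 
  show "Polynomial.degree p \<le> Polynomial.degree (lift p)"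
  proof (cases "p = 0")
    case False
    then have "Polynomial.coeff (lift p) (Polynomial.degree p) \<noteq> 0" 
      using inj0[of "Polynomial.lead_coeff p"] p by (auto simp: coeff_lift PR_def)
    then show ?thesis by (rule le_degree)
  qed simp
qed

lemma countable_PR: "countable PR"
proof -
  have "PR \<subseteq> Poly ` lists R"
  proof
    fix p assume "p \<in> PR"
    then have "coeffs p \<in> lists R" by (auto simp: PR_def coeffs_def)
    then show "p \<in> Poly ` lists R" using image_eqI[of p Poly "coeffs p"] by simp
  qed
  then show ?thesis using countable_subset countable_image[OF countable_lists[OF countable]] by metis
qed

text \<open>Division with remainder over a subring that need not be a field: \<open>p\<close> is first multiplied by a nonzero constant.\<close>

lemma pseudo_division:
  assumes m: "m \<in> PR" "m \<noteq> 0" and p: "p \<in> PR"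
  shows "\<exists>c q r. c \<in> R \<and> c \<noteq> 0 \<and> q \<in> PR \<and> r \<in> PR \<and> Polynomial.smult c p = m * q + r \<and> (r = 0 \<or> Polynomial.degree r < Polynomial.degree m)"
  using p
proof (induction "Polynomial.degree p" arbitrary: p rule: less_induct)
  case less
  show ?case
  proof (cases "p = 0 \<or> Polynomial.degree p < Polynomial.degree m")
    case True
    then show ?thesis using less.prems PR_0 by (intro exI[of _ 1] exI[of _ 0] exI[of _ p]) auto
  next
    case False
    define a where "a = Polynomial.lead_coeff m"
    define b where "b = Polynomial.lead_coeff p"
    define d where "d = Polynomial.degree p - Polynomial.degree m"
    have ab: "a \<in> R" "b \<in> R" "a \<noteq> 0" "b \<noteq> 0" using m less.prems False by (auto simp: PR_def a_def b_def)
    define p' where "p' = Polynomial.smult a p + - (Polynomial.monom b d * m)"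
    have bm: "Polynomial.monom b d \<in> PR" using PR_monom[OF ab(2)] by simp
    then have "- (Polynomial.monom b d * m) \<in> PR"
      using PR_mult[OF bm m(1)] PR_uminus[of "Polynomial.monom b d * m"] by simp
    then have p': "p' \<in> PR"
      unfolding p'_def using PR_add conjunct1[OF PR_smult[OF ab(1) less.prems]] by blast
    have small: "p' = 0 \<or> Polynomial.degree p' < Polynomial.degree p"
    proof (rule ccontr)
      assume "\<not> (p' = 0 \<or> Polynomial.degree p' < Polynomial.degree p)"
      then have ne: "p' \<noteq> 0" "Polynomial.degree p \<le> Polynomial.degree p'" by auto
      have "Polynomial.degree (Polynomial.monom b d * m) \<le> Polynomial.degree p"
        using Polynomial.degree_mult_le[of "Polynomial.monom b d" m] Polynomial.degree_monom_le[of b d] False by (auto simp: d_def)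
      then have le: "Polynomial.degree p' \<le> Polynomial.degree p"
        unfolding p'_def by (intro degree_add_le) (auto intro: order_trans[OF degree_smult_le])
      have "Polynomial.coeff p' (Polynomial.degree p) = a * b - b * a"
        using False by (simp add: p'_def coeff_monom_mult d_def a_def b_def)
      then have "Polynomial.coeff p' (Polynomial.degree p') = 0" using ne le by simp
      then show False using ne(1) by simp
    qed
    have "\<exists>c q r. c \<in> R \<and> c \<noteq> 0 \<and> q \<in> PR \<and> r \<in> PR \<and> Polynomial.smult c p' = m * q + r \<and> (r = 0 \<or> Polynomial.degree r < Polynomial.degree m)"
    proof (cases "p' = 0")
      case True
      then show ?thesis using PR_0 by (intro exI[of _ 1] exI[of _ 0]) auto
    next
      case False
      then show ?thesis using less.hyps[OF _ p'] small by blast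
    qed
    then obtain c q r where cqr: "c \<in> R" "c \<noteq> 0" "q \<in> PR" "r \<in> PR" "Polynomial.smult c p' = m * q + r" "r = 0 \<or> Polynomial.degree r < Polynomial.degree m"
      by blast
    have "Polynomial.smult (c * a) p = m * (q + Polynomial.smult c (Polynomial.monom b d)) + r"
      using cqr(5) by (simp add: p'_def smult_diff_right algebra_simps)
    moreover have "q + Polynomial.smult c (Polynomial.monom b d) \<in> PR" 
      using PR_add[OF cqr(3)] PR_smult[OF cqr(1) bm] by simp
    moreover have "c * a \<in> R" "c * a \<noteq> 0" using mult cqr ab by auto
    ultimately show ?thesis using cqr(4,6) by blast
  qed
qed

text \<open>The polynomial relations of \<open>c\<close> over \<open>R\<close> correspond to those of \<open>d\<close> over the image of \<open>R\<close>; this is the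
condition for extending \<open>\<phi>\<close> to \<open>R[c]\<close> by \<open>c \<mapsto> d\<close>.\<close>

definition conjugate :: "complex \<Rightarrow> complex \<Rightarrow> bool" where
  "conjugate c d \<longleftrightarrow> (\<forall>p\<in>PR. poly p c = 0 \<longleftrightarrow> poly (lift p) d = 0)"

text \<open>The value at \<open>p(c)\<close> is that of the image polynomial of \<open>p\<close> at \<open>d\<close>; conjugacy makes this well defined and
injective.\<close>

lemma extend:
  assumes cd: "conjugate c d"
  shows "\<exists>R' \<phi>'. embedding R' \<phi>' \<and> R \<subseteq> R' \<and> c \<in> R' \<and> \<phi>' c = d \<and> (\<forall>x\<in>R. \<phi>' x = \<phi> x)"
proof -
  define R' where "R' = (\<lambda>p. poly p c) ` PR"
  define \<phi>' where "\<phi>' = (\<lambda>x. poly (lift (SOME p. p \<in> PR \<and> poly p c = x)) d)"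
  have val: "\<phi>' (poly p c) = poly (lift p) d" if p: "p \<in> PR" for p
  proof -
    define q where "q = (SOME q. q \<in> PR \<and> poly q c = poly p c)"
    have q: "q \<in> PR \<and> poly q c = poly p c" unfolding q_def by (rule someI[of _ p]) (use p in simp)
    have "q + - p \<in> PR" "lift (q + - p) = lift q + - lift p" using PR_add[of q "- p"] PR_uminus[OF p] q by auto
    moreover have "poly (q + - p) c = 0" using q by simp
    ultimately have "poly (lift q + - lift p) d = 0" using cd unfolding conjugate_def by metis
    then show ?thesis by (simp add: \<phi>'_def q_def)
  qed
  have const: "x \<in> R' \<and> \<phi>' x = \<phi> x" if "x \<in> R" for x
    using val[of "[:x:]"] PR_const[OF that] unfolding R'_def by (auto intro!: image_eqI[of _ _ "[:x:]"])
  have "embedding R' \<phi>'"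
  proof
    show "0 \<in> R'" "\<phi>' 0 = 0" "1 \<in> R'" "\<phi>' 1 = 1" using const[of 0] const[of 1] by auto
    show "of_rat q \<in> R'" "\<phi>' (of_rat q) = of_rat q" for q using const[OF rat(1)] rat(2) by auto
    show "countable R'" unfolding R'_def using countable_PR by simp
    fix x y assume "x \<in> R'" "y \<in> R'"
    then obtain p q where pq: "p \<in> PR" "q \<in> PR" "x = poly p c" "y = poly q c" by (auto simp: R'_def)
    show "x + y \<in> R' \<and> \<phi>' (x + y) = \<phi>' x + \<phi>' y"
      using val[of "p + q"] val[of p] val[of q] PR_add[OF pq(1,2)] pq
      by (auto simp: R'_def intro!: image_eqI[of _ _ "p + q"])
    show "x * y \<in> R' \<and> \<phi>' (x * y) = \<phi>' x * \<phi>' y"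
      using val[of "p * q"] val[of p] val[of q] PR_mult[OF pq(1,2)] pq
      by (auto simp: R'_def intro!: image_eqI[of _ _ "p * q"])
  next
    fix x assume "x \<in> R'" "\<phi>' x = 0"
    then obtain p where p: "p \<in> PR" "x = poly p c" by (auto simp: R'_def)
    then have "poly (lift p) d = 0" using val \<open>\<phi>' x = 0\<close> by simp
    then show "x = 0" using cd p unfolding conjugate_def by blast
  qed
  moreover have "[:0, 1:] = Polynomial.monom (1::complex) 1" by (simp add: monom_altdef)
  then have "[:0, 1:] \<in> PR \<and> lift [:0, 1:] = [:0, 1:]" using PR_monom[of 1 1] by simp
  then have "c \<in> R' \<and> \<phi>' c = d" using val[of "[:0, 1:]"] by (auto simp: R'_def intro!: image_eqI[of _ _ "[:0, 1:]"])
  ultimately show ?thesis using const by blast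
qed

text \<open>The image polynomials have countably many roots altogether.\<close>

lemma conjugate_transcendental:
  assumes tr: "\<And>p. p \<in> PR \<Longrightarrow> poly p c = 0 \<Longrightarrow> p = 0" and C: "countable C"
  shows "\<exists>d. d \<notin> C \<and> conjugate c d"
proof -
  define Z where "Z = (\<Union>p\<in>PR - {0}. {z. poly (lift p) z = 0})"
  have "countable Z"
    unfolding Z_def
  proof (rule countable_UN)
    show "countable (PR - {0})" using countable_PR by simp
    fix p assume "p \<in> PR - {0}"
    then show "countable {z. poly (lift p) z = 0}"
      using lift_eq_0 by (intro countable_finite poly_roots_finite) auto
  qed
  then have "Z \<union> C \<noteq> UNIV" using C uncountable_UNIV_complex by (metis countable_Un)
  then obtain d where d: "d \<notin> Z" "d \<notin> C" by blast
  have "conjugate c d"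
    unfolding conjugate_def using d(1) tr PR_0(2) unfolding Z_def by fastforce
  then show ?thesis using d(2) by blast
qed

text \<open>One direction is division by \<open>m\<close>. For the other, a counterexample \<open>p\<close> of minimal degree has degree below that of \<open>m\<close> and
divides \<open>m\<close> up to a constant, which contradicts the minimality of \<open>m\<close> unless \<open>p\<close> is constant.\<close>

lemma conjugate_algebraic:
  assumes m: "m \<in> PR" "m \<noteq> 0" "poly m c = 0"
    and min: "\<And>p. p \<in> PR \<Longrightarrow> p \<noteq> 0 \<Longrightarrow> poly p c = 0 \<Longrightarrow> Polynomial.degree m \<le> Polynomial.degree p"
    and d: "poly (lift m) d = 0"
  shows "conjugate c d"
proof -
  have lifted: "\<phi> k * poly (lift p) d = poly (lift f) d * poly (lift q) d + poly (lift r) d"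
    if "k \<in> R" "p \<in> PR" "f \<in> PR" "q \<in> PR" "r \<in> PR" "Polynomial.smult k p = f * q + r" for k p f q r
  proof -
    have "lift (Polynomial.smult k p) = lift (f * q + r)" using that(6) by simp
    then have "Polynomial.smult (\<phi> k) (lift p) = lift f * lift q + lift r"
      using PR_smult[OF that(1,2)] PR_mult[OF that(3,4)] PR_add[of "f * q" r] that(5) by simp
    then show ?thesis by (metis poly_add poly_mult poly_smult)
  qed
  have unlifted: "k * poly p c = poly f c * poly q c + poly r c" if "Polynomial.smult k p = f * q + r" for k p f q r
    using arg_cong[OF that, of "\<lambda>p. poly p c"] by simp
  have 1: "poly (lift p) d = 0" if p: "p \<in> PR" "poly p c = 0" for p
  proof -
    obtain k q r where kqr: "k \<in> R" "k \<noteq> 0" "q \<in> PR" "r \<in> PR" "Polynomial.smult k p = m * q + r" "r = 0 \<or> Polynomial.degree r < Polynomial.degree m"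
      using pseudo_division[OF m(1,2) p(1)] by blast
    have "poly r c = 0" using unlifted[OF kqr(5)] m(3) p(2) by simp
    then have "r = 0" using min[OF kqr(4)] kqr(6) by (meson leD)
    then have "\<phi> k * poly (lift p) d = 0" using lifted[OF kqr(1) p(1) m(1) kqr(3,4,5)] d PR_0 by simp
    then show ?thesis using inj0 kqr(1,2) by auto
  qed
  have 2: "poly p c = 0" if "p \<in> PR" "poly (lift p) d = 0" for p
    using that
  proof (induction "Polynomial.degree p" arbitrary: p rule: less_induct)
    case less
    show ?case
    proof (rule ccontr)
      assume pc: "poly p c \<noteq> 0"
      then have p0: "p \<noteq> 0" by auto
      obtain k q r where kqr: "k \<in> R" "k \<noteq> 0" "q \<in> PR" "r \<in> PR" "Polynomial.smult k p = m * q + r" "r = 0 \<or> Polynomial.degree r < Polynomial.degree m"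
        using pseudo_division[OF m(1,2) less.prems(1)] by blast
      have rc: "poly r c \<noteq> 0" using unlifted[OF kqr(5)] m(3) pc kqr(2) by auto
      have "poly (lift r) d = 0" using lifted[OF kqr(1) less.prems(1) m(1) kqr(3,4,5)] d less.prems(2) by simp
      then have "Polynomial.degree p \<le> Polynomial.degree r" using less.hyps[OF _ kqr(4)] rc by (meson not_le)
      then have pm: "Polynomial.degree p < Polynomial.degree m" using kqr(6) rc by auto
      obtain k' q' r' where kqr': "k' \<in> R" "k' \<noteq> 0" "q' \<in> PR" "r' \<in> PR" "Polynomial.smult k' m = p * q' + r'" "r' = 0 \<or> Polynomial.degree r' < Polynomial.degree p"
        using pseudo_division[OF less.prems(1) p0 m(1)] by blast
      have "poly (lift r') d = 0" using lifted[OF kqr'(1) m(1) less.prems(1) kqr'(3,4,5)] d less.prems(2) by simp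
      then have "poly r' c = 0" using less.hyps[OF _ kqr'(4)] kqr'(6) by auto
      then have r'0: "r' = 0" using min[OF kqr'(4)] kqr'(6) pm by fastforce
      then have "poly q' c = 0" using unlifted[OF kqr'(5)] m(3) pc by simp
      moreover have eq: "Polynomial.smult k' m = p * q'" using kqr'(5) r'0 by simp
      then have q'0: "q' \<noteq> 0" using kqr'(2) m(2) by auto
      ultimately have "Polynomial.degree m \<le> Polynomial.degree q'" using min[OF kqr'(3)] by blast
      moreover have "Polynomial.degree m = Polynomial.degree p + Polynomial.degree q'"
        using arg_cong[OF eq, of Polynomial.degree] kqr'(2) p0 q'0 by (simp add: degree_mult_eq)
      ultimately have "Polynomial.degree p = 0" by simp
      then obtain a where a: "p = [:a:]" by (rule degree_eq_zeroE)
      then have aR: "a \<in> R" using less.prems(1) by (auto simp: PR_def coeff_pCons dest: spec[of _ 0])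
      then have "\<phi> a = 0" using less.prems(2) PR_const[of a] a by simp
      then show False using inj0[OF aR] p0 a by simp
    qed
  qed
  show ?thesis unfolding conjugate_def using 1 2 by blast
qed

lemma minimal_polynomial:
  assumes "p \<in> PR" "p \<noteq> 0" "poly p c = 0"
  obtains m where "m \<in> PR" "m \<noteq> 0" "poly m c = 0"
    "\<And>q. q \<in> PR \<Longrightarrow> q \<noteq> 0 \<Longrightarrow> poly q c = 0 \<Longrightarrow> Polynomial.degree m \<le> Polynomial.degree q"
  using that arg_min_nat_lemma[of "\<lambda>m. m \<in> PR \<and> m \<noteq> 0 \<and> poly m c = 0" p Polynomial.degree] assms by blast

lemma exists_conjugate: "\<exists>d. conjugate c d"
proof (cases "\<exists>p\<in>PR. p \<noteq> 0 \<and> poly p c = 0")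
  case False
  then show ?thesis using conjugate_transcendental[of c "{}"] by blast
next
  case True
  then obtain p where "p \<in> PR" "p \<noteq> 0" "poly p c = 0" by blast
  then obtain m where m: "m \<in> PR" "m \<noteq> 0" "poly m c = 0"
    "\<And>q. q \<in> PR \<Longrightarrow> q \<noteq> 0 \<Longrightarrow> poly q c = 0 \<Longrightarrow> Polynomial.degree m \<le> Polynomial.degree q" by (rule minimal_polynomial) blast
  have "Polynomial.degree m \<noteq> 0"
  proof
    assume "Polynomial.degree m = 0"
    then obtain b where "m = [:b:]" by (rule degree_eq_zeroE)
    then show False using m(2,3) by simp
  qed
  then have "\<not> constant (poly (lift m))" using degree_lift[OF m(1)] by (simp add: constant_degree)
  then obtain d where "poly (lift m) d = 0" using fundamental_theorem_of_algebra by blast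
  then show ?thesis using conjugate_algebraic[OF m] by blast
qed

lemma extend_finite:
  assumes "finite C"
  shows "\<exists>R' \<phi>'. embedding R' \<phi>' \<and> R \<subseteq> R' \<and> C \<subseteq> R' \<and> (\<forall>x\<in>R. \<phi>' x = \<phi> x)"
  using assms
proof (induction C)
  case empty
  show ?case using embedding_axioms by blast
next
  case (insert c C)
  then obtain R' \<phi>' where *: "embedding R' \<phi>'" "R \<subseteq> R'" "C \<subseteq> R'" "\<forall>x\<in>R. \<phi>' x = \<phi> x" by blast
  then interpret E: embedding R' \<phi>' by blast
  obtain d where "E.conjugate c d" using E.exists_conjugate by blast
  from E.extend[OF this] obtain R'' \<phi>'' where "embedding R'' \<phi>''" "R' \<subseteq> R''" "c \<in> R''" "\<forall>x\<in>R'. \<phi>'' x = \<phi>' x"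
    by blast
  then show ?case using * by (intro exI[of _ R''] exI[of _ \<phi>'']) auto
qed

end

lemma embedding_rat: "embedding (range of_rat) id"
  by unfold_locales
    (auto simp flip: of_rat_add of_rat_mult intro: range_eqI[of _ _ 0] range_eqI[of _ _ 1] simp: countable_image)

text \<open>A transcendental number can be sent to any other transcendental one. An irrational algebraic number has a minimal polynomial of
degree at least \<open>2\<close>, which has a second root because it is separable. The embedding then extends to finitely
many further elements one at a time.\<close>

lemma exists_embedding_moving:
  assumes a: "a \<notin> range (of_rat :: rat \<Rightarrow> complex)" and C: "finite C"
  shows "\<exists>R \<phi>. embedding R \<phi> \<and> a \<in> R \<and> C \<subseteq> R \<and> \<phi> a \<noteq> a"
proof -
  interpret E: embedding "range of_rat" id by (rule embedding_rat)
  have lift_id: "E.lift p = p" for p by (simp add: poly_eq_iff E.coeff_lift)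
  have "\<exists>d. d \<noteq> a \<and> E.conjugate a d"
  proof (cases "\<exists>p\<in>E.PR. p \<noteq> 0 \<and> poly p a = 0")
    case False
    then show ?thesis using E.conjugate_transcendental[of a "{a}"] by blast
  next
    case True
    then obtain p where "p \<in> E.PR" "p \<noteq> 0" "poly p a = 0" by blast
    then obtain m where m: "m \<in> E.PR" "m \<noteq> 0" "poly m a = 0"
      "\<And>q. q \<in> E.PR \<Longrightarrow> q \<noteq> 0 \<Longrightarrow> poly q a = 0 \<Longrightarrow> Polynomial.degree m \<le> Polynomial.degree q" by (rule E.minimal_polynomial) blast
    obtain g where g: "m = [:-a, 1:] * g" using m(3) by (auto simp: poly_eq_0_iff_dvd)
    have g0: "g \<noteq> 0" using m(2) g by auto
    have dm: "Polynomial.degree m = Suc (Polynomial.degree g)" 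
      unfolding g using Polynomial.degree_mult_eq[of "[:-a, 1:]" g] g0 by (simp del: mult_pCons_left)
    have "Polynomial.degree g \<noteq> 0"
    proof
      assume "Polynomial.degree g = 0"
      then obtain b where b: "g = [:b:]" by (rule degree_eq_zeroE)
      then have "Polynomial.coeff m 0 = - a * b" "Polynomial.coeff m 1 = b" by (simp_all add: g)
      moreover have "Polynomial.coeff m 0 \<in> range of_rat" "Polynomial.coeff m 1 \<in> range of_rat" using m(1) unfolding E.PR_def by blast+
      ultimately obtain x y where "of_rat x = - a * b" "of_rat y = b" by (metis imageE)
      moreover have "b \<noteq> 0" using b g0 by simp
      ultimately have "a = of_rat (- x / y)" by (simp add: of_rat_divide of_rat_minus)
      then show False using a by blast
    qed
    then have "\<not> constant (poly g)" by (simp add: constant_degree)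
    then obtain d where d: "poly g d = 0" using fundamental_theorem_of_algebra by blast
    \<comment> \<open>Otherwise \<open>a\<close> would be a root of the derivative of its minimal polynomial.\<close>
    have "d \<noteq> a"
    proof
      assume "d = a"
      then have "poly (pderiv m) a = 0" using d unfolding g pderiv_mult by (simp add: pderiv_pCons)
      moreover have "pderiv m \<in> E.PR"
        unfolding E.PR_def mem_Collect_eq coeff_pderiv
      proof
        fix i
        have "Polynomial.coeff m (Suc i) \<in> range of_rat" using m(1) unfolding E.PR_def by blast
        then obtain x where "Polynomial.coeff m (Suc i) = of_rat x" by blast
        then have "of_nat (Suc i) * Polynomial.coeff m (Suc i) = of_rat (of_nat (Suc i) * x)"
          by (simp only: of_rat_mult of_rat_of_nat_eq)
        then show "of_nat (Suc i) * Polynomial.coeff m (Suc i) \<in> range of_rat" by blast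
      qed
      moreover have "pderiv m \<noteq> 0" using dm by (simp add: pderiv_eq_0_iff)
      ultimately have "Polynomial.degree m \<le> Polynomial.degree (pderiv m)" using m(4) by blast
      then show False using dm by (simp add: degree_pderiv)
    qed
    moreover have "poly (E.lift m) d = 0" using d by (simp add: lift_id g)
    with m have "E.conjugate a d" by (intro E.conjugate_algebraic[of m a d]) blast+
    ultimately show ?thesis by blast
  qed
  then obtain d where d: "d \<noteq> a" "E.conjugate a d" by blast
  obtain R \<phi> where R: "embedding R \<phi>" "a \<in> R" "\<phi> a = d" using E.extend[OF d(2)] by blast
  interpret F: embedding R \<phi> by (rule R(1))
  obtain R' \<phi>' where "embedding R' \<phi>'" "R \<subseteq> R'" "C \<subseteq> R'" "\<forall>x\<in>R. \<phi>' x = \<phi> x"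
    using F.extend_finite[OF C] by blast
  then show ?thesis using R d(1) by (intro exI[of _ R'] exI[of _ \<phi>']) auto
qed

section \<open>Polynomial expressions in matrix entries\<close>

text \<open>Polynomials in matrix entries as expressions (constants, variables, sums and products), on which derivations,
translations and quotients can be defined by recursion.\<close>

datatype pexp = PC complex | PV "nat \<times> nat" | PA pexp pexp | PM pexp pexp

primrec pev :: "(complex \<Rightarrow> 'b::comm_ring_1) \<Rightarrow> (nat \<times> nat \<Rightarrow> 'b) \<Rightarrow> pexp \<Rightarrow> 'b" where
  "pev c x (PC a) = c a"
| "pev c x (PV v) = x v"
| "pev c x (PA e f) = pev c x e + pev c x f"
| "pev c x (PM e f) = pev c x e * pev c x f"

abbreviation pval :: "(nat \<times> nat \<Rightarrow> complex) \<Rightarrow> pexp \<Rightarrow> complex" where "pval \<equiv> pev (\<lambda>a. a)"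

primrec pvars :: "pexp \<Rightarrow> (nat \<times> nat) set" where
  "pvars (PC a) = {}"
| "pvars (PV v) = {v}"
| "pvars (PA e f) = pvars e \<union> pvars f"
| "pvars (PM e f) = pvars e \<union> pvars f"

definition psum :: "pexp list \<Rightarrow> pexp" where "psum es = foldr PA es (PC 0)"

lemma pev_psum: "c 0 = 0 \<Longrightarrow> pev c x (psum es) = (\<Sum>e\<leftarrow>es. pev c x e)"
  unfolding psum_def by (induction es) simp_all

lemma pvars_psum: "pvars (psum es) = (\<Union>e\<in>set es. pvars e)"
  unfolding psum_def by (induction es) simp_all

lemma pev_psum_upt: "c 0 = 0 \<Longrightarrow> pev c x (psum (map h [0..<n])) = (\<Sum>l<n. pev c x (h l))"
  by (simp add: pev_psum comp_def interv_sum_list_conv_sum_set_nat atLeast0LessThan)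

lemma pev_cong: "(\<And>v. v \<in> pvars e \<Longrightarrow> x v = y v) \<Longrightarrow> pev c x e = pev c y e"
  by (induction e) simp_all

text \<open>The left-invariant derivation attached to \<open>Y\<close>: it sends the matrix \<open>x\<close> of coordinates to \<open>x Y\<close>, so it
differentiates along the curves \<open>t \<mapsto> x exp (t Y)\<close>.\<close>

primrec pdiff :: "nat \<Rightarrow> (nat \<times> nat \<Rightarrow> complex) \<Rightarrow> pexp \<Rightarrow> pexp" where
  "pdiff n Y (PC a) = PC 0"
| "pdiff n Y (PV v) = psum (map (\<lambda>l. PM (PV (fst v, l)) (PC (Y (l, snd v)))) [0..<n])"
| "pdiff n Y (PA e f) = PA (pdiff n Y e) (pdiff n Y f)"
| "pdiff n Y (PM e f) = PA (PM (pdiff n Y e) f) (PM e (pdiff n Y f))"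

lemma pvars_pdiff: "pvars e \<subseteq> mat_index n \<Longrightarrow> pvars (pdiff n Y e) \<subseteq> mat_index n"
  by (induction e) (auto simp: pvars_psum)

lemma fps_deriv_pev:
  "pvars e \<subseteq> mat_index n \<Longrightarrow>
   fps_deriv (pev fps_const (expm n Y 1) e) = pev fps_const (expm n Y 1) (pdiff n Y e)"
  by (induction e) (auto simp: pev_psum_upt expm_deriv)

lemma pval_pdiff_linear:
  "pval x (pdiff n (\<lambda>v. a * Y v + b * Z v) e) = a * pval x (pdiff n Y e) + b * pval x (pdiff n Z e)"
  by (induction e) (simp_all add: pev_psum_upt sum.distrib sum_distrib_left algebra_simps)

text \<open>The polynomial \<open>x \<mapsto> e (g x)\<close>.\<close>

primrec ptrans :: "nat \<Rightarrow> (nat \<times> nat \<Rightarrow> complex) \<Rightarrow> pexp \<Rightarrow> pexp" where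
  "ptrans n g (PC a) = PC a"
| "ptrans n g (PV v) = psum (map (\<lambda>l. PM (PC (g (fst v, l))) (PV (l, snd v))) [0..<n])"
| "ptrans n g (PA e f) = PA (ptrans n g e) (ptrans n g f)"
| "ptrans n g (PM e f) = PM (ptrans n g e) (ptrans n g f)"

lemma pvars_ptrans: "pvars e \<subseteq> mat_index n \<Longrightarrow> pvars (ptrans n g e) \<subseteq> mat_index n"
  by (induction e) (auto simp: pvars_psum)

lemma pval_ptrans: "pval x (ptrans n g e) = pval (mm n g x) e"
  by (induction e) (auto simp: pev_psum_upt mm_def)

lemma pval_pdiff_ptrans: "pval x (pdiff n Y (ptrans n g e)) = pval (mm n g x) (pdiff n Y e)"
proof (induction e)
  case (PV v)
  obtain i j where v: "v = (i, j)" by fastforce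
  have d: "pev c x (pdiff n Y (psum (map h ls))) = (\<Sum>l\<leftarrow>ls. pev c x (pdiff n Y (h l)))" if "c 0 = 0" for c :: "complex \<Rightarrow> complex" and h and ls :: "nat list"
    unfolding psum_def by (induction ls) (simp_all add: that)
  have "pval x (pdiff n Y (ptrans n g (PV v))) = mm n g (mm n x Y) (i, j)"
    by (simp add: d v pev_psum_upt comp_def interv_sum_list_conv_sum_set_nat atLeast0LessThan mm_def)
  also have "\<dots> = pval (mm n g x) (pdiff n Y (PV v))"
    unfolding mm_assoc[symmetric] by (simp add: v pev_psum_upt mm_def)
  finally show ?case .
qed (simp_all add: pval_ptrans)

text \<open>Coefficients \<open>e\<^sub>b\<close> of Hadamard's lemma at the identity, \<open>e(x) - e(1) = \<Sum>\<^sub>b e\<^sub>b(x) (x\<^sub>b - 1\<^sub>b)\<close>. Their values at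
\<open>1\<close> are the partial derivatives of \<open>e\<close>.\<close>

primrec hadamard :: "nat \<times> nat \<Rightarrow> pexp \<Rightarrow> pexp" where
  "hadamard b (PC a) = PC 0"
| "hadamard b (PV v) = PC (if v = b then 1 else 0)"
| "hadamard b (PA e f) = PA (hadamard b e) (hadamard b f)"
| "hadamard b (PM e f) = PA (PM (hadamard b e) f) (PM (PC (pval idm e)) (hadamard b f))"

lemma pvars_hadamard: "pvars (hadamard b e) \<subseteq> pvars e"
  by (induction e) auto

lemma hadamard_expansion:
  "pvars e \<subseteq> mat_index n \<Longrightarrow>
   pval x e - pval idm e = (\<Sum>b\<in>mat_index n. pval x (hadamard b e) * (x b - idm b))"
proof (induction e)
  case (PV v)
  have "(\<Sum>b\<in>mat_index n. pval x (hadamard b (PV v)) * (x b - idm b)) =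
      (\<Sum>b\<in>mat_index n. if v = b then x b - idm b else 0)" by (intro sum.cong) auto
  then show ?case using PV by simp
next
  case (PA e f)
  then show ?case by (simp add: sum.distrib distrib_right add_diff_add)
next
  case (PM e f)
  have "pval x e * pval x f - pval idm e * pval idm f =
      (pval x e - pval idm e) * pval x f + pval idm e * (pval x f - pval idm f)" by (simp add: algebra_simps)
  also have "\<dots> = (\<Sum>b\<in>mat_index n. pval x (hadamard b (PM e f)) * (x b - idm b))"
  proof -
    have "(\<Sum>b\<in>mat_index n. pval x (hadamard b (PM e f)) * (x b - idm b)) =
        (\<Sum>b\<in>mat_index n. pval x (hadamard b e) * (x b - idm b)) * pval x f +
        pval idm e * (\<Sum>b\<in>mat_index n. pval x (hadamard b f) * (x b - idm b))"
      unfolding sum_distrib_left sum_distrib_right sum.distrib[symmetric]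
      by (rule sum.cong) (simp_all add: algebra_simps)
    then show ?thesis using PM by simp
  qed
  finally show ?case by simp
qed simp

lemma pval_pdiff_idm:
  "pvars e \<subseteq> mat_index n \<Longrightarrow>
   pval idm (pdiff n Y e) = (\<Sum>b\<in>mat_index n. Y b * pval idm (hadamard b e))"
proof (induction e)
  case (PV v)
  obtain i j where v: "v = (i, j)" by fastforce
  have "pval idm (pdiff n Y (PV v)) = mm n idm Y (i, j)" by (simp add: v pev_psum_upt mm_def)
  also have "\<dots> = Y v" using PV by (simp add: v mm_idm_left)
  also have "\<dots> = (\<Sum>b\<in>mat_index n. if v = b then Y b else 0)" using PV by simp
  also have "\<dots> = (\<Sum>b\<in>mat_index n. Y b * pval idm (hadamard b (PV v)))" by (intro sum.cong) auto
  finally show ?case .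
qed (simp_all add: sum.distrib sum_distrib_left sum_distrib_right algebra_simps)

text \<open>The coordinates of \<open>g x\<close> are bilinear in \<open>g\<close> and \<open>x\<close>, and finite sums of such products are closed under
multiplication. Hence the translates of a polynomial span a finite-dimensional space.\<close>

lemma finite_rank_translation:
  "\<exists>L. \<forall>g x. pval (mm n g x) e = (\<Sum>(\<alpha>, \<beta>)\<leftarrow>L. \<alpha> g * \<beta> x)"
proof (induction e)
  case (PC a)
  show ?case by (rule exI[of _ "[(\<lambda>_. a, \<lambda>_. 1)]"]) simp
next
  case (PV v)
  show ?case
    by (rule exI[of _ "map (\<lambda>l. (\<lambda>g. g (fst v, l), \<lambda>x. x (l, snd v))) [0..<n]"])
      (cases v, simp add: mm_def comp_def interv_sum_list_conv_sum_set_nat atLeast0LessThan)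
next
  case (PA e f)
  then obtain L L' where "\<forall>g x. pval (mm n g x) e = (\<Sum>(\<alpha>, \<beta>)\<leftarrow>L. \<alpha> g * \<beta> x)"
    "\<forall>g x. pval (mm n g x) f = (\<Sum>(\<alpha>, \<beta>)\<leftarrow>L'. \<alpha> g * \<beta> x)" by blast
  then show ?case by (intro exI[of _ "L @ L'"]) simp
next
  case (PM e f)
  then obtain L L' where L: "\<And>g x. pval (mm n g x) e = (\<Sum>(\<alpha>, \<beta>)\<leftarrow>L. \<alpha> g * \<beta> x)"
    and L': "\<And>g x. pval (mm n g x) f = (\<Sum>(\<alpha>, \<beta>)\<leftarrow>L'. \<alpha> g * \<beta> x)" by blast
  define P where "P = (\<lambda>L. concat (map (\<lambda>(\<alpha>, \<beta>). map (\<lambda>(\<alpha>', \<beta>'). (\<lambda>g. \<alpha> g * \<alpha>' g :: complex, \<lambda>x. \<beta> x * \<beta>' x :: complex)) L') L))"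
  have row: "(\<Sum>(\<gamma>, \<delta>)\<leftarrow>map (\<lambda>(\<alpha>', \<beta>'). (\<lambda>g. \<alpha> g * \<alpha>' g, \<lambda>x. \<beta> x * \<beta>' x)) L'. \<gamma> g * \<delta> x) =
      \<alpha> g * \<beta> x * (\<Sum>(\<alpha>, \<beta>)\<leftarrow>L'. \<alpha> g * \<beta> x)" for g x :: "nat \<times> nat \<Rightarrow> complex" and \<alpha> \<beta>
    by (induction L') (auto simp: algebra_simps)
  have "(\<Sum>(\<gamma>, \<delta>)\<leftarrow>P L. \<gamma> g * \<delta> x) = (\<Sum>(\<alpha>, \<beta>)\<leftarrow>L. \<alpha> g * \<beta> x) * (\<Sum>(\<alpha>, \<beta>)\<leftarrow>L'. \<alpha> g * \<beta> x)" for g x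
    unfolding P_def by (induction L) (auto simp: row[unfolded map_map] algebra_simps)
  then show ?case using L L' by (intro exI[of _ "P L"]) simp
qed

section \<open>Linear algebra\<close>

text \<open>Induction on \<open>K\<close>, eliminating one coordinate at a time.\<close>

lemma linear_dependence:
  fixes v :: "'a \<Rightarrow> nat \<Rightarrow> complex"
  assumes "finite A" "K < card A"
  shows "\<exists>\<mu>. (\<exists>a\<in>A. \<mu> a \<noteq> 0) \<and> (\<forall>k<K. (\<Sum>a\<in>A. \<mu> a * v a k) = 0)"
  using assms
proof (induction K arbitrary: A v)
  case 0
  then have "A \<noteq> {}" by auto
  then show ?case by (intro exI[of _ "\<lambda>_. 1"]) auto
next
  case (Suc K)
  show ?case
  proof (cases "\<forall>a\<in>A. v a K = 0")
    case True
    obtain \<mu> where "\<exists>a\<in>A. \<mu> a \<noteq> 0" "\<forall>k<K. (\<Sum>a\<in>A. \<mu> a * v a k) = 0"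
      using Suc.IH[of A v] Suc.prems by auto
    then show ?thesis using True by (intro exI[of _ \<mu>]) (auto simp: less_Suc_eq)
  next
    case False
    then obtain a0 where a0: "a0 \<in> A" "v a0 K \<noteq> 0" by blast
    define w where "w = (\<lambda>a k. v a k - v a K / v a0 K * v a0 k)"
    have "finite (A - {a0})" "K < card (A - {a0})" using Suc.prems a0 by auto
    then obtain \<mu> where \<mu>: "\<exists>a\<in>A - {a0}. \<mu> a \<noteq> 0" "\<forall>k<K. (\<Sum>a\<in>A - {a0}. \<mu> a * w a k) = 0"
      using Suc.IH[of "A - {a0}" w] by blast
    have wK: "w a K = 0" for a using a0 by (simp add: w_def)
    \<comment> \<open>The coefficient at \<open>a0\<close> undoes the elimination of coordinate \<open>K\<close>.\<close>
    define \<nu> where "\<nu> = \<mu>(a0 := - (\<Sum>a\<in>A - {a0}. \<mu> a * (v a K / v a0 K)))"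
    have "(\<Sum>a\<in>A. \<nu> a * v a k) = (\<Sum>a\<in>A - {a0}. \<mu> a * w a k)" for k
    proof -
      have "(\<Sum>a\<in>A. \<nu> a * v a k) = \<nu> a0 * v a0 k + (\<Sum>a\<in>A - {a0}. \<nu> a * v a k)"
        using Suc.prems(1) a0(1) by (rule sum.remove)
      also have "(\<Sum>a\<in>A - {a0}. \<nu> a * v a k) = (\<Sum>a\<in>A - {a0}. \<mu> a * v a k)"
        by (rule sum.cong) (auto simp: \<nu>_def)
      also have "\<nu> a0 * v a0 k = - (\<Sum>a\<in>A - {a0}. \<mu> a * (v a K / v a0 K * v a0 k))"
        by (simp add: \<nu>_def sum_distrib_right mult.assoc)
      finally show ?thesis by (simp add: w_def right_diff_distrib sum_subtractf)
    qed
    then have "\<forall>k<Suc K. (\<Sum>a\<in>A. \<nu> a * v a k) = 0" using \<mu>(2) wK by (auto simp: less_Suc_eq)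
    moreover have "\<exists>a\<in>A. \<nu> a \<noteq> 0" using \<mu>(1) by (auto simp: \<nu>_def)
    ultimately show ?thesis by blast
  qed
qed

text \<open>Induction on \<open>B\<close>. If some \<open>w0 \<in> W\<close> has the value \<open>1\<close> at the new index \<open>c\<close>, the hypothesis is applied to
the subspace \<open>V\<close> of vectors vanishing at \<open>c\<close>: an annihilator of \<open>V\<close> extends to one of \<open>W\<close>, and a dual basis in
\<open>V\<close> is completed by \<open>w0\<close> minus its projection.\<close>

lemma annihilator_or_dual_basis:
  fixes W :: "('a \<Rightarrow> complex) set"
  assumes "finite B" and W: "\<And>v w a b. v \<in> W \<Longrightarrow> w \<in> W \<Longrightarrow> (\<lambda>x. a * v x + b * w x) \<in> W" and ne: "W \<noteq> {}"
  shows "(\<exists>y. (\<exists>b\<in>B. y b \<noteq> 0) \<and> (\<forall>w\<in>W. (\<Sum>b\<in>B. y b * w b) = 0)) \<or>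
         (\<forall>a\<in>B. \<exists>w\<in>W. \<forall>b\<in>B. w b = (if a = b then 1 else 0))"
  using assms
proof (induction B arbitrary: W)
  case empty then show ?case by simp
next
  case (insert c B)
  show ?case
  proof (cases "\<forall>w\<in>W. w c = 0")
    case True
    have "(\<Sum>b\<in>insert c B. (if b = c then 1 else 0) * w b) = 0" if "w \<in> W" for w
    proof -
      have "(\<Sum>b\<in>B. (if b = c then 1 else 0) * w b) = 0" by (rule sum.neutral) (use insert.hyps in auto)
      then show ?thesis using insert.hyps True that by simp
    qed
    then show ?thesis by (intro disjI1 exI[of _ "\<lambda>b. if b = c then 1 else 0"]) simp
  next
    case False
    then obtain w1 where w1: "w1 \<in> W" "w1 c \<noteq> 0" by blast
    define w0 where "w0 = (\<lambda>x. inverse (w1 c) * w1 x + 0 * w1 x)"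
    have w0: "w0 \<in> W" unfolding w0_def by (rule insert.prems(1)[OF w1(1) w1(1)])
    have w0c: "w0 c = 1" using w1(2) by (simp add: w0_def)
    define V where "V = {w\<in>W. w c = 0}"
    have V: "(\<lambda>x. a * v x + b * w x) \<in> V" if "v \<in> V" "w \<in> V" for v w a b
      using insert.prems(1)[of v w a b] that by (auto simp: V_def)
    have "(\<lambda>x. 0 * w0 x + 0 * w0 x) \<in> V" using insert.prems(1)[OF w0 w0, of 0 0] by (simp add: V_def)
    then have Vne: "V \<noteq> {}" by blast
    have red: "(\<lambda>x. 1 * w x + (- w c) * w0 x) \<in> V" if "w \<in> W" for w
      using insert.prems(1)[OF that w0, of 1 "- w c"] w0c by (simp add: V_def)
    from insert.IH[OF V Vne] show ?thesis
    proof
      assume "\<exists>y. (\<exists>b\<in>B. y b \<noteq> 0) \<and> (\<forall>w\<in>V. (\<Sum>b\<in>B. y b * w b) = 0)"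
      then obtain y where y: "\<exists>b\<in>B. y b \<noteq> 0" "\<And>w. w \<in> V \<Longrightarrow> (\<Sum>b\<in>B. y b * w b) = 0" by blast
      \<comment> \<open>The value at \<open>c\<close> is chosen to make the extended vector annihilate \<open>w0\<close> too.\<close>
      define z where "z = y(c := - (\<Sum>b\<in>B. y b * w0 b))"
      have zB: "z b = y b" if "b \<in> B" for b using that insert.hyps by (auto simp: z_def)
      have "(\<Sum>b\<in>insert c B. z b * w b) = 0" if "w \<in> W" for w
      proof -
        have "(\<Sum>b\<in>insert c B. z b * w b) = z c * w c + (\<Sum>b\<in>B. y b * w b)"
          using insert.hyps zB by simp
        also have "z c * w c = - (\<Sum>b\<in>B. y b * (w c * w0 b))"
          by (simp add: z_def sum_distrib_left mult_ac)
        also have "\<dots> + (\<Sum>b\<in>B. y b * w b) = (\<Sum>b\<in>B. y b * (1 * w b + (- w c) * w0 b))"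
          unfolding sum_negf[symmetric] sum.distrib[symmetric] by (rule sum.cong) (auto simp: algebra_simps)
        also have "\<dots> = 0" by (rule y(2)[OF red[OF that]])
        finally show ?thesis .
      qed
      moreover have "\<exists>b\<in>insert c B. z b \<noteq> 0" using y(1) zB by auto
      ultimately show ?thesis by blast
    next
      assume "\<forall>a\<in>B. \<exists>w\<in>V. \<forall>b\<in>B. w b = (if a = b then 1 else 0)"
      then have "\<forall>a\<in>B. \<exists>w. w \<in> V \<and> (\<forall>b\<in>B. w b = (if a = b then 1 else 0))" by blast
      then obtain u where u: "\<And>a. a \<in> B \<Longrightarrow> u a \<in> V \<and> (\<forall>b\<in>B. u a b = (if a = b then 1 else 0))" by metis
      have sums: "(\<lambda>x. 1 * w0 x + (- 1) * (\<Sum>a\<in>A. w0 a * u a x)) \<in> W" if "A \<subseteq> B" for A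
        using finite_subset[OF that insert.hyps(1)] that
      proof (induction A)
        case empty
        then show ?case using w0 by simp
      next
        case (insert a A)
        then have "(\<lambda>x. 1 * w0 x + (- 1) * (\<Sum>a\<in>A. w0 a * u a x)) \<in> W" "u a \<in> W" using u[of a] by (auto simp: V_def)
        from insert.prems have "a \<in> B" by simp
        have "(\<lambda>x. 1 * (1 * w0 x + (- 1) * (\<Sum>a\<in>A. w0 a * u a x)) + (- w0 a) * u a x) \<in> W"
          by (rule \<open>\<And>v w a b. v \<in> W \<Longrightarrow> w \<in> W \<Longrightarrow> (\<lambda>x. a * v x + b * w x) \<in> W\<close>) fact+
        then show ?case using insert.hyps by (simp add: algebra_simps)
      qed
      define v where "v = (\<lambda>x. 1 * w0 x + (- 1) * (\<Sum>a\<in>B. w0 a * u a x))"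
      have v: "v \<in> W" "v c = 1" "\<And>b. b \<in> B \<Longrightarrow> v b = 0"
      proof -
        show "v \<in> W" unfolding v_def by (rule sums) simp
        have "u a c = 0" if "a \<in> B" for a using u[OF that] by (simp add: V_def)
        then show "v c = 1" using w0c by (simp add: v_def)
        fix b assume b: "b \<in> B"
        have "(\<Sum>a\<in>B. w0 a * u a b) = (\<Sum>a\<in>B. if a = b then w0 a else 0)"
          by (rule sum.cong) (use u b in auto)
        then show "v b = 0" using b insert.hyps(1) by (simp add: v_def)
      qed
      have "\<exists>w\<in>W. \<forall>b\<in>insert c B. w b = (if a = b then 1 else 0)" if a: "a \<in> insert c B" for a
      proof (cases "a = c")
        case True
        then show ?thesis using v insert.hyps by (intro bexI[of _ v]) auto
      next
        case False
        then have "a \<in> B" using a by simp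
        then have "u a \<in> W" "u a c = 0" "\<forall>b\<in>B. u a b = (if a = b then 1 else 0)" using u[of a] by (auto simp: V_def)
        then show ?thesis using False by (intro bexI[of _ "u a"]) auto
      qed
      then show ?thesis by blast
    qed
  qed
qed

text \<open>Gaussian elimination without division on a matrix of polynomials that is the identity matrix at the point
\<open>1\<close>. Cramer's rule would give the determinant as \<open>h\<close>; the product of the pivots serves as well.\<close>

lemma elimination:
  assumes "finite B" and "\<And>a b. a \<in> B \<Longrightarrow> b \<in> B \<Longrightarrow> pvars (M a b) \<subseteq> mat_index n"
    and "\<And>a b. a \<in> B \<Longrightarrow> b \<in> B \<Longrightarrow> pval idm (M a b) = (if a = b then 1 else 0)"
  shows "\<exists>h. pvars h \<subseteq> mat_index n \<and> pval idm h = 1 \<and>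
     (\<forall>x y. (\<forall>a\<in>B. (\<Sum>b\<in>B. pval x (M a b) * y b) = 0) \<longrightarrow> (\<forall>b\<in>B. pval x h * y b = 0))"
  using assms
proof (induction B arbitrary: M)
  case empty
  show ?case by (rule exI[of _ "PC 1"]) simp
next
  case (insert c B)
  \<comment> \<open>The rows other than \<open>c\<close> after clearing column \<open>c\<close> with the pivot \<open>M c c\<close>, which is \<open>1\<close> at the identity.\<close>
  define M' where "M' = (\<lambda>a b. PA (PM (M c c) (M a b)) (PM (PC (-1)) (PM (M a c) (M c b))))"
  have "\<exists>h. pvars h \<subseteq> mat_index n \<and> pval idm h = 1 \<and>
     (\<forall>x y. (\<forall>a\<in>B. (\<Sum>b\<in>B. pval x (M' a b) * y b) = 0) \<longrightarrow> (\<forall>b\<in>B. pval x h * y b = 0))"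
  proof (rule insert.IH)
    fix a b assume ab: "a \<in> B" "b \<in> B"
    then show "pvars (M' a b) \<subseteq> mat_index n" using insert.prems(1) by (auto simp: M'_def)
    have "a \<noteq> c" "b \<noteq> c" using ab insert.hyps by auto
    then show "pval idm (M' a b) = (if a = b then 1 else 0)" using insert.prems(2) ab by (auto simp: M'_def)
  qed
  then obtain h where h: "pvars h \<subseteq> mat_index n" "pval idm h = 1"
    "\<And>x y b. \<forall>a\<in>B. (\<Sum>b\<in>B. pval x (M' a b) * y b) = 0 \<Longrightarrow> b \<in> B \<Longrightarrow> pval x h * y b = 0" by blast
  define k where "k = PM h (M c c)"
  have "pval x k * y b = 0"
    if sys: "\<forall>a\<in>insert c B. (\<Sum>b\<in>insert c B. pval x (M a b) * y b) = 0" and b: "b \<in> insert c B" for x y b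
  proof -
    have row: "pval x (M a c) * y c + (\<Sum>b\<in>B. pval x (M a b) * y b) = 0" if "a \<in> insert c B" for a
      using bspec[OF sys that] insert.hyps by simp
    have "(\<Sum>b\<in>B. pval x (M' a b) * y b) = 0" if a: "a \<in> B" for a
    proof -
      have "(\<Sum>b\<in>B. pval x (M' a b) * y b) =
          pval x (M c c) * (\<Sum>b\<in>B. pval x (M a b) * y b) - pval x (M a c) * (\<Sum>b\<in>B. pval x (M c b) * y b)"
        by (simp add: M'_def sum_distrib_left sum_subtractf[symmetric] algebra_simps)
      also have "(\<Sum>b\<in>B. pval x (M a b) * y b) = - (pval x (M a c) * y c)"
        using row[of a] a by (simp add: eq_neg_iff_add_eq_0 add.commute)
      also have "(\<Sum>b\<in>B. pval x (M c b) * y b) = - (pval x (M c c) * y c)"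
        using row[of c] by (simp add: eq_neg_iff_add_eq_0 add.commute)
      finally show ?thesis by (simp add: algebra_simps)
    qed
    then have hB: "pval x h * y b = 0" if "b \<in> B" for b using h(3) that by blast
    show ?thesis
    proof (cases "b = c")
      case True
      have "pval x h * (\<Sum>b\<in>B. pval x (M c b) * y b) = (\<Sum>b\<in>B. pval x (M c b) * (pval x h * y b))"
        by (simp add: sum_distrib_left mult_ac)
      also have "\<dots> = 0" using hB by (intro sum.neutral) auto
      finally have z: "pval x h * (\<Sum>b\<in>B. pval x (M c b) * y b) = 0" .
      have "pval x (M c c) * y c + (\<Sum>b\<in>B. pval x (M c b) * y b) = 0" using row[of c] by blast
      then have "pval x h * (pval x (M c c) * y c) + pval x h * (\<Sum>b\<in>B. pval x (M c b) * y b) = 0"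
        by (simp only: distrib_left[symmetric] mult_zero_right)
      then have "pval x h * (pval x (M c c) * y c) = 0" by (simp only: z add_0_right)
      then show ?thesis by (simp only: k_def pev.simps True mult.assoc)
    next
      case False
      then have "pval x h * y b = 0" using hB[of b] b by blast
      moreover have "pval x k * y b = pval x (M c c) * (pval x h * y b)" by (simp add: k_def)
      ultimately show ?thesis by (simp only: mult_zero_right)
    qed
  qed
  moreover have "pvars k \<subseteq> mat_index n" "pval idm k = 1" using h(1,2) insert.prems by (auto simp: k_def)
  ultimately show ?case by blast
qed

section \<open>Complex matrix groups and entire matrix curves\<close>

lemma complex_ring_simps: "carrier complex_ring = UNIV" "monoid.mult complex_ring = (*)" "one complex_ring = 1"
  "ring.zero complex_ring = 0" "add complex_ring = (+)"
  by (simp_all add: ring_of_type_algebra_def)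

lemma cring_complex: "cring complex_ring" by (rule cring_from_type_algebra)

lemma finsum_complex: "finite A \<Longrightarrow> finsum complex_ring f A = sum f A"
proof -
  interpret cring complex_ring by (rule cring_complex)
  show "finite A \<Longrightarrow> finsum complex_ring f A = sum f A"
    by (induction A rule: finite_induct) (simp_all add: finsum_insert complex_ring_simps Pi_def)
qed

lemma finprod_complex: "finite A \<Longrightarrow> finprod complex_ring f A = prod f A"
proof -
  interpret cring complex_ring by (rule cring_complex)
  show "finite A \<Longrightarrow> finprod complex_ring f A = prod f A"
    by (induction A rule: finite_induct) (simp_all add: finprod_insert complex_ring_simps Pi_def)
qed

lemma pow_complex: "x [^]\<^bsub>complex_ring\<^esub> (k::nat) = x ^ k"
  by (induction k) (simp_all add: complex_ring_simps mult.commute)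

lemma mpoly_eval_complex: "mpoly_eval complex_ring c f x = meval c f x"
  unfolding mpoly_eval_def meval_def by (simp add: finsum_complex finprod_complex pow_complex complex_ring_simps)

lemma mat_complex:
  "carrier (mat_monoid complex_ring n) = (\<Pi>\<^sub>E ij\<in>mat_index n. UNIV)"
  "g \<otimes>\<^bsub>mat_monoid complex_ring n\<^esub> h = restrict (mm n g h) (mat_index n)"
  "\<one>\<^bsub>mat_monoid complex_ring n\<^esub> = restrict idm (mat_index n)"
  by (auto simp: mat_monoid_def complex_ring_simps finsum_complex mm_def idm_def intro!: restrict_ext)

lemma mm_restrict: "restrict (mm n (restrict g (mat_index n)) h) (mat_index n) = restrict (mm n g h) (mat_index n)"
  "restrict (mm n g (restrict h (mat_index n))) (mat_index n) = restrict (mm n g h) (mat_index n)"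
  by (auto simp: mm_def intro!: restrict_ext)

lemma monoid_mat_complex: "monoid (mat_monoid complex_ring n)"
proof (rule monoidI)
  fix g assume "g \<in> carrier (mat_monoid complex_ring n)"
  then have g: "restrict g (mat_index n) = g" by (simp add: mat_complex PiE_iff extensional_restrict)
  have "restrict (mm n idm g) (mat_index n) = restrict g (mat_index n)"
    "restrict (mm n g idm) (mat_index n) = restrict g (mat_index n)"
    by (auto simp: mm_idm_left mm_idm_right intro!: restrict_ext)
  then show "\<one>\<^bsub>mat_monoid complex_ring n\<^esub> \<otimes>\<^bsub>mat_monoid complex_ring n\<^esub> g = g"
    "g \<otimes>\<^bsub>mat_monoid complex_ring n\<^esub> \<one>\<^bsub>mat_monoid complex_ring n\<^esub> = g"
    unfolding mat_complex mm_restrict using g by simp_all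
qed (simp_all add: mat_complex mm_restrict mm_assoc)

lemma group_GL_complex: "group (GL complex_ring n)"
  unfolding GL_def by (rule monoid.units_group[OF monoid_mat_complex])

lemma GL_complexI:
  assumes "\<And>ij. ij \<in> mat_index n \<Longrightarrow> mm n A B ij = idm ij" "\<And>ij. ij \<in> mat_index n \<Longrightarrow> mm n B A ij = idm ij"
  shows "restrict A (mat_index n) \<in> carrier (GL complex_ring n)"
proof -
  have 1: "restrict (mm n A B) (mat_index n) = restrict idm (mat_index n)" by (rule restrict_ext) (rule assms(1))
  have 2: "restrict (mm n B A) (mat_index n) = restrict idm (mat_index n)" by (rule restrict_ext) (rule assms(2))
  have carr: "restrict C (mat_index n) \<in> carrier (mat_monoid complex_ring n)" for C
    unfolding mat_complex by (simp add: PiE_def)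
  have "restrict B (mat_index n) \<otimes>\<^bsub>mat_monoid complex_ring n\<^esub> restrict A (mat_index n) = \<one>\<^bsub>mat_monoid complex_ring n\<^esub>"
    "restrict A (mat_index n) \<otimes>\<^bsub>mat_monoid complex_ring n\<^esub> restrict B (mat_index n) = \<one>\<^bsub>mat_monoid complex_ring n\<^esub>"
    by (simp_all only: mat_complex mm_restrict 1 2)
  then show ?thesis using carr[of A] carr[of B]
    by (simp only: GL_def units_of_def Units_def partial_object.select_convs mem_Collect_eq) blast
qed

lemma pval_restrict: "pvars e \<subseteq> mat_index n \<Longrightarrow> pev c (restrict x (mat_index n)) e = pev c x e"
  by (rule pev_cong) auto

lemma expression_of_sum:
  assumes "finite A" "\<And>a. a \<in> A \<Longrightarrow> \<exists>e. pvars e \<subseteq> V \<and> (\<forall>x. pval x e = F a x) \<and> (\<forall>x. pev fps_const x e = G a x)"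
  shows "\<exists>e. pvars e \<subseteq> V \<and> (\<forall>x. pval x e = (\<Sum>a\<in>A. F a x)) \<and> (\<forall>x. pev fps_const x e = (\<Sum>a\<in>A. G a x))"
  using assms
proof (induction A)
  case empty show ?case by (rule exI[of _ "PC 0"]) simp
next
  case (insert a A)
  obtain e where "pvars e \<subseteq> V" "\<forall>x. pval x e = (\<Sum>a\<in>A. F a x)" "\<forall>x. pev fps_const x e = (\<Sum>a\<in>A. G a x)"
    using insert by auto
  moreover obtain f where "pvars f \<subseteq> V" "\<forall>x. pval x f = F a x" "\<forall>x. pev fps_const x f = G a x"
    using insert.prems[OF insertI1] by blast
  ultimately show ?case using insert.hyps by (intro exI[of _ "PA f e"]) simp
qed

lemma expression_of_prod:
  assumes "finite A" "\<And>a. a \<in> A \<Longrightarrow> \<exists>e. pvars e \<subseteq> V \<and> (\<forall>x. pval x e = F a x) \<and> (\<forall>x. pev fps_const x e = G a x)"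
  shows "\<exists>e. pvars e \<subseteq> V \<and> (\<forall>x. pval x e = (\<Prod>a\<in>A. F a x)) \<and> (\<forall>x. pev fps_const x e = (\<Prod>a\<in>A. G a x))"
  using assms
proof (induction A)
  case empty show ?case by (rule exI[of _ "PC 1"]) simp
next
  case (insert a A)
  obtain e where "pvars e \<subseteq> V" "\<forall>x. pval x e = (\<Prod>a\<in>A. F a x)" "\<forall>x. pev fps_const x e = (\<Prod>a\<in>A. G a x)"
    using insert by auto
  moreover obtain f where "pvars f \<subseteq> V" "\<forall>x. pval x f = F a x" "\<forall>x. pev fps_const x f = G a x"
    using insert.prems[OF insertI1] by blast
  ultimately show ?case using insert.hyps by (intro exI[of _ "PM f e"]) simp
qed

lemma expression_of_power:
  "v \<in> V \<Longrightarrow> \<exists>e. pvars e \<subseteq> V \<and> (\<forall>x. pval x e = x v ^ k) \<and> (\<forall>x. pev fps_const x e = x v ^ k)"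
proof (induction k)
  case 0 show ?case by (rule exI[of _ "PC 1"]) simp
next
  case (Suc k)
  then obtain e where "pvars e \<subseteq> V" "\<forall>x. pval x e = x v ^ k" "\<forall>x. pev fps_const x e = x v ^ k" by blast
  then show ?case using Suc.prems by (intro exI[of _ "PM (PV v) e"]) simp
qed

text \<open>A rational polynomial is turned into an expression that has the right values both at complex matrices and at
matrices of power series.\<close>

lemma expression_of_mpoly:
  assumes s: "s \<in> mpolys n"
  shows "\<exists>e. pvars e \<subseteq> mat_index n \<and> (\<forall>x. pval x e = meval of_rat s x) \<and>
     (\<forall>x. pev fps_const x e = meval (\<lambda>q. fps_const (of_rat q)) s x)"
  unfolding meval_def
proof (rule expression_of_sum)
  fix m assume m: "m \<in> Poly_Mapping.keys s"
  have "\<exists>e. pvars e \<subseteq> mat_index n \<and>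
      (\<forall>x. pval x e = (\<Prod>v\<in>Poly_Mapping.keys m. x v ^ Poly_Mapping.lookup m v)) \<and>
      (\<forall>x. pev fps_const x e = (\<Prod>v\<in>Poly_Mapping.keys m. x v ^ Poly_Mapping.lookup m v))"
  proof (rule expression_of_prod)
    fix v assume "v \<in> Poly_Mapping.keys m"
    then have "v \<in> mat_index n" using s m unfolding mpolys_def by blast
    then show "\<exists>e. pvars e \<subseteq> mat_index n \<and> (\<forall>x. pval x e = x v ^ Poly_Mapping.lookup m v) \<and>
        (\<forall>x. pev fps_const x e = x v ^ Poly_Mapping.lookup m v)" by (rule expression_of_power)
  qed simp
  then obtain e where "pvars e \<subseteq> mat_index n"
    "\<forall>x. pval x e = (\<Prod>v\<in>Poly_Mapping.keys m. x v ^ Poly_Mapping.lookup m v)"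
    "\<forall>x. pev fps_const x e = (\<Prod>v\<in>Poly_Mapping.keys m. x v ^ Poly_Mapping.lookup m v)" by blast
  then show "\<exists>e. pvars e \<subseteq> mat_index n \<and>
      (\<forall>x. pval x e = of_rat (Poly_Mapping.lookup s m) * (\<Prod>v\<in>Poly_Mapping.keys m. x v ^ Poly_Mapping.lookup m v)) \<and>
      (\<forall>x. pev fps_const x e = fps_const (of_rat (Poly_Mapping.lookup s m)) * (\<Prod>v\<in>Poly_Mapping.keys m. x v ^ Poly_Mapping.lookup m v))"
    by (intro exI[of _ "PM (PC (of_rat (Poly_Mapping.lookup s m))) e"]) simp
qed simp

lemma of_rat_fact: "of_rat (fact k) = (fact k :: complex)"
  by (metis of_nat_fact of_rat_of_nat_eq)

text \<open>The entries of \<open>Y\<^sup>k\<close> grow at most like \<open>D\<^sup>k\<close>.\<close>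

lemma expm_conv_radius:
  fixes Y :: "nat \<times> nat \<Rightarrow> complex"
  assumes ij: "ij \<in> mat_index n" shows "fps_conv_radius (expm n Y a ij) = (\<infinity> :: ereal)"
proof -
  define B where "B = (\<Sum>v\<in>mat_index n. norm (Y v))"
  define D where "D = real n * B"
  have B0: "B \<ge> 0" unfolding B_def by (intro sum_nonneg) auto
  have B: "norm (Y v) \<le> B" if "v \<in> mat_index n" for v
    unfolding B_def by (rule member_le_sum[of v]) (use that in auto)
  have pow: "norm (mpow n Y k v) \<le> D ^ k" if "v \<in> mat_index n" for k v
    using that
  proof (induction k arbitrary: v)
    case 0 then show ?case by (auto simp: idm_def)
  next
    case (Suc k)
    obtain i j where v: "v = (i, j)" "i < n" "j < n" using Suc.prems by auto
    have "norm (\<Sum>l<n. mpow n Y k (i, l) * Y (l, j)) \<le> (\<Sum>l<n. D ^ k * B)"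
    proof (rule order_trans[OF norm_sum sum_mono])
      fix l assume "l \<in> {..<n}"
      then show "norm (mpow n Y k (i, l) * Y (l, j)) \<le> D ^ k * B"
        unfolding norm_mult using Suc.IH[of "(i, l)"] B[of "(l, j)"] v B0 by (intro mult_mono) (auto simp: D_def)
    qed
    also have "\<dots> = D ^ Suc k" by (simp add: D_def)
    finally show ?case by (simp add: v mm_def)
  qed
  show ?thesis unfolding fps_conv_radius_def
  proof (rule conv_radius_inftyI'')
    fix z :: complex
    show "summable (\<lambda>k. fps_nth (expm n Y a ij) k * z ^ k)"
    proof (rule summable_comparison_test')
      show "summable (\<lambda>k. inverse (fact k) * (norm a * D * norm z) ^ k)" by (rule summable_exp)
      fix k :: nat
      have "norm (fps_nth (expm n Y a ij) k * z ^ k) = inverse (fact k) * (norm a ^ k * norm (mpow n Y k ij) * norm z ^ k)"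
        by (simp add: norm_mult norm_inverse norm_power divide_inverse norm_fact)
      also have "\<dots> \<le> inverse (fact k) * (norm a ^ k * D ^ k * norm z ^ k)"
        using pow[OF ij] by (intro mult_left_mono mult_right_mono) auto
      finally show "norm (fps_nth (expm n Y a ij) k * z ^ k) \<le> inverse (fact k) * (norm a * D * norm z) ^ k"
        by (simp add: power_mult_distrib)
    qed
  qed
qed

lemma pev_conv_radius:
  assumes "\<And>v. v \<in> pvars e \<Longrightarrow> fps_conv_radius (E v) = (\<infinity> :: ereal)"
  shows "fps_conv_radius (pev fps_const E e) = (\<infinity> :: ereal) \<and> eval_fps (pev fps_const E e) z = pval (\<lambda>v. eval_fps (E v) z) e"
  using assms
proof (induction e)
  case (PA e f)
  then have *: "fps_conv_radius (pev fps_const E e) = \<infinity>" "fps_conv_radius (pev fps_const E f) = \<infinity>"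
    "eval_fps (pev fps_const E e) z = pval (\<lambda>v. eval_fps (E v) z) e"
    "eval_fps (pev fps_const E f) z = pval (\<lambda>v. eval_fps (E v) z) f" by auto
  then show ?case using fps_conv_radius_add[of "pev fps_const E e" "pev fps_const E f"] by (simp add: eval_fps_add)
next
  case (PM e f)
  then have *: "fps_conv_radius (pev fps_const E e) = \<infinity>" "fps_conv_radius (pev fps_const E f) = \<infinity>"
    "eval_fps (pev fps_const E e) z = pval (\<lambda>v. eval_fps (E v) z) e"
    "eval_fps (pev fps_const E f) z = pval (\<lambda>v. eval_fps (E v) z) f" by auto
  then show ?case using fps_conv_radius_mult[of "pev fps_const E e" "pev fps_const E f"] by (simp add: eval_fps_mult)
qed auto

lemma eval_expm_inverse:
  assumes ij: "i < n" "j < n"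
  shows "(\<Sum>l<n. eval_fps (expm n Y a (i, l)) z * eval_fps (expm n Y (- a) (l, j)) z) = (idm (i, j) :: complex)"
proof -
  define e where "e = psum (map (\<lambda>l. PM (PV (0, l)) (PV (1, l))) [0..<n])"
  define E where "E = (\<lambda>(b, l). if b = (0::nat) then expm n Y a (i, l) else expm n Y (- a) (l, j))"
  have ev: "pvars e \<subseteq> {0, 1} \<times> {..<n}" by (auto simp: e_def pvars_psum)
  have "fps_conv_radius (E v) = \<infinity>" if v: "v \<in> pvars e" for v
  proof -
    have "snd v < n" using ev v by auto
    then show ?thesis using ij by (auto simp: E_def case_prod_beta expm_conv_radius)
  qed
  then have "eval_fps (pev fps_const E e) z = pval (\<lambda>v. eval_fps (E v) z) e" by (rule pev_conv_radius[THEN conjunct2])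
  moreover have "pval (\<lambda>v. eval_fps (E v) z) e = (\<Sum>l<n. eval_fps (expm n Y a (i, l)) z * eval_fps (expm n Y (- a) (l, j)) z)"
    by (simp add: e_def pev_psum_upt E_def)
  moreover have "pev fps_const E e = mm n (expm n Y a) (expm n Y (- a)) (i, j)"
    by (simp add: e_def pev_psum_upt E_def mm_def)
  moreover have "mm n (expm n Y a) (expm n Y (- a)) (i, j) = idm (i, j)"
    using expm_add[OF ij, of Y a "- a"] by (simp add: expm_0 idm_def)
  moreover have "eval_fps (idm (i, j)) z = idm (i, j)" by (simp add: idm_def)
  ultimately show ?thesis by simp
qed

section \<open>Positive dimension\<close>

definition univariate :: "nat \<times> nat \<Rightarrow> complex poly \<Rightarrow> complex mpoly" where
  "univariate v q = (\<Sum>k\<le>Polynomial.degree q. Poly_Mapping.single (Poly_Mapping.single v k) (Polynomial.coeff q k))"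

lemma univariate:
  assumes v: "v \<in> mat_index n"
  shows "univariate v q \<in> mpolys n" "mpoly_eval complex_ring (\<lambda>c. c) (univariate v q) x = poly q (x v)"
proof -
  define m where "m = (\<lambda>k::nat. Poly_Mapping.single v k)"
  have inj: "m k = m l \<longleftrightarrow> k = l" for k l unfolding m_def by (metis lookup_single_eq)
  have look: "Poly_Mapping.lookup (univariate v q) (m k) = (if k \<le> Polynomial.degree q then Polynomial.coeff q k else 0)" for k
  proof -
    have "Poly_Mapping.lookup (univariate v q) (m k) =
        (\<Sum>l\<le>Polynomial.degree q. if l = k then Polynomial.coeff q l else 0)"
      unfolding univariate_def Poly_Mapping.lookup_sum
      by (rule sum.cong) (auto simp: lookup_single m_def[symmetric] inj when_def)
    then show ?thesis by simp
  qed
  have keys: "Poly_Mapping.keys (univariate v q) \<subseteq> m ` {..Polynomial.degree q}"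
  proof
    fix k assume "k \<in> Poly_Mapping.keys (univariate v q)"
    then have "(\<Sum>l\<le>Polynomial.degree q. Poly_Mapping.lookup (Poly_Mapping.single (m l) (Polynomial.coeff q l)) k) \<noteq> 0"
      by (simp add: univariate_def Poly_Mapping.lookup_sum m_def in_keys_iff)
    then obtain l where l: "l \<in> {..Polynomial.degree q}" "Poly_Mapping.lookup (Poly_Mapping.single (m l) (Polynomial.coeff q l)) k \<noteq> 0"
      by (rule sum.not_neutral_contains_not_neutral)
    then have "k = m l" by (auto simp: lookup_single when_def split: if_splits)
    then show "k \<in> m ` {..Polynomial.degree q}" using l(1) by blast
  qed
  have km: "Poly_Mapping.keys (m k) \<subseteq> {v}" for k by (simp add: m_def)
  show "univariate v q \<in> mpolys n" using keys km v unfolding mpolys_def by blast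
  have mon: "(\<Prod>w\<in>Poly_Mapping.keys (m k). x w ^ Poly_Mapping.lookup (m k) w) = x v ^ k" for k
    by (cases "k = 0") (simp_all add: m_def)
  have "meval (\<lambda>c. c) (univariate v q) x = (\<Sum>k\<in>m ` {..Polynomial.degree q}. Poly_Mapping.lookup (univariate v q) k *
      (\<Prod>w\<in>Poly_Mapping.keys k. x w ^ Poly_Mapping.lookup k w))"
    unfolding meval_def by (rule sum.mono_neutral_left) (use keys in \<open>auto simp: in_keys_iff\<close>)
  also have "\<dots> = (\<Sum>k\<le>Polynomial.degree q. Polynomial.coeff q k * x v ^ k)"
    by (subst sum.reindex) (auto simp: inj_on_def inj mon look)
  finally show "mpoly_eval complex_ring (\<lambda>c. c) (univariate v q) x = poly q (x v)"
    by (simp add: mpoly_eval_complex poly_altdef)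
qed

text \<open>An irreducible set with a proper irreducible subset has at least two points. If it were finite, some matrix entry would take
different values on it, and splitting it by the values of that entry would contradict irreducibility.\<close>

lemma positive_dimension_infinite:
  assumes "0 < zariski_dim n V" shows "infinite V"
proof
  assume fin: "finite V"
  obtain k Z where "0 < enat k" and Z: "\<forall>i\<le>k. zariski_irreducible n (Z i) \<and> Z i \<subseteq> V" "\<forall>i<k. Z i \<subset> Z (Suc i)"
    using assms unfolding zariski_dim_def less_Sup_iff by blast
  then have k: "0 < k" by (metis enat_ord_simps(2) zero_enat_def)
  define Z0 where "Z0 = Z 0"
  define Z1 where "Z1 = Z 1"
  have "zariski_irreducible n Z0" "Z0 \<subset> Z1" "zariski_irreducible n Z1" "Z1 \<subseteq> V"
    using Z k by (auto simp: Z0_def Z1_def Suc_le_eq)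
  then have Z01: "Z0 \<noteq> {}" "Z0 \<subset> Z1" "finite Z1" and irr: "\<And>A B. zariski_closed n A \<Longrightarrow> zariski_closed n B \<Longrightarrow> Z1 = A \<union> B \<Longrightarrow> Z1 = A \<or> Z1 = B"
    and cl: "zariski_closed n Z1"
    using finite_subset[OF _ fin] unfolding zariski_irreducible_def by auto
  obtain S where S: "S \<subseteq> mpolys n" "Z1 = zeros_GL complex_ring (\<lambda>c. c) n S" using cl unfolding zariski_closed_def by blast
  obtain z0 where z0: "z0 \<in> Z0" using Z01 by blast
  obtain z1 where z1: "z1 \<in> Z1" "z1 \<notin> Z0" using Z01 by blast
  have z01: "z0 \<in> Z1" "z0 \<noteq> z1" using z0 z1 Z01 by auto
  have ext: "g \<in> extensional (mat_index n)" if "g \<in> Z1" for g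
    using that by (auto simp: S(2) zeros_GL_def GL_def units_of_def Units_def mat_complex PiE_iff)
  obtain v where v: "v \<in> mat_index n" "z0 v \<noteq> z1 v"
    using extensionalityI[OF ext[OF z01(1)] ext[OF z1(1)]] z01(2) by blast
  define c where "c = z0 v"
  \<comment> \<open>The values of the entry \<open>v\<close> on \<open>Z1\<close> other than \<open>c\<close> are the roots of \<open>q\<close>.\<close>
  define q where "q = (\<Prod>d\<in>(\<lambda>g. g v) ` Z1 - {c}. [:- d, 1:])"
  define A where "A = zeros_GL complex_ring (\<lambda>c. c) n (insert (univariate v [:- c, 1:]) S)"
  define B where "B = zeros_GL complex_ring (\<lambda>c. c) n (insert (univariate v q) S)"
  have pq: "poly q y = (\<Prod>d\<in>(\<lambda>g. g v) ` Z1 - {c}. y - d)" for y by (simp add: q_def poly_prod)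
  have q0: "poly q y = 0 \<longleftrightarrow> y \<in> (\<lambda>g. g v) ` Z1 - {c}" for y
    unfolding pq using Z01(3) by (subst prod_zero_iff) auto
  have A: "g \<in> A \<longleftrightarrow> g \<in> Z1 \<and> g v = c" and B: "g \<in> B \<longleftrightarrow> g \<in> Z1 \<and> poly q (g v) = 0" for g
    by (auto simp: A_def B_def S(2) zeros_GL_def univariate(2)[OF v(1)] complex_ring_simps)
  have "zariski_closed n A" "zariski_closed n B"
    unfolding zariski_closed_def A_def B_def using S(1) univariate(1)[OF v(1)] by blast+
  moreover have "Z1 = A \<union> B" using A B q0 by auto
  ultimately have "Z1 = A \<or> Z1 = B" by (rule irr)
  then show False
  proof
    assume "Z1 = A"
    then have "z1 v = c" using z1(1) A by blast
    then show False using v(2) by (simp add: c_def)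
  next
    assume "Z1 = B"
    then have "poly q (z0 v) = 0" using z01(1) B by blast
    then show False using q0 by (simp add: c_def)
  qed
qed

section \<open>The Lie algebra and its rational elements\<close>

text \<open>The defining equations \<open>S\<close> are rational, while \<open>ideal\<close> consists of all complex polynomials that vanish on the group.\<close>

locale algebraic_group =
  fixes n :: nat and \<GG> :: "(nat \<times> nat \<Rightarrow> complex) set" and S :: "rat mpoly set"
  assumes subgroup: "subgroup \<GG> (GL complex_ring n)" and S: "S \<subseteq> mpolys n"
    and zeros: "\<GG> = zeros_GL complex_ring of_rat n S"
begin

definition ideal :: "pexp set" where
  "ideal = {e. pvars e \<subseteq> mat_index n \<and> (\<forall>g\<in>\<GG>. pval g e = 0)}"

text \<open>The tangent space of the group at the identity.\<close>

definition lie :: "(nat \<times> nat \<Rightarrow> complex) set" where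
  "lie = {Y. \<forall>e\<in>ideal. pval idm (pdiff n Y e) = 0}"

lemma points_vanish: "g \<in> \<GG> \<Longrightarrow> s \<in> S \<Longrightarrow> meval of_rat s g = 0"
  unfolding zeros zeros_GL_def by (simp add: mpoly_eval_complex complex_ring_simps)

lemma group_mult: "g \<in> \<GG> \<Longrightarrow> h \<in> \<GG> \<Longrightarrow> restrict (mm n g h) (mat_index n) \<in> \<GG>"
  using subgroup.m_closed[OF subgroup] by (simp add: GL_def units_of_def mat_complex)

lemma group_one: "restrict idm (mat_index n) \<in> \<GG>"
  using subgroup.one_closed[OF subgroup] by (simp add: GL_def units_of_def mat_complex)

lemma group_inverse:
  assumes "g \<in> \<GG>" shows "\<exists>h\<in>\<GG>. restrict (mm n h g) (mat_index n) = restrict idm (mat_index n) \<and>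
     restrict (mm n g h) (mat_index n) = restrict idm (mat_index n)"
proof -
  interpret group "GL complex_ring n" by (rule group_GL_complex)
  have "g \<in> carrier (GL complex_ring n)" using assms subgroup.subset[OF subgroup] by blast
  then have "inv\<^bsub>GL complex_ring n\<^esub> g \<otimes>\<^bsub>GL complex_ring n\<^esub> g = \<one>\<^bsub>GL complex_ring n\<^esub>"
    "g \<otimes>\<^bsub>GL complex_ring n\<^esub> inv\<^bsub>GL complex_ring n\<^esub> g = \<one>\<^bsub>GL complex_ring n\<^esub>" by simp_all
  then show ?thesis using subgroup.m_inv_closed[OF subgroup assms]
    by (intro bexI[of _ "inv\<^bsub>GL complex_ring n\<^esub> g"]) (simp_all add: GL_def units_of_def mat_complex)
qed

lemma ideal_ptrans: assumes "e \<in> ideal" "g \<in> \<GG>" shows "ptrans n g e \<in> ideal"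
proof -
  have e: "pvars e \<subseteq> mat_index n" using assms by (simp add: ideal_def)
  have "pval x (ptrans n g e) = 0" if "x \<in> \<GG>" for x
    using group_mult[OF assms(2) that] assms(1) pval_restrict[OF e, of "\<lambda>a. a" "mm n g x"]
    by (simp add: pval_ptrans ideal_def)
  then show ?thesis using pvars_ptrans[OF e] by (simp add: ideal_def)
qed

text \<open>Translation by \<open>g \<in> \<GG>\<close> preserves the ideal and commutes with left-invariant derivations, so vanishing of the derivative
at \<open>1\<close> gives vanishing at \<open>g\<close>.\<close>

lemma ideal_pdiff: assumes Y: "Y \<in> lie" and e: "e \<in> ideal" shows "pdiff n Y e \<in> ideal"
proof -
  have ev: "pvars e \<subseteq> mat_index n" using e by (simp add: ideal_def)
  have "pval g (pdiff n Y e) = 0" if g: "g \<in> \<GG>" for g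
  proof -
    have "pval (mm n g idm) (pdiff n Y e) = 0"
      using Y ideal_ptrans[OF e g] by (simp add: lie_def pval_pdiff_ptrans[symmetric])
    moreover have "pval (mm n g idm) (pdiff n Y e) = pval g (pdiff n Y e)"
      by (rule pev_cong) (use subsetD[OF pvars_pdiff[OF ev, of Y]] in \<open>force simp: mm_idm_right\<close>)
    ultimately show ?thesis by simp
  qed
  then show ?thesis using pvars_pdiff[OF ev] by (simp add: ideal_def)
qed

lemma pev_nth_0: "pvars e \<subseteq> mat_index n \<Longrightarrow> fps_nth (pev fps_const (expm n Y a) e) 0 = pval idm e"
  by (induction e) auto

text \<open>All derivatives of \<open>e (exp (t Y))\<close> at \<open>t = 0\<close> are values at \<open>1\<close> of iterated derivatives of \<open>e\<close>, which stay in the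
ideal.\<close>

lemma exponential_vanishing:
  assumes Y: "Y \<in> lie" and e: "e \<in> ideal"
  shows "pev fps_const (expm n Y 1) e = 0"
proof -
  have "fps_nth (pev fps_const (expm n Y 1) e) k = 0" if "e \<in> ideal" for e k
    using that
  proof (induction k arbitrary: e)
    case 0
    have ev: "pvars e \<subseteq> mat_index n" using 0 by (simp add: ideal_def)
    then have "pval idm e = 0" using 0 group_one pval_restrict[OF ev, of "\<lambda>a. a" idm] by (simp add: ideal_def)
    then show ?case using pev_nth_0[OF ev] by simp
  next
    case (Suc k)
    have ev: "pvars e \<subseteq> mat_index n" using Suc.prems by (simp add: ideal_def)
    have "of_nat (Suc k) * fps_nth (pev fps_const (expm n Y 1) e) (Suc k) = fps_nth (fps_deriv (pev fps_const (expm n Y 1) e)) k"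
      by (simp only: fps_deriv_nth Suc_eq_plus1)
    also have "\<dots> = 0" unfolding fps_deriv_pev[OF ev] by (rule Suc.IH[OF ideal_pdiff[OF Y Suc.prems]])
    finally have "(of_nat (Suc k) :: complex) = 0 \<or> fps_nth (pev fps_const (expm n Y 1) e) (Suc k) = 0"
      by (rule mult_eq_0_iff[THEN iffD1])
    then show ?case by (simp only: of_nat_eq_0_iff nat.simps) simp
  qed
  then show ?thesis using e by (intro fps_ext) simp
qed

text \<open>Together with \<open>exponential_vanishing\<close> this describes the Lie algebra by rational equations alone. If these vanish on the formal
curve, then the entire curve \<open>z \<mapsto> exp (z Y)\<close> runs inside the group, so all polynomials of the ideal vanish along it,
and their derivatives at \<open>0\<close> do too.\<close>

lemma vanishing_imp_lie:
  assumes van: "\<And>s. s \<in> S \<Longrightarrow> meval (\<lambda>q. fps_const (of_rat q)) s (expm n Y 1) = 0"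
  shows "Y \<in> lie"
proof -
  define x where "x = (\<lambda>z v. eval_fps (expm n Y 1 v) z)"
  define y where "y = (\<lambda>z v. eval_fps (expm n Y (-1) v) z)"
  have rad: "fps_conv_radius (expm n Y a v) = \<infinity>" if "v \<in> mat_index n" for a v using expm_conv_radius[OF that] .
  have ev_x: "fps_conv_radius (pev fps_const (expm n Y 1) e) = \<infinity> \<and> eval_fps (pev fps_const (expm n Y 1) e) z = pval (x z) e"
    if "pvars e \<subseteq> mat_index n" for e z
    unfolding x_def by (rule pev_conv_radius, rule rad) (use that in blast)
  have x\<GG>: "restrict (x z) (mat_index n) \<in> \<GG>" for z
  proof -
    have "restrict (x z) (mat_index n) \<in> carrier (GL complex_ring n)"
    proof (rule GL_complexI)
      show "mm n (x z) (y z) ij = idm ij" if ij: "ij \<in> mat_index n" for ij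
        using eval_expm_inverse[of "fst ij" n "snd ij" Y 1 z] ij by (cases ij) (simp add: x_def y_def mm_def)
      show "mm n (y z) (x z) ij = idm ij" if ij: "ij \<in> mat_index n" for ij
        using eval_expm_inverse[of "fst ij" n "snd ij" Y "-1" z] ij by (cases ij) (simp add: x_def y_def mm_def)
    qed
    moreover have "mpoly_eval complex_ring of_rat s (restrict (x z) (mat_index n)) = \<zero>\<^bsub>complex_ring\<^esub>" if s: "s \<in> S" for s
    proof -
      obtain e where e: "pvars e \<subseteq> mat_index n" "\<And>x. pval x e = meval of_rat s x"
        "\<And>x. pev fps_const x e = meval (\<lambda>q. fps_const (of_rat q)) s x" using expression_of_mpoly[of s n] s S by blast
      have "meval of_rat s (restrict (x z) (mat_index n)) = pval (x z) e" using pval_restrict[OF e(1)] e(2) by metis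
      also have "\<dots> = eval_fps (pev fps_const (expm n Y 1) e) z"
        using ev_x[OF e(1)] by simp
      also have "\<dots> = 0" using van[OF s] by (simp add: e(3))
      finally show ?thesis by (simp add: mpoly_eval_complex complex_ring_simps)
    qed
    ultimately show ?thesis unfolding zeros zeros_GL_def by blast
  qed
  have "pval idm (pdiff n Y e) = 0" if e: "e \<in> ideal" for e
  proof -
    have ev: "pvars e \<subseteq> mat_index n" using e by (simp add: ideal_def)
    define F where "F = pev fps_const (expm n Y 1) e"
    have F: "fps_conv_radius F = \<infinity>" "\<And>z. eval_fps F z = pval (x z) e"
      using ev_x[OF ev] by (simp_all add: F_def)
    have "eval_fps F z = 0" for z
      using F(2)[of z] x\<GG>[of z] e pval_restrict[OF ev, of "\<lambda>a. a" "x z"] by (simp add: ideal_def)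
    then have "F = 0" using F(1) by (intro eval_fps_eqD) auto
    then have "fps_nth (fps_deriv F) 0 = 0" by simp
    then show ?thesis unfolding F_def fps_deriv_pev[OF ev] using pev_nth_0[OF pvars_pdiff[OF ev]] by simp
  qed
  then show ?thesis by (simp add: lie_def)
qed

lemma lie_linear: "Y \<in> lie \<Longrightarrow> Z \<in> lie \<Longrightarrow> (\<lambda>v. a * Y v + b * Z v) \<in> lie"
  by (simp add: lie_def pval_pdiff_linear)

text \<open>If the Lie algebra were zero, the differentials at \<open>1\<close> of the ideal would contain a dual basis. Hadamard's lemma turns this into
a linear system for the entries of \<open>x - 1\<close> that is satisfied on the group and invertible at \<open>1\<close>; eliminating
yields a polynomial \<open>h\<close> with \<open>h(1) = 1\<close> that vanishes at all other points of the group. The translates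
\<open>x \<mapsto> h (a\<^sup>-\<^sup>1 x)\<close> for different \<open>a\<close> in the group are linearly independent, but span a finite-dimensional space.\<close>

lemma lie_nonzero:
  assumes inf: "infinite \<GG>" shows "\<exists>Y\<in>lie. \<exists>v\<in>mat_index n. Y v \<noteq> 0"
proof (rule ccontr)
  assume none: "\<not> (\<exists>Y\<in>lie. \<exists>v\<in>mat_index n. Y v \<noteq> 0)"
  define W where "W = (\<lambda>e b. pval idm (hadamard b e)) ` ideal"
  have lin: "(\<lambda>x. a * v x + b * w x) \<in> W" if vw: "v \<in> W" "w \<in> W" for v w a b
  proof -
    obtain e f where ef: "e \<in> ideal" "f \<in> ideal" "v = (\<lambda>b. pval idm (hadamard b e))" "w = (\<lambda>b. pval idm (hadamard b f))"
      using vw by (auto simp: W_def)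
    define g where "g = PA (PM (PC a) e) (PM (PC b) f)"
    have "g \<in> ideal" using ef by (simp add: g_def ideal_def)
    moreover have "(\<lambda>x. a * v x + b * w x) = (\<lambda>b. pval idm (hadamard b g))" by (simp add: g_def ef)
    ultimately show ?thesis unfolding W_def by blast
  qed
  have "PC 0 \<in> ideal" by (simp add: ideal_def)
  then have Wne: "W \<noteq> {}" by (auto simp: W_def)
  have "finite (mat_index n)" by simp
  from annihilator_or_dual_basis[OF this lin Wne]
  have "\<forall>a\<in>mat_index n. \<exists>w\<in>W. \<forall>b\<in>mat_index n. w b = (if a = b then 1 else 0)"
  proof
    assume "\<exists>y. (\<exists>b\<in>mat_index n. y b \<noteq> 0) \<and> (\<forall>w\<in>W. (\<Sum>b\<in>mat_index n. y b * w b) = 0)"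
    then obtain y where y: "\<exists>b\<in>mat_index n. y b \<noteq> 0" "\<And>w. w \<in> W \<Longrightarrow> (\<Sum>b\<in>mat_index n. y b * w b) = 0" by blast
    have "y \<in> lie"
      unfolding lie_def
    proof (intro CollectI ballI)
      fix e assume e: "e \<in> ideal"
      then have "pvars e \<subseteq> mat_index n" by (simp add: ideal_def)
      then have "pval idm (pdiff n y e) = (\<Sum>b\<in>mat_index n. y b * pval idm (hadamard b e))" by (rule pval_pdiff_idm)
      also have "\<dots> = 0" using y(2)[of "\<lambda>b. pval idm (hadamard b e)"] e by (auto simp: W_def)
      finally show "pval idm (pdiff n y e) = 0" .
    qed
    then show ?thesis using none y(1) by blast
  qed simp
  then have "\<forall>a\<in>mat_index n. \<exists>e. e \<in> ideal \<and> (\<forall>b\<in>mat_index n. pval idm (hadamard b e) = (if a = b then 1 else 0))"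
    unfolding W_def by blast
  then obtain f where f: "\<And>a. a \<in> mat_index n \<Longrightarrow> f a \<in> ideal \<and> (\<forall>b\<in>mat_index n. pval idm (hadamard b (f a)) = (if a = b then 1 else 0))"
    by metis
  have fv: "pvars (f a) \<subseteq> mat_index n" if "a \<in> mat_index n" for a using f[OF that] by (simp add: ideal_def)
  have "\<exists>h. pvars h \<subseteq> mat_index n \<and> pval idm h = 1 \<and>
      (\<forall>x y. (\<forall>a\<in>mat_index n. (\<Sum>b\<in>mat_index n. pval x (hadamard b (f a)) * y b) = 0) \<longrightarrow> (\<forall>b\<in>mat_index n. pval x h * y b = 0))"
  proof (rule elimination)
    show "finite (mat_index n)" by simp
    fix a b assume ab: "a \<in> mat_index n" "b \<in> mat_index n"
    show "pvars (hadamard b (f a)) \<subseteq> mat_index n" by (rule order_trans[OF pvars_hadamard fv[OF ab(1)]])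
    show "pval idm (hadamard b (f a)) = (if a = b then 1 else 0)" using f[OF ab(1)] ab(2) by blast
  qed
  then obtain h where h: "pvars h \<subseteq> mat_index n" "pval idm h = 1"
    "\<And>x y b. \<forall>a\<in>mat_index n. (\<Sum>b\<in>mat_index n. pval x (hadamard b (f a)) * y b) = 0 \<Longrightarrow> b \<in> mat_index n \<Longrightarrow> pval x h * y b = 0" by blast
  \<comment> \<open>The point \<open>1\<close> is the only one of the group outside the zeros of \<open>h\<close>.\<close>
  have iso: "x = restrict idm (mat_index n)" if x: "x \<in> \<GG>" "pval x h \<noteq> 0" for x
  proof -
    have "(\<Sum>b\<in>mat_index n. pval x (hadamard b (f a)) * (x b - idm b)) = 0" if a: "a \<in> mat_index n" for a
    proof -
      have "pval idm (f a) = 0"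
        using f[OF a] group_one pval_restrict[OF fv[OF a], of "\<lambda>a. a" idm] by (simp add: ideal_def)
      moreover have "pval x (f a) = 0" using f[OF a] x(1) by (simp add: ideal_def)
      ultimately show ?thesis using hadamard_expansion[OF fv[OF a], of x] by simp
    qed
    then have "pval x h * (x b - idm b) = 0" if "b \<in> mat_index n" for b using h(3)[of x "\<lambda>b. x b - idm b" b] that by blast
    then have "x b = idm b" if "b \<in> mat_index n" for b using x(2) that by auto
    moreover have "x \<in> extensional (mat_index n)"
      using x(1) by (auto simp: zeros zeros_GL_def GL_def units_of_def Units_def mat_complex PiE_iff)
    ultimately show ?thesis by (intro extensionalityI[of _ "mat_index n"]) auto
  qed
  obtain L where L: "\<And>g x. pval (mm n g x) h = (\<Sum>(\<alpha>, \<beta>)\<leftarrow>L. \<alpha> g * \<beta> x)" using finite_rank_translation by blast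
  obtain A where A: "A \<subseteq> \<GG>" "finite A" "card A = Suc (length L)" using infinite_arbitrarily_large[OF inf] by blast
  obtain i where i: "\<And>g. g \<in> \<GG> \<Longrightarrow> i g \<in> \<GG> \<and> restrict (mm n (i g) g) (mat_index n) = restrict idm (mat_index n) \<and>
     restrict (mm n g (i g)) (mat_index n) = restrict idm (mat_index n)" using group_inverse by metis
  obtain \<mu> where \<mu>: "\<exists>a\<in>A. \<mu> a \<noteq> 0" "\<forall>k<length L. (\<Sum>a\<in>A. \<mu> a * fst (L ! k) (i a)) = 0"
    using linear_dependence[OF A(2), of "length L" "\<lambda>a k. fst (L ! k) (i a)"] A(3) by auto
  have zero: "(\<Sum>a\<in>A. \<mu> a * pval (mm n (i a) x) h) = 0" for x
  proof -
    have "pval (mm n g x) h = (\<Sum>k<length L. fst (L ! k) g * snd (L ! k) x)" for g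
      unfolding L by (simp add: sum_list_sum_nth case_prod_beta atLeast0LessThan)
    then have "(\<Sum>a\<in>A. \<mu> a * pval (mm n (i a) x) h) = (\<Sum>a\<in>A. \<Sum>k<length L. \<mu> a * fst (L ! k) (i a) * snd (L ! k) x)"
      by (simp add: sum_distrib_left mult.assoc)
    also have "\<dots> = (\<Sum>k<length L. \<Sum>a\<in>A. \<mu> a * fst (L ! k) (i a) * snd (L ! k) x)" by (rule sum.swap)
    also have "\<dots> = (\<Sum>k<length L. (\<Sum>a\<in>A. \<mu> a * fst (L ! k) (i a)) * snd (L ! k) x)" by (simp add: sum_distrib_right)
    also have "\<dots> = 0" using \<mu>(2) by simp
    finally show ?thesis .
  qed
  obtain b where b: "b \<in> A" "\<mu> b \<noteq> 0" using \<mu>(1) by blast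
  have b\<GG>: "b \<in> \<GG>" using b A by blast
  have "pval (mm n (i a) b) h = (if a = b then 1 else 0)" if a: "a \<in> A" for a
  proof -
    have a\<GG>: "a \<in> \<GG>" using a A by blast
    have r: "pval (mm n (i a) b) h = pval (restrict (mm n (i a) b) (mat_index n)) h"
      using pval_restrict[OF h(1), of "\<lambda>a. a"] by simp
    show ?thesis
    proof (cases "a = b")
      case True
      then show ?thesis using r i[OF a\<GG>] pval_restrict[OF h(1), of "\<lambda>a. a" idm] h(2) by simp
    next
      case False
      have "pval (restrict (mm n (i a) b) (mat_index n)) h = 0"
      proof (rule ccontr)
        assume "pval (restrict (mm n (i a) b) (mat_index n)) h \<noteq> 0"
        then have e: "restrict (mm n (i a) b) (mat_index n) = restrict idm (mat_index n)"
          using iso group_mult i[OF a\<GG>] b\<GG> by blast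
        interpret M: monoid "mat_monoid complex_ring n" by (rule monoid_mat_complex)
        have carr: "g \<in> carrier (mat_monoid complex_ring n)" if "g \<in> \<GG>" for g
          using that by (auto simp: zeros zeros_GL_def GL_def units_of_def Units_def)
        have "i a \<otimes>\<^bsub>mat_monoid complex_ring n\<^esub> b = \<one>\<^bsub>mat_monoid complex_ring n\<^esub>"
          "a \<otimes>\<^bsub>mat_monoid complex_ring n\<^esub> i a = \<one>\<^bsub>mat_monoid complex_ring n\<^esub>"
          using e i[OF a\<GG>] by (simp_all only: mat_complex)
        then have "a = b"
          using carr[OF a\<GG>] carr[OF b\<GG>] carr[of "i a"] i[OF a\<GG>] M.m_assoc[of a "i a" b]
          by (metis M.l_one M.r_one)
        then show False using False by simp
      qed
      then show ?thesis using r False by simp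
    qed
  qed
  then have "(\<Sum>a\<in>A. \<mu> a * pval (mm n (i a) b) h) = (\<Sum>a\<in>A. if a = b then \<mu> a else 0)"
    by (intro sum.cong) auto
  then show False using zero[of b] b A(2) by simp
qed

text \<open>Applying \<open>\<phi>\<close> to the coefficients of the rational equations satisfied by the formal exponential of \<open>Y\<close> gives those for
\<open>\<phi> Y\<close>.\<close>

lemma lie_conjugate:
  assumes emb: "embedding R \<phi>" and Y: "Y \<in> lie" and R: "\<And>v. v \<in> mat_index n \<Longrightarrow> Y v \<in> R"
  shows "(\<lambda>v. \<phi> (Y v)) \<in> lie"
proof (rule vanishing_imp_lie)
  fix s assume s: "s \<in> S"
  then have sm: "s \<in> mpolys n" using S by blast
  interpret embedding R \<phi> by (rule emb)
  interpret F: partial_hom "{a. \<forall>k. fps_nth a k \<in> R}" "\<lambda>a. Abs_fps (\<lambda>k. \<phi> (fps_nth a k))" by (rule fps)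
  obtain e where e: "pvars e \<subseteq> mat_index n" "\<And>x. pval x e = meval of_rat s x"
    "\<And>x. pev fps_const x e = meval (\<lambda>q. fps_const (of_rat q)) s x" using expression_of_mpoly[OF sm] by blast
  have eI: "e \<in> ideal" using e(1,2) points_vanish[OF _ s] by (simp add: ideal_def)
  have 0: "meval (\<lambda>q. fps_const (of_rat q)) s (expm n Y 1) = 0"
    using exponential_vanishing[OF Y eI] unfolding e(3) .
  have x: "expm n Y 1 ij \<in> {a. \<forall>k. fps_nth a k \<in> R} \<and>
      Abs_fps (\<lambda>k. \<phi> (fps_nth (expm n Y 1 ij) k)) = expm n (\<lambda>v. \<phi> (Y v)) 1 ij" if ij: "ij \<in> mat_index n" for ij
  proof -
    have m: "mpow n Y k ij \<in> R \<and> \<phi> (mpow n Y k ij) = mpow n (\<lambda>v. \<phi> (Y v)) k ij" for k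
      by (rule mpow[OF _ ij]) (use R in auto)
    have c: "(1 / fact k :: complex) \<in> R" "\<phi> (1 / fact k) = 1 / fact k" for k
      using rat[of "1 / fact k"] by (simp_all add: of_rat_divide of_rat_fact)
    show ?thesis using mult[OF c(1) conjunct1[OF m]] m c(2) by (auto intro!: fps_ext)
  qed
  have c: "fps_const (of_rat q) \<in> {a. \<forall>k. fps_nth a k \<in> R}"
    "Abs_fps (\<lambda>k. \<phi> (fps_nth (fps_const (of_rat q)) k)) = fps_const (of_rat q)" for q
    using rat by (auto intro!: fps_ext)
  have "Abs_fps (\<lambda>k. \<phi> (fps_nth (meval (\<lambda>q. fps_const (of_rat q)) s (expm n Y 1)) k)) =
      meval (\<lambda>q. fps_const (of_rat q)) s (expm n (\<lambda>v. \<phi> (Y v)) 1)"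
    by (rule F.meval[where c = "\<lambda>q. fps_const (of_rat q)" and x = "expm n Y 1", OF sm c x, THEN conjunct2])
  then show "meval (\<lambda>q. fps_const (of_rat q)) s (expm n (\<lambda>v. \<phi> (Y v)) 1) = 0"
    unfolding 0 using F.zero(2) by (rule trans[OF sym])
qed

text \<open>Take a nonzero element of the Lie algebra with as few nonzero entries as possible and scale one of them to \<open>1\<close>. If an entry
were moved by an embedding \<open>\<phi>\<close>, then \<open>Y - \<phi> Y\<close> would be a nonzero element of smaller support.\<close>

lemma rational_lie_element:
  assumes inf: "infinite \<GG>"
  shows "\<exists>Y :: nat \<times> nat \<Rightarrow> rat. (\<exists>v\<in>mat_index n. Y v \<noteq> 0) \<and>
     (\<exists>Z\<in>lie. \<forall>v\<in>mat_index n. Z v = of_rat (Y v))"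
proof -
  define supp where "supp = (\<lambda>Y :: nat \<times> nat \<Rightarrow> complex. {v\<in>mat_index n. Y v \<noteq> 0})"
  define P where "P = (\<lambda>Y. Y \<in> lie \<and> supp Y \<noteq> {})"
  obtain Y0 where "P Y0" using lie_nonzero[OF inf] by (auto simp: P_def supp_def)
  then obtain Y1 where Y1: "P Y1" "\<And>Z. P Z \<Longrightarrow> card (supp Y1) \<le> card (supp Z)"
    using arg_min_nat_lemma[of P Y0 "\<lambda>Y. card (supp Y)"] by blast
  obtain w where w: "w \<in> mat_index n" "Y1 w \<noteq> 0" using Y1(1) by (auto simp: P_def supp_def)
  define Y where "Y = (\<lambda>v. inverse (Y1 w) * Y1 v + 0 * Y1 v)"
  have Yl: "Y \<in> lie" unfolding Y_def using lie_linear Y1(1) by (simp only: P_def)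
  have Yw: "Y w = 1" using w by (simp add: Y_def)
  have sY: "supp Y = supp Y1" using w by (auto simp: supp_def Y_def)
  have rat: "Y v \<in> range of_rat" if v: "v \<in> mat_index n" for v
  proof (rule ccontr)
    assume "Y v \<notin> range of_rat"
    then obtain R \<phi> where emb: "embedding R \<phi>" and R: "Y v \<in> R" "Y ` mat_index n \<subseteq> R" "\<phi> (Y v) \<noteq> Y v"
      using exists_embedding_moving[of "Y v" "Y ` mat_index n"] by auto
    interpret embedding R \<phi> by (rule emb)
    define Z where "Z = (\<lambda>u. 1 * Y u + (-1) * \<phi> (Y u))"
    have "Z \<in> lie" unfolding Z_def by (rule lie_linear[OF Yl lie_conjugate[OF emb Yl]]) (use R in auto)
    moreover have "v \<in> supp Z" using v R(3) by (simp add: supp_def Z_def)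
    ultimately have "card (supp Y1) \<le> card (supp Z)" using Y1(2)[of Z] by (auto simp: P_def)
    moreover have "supp Z \<subset> supp Y1"
    proof
      show "supp Z \<subseteq> supp Y1" unfolding sY[symmetric] by (auto simp: supp_def Z_def)
      have "w \<in> supp Y1" "w \<notin> supp Z" using w Yw by (auto simp: supp_def Z_def)
      then show "supp Z \<noteq> supp Y1" by blast
    qed
    then have "card (supp Z) < card (supp Y1)" by (intro psubset_card_mono) (auto simp: supp_def)
    ultimately show False by simp
  qed
  then have "\<forall>v\<in>mat_index n. \<exists>q. Y v = of_rat q" by blast
  then obtain q where q: "\<And>v. v \<in> mat_index n \<Longrightarrow> Y v = of_rat (q v)" by metis
  moreover have "q w \<noteq> 0" using q[OF w(1)] Yw by auto
  ultimately show ?thesis using Yl w(1) by blast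
qed

end

lemma mpow_scale: "mpow n (\<lambda>v. a * Y v) k ij = a ^ k * mpow n Y k ij"
  by (induction k arbitrary: ij) (auto simp: mm_def sum_distrib_left mult_ac)

text \<open>The equations hold with rational power series because they hold with complex ones.\<close>

theorem rational_one_parameter_subgroup:
  assumes G: "linear_algebraic_group_over_Q n \<GG>" and dim: "0 < zariski_dim n \<GG>"
  shows "\<exists>Y :: nat \<times> nat \<Rightarrow> rat. (\<exists>v\<in>mat_index n. Y v \<noteq> 0) \<and>
     (\<forall>f\<in>rational_ideal n \<GG>. \<forall>a. meval fps_const f (expm n Y a) = 0)"
proof -
  obtain S where "subgroup \<GG> (GL complex_ring n)" "S \<subseteq> mpolys n" "\<GG> = zeros_GL complex_ring of_rat n S"
    using G unfolding linear_algebraic_group_over_Q_def by blast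
  then interpret algebraic_group n \<GG> S by (rule algebraic_group.intro)
  obtain Y :: "nat \<times> nat \<Rightarrow> rat" and Z where Y: "\<exists>v\<in>mat_index n. Y v \<noteq> 0"
    and Z: "Z \<in> lie" "\<And>v. v \<in> mat_index n \<Longrightarrow> Z v = of_rat (Y v)"
    using rational_lie_element[OF positive_dimension_infinite[OF dim]] by blast
  have "meval fps_const f (expm n Y a) = 0" if f: "f \<in> rational_ideal n \<GG>" for f a
  proof -
    have fm: "f \<in> mpolys n" using f by (simp add: rational_ideal_def)
    obtain e where e: "pvars e \<subseteq> mat_index n" "\<And>x. pval x e = meval of_rat f x"
      "\<And>x. pev fps_const x e = meval (\<lambda>q. fps_const (of_rat q)) f x" using expression_of_mpoly[OF fm] by blast
    have eI: "e \<in> ideal" using e(1,2) f by (auto simp: ideal_def rational_ideal_def mpoly_eval_complex)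
    define Za where "Za = (\<lambda>v. of_rat a * Z v + 0 * Z v)"
    have "Za \<in> lie" unfolding Za_def by (rule lie_linear[OF Z(1) Z(1)])
    then have 0: "meval (\<lambda>q. fps_const (of_rat q)) f (expm n Za 1) = 0"
      using exponential_vanishing[OF _ eI] unfolding e(3) by blast
    interpret H: partial_hom UNIV "of_rat :: rat \<Rightarrow> complex" by unfold_locales (auto simp: of_rat_add of_rat_mult)
    interpret F: partial_hom "{a. \<forall>k. fps_nth a k \<in> UNIV}" "\<lambda>a. Abs_fps (\<lambda>k. of_rat (fps_nth a k) :: complex)" by (rule H.fps)
    have m: "mpow n Y k ij \<in> UNIV \<and> of_rat (mpow n Y k ij) = mpow n Z k ij" if "ij \<in> mat_index n" for k ij
      by (rule H.mpow[OF _ that]) (use Z(2) in auto)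
    have x: "expm n Y a ij \<in> {a. \<forall>k. fps_nth a k \<in> UNIV} \<and>
        Abs_fps (\<lambda>k. of_rat (fps_nth (expm n Y a ij) k)) = expm n Za 1 ij" if "ij \<in> mat_index n" for ij
      using m[OF that] by (auto intro!: fps_ext simp: Za_def mpow_scale of_rat_mult of_rat_divide of_rat_power of_rat_fact)
    have c: "fps_const q \<in> {a. \<forall>k. fps_nth a k \<in> UNIV}"
      "Abs_fps (\<lambda>k. of_rat (fps_nth (fps_const q) k) :: complex) = fps_const (of_rat q)" for q :: rat
      by (auto intro!: fps_ext)
    have "Abs_fps (\<lambda>k. of_rat (fps_nth (meval fps_const f (expm n Y a)) k) :: complex) =
        meval (\<lambda>q. fps_const (of_rat q)) f (expm n Za 1)"
      by (rule F.meval[where c = fps_const and x = "expm n Y a", OF fm c x, THEN conjunct2])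
    then have "Abs_fps (\<lambda>k. of_rat (fps_nth (meval fps_const f (expm n Y a)) k) :: complex) = 0"
      unfolding 0 .
    then have "(of_rat (fps_nth (meval fps_const f (expm n Y a)) k) :: complex) = 0" for k
      by (metis fps_nth_Abs_fps fps_zero_nth)
    then show ?thesis by (intro fps_ext) simp
  qed
  then show ?thesis using Y by blast
qed

section \<open>Finite axiomatizability\<close>

lemma points_Zpi_FA_finite:
  assumes G: "linear_algebraic_group_over_Q n \<GG>" "0 < zariski_dim n \<GG>"
    and primes: "\<forall>p\<in>\<pi>. Factorial_Ring.prime p"
    and FA: "FA_in {H. profinite_group H} (points_Zpi n \<GG> \<pi>)"
  shows "finite \<pi>"
proof -
  obtain Y :: "nat \<times> nat \<Rightarrow> rat" where Y: "\<exists>v\<in>mat_index n. Y v \<noteq> 0"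
    "\<forall>f\<in>rational_ideal n \<GG>. \<forall>a. meval fps_const f (expm n Y a) = 0"
    using rational_one_parameter_subgroup[OF G] by blast
  have points: "padic_points p n \<GG>" if "p \<in> \<pi>" "group (points_Zp n \<GG> p)" for p
    using that primes by (intro padic_points.intro padic.intro padic_points_axioms.intro) auto
  show ?thesis
  proof (rule FA_product_finite[OF FA[unfolded points_Zpi_def]])
    fix p assume p: "p \<in> \<pi>" "group (points_Zp n \<GG> p)"
    obtain u where u: "u \<in> carrier (points_Zp n \<GG> p)"
      "\<forall>m>0. u [^]\<^bsub>points_Zp n \<GG> p\<^esub> (m::nat) \<noteq> \<one>\<^bsub>points_Zp n \<GG> p\<^esub>"
      "\<forall>q. Factorial_Ring.prime q \<longrightarrow> q \<noteq> p \<longrightarrow>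
        (\<forall>j. \<exists>v\<in>carrier (points_Zp n \<GG> p). v [^]\<^bsub>points_Zp n \<GG> p\<^esub> (q ^ j) = u)"
      using padic_points.divisible_point[OF points[OF p] Y(1)] Y(2) by blast
    show "\<exists>u\<in>carrier (points_Zp n \<GG> p).
        (\<forall>m>0. u [^]\<^bsub>points_Zp n \<GG> p\<^esub> (m::nat) \<noteq> \<one>\<^bsub>points_Zp n \<GG> p\<^esub>) \<and>
        (\<forall>q\<in>\<pi>. q \<noteq> p \<longrightarrow>
          (\<forall>j. \<exists>v\<in>carrier (points_Zp n \<GG> p). v [^]\<^bsub>points_Zp n \<GG> p\<^esub> (q ^ j) = u))"
      using u primes by (intro bexI[OF _ u(1)] conjI) blast+
  next
    fix p T
    assume p: "p \<in> \<pi>" "group (points_Zp n \<GG> p)" and T: "T \<subseteq> carrier (points_Zp n \<GG> p)"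
      "\<And>x y. x \<in> T \<Longrightarrow> y \<in> T \<Longrightarrow> x \<otimes>\<^bsub>points_Zp n \<GG> p\<^esub> y = y \<otimes>\<^bsub>points_Zp n \<GG> p\<^esub> x"
      "\<And>x. x \<in> T \<Longrightarrow> \<exists>m>0. x [^]\<^bsub>points_Zp n \<GG> p\<^esub> (m::nat) = \<one>\<^bsub>points_Zp n \<GG> p\<^esub>"
    show "finite T" by (rule padic_points.commuting_torsion_finite[OF points[OF p] T])
  next
    fix p y
    assume p: "p \<in> \<pi>" "group (points_Zp n \<GG> p)" and y: "y \<in> carrier (points_Zp n \<GG> p)"
      "\<And>j. \<exists>w\<in>carrier (points_Zp n \<GG> p). w [^]\<^bsub>points_Zp n \<GG> p\<^esub> (p ^ j) = y"
    show "\<exists>m>0. y [^]\<^bsub>points_Zp n \<GG> p\<^esub> (m::nat) = \<one>\<^bsub>points_Zp n \<GG> p\<^esub>"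
      by (rule padic_points.divisible_imp_torsion[OF points[OF p] y])
  qed
qed

theorem proposition1p3:
  fixes G :: "'a topgroup"
    and n :: nat
    and \<GG> :: "(nat \<times> nat \<Rightarrow> complex) set"
    and \<pi> :: "nat set"
  shows "(pronilpotent_group G \<and>
          (FA_in {H. profinite_group H} G \<or> FA_in {H. pronilpotent_group H} G) \<longrightarrow>
            finite {p. Factorial_Ring.prime p \<and> (\<exists>P. sylow_pro_subgroup p G P \<and> P \<noteq> {\<one>\<^bsub>G\<^esub>})}) \<and>
         (linear_algebraic_group_over_Q n \<GG> \<and> 0 < zariski_dim n \<GG> \<and>
          (\<forall>p\<in>\<pi>. Factorial_Ring.prime p) \<and> FA_in {H. profinite_group H} (points_Zpi n \<GG> \<pi>) \<longrightarrow>
            finite \<pi>)"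
  using pronilpotent_FA_finite_primes[of G] points_Zpi_FA_finite[of n \<GG> \<pi>] by blast

end
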